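(* Let $\mathcal{O}=\{t_1,\dots,t_\mu\}$ be an order ideal in $\mathbb{T}^n$, and let $\mathcal{H}=(H_0,H_1,\dots)$ be an $(n,\mu)$-admissible Hilbert function which dominates $\mathrm{HF}^a_{\mathcal{O}}$. Define an ideal $I^{\mathrm{SG}}_{\mathcal{O}}$ of $K[C]$ as follows. If $\mathcal{H}$ is not symmetric, let $I^{\mathrm{SG}}_{\mathcal{O}}=\langle 0\rangle$. Otherwise, let $I^{\mathrm{SG}}_{\mathcal{O}}=I^{\mathrm{NCB}}_{\mathcal{O}}$, where $$I^{\mathrm{NCB}}_{\mathcal{O}}=\sum_{i=1}^\ell\Bigl(\bigl(I^{\mathrm{dfb}}_{\mathcal{O}\mathcal{O}'_i}+I(\mathbb{B}_{\mathcal{O}}(\overline{\mathcal{H}}))\bigr)\cap\bigl(J_i+I(\mathbb{B}_{\mathcal{O}}(\overline{\mathcal{H}}))\bigr)\Bigr),$$ $\mathcal{O}'_1,\dots,\mathcal{O}'_\ell$ are all order ideals in $\mathbb{T}^n$ with affine Hilbert function $\mathcal{H}$, and $I^{\mathrm{dfb}}_{\mathcal{O}\mathcal{O}'_i},J_i\subseteq K[C]$ are obtained from $J_{\mathcal{O}'_i}=\mathrm{CBLocus}(\mathcal{O}'_i)$ by the combination procedure (both defined in the context). Then the $K$-rational points $\Gamma$ of $\mathbb{B}_{\mathcal{O}}(\mathcal{H})\setminus\mathcal{Z}(I^{\mathrm{SG}}_{\mathcal{O}})$ are precisely the ones in $\mathbb{B}_{\mathcal{O}}(\mathcal{H})$ which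 represent 0-dimensional affine schemes $\mathbb{X}_\Gamma$ that are strictly Gorenstein.
   Context: $K$ is an arbitrary field, $P=K[x_1,\dots,x_n]$, and $\mathbb{T}^n$ is the monoid of terms (power products) in $x_1,\dots,x_n$. An order ideal is a finite set $\mathcal{O}=\{t_1,\dots,t_\mu\}\subset\mathbb{T}^n$ with $\mu\ge 1$ containing every divisor in $\mathbb{T}^n$ of each of its elements; it is always ordered so that $\deg(t_1)\le\cdots\le\deg(t_\mu)$, hence $t_1=1$. Its border is $\partial\mathcal{O}=(x_1\mathcal{O}\cup\cdots\cup x_n\mathcal{O})\setminus\mathcal{O}=\{b_1,\dots,b_\nu\}$, and its affine Hilbert function is $\mathrm{HF}^a_{\mathcal{O}}(i)=\#\{j\mid\deg(t_j)\le i\}$. Let $C=\{c_{ij}\mid 1\le i\le\mu,\ 1\le j\le\nu\}$ be new indeterminates (the coordinates of $\mathbb{B}_{\mathcal{O}}$). The $r$-th generic multiplication matrix $\mathcal{A}_r=(a^{(r)}_{ij})\in\mathrm{Mat}_\mu(K[C])$ has $a^{(r)}_{ij}=\delta_{im}$ (Kronecker delta) if $x_rt_j=t_m$ and $a^{(r)}_{ij}=c_{im}$ if $x_rt_j=b_m$. $I(\mathbb{B}_{\mathcal{O}})\subseteq K[C]$ is generated by the entries of all commutators $\mathcal{A}_r\mathcal{A}_s-\mathcal{A}_s\mathcal{A}_r$, and the border basis scheme $\mathbb{B}_{\mathcal{O}}\subseteq\mathrm{Spec}(K[C])$ is the closed subscheme it defines. For a $K$-rational point $\Gamma=(\gamma_{ij})$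 of $\mathbb{B}_{\mathcal{O}}$, let $I_\Gamma\subset P$ be generated by $b_j-\sum_i\gamma_{ij}t_i$; $\Gamma$ represents the 0-dimensional scheme $\mathbb{X}_\Gamma\subset\mathbb{A}^n_K$ with vanishing ideal $I_\Gamma$, and $R_\Gamma=P/I_\Gamma$. All of this applies likewise to other order ideals $\mathcal{O}'$, with coordinates denoted $C'=\{c'_{\kappa\lambda}\}$. For a term $t=x_1^{\alpha_1}\cdots x_n^{\alpha_n}$, $t(M_1,\dots,M_n)=M_1^{\alpha_1}\cdots M_n^{\alpha_n}$; $\mathrm{adj}$ is the adjugate matrix; $\mathcal{Z}(\cdot)$ is the zero locus. For a 0-dimensional $\mathbb{X}\subset\mathbb{A}^n_K$ with $R_{\mathbb{X}}=P/I_{\mathbb{X}}$, let $F_iR_{\mathbb{X}}$ be the image of the polynomials of degree $\le i$; $\mathrm{HF}^a_{\mathbb{X}}(i)=\mathrm{HF}^a_{R_{\mathbb{X}}}(i)=\dim_K F_iR_{\mathbb{X}}$. $\mathbb{X}$ is a strict Gorenstein scheme (strictly Gorenstein) if the associated graded ring $\bigoplus_iF_iR_{\mathbb{X}}/F_{i-1}R_{\mathbb{X}}$ is a Gorenstein ring. An affine Hilbert function $\mathcal{H}=(H_0,H_1,\dots)$ with $\rho=\min\{i\mid H_i=\mu\}$ is symmetric if its difference function $h_0=H_0$, $h_i=H_i-H_{i-1}$ satisfies $h_i=h_{\rho-i}$ for $i=1,\dots,\rho$. A sequence $(H_i)$ dominates $(H'_i)$ if $H_i\ge H'_i$ for all $i\ge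 0$ (strictly, if they moreover differ); $\mathcal{H}$ is $(n,\mu)$-admissible if $\mathcal{H}=\mathrm{HF}^a_{\mathbb{X}}$ for some 0-dimensional $\mathbb{X}\subset\mathbb{A}^n_K$ of length $\mu$. $\mathbb{B}_{\mathcal{O}}(\overline{\mathcal{H}})$ is the closed subscheme of $\mathbb{B}_{\mathcal{O}}$ which is the closure of the set of $K$-rational points $\Gamma$ with $\mathrm{HF}^a_{R_\Gamma}$ dominated by $\mathcal{H}$; $\mathbb{B}_{\mathcal{O}}(\mathcal{H})$ is the complement in it of the closure of the set of those $\Gamma$ with $\mathrm{HF}^a_{R_\Gamma}$ strictly dominated by $\mathcal{H}$ (so its $K$-rational points are the $\Gamma$ with $\mathrm{HF}^a_{R_\Gamma}=\mathcal{H}$). Ideals: for a sequence $\mathcal{G}=(G_0,G_1,\dots)$ dominating $\mathrm{HF}^a_{\mathcal{O}}$ with $\sigma=\min\{i\mid G_i=\mu\}$, $I(\mathbb{B}_{\mathcal{O}}(\overline{\mathcal{G}}))=I(\mathbb{B}_{\mathcal{O}})+\sum_{i=1}^{\sigma-1}D_i$, where $D_i$ is generated by the minors of size $G_i+1$ of the matrix whose columns are the first columns of $u(\mathcal{A}_1,\dots,\mathcal{A}_n)$, $u$ ranging over the terms of degree $\le i$ (minors of size exceeding the matrix contribute the zero ideal). With $\rho=\min\{i\mid H_i=\mu\}$ and $\mathcal{H}'_i$ obtained from $\mathcal{H}$ by replacing $H_i$ with $H_i-1$, $I(Z_{\mathcal{O}}(\overline{\mathcal{H}}))=\bigcap I(\mathbb{B}_{\mathcal{O}}(\overline{\mathcal{H}'_i}))$,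 where the intersection is over $i\in\{1,\dots,\rho\}$ with $H_i-1\ge\mathrm{HF}^a_{\mathcal{O}}(i)$ (empty intersection $=\langle 1\rangle$). $\mathrm{CBLocus}(\mathcal{O}')$ for an order ideal $\mathcal{O}'=\{t'_1,\dots,t'_\mu\}$ with border $\{b'_\lambda\}$ and coordinates $C'=\{c'_{\kappa\lambda}\}$: let $I(\mathbb{B}^{\mathrm{df}}_{\mathcal{O}'})$ be $I(\mathbb{B}_{\mathcal{O}'})$ plus the ideal generated by all $c'_{\kappa\lambda}$ with $\deg(t'_\kappa)>\deg(b'_\lambda)$; let $M_{t'_i}$ be the matrix $t'_i$ evaluated at the generic multiplication matrices for $\mathcal{O}'$ with these $c'_{\kappa\lambda}$ set to zero; let $\Delta=\#\{i\mid\deg(t'_i)=\deg(t'_\mu)\}$; for $j=1,\dots,\Delta$ let $V_j$ be the matrix whose $i$-th column is the $(\mu-\Delta+j)$-th column of $M_{t'_i}^{\mathrm{tr}}$; then $\mathrm{CBLocus}(\mathcal{O}')$ is $I(\mathbb{B}^{\mathrm{df}}_{\mathcal{O}'})$ plus the ideal of maximal minors of the block column matrix $\mathrm{Col}(V_1,\dots,V_\Delta)$. Combination procedure: for $\mathcal{O}'_i=\{t'_1,\dots,t'_\mu\}$ with border $\{b'_\lambda\}$, coordinates $C'_i=\{c'_{\kappa\lambda}\}$ and $J_{\mathcal{O}'_i}=\langle a_{i1},\dots,a_{ir_i}\rangle$, let $T'\in\mathrm{Mat}_\mu(K[C])$ be the matrix whose $\kappa$-th column is the first column of $t'_\kappa(\mathcal{A}_1,\dots,\mathcal{A}_n)$,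 let $\delta_i=\det(T')$, let $B'_\lambda$ be the first column of $b'_\lambda(\mathcal{A}_1,\dots,\mathcal{A}_n)$, and let $p_{\kappa\lambda}\in K[C]$ be the $\kappa$-th entry of $\mathrm{adj}(T')B'_\lambda$. Let $a^\ast_{ij}\in K[C'_i][z]$ be the homogenization of $a_{ij}$ with respect to a new indeterminate $z$, and $\hat a_{ij}\in K[C]$ the result of substituting $c'_{\kappa\lambda}\mapsto p_{\kappa\lambda}$, $z\mapsto\delta_i$ in it. Then $J_i=\langle\hat a_{i1},\dots,\hat a_{ir_i}\rangle$ and $I^{\mathrm{dfb}}_{\mathcal{O}\mathcal{O}'_i}=I(Z_{\mathcal{O}}(\overline{\mathcal{H}}))\cap\langle\delta_i\rangle$. Conventions: $K$-rational points are to be read as $L$-rational points over field extensions $L\supseteq K$, e.g. $L=\overline{K}$ (in particular closures are formed using $\overline{K}$-rational points); subschemes and their defining ideals are considered up to radical. *)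

theory Defs
  imports
    "HOL-Library.Poly_Mapping"
    "HOL-Algebra.Embedded_Algebras"
    "HOL-Algebra.Ring_Divisibility"
    "HOL-Algebra.QuotRing"
    "HOL-Algebra.Module"
    "HOL-Algebra.Algebraic_Closure_Type"
    "Jordan_Normal_Form.Determinant"
    "Jordan_Normal_Form.DL_Submatrix"
begin

section \<open>Gorenstein rings\<close>

definition regular_module :: "('a, 'x) ring_scheme \<Rightarrow> ('a, 'a) module" where
  "regular_module R =
    \<lparr>carrier = carrier R, monoid.mult = monoid.mult R, one = one R, zero = zero R, add = add R,
     module.smult = monoid.mult R\<rparr>"

definition linear_maps ::
  "('a, 'x) ring_scheme \<Rightarrow> ('a, 'm, 'y) module_scheme \<Rightarrow> ('a, 'n, 'z) module_scheme \<Rightarrow> ('m \<Rightarrow> 'n) set" where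
  "linear_maps R M N =
    {f \<in> carrier M \<rightarrow> carrier N.
      (\<forall>x\<in>carrier M. \<forall>y\<in>carrier M. f (x \<oplus>\<^bsub>M\<^esub> y) = f x \<oplus>\<^bsub>N\<^esub> f y) \<and>
      (\<forall>r\<in>carrier R. \<forall>x\<in>carrier M. f (r \<odot>\<^bsub>M\<^esub> x) = r \<odot>\<^bsub>N\<^esub> f x)}"

text \<open>Injectivity is stated in Baer's form, because a formula of HOL cannot quantify over the
  types of the modules occurring in the general lifting property.\<close>

definition injective_module :: "('a, 'x) ring_scheme \<Rightarrow> ('a, 'm, 'y) module_scheme \<Rightarrow> bool" where
  "injective_module R E \<longleftrightarrow> module R E \<and>
    (\<forall>I. ideal I R \<longrightarrow>
      (\<forall>f \<in> linear_maps R ((regular_module R)\<lparr>carrier := I\<rparr>) E.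
        \<exists>g \<in> linear_maps R (regular_module R) E. \<forall>x\<in>I. g x = f x))"

text \<open>Existence of a bounded injective resolution
  \<open>0 \<rightarrow> M \<rightarrow> E\<^sub>0 \<rightarrow> E\<^sub>1 \<rightarrow> \<dots> \<rightarrow> E\<^sub>d \<rightarrow> 0\<close>.
  The modules \<open>E\<^sub>i\<close> live in the type \<^typ>\<open>nat \<Rightarrow> 'm\<close>.  For \<open>M\<close> the regular module of a
  Noetherian ring \<open>R\<close> this is no restriction: the minimal injective resolution consists of modules
  of cardinality at most \<open>max |R| \<aleph>\<^sub>0\<close>.\<close>

definition finite_injective_dimension ::
  "('a, 'x) ring_scheme \<Rightarrow> ('a, 'm, 'y) module_scheme \<Rightarrow> bool" where
  "finite_injective_dimension R M \<longleftrightarrow>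
    (\<exists>(E :: nat \<Rightarrow> ('a, nat \<Rightarrow> 'm) module) \<iota> \<delta> (d :: nat).
      (\<forall>i. injective_module R (E i)) \<and>
      (\<forall>i>d. carrier (E i) = {\<zero>\<^bsub>E i\<^esub>}) \<and>
      \<iota> \<in> linear_maps R M (E 0) \<and> inj_on \<iota> (carrier M) \<and>
      (\<forall>i. \<delta> i \<in> linear_maps R (E i) (E (Suc i))) \<and>
      \<iota> ` carrier M = {x \<in> carrier (E 0). \<delta> 0 x = \<zero>\<^bsub>E 1\<^esub>} \<and>
      (\<forall>i. \<delta> i ` carrier (E i) =
        {x \<in> carrier (E (Suc i)). \<delta> (Suc i) x = \<zero>\<^bsub>E (Suc (Suc i))\<^esub>}))"

definition fraction :: "('a, 'x) ring_scheme \<Rightarrow> 'a set \<Rightarrow> 'a \<Rightarrow> 'a \<Rightarrow> ('a \<times> 'a) set" where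
  "fraction R p r s =
    {(r', s'). r' \<in> carrier R \<and> s' \<in> carrier R - p \<and>
      (\<exists>u \<in> carrier R - p. u \<otimes>\<^bsub>R\<^esub> (r \<otimes>\<^bsub>R\<^esub> s') = u \<otimes>\<^bsub>R\<^esub> (r' \<otimes>\<^bsub>R\<^esub> s))}"

definition localization :: "('a, 'x) ring_scheme \<Rightarrow> 'a set \<Rightarrow> ('a \<times> 'a) set ring" where
  "localization R p =
    \<lparr>carrier = {fraction R p r s | r s. r \<in> carrier R \<and> s \<in> carrier R - p},
     monoid.mult = (\<lambda>A B. \<Union>{fraction R p (r \<otimes>\<^bsub>R\<^esub> r') (s \<otimes>\<^bsub>R\<^esub> s') | r s r' s'.
       (r, s) \<in> A \<and> (r', s') \<in> B}),
     one = fraction R p \<one>\<^bsub>R\<^esub> \<one>\<^bsub>R\<^esub>,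
     zero = fraction R p \<zero>\<^bsub>R\<^esub> \<one>\<^bsub>R\<^esub>,
     add = (\<lambda>A B. \<Union>{fraction R p ((r \<otimes>\<^bsub>R\<^esub> s') \<oplus>\<^bsub>R\<^esub> (r' \<otimes>\<^bsub>R\<^esub> s)) (s \<otimes>\<^bsub>R\<^esub> s') | r s r' s'.
       (r, s) \<in> A \<and> (r', s') \<in> B})\<rparr>"

definition gorenstein_ring :: "('a, 'x) ring_scheme \<Rightarrow> bool" where
  "gorenstein_ring R \<longleftrightarrow> cring R \<and> noetherian_ring R \<and>
    (\<forall>p. primeideal p R \<longrightarrow>
      finite_injective_dimension (localization R p) (regular_module (localization R p)))"


section \<open>The associated graded ring of a filtered ring\<close>

definition filtration_prev :: "('a, 'x) ring_scheme \<Rightarrow> (nat \<Rightarrow> 'a set) \<Rightarrow> nat \<Rightarrow> 'a set" where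
  "filtration_prev R F i = (if i = 0 then {\<zero>\<^bsub>R\<^esub>} else F (i - 1))"

text \<open>An element of the direct sum of the quotients \<open>F\<^sub>i R / F\<^bsub>i-1\<^esub> R\<close> is a finitely supported
  family of cosets; homogeneous components are multiplied through representatives.\<close>

definition associated_graded_ring ::
  "('a, 'x) ring_scheme \<Rightarrow> (nat \<Rightarrow> 'a set) \<Rightarrow> (nat \<Rightarrow> 'a set) ring" where
  "associated_graded_ring R F =
    \<lparr>carrier = {u. (\<forall>i. \<exists>r \<in> F i. u i = filtration_prev R F i +>\<^bsub>R\<^esub> r) \<and>
                   finite {i. u i \<noteq> filtration_prev R F i}},
     monoid.mult = (\<lambda>u v k. \<Union>{filtration_prev R F k +>\<^bsub>R\<^esub> (\<Oplus>\<^bsub>R\<^esub> i \<in> {..k}. r i \<otimes>\<^bsub>R\<^esub> s (k - i)) | r s.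
                          (\<forall>i\<le>k. r i \<in> u i) \<and> (\<forall>i\<le>k. s i \<in> v i)}),
     one = (\<lambda>i. if i = 0 then filtration_prev R F 0 +>\<^bsub>R\<^esub> \<one>\<^bsub>R\<^esub> else filtration_prev R F i),
     zero = (\<lambda>i. filtration_prev R F i),
     add = (\<lambda>u v i. u i <+>\<^bsub>R\<^esub> v i)\<rparr>"


section \<open>Polynomials\<close>

type_synonym 'v pp = "'v \<Rightarrow>\<^sub>0 nat"
type_synonym ('v, 'a) mpoly = "'v pp \<Rightarrow>\<^sub>0 'a"

definition mpoly_ring :: "'v set \<Rightarrow> ('v, 'a::comm_ring_1) mpoly ring" where
  "mpoly_ring V =
    \<lparr>carrier = {p. \<forall>m \<in> Poly_Mapping.keys p. Poly_Mapping.keys m \<subseteq> V},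
     monoid.mult = (*), one = 1, zero = 0, add = (+)\<rparr>"

definition const :: "'a::comm_ring_1 \<Rightarrow> ('v, 'a) mpoly" where
  "const c = Poly_Mapping.single 0 c"

definition indet :: "'v \<Rightarrow> ('v, 'a::comm_ring_1) mpoly" where
  "indet v = Poly_Mapping.single (Poly_Mapping.single v 1) 1"

definition pp_deg :: "'v pp \<Rightarrow> nat" where
  "pp_deg m = (\<Sum>v \<in> Poly_Mapping.keys m. Poly_Mapping.lookup m v)"

definition mpoly_deg :: "('v, 'a::comm_ring_1) mpoly \<Rightarrow> nat" where
  "mpoly_deg p = Max (insert 0 (pp_deg ` Poly_Mapping.keys p))"

text \<open>Evaluation of a polynomial at \<open>a\<close>, with coefficients mapped by \<open>\<phi>\<close>.\<close>

definition mpoly_at :: "('a::comm_ring_1 \<Rightarrow> 'b::comm_ring_1) \<Rightarrow> ('v \<Rightarrow> 'b) \<Rightarrow> ('v, 'a) mpoly \<Rightarrow> 'b" where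
  "mpoly_at \<phi> a p = (\<Sum>m \<in> Poly_Mapping.keys p. \<phi> (Poly_Mapping.lookup p m) *
     (\<Prod>v \<in> Poly_Mapping.keys m. a v ^ Poly_Mapping.lookup m v))"

text \<open>The homogenizing indeterminate is \<^const>\<open>None\<close>.\<close>

definition homogenization :: "('v, 'a::comm_ring_1) mpoly \<Rightarrow> ('v option, 'a) mpoly" where
  "homogenization p = (\<Sum>m \<in> Poly_Mapping.keys p.
     Poly_Mapping.single
       ((\<Sum>v \<in> Poly_Mapping.keys m. Poly_Mapping.single (Some v) (Poly_Mapping.lookup m v))
         + Poly_Mapping.single None (mpoly_deg p - pp_deg m))
       (Poly_Mapping.lookup p m))"


section \<open>Zero-dimensional affine schemes\<close>

text \<open>A closed subscheme of affine \<open>n\<close>-space is given by an ideal of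
  \<^term>\<open>mpoly_ring {..<n}\<close>; the indeterminates are numbered from \<open>0\<close>.\<close>

definition coord_ring :: "nat \<Rightarrow> (nat, 'a::field) mpoly set \<Rightarrow> (nat, 'a) mpoly set ring" where
  "coord_ring n I = mpoly_ring {..<n} Quot I"

definition coord_consts :: "nat \<Rightarrow> (nat, 'a::field) mpoly set \<Rightarrow> (nat, 'a) mpoly set set" where
  "coord_consts n I = {I +>\<^bsub>mpoly_ring {..<n}\<^esub> const c | c. True}"

definition degree_filtration ::
  "nat \<Rightarrow> (nat, 'a::field) mpoly set \<Rightarrow> nat \<Rightarrow> (nat, 'a) mpoly set set" where
  "degree_filtration n I i =
    {I +>\<^bsub>mpoly_ring {..<n}\<^esub> p | p. p \<in> carrier (mpoly_ring {..<n}) \<and>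
       (\<forall>m \<in> Poly_Mapping.keys p. pp_deg m \<le> i)}"

definition affine_HF :: "nat \<Rightarrow> (nat, 'a::field) mpoly set \<Rightarrow> nat \<Rightarrow> nat" where
  "affine_HF n I i = ring.dim (coord_ring n I) (coord_consts n I) (degree_filtration n I i)"

definition strictly_gorenstein :: "nat \<Rightarrow> (nat, 'a::field) mpoly set \<Rightarrow> bool" where
  "strictly_gorenstein n I \<longleftrightarrow>
    gorenstein_ring (associated_graded_ring (coord_ring n I) (degree_filtration n I))"

definition admissible :: "'a::field itself \<Rightarrow> nat \<Rightarrow> nat \<Rightarrow> (nat \<Rightarrow> nat) \<Rightarrow> bool" where
  "admissible _ n \<mu> H \<longleftrightarrow>
    (\<exists>I :: (nat, 'a) mpoly set. ideal I (mpoly_ring {..<n}) \<and>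
       ring.dimension (coord_ring n I) \<mu> (coord_consts n I) (carrier (coord_ring n I)) \<and>
       H = affine_HF n I)"

definition dominates :: "(nat \<Rightarrow> nat) \<Rightarrow> (nat \<Rightarrow> nat) \<Rightarrow> bool" where
  "dominates H H' \<longleftrightarrow> (\<forall>i. H' i \<le> H i)"

definition strictly_dominates :: "(nat \<Rightarrow> nat) \<Rightarrow> (nat \<Rightarrow> nat) \<Rightarrow> bool" where
  "strictly_dominates H H' \<longleftrightarrow> dominates H H' \<and> H \<noteq> H'"

definition hf_diff :: "(nat \<Rightarrow> nat) \<Rightarrow> nat \<Rightarrow> int" where
  "hf_diff H i = (if i = 0 then int (H 0) else int (H i) - int (H (i - 1)))"

definition symmetric_HF :: "nat \<Rightarrow> (nat \<Rightarrow> nat) \<Rightarrow> bool" where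
  "symmetric_HF \<mu> H \<longleftrightarrow>
    (let \<rho> = (LEAST i. H i = \<mu>) in \<forall>i \<in> {1..\<rho>}. hf_diff H i = hf_diff H (\<rho> - i))"


section \<open>Order ideals and border basis schemes\<close>

definition order_ideal :: "nat \<Rightarrow> nat pp set \<Rightarrow> bool" where
  "order_ideal n T \<longleftrightarrow> finite T \<and> T \<noteq> {} \<and> (\<forall>t \<in> T. Poly_Mapping.keys t \<subseteq> {..<n}) \<and>
    (\<forall>t \<in> T. \<forall>s s'. t = s + s' \<longrightarrow> s \<in> T)"

definition border :: "nat \<Rightarrow> nat pp set \<Rightarrow> nat pp set" where
  "border n T = {Poly_Mapping.single r 1 + t | r t. r < n \<and> t \<in> T} - T"

definition order_ideal_HF :: "nat pp set \<Rightarrow> nat \<Rightarrow> nat" where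
  "order_ideal_HF T i = card {t \<in> T. pp_deg t \<le> i}"

text \<open>The lists \<open>ts\<close> and \<open>bs\<close> are enumerations of an order ideal and of its border.\<close>

definition order_ideal_enum :: "nat \<Rightarrow> nat pp list \<Rightarrow> nat pp list \<Rightarrow> bool" where
  "order_ideal_enum n ts bs \<longleftrightarrow>
    order_ideal n (set ts) \<and> distinct ts \<and> sorted (map pp_deg ts) \<and>
    set bs = border n (set ts) \<and> distinct bs"

text \<open>All indices run from \<open>0\<close>.  The indeterminate \<open>c\<^bsub>ij\<^esub>\<close> is \<^term>\<open>indet (i, j)\<close>.\<close>

definition C_ring :: "nat pp list \<Rightarrow> nat pp list \<Rightarrow> (nat \<times> nat, 'a::field) mpoly ring" where
  "C_ring ts bs = mpoly_ring ({..<length ts} \<times> {..<length bs})"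

text \<open>The \<open>r\<close>-th multiplication matrix, with the values \<open>c\<close> in place of the \<open>c\<^bsub>ij\<^esub>\<close>.\<close>

definition mult_matrix ::
  "nat pp list \<Rightarrow> nat pp list \<Rightarrow> (nat \<times> nat \<Rightarrow> 'b::comm_ring_1) \<Rightarrow> nat \<Rightarrow> 'b mat" where
  "mult_matrix ts bs c r = mat (length ts) (length ts) (\<lambda>(i, j).
     let u = Poly_Mapping.single r 1 + ts ! j in
     if u \<in> set ts then (if ts ! i = u then 1 else 0)
     else c (i, THE m. m < length bs \<and> bs ! m = u))"

abbreviation generic_matrix ::
  "nat pp list \<Rightarrow> nat pp list \<Rightarrow> nat \<Rightarrow> (nat \<times> nat, 'a::field) mpoly mat" where
  "generic_matrix ts bs \<equiv> mult_matrix ts bs indet"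

definition term_at :: "nat \<Rightarrow> nat \<Rightarrow> (nat \<Rightarrow> 'b::comm_ring_1 mat) \<Rightarrow> nat pp \<Rightarrow> 'b mat" where
  "term_at n \<mu> M t = foldr (\<lambda>r B. (M r ^\<^sub>m Poly_Mapping.lookup t r) * B) [0..<n] (1\<^sub>m \<mu>)"

text \<open>The matrix whose columns are the first columns of \<open>u(A\<^sub>1,\<dots>,A\<^sub>n)\<close> for \<open>u\<close> in the list \<open>us\<close>,
  where \<open>A\<^sub>r\<close> are the generic multiplication matrices.\<close>

definition first_columns ::
  "nat \<Rightarrow> nat pp list \<Rightarrow> nat pp list \<Rightarrow> nat pp list \<Rightarrow> (nat \<times> nat, 'a::field) mpoly mat" where
  "first_columns n ts bs us = mat_of_cols (length ts)
     (map (\<lambda>u. col (term_at n (length ts) (generic_matrix ts bs) u) 0) us)"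

definition minors :: "nat \<Rightarrow> 'b::comm_ring_1 mat \<Rightarrow> 'b set" where
  "minors k M = {det (submatrix M I J) | I J.
     I \<subseteq> {..<dim_row M} \<and> J \<subseteq> {..<dim_col M} \<and> card I = k \<and> card J = k}"

definition bbs_ideal :: "nat \<Rightarrow> nat pp list \<Rightarrow> nat pp list \<Rightarrow> (nat \<times> nat, 'a::field) mpoly set" where
  "bbs_ideal n ts bs = Idl\<^bsub>C_ring ts bs\<^esub>
    {(generic_matrix ts bs r * generic_matrix ts bs s
       - generic_matrix ts bs s * generic_matrix ts bs r) $$ (i, j) | r s i j.
     r < n \<and> s < n \<and> i < length ts \<and> j < length ts}"

text \<open>The defining ideal of the locus where the affine Hilbert function is dominated by \<open>G\<close>;
  the terms of degree at most \<open>i\<close> are listed in an arbitrary fixed order.\<close>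

definition bbs_HF_ideal ::
  "nat \<Rightarrow> nat pp list \<Rightarrow> nat pp list \<Rightarrow> (nat \<Rightarrow> nat) \<Rightarrow> (nat \<times> nat, 'a::field) mpoly set" where
  "bbs_HF_ideal n ts bs G =
    (let \<sigma> = (LEAST i. G i = length ts);
         us = (\<lambda>i. sorted_list_of_set {u. Poly_Mapping.keys u \<subseteq> {..<n} \<and> pp_deg u \<le> i})
     in bbs_ideal n ts bs <+>\<^bsub>C_ring ts bs\<^esub>
        Idl\<^bsub>C_ring ts bs\<^esub> (\<Union>i \<in> {1..<\<sigma>}. minors (G i + 1) (first_columns n ts bs (us i))))"

text \<open>The locus where the affine Hilbert function is strictly dominated by \<open>H\<close>; the empty intersection is the unit ideal.\<close>

definition bbs_Z_ideal ::
  "nat \<Rightarrow> nat pp list \<Rightarrow> nat pp list \<Rightarrow> (nat \<Rightarrow> nat) \<Rightarrow> (nat \<times> nat, 'a::field) mpoly set" where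
  "bbs_Z_ideal n ts bs H =
    (let \<rho> = (LEAST i. H i = length ts)
     in carrier (C_ring ts bs) \<inter>
        (\<Inter>i \<in> {i \<in> {1..\<rho>}. int (H i) - 1 \<ge> int (order_ideal_HF (set ts) i)}.
           bbs_HF_ideal n ts bs (H(i := H i - 1))))"


section \<open>Rational points\<close>

text \<open>A point with coordinates in an extension field, embedded by \<open>\<phi>\<close>, is a matrix \<open>\<Gamma>\<close>.\<close>

definition zero_locus ::
  "('k::field \<Rightarrow> 'l::field) \<Rightarrow> nat pp list \<Rightarrow> nat pp list \<Rightarrow> (nat \<times> nat, 'k) mpoly set \<Rightarrow> 'l mat set" where
  "zero_locus \<phi> ts bs I = {\<Gamma> \<in> carrier_mat (length ts) (length bs).
     \<forall>f \<in> I. mpoly_at \<phi> (\<lambda>ij. \<Gamma> $$ ij) f = 0}"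

definition point_ideal ::
  "nat \<Rightarrow> nat pp list \<Rightarrow> nat pp list \<Rightarrow> 'l::field mat \<Rightarrow> (nat, 'l) mpoly set" where
  "point_ideal n ts bs \<Gamma> = Idl\<^bsub>mpoly_ring {..<n}\<^esub>
    {Poly_Mapping.single (bs ! j) 1 - (\<Sum>i<length ts. Poly_Mapping.single (ts ! i) (\<Gamma> $$ (i, j)))
     | j. j < length bs}"

text \<open>The ideal of the Zariski closure, inside the spectrum of \<^term>\<open>C_ring ts bs\<close>, of a set of
  points over the algebraic closure.\<close>

definition vanishing_ideal ::
  "nat pp list \<Rightarrow> nat pp list \<Rightarrow> 'k::field alg_closure mat set \<Rightarrow> (nat \<times> nat, 'k) mpoly set" where
  "vanishing_ideal ts bs S = {f \<in> carrier (C_ring ts bs).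
     \<forall>\<Gamma> \<in> S. mpoly_at to_ac (\<lambda>ij. \<Gamma> $$ ij) f = 0}"

text \<open>The \<open>L\<close>-rational points of \<open>B\<^sub>O(H)\<close>, the difference of the closures of two sets of points.\<close>

definition bbs_HF_points ::
  "('k::field \<Rightarrow> 'l::field) \<Rightarrow> nat \<Rightarrow> nat pp list \<Rightarrow> nat pp list \<Rightarrow> (nat \<Rightarrow> nat) \<Rightarrow> 'l mat set" where
  "bbs_HF_points \<phi> n ts bs H =
    (let B = zero_locus (to_ac :: 'k \<Rightarrow> 'k alg_closure) ts bs (bbs_ideal n ts bs);
         S = {\<Gamma> \<in> B. dominates H (affine_HF n (point_ideal n ts bs \<Gamma>))};
         S' = {\<Gamma> \<in> B. strictly_dominates H (affine_HF n (point_ideal n ts bs \<Gamma>))}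
     in zero_locus \<phi> ts bs (vanishing_ideal ts bs S)
        - zero_locus \<phi> ts bs (vanishing_ideal ts bs S'))"


section \<open>The non-Cayley-Bacharach locus\<close>

definition df_ideal :: "nat \<Rightarrow> nat pp list \<Rightarrow> nat pp list \<Rightarrow> (nat \<times> nat, 'a::field) mpoly set" where
  "df_ideal n ts bs = bbs_ideal n ts bs <+>\<^bsub>C_ring ts bs\<^esub>
    Idl\<^bsub>C_ring ts bs\<^esub> {indet (k, l) | k l. k < length ts \<and> l < length bs \<and>
      pp_deg (ts ! k) > pp_deg (bs ! l)}"

definition df_matrix ::
  "nat pp list \<Rightarrow> nat pp list \<Rightarrow> nat \<Rightarrow> (nat \<times> nat, 'a::field) mpoly mat" where
  "df_matrix ts bs = mult_matrix ts bs
    (\<lambda>(k, l). if pp_deg (ts ! k) > pp_deg (bs ! l) then 0 else indet (k, l))"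

text \<open>With \<open>\<Delta> \<ge> 1\<close> blocks, the block column matrix is a \<open>\<Delta>\<mu> \<times> \<mu>\<close> matrix, so that its maximal
  minors have size \<open>\<mu>\<close>.\<close>

definition CBLocus :: "nat \<Rightarrow> nat pp list \<Rightarrow> nat pp list \<Rightarrow> (nat \<times> nat, 'a::field) mpoly set" where
  "CBLocus n ts bs =
    (let \<mu> = length ts;
         \<Delta> = card {i. i < \<mu> \<and> pp_deg (ts ! i) = pp_deg (ts ! (\<mu> - 1))};
         V = (\<lambda>j. mat_of_cols \<mu>
               (map (\<lambda>t. col (transpose_mat (term_at n \<mu> (df_matrix ts bs) t)) (\<mu> - \<Delta> + j)) ts));
         Col = mat (\<Delta> * \<mu>) \<mu> (\<lambda>(a, i). V (a div \<mu>) $$ (a mod \<mu>, i))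
     in df_ideal n ts bs <+>\<^bsub>C_ring ts bs\<^esub> Idl\<^bsub>C_ring ts bs\<^esub> (minors \<mu> Col))"

text \<open>The combination procedure: \<open>ts, bs\<close> belong to \<open>O\<close>, and \<open>ts', bs'\<close> to \<open>O'\<close>.\<close>

definition base_change_det ::
  "nat \<Rightarrow> nat pp list \<Rightarrow> nat pp list \<Rightarrow> nat pp list \<Rightarrow> (nat \<times> nat, 'a::field) mpoly" where
  "base_change_det n ts bs ts' = det (first_columns n ts bs ts')"

definition base_change_coord ::
  "nat \<Rightarrow> nat pp list \<Rightarrow> nat pp list \<Rightarrow> nat pp list \<Rightarrow> nat pp list \<Rightarrow>
   nat \<times> nat \<Rightarrow> (nat \<times> nat, 'a::field) mpoly" where
  "base_change_coord n ts bs ts' bs' = (\<lambda>(k, l).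
     (adj_mat (first_columns n ts bs ts') *\<^sub>v
        col (term_at n (length ts) (generic_matrix ts bs) (bs' ! l)) 0) $ k)"

definition transported ::
  "nat \<Rightarrow> nat pp list \<Rightarrow> nat pp list \<Rightarrow> nat pp list \<Rightarrow> nat pp list \<Rightarrow>
   (nat \<times> nat, 'a::field) mpoly \<Rightarrow> (nat \<times> nat, 'a) mpoly" where
  "transported n ts bs ts' bs' a = mpoly_at const
     (\<lambda>v. case v of None \<Rightarrow> base_change_det n ts bs ts'
                  | Some kl \<Rightarrow> base_change_coord n ts bs ts' bs' kl)
     (homogenization a)"

definition J_ideal ::
  "nat \<Rightarrow> nat pp list \<Rightarrow> nat pp list \<Rightarrow> nat pp list \<Rightarrow> nat pp list \<Rightarrow>
   (nat \<times> nat, 'a::field) mpoly list \<Rightarrow> (nat \<times> nat, 'a) mpoly set" where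
  "J_ideal n ts bs ts' bs' as = Idl\<^bsub>C_ring ts bs\<^esub> (transported n ts bs ts' bs' ` set as)"

definition dfb_ideal ::
  "nat \<Rightarrow> nat pp list \<Rightarrow> nat pp list \<Rightarrow> (nat \<Rightarrow> nat) \<Rightarrow> nat pp list \<Rightarrow>
   (nat \<times> nat, 'a::field) mpoly set" where
  "dfb_ideal n ts bs H ts' =
    bbs_Z_ideal n ts bs H \<inter> Idl\<^bsub>C_ring ts bs\<^esub> {base_change_det n ts bs ts'}"

text \<open>For \<open>i < l\<close>, the order ideal \<open>O'\<^sub>i\<close> and its border are listed by \<open>ts' i\<close> and \<open>bs' i\<close>, and
  \<open>as i\<close> lists the chosen generators of its ideal \<^const>\<open>CBLocus\<close>.\<close>

definition NCB_ideal ::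
  "nat \<Rightarrow> nat pp list \<Rightarrow> nat pp list \<Rightarrow> (nat \<Rightarrow> nat) \<Rightarrow> nat \<Rightarrow>
   (nat \<Rightarrow> nat pp list) \<Rightarrow> (nat \<Rightarrow> nat pp list) \<Rightarrow> (nat \<Rightarrow> (nat \<times> nat, 'a) mpoly list) \<Rightarrow>
   (nat \<times> nat, 'a::field) mpoly set" where
  "NCB_ideal n ts bs H l ts' bs' as = Idl\<^bsub>C_ring ts bs\<^esub> (\<Union>i<l.
     (dfb_ideal n ts bs H (ts' i) <+>\<^bsub>C_ring ts bs\<^esub> bbs_HF_ideal n ts bs H) \<inter>
     (J_ideal n ts bs (ts' i) (bs' i) (as i) <+>\<^bsub>C_ring ts bs\<^esub> bbs_HF_ideal n ts bs H))"

definition SG_ideal ::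
  "nat \<Rightarrow> nat pp list \<Rightarrow> nat pp list \<Rightarrow> (nat \<Rightarrow> nat) \<Rightarrow> nat \<Rightarrow>
   (nat \<Rightarrow> nat pp list) \<Rightarrow> (nat \<Rightarrow> nat pp list) \<Rightarrow> (nat \<Rightarrow> (nat \<times> nat, 'a) mpoly list) \<Rightarrow>
   (nat \<times> nat, 'a::field) mpoly set" where
  "SG_ideal n ts bs H l ts' bs' as =
    (if symmetric_HF (length ts) H then NCB_ideal n ts bs H l ts' bs' as
     else Idl\<^bsub>C_ring ts bs\<^esub> {0})"

end

theory Submission
  imports Defs "HOL-Library.Function_Algebras"
begin

text \<open>Let \<open>\<Gamma>\<close> be a point with \<open>HF\<^sup>a = H\<close> and \<open>R\<^sub>\<Gamma> = P/I\<^sub>\<Gamma>\<close>.  The theorem rests on three facts.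

  First, a criterion for the associated graded ring to be Gorenstein (\<open>gorenstein_iff\<close>): this happens
  exactly when the affine Hilbert function is symmetric and \<open>R\<^sub>\<Gamma>\<close> has the Cayley-Bacharach property,
  i.e. the ideal of no non-zero element lies in \<open>F\<^bsub>\<rho>-1\<^esub>R\<^sub>\<Gamma>\<close>.  The graded ring is local with nilpotent
  maximal ideal, and for such a ring Gorenstein means self-injective
  (\<open>gorenstein_iff_self_injective\<close>).  Self-injectivity forces a one-dimensional socle, hence a top component of
  dimension one and non-degenerate pairings of \<open>F\<^sub>i/F\<^bsub>i-1\<^esub>\<close> with \<open>F\<^bsub>\<rho>-i\<^esub>/F\<^bsub>\<rho>-i-1\<^esub>\<close>.  Conversely, such
  pairings give a linear form that identifies the graded ring with its dual, and then every homomorphism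
  from an ideal is a multiplication.  Counting dimensions of orthogonal spaces
  shows that all pairings are non-degenerate if and only if both stated conditions hold.

  Second, if an order ideal \<open>O'\<close> has affine Hilbert function \<open>H\<close> and its terms are a basis of \<open>R\<^sub>\<Gamma>\<close>, they are
  automatically adapted to the degree filtration.  For symmetric \<open>H\<close> there is only one term of top
  degree, \<open>F\<^bsub>\<rho>-1\<^esub>R\<^sub>\<Gamma>\<close> is the kernel of the corresponding coordinate, and the matrix whose maximal minors
  generate \<^const>\<open>CBLocus\<close> is the Gram matrix of the pairing \<open>(f, g) \<mapsto>\<close> top coordinate of \<open>f g\<close>
  (\<open>CBLocus_vanishes_iff\<close>).  So \<^const>\<open>CBLocus\<close> vanishes precisely when the Cayley-Bacharach
  property fails.

  Third, \<open>\<delta>\<close> is the determinant of the base change from \<open>O\<close> to \<open>O'\<close>.  Where it does not vanish, the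
  same ideal \<open>I\<^sub>\<Gamma>\<close> is given by a point of the border basis scheme of \<open>O'\<close> whose coordinates are the
  quotients by \<open>\<delta>\<close> of the base change polynomials (\<open>moved_point\<close>), and homogenization clears the denominators
  (\<open>transported_at\<close>).  For every \<open>\<Gamma>\<close> some \<open>O'\<close> with Hilbert function \<open>H\<close> satisfies \<open>\<delta> \<noteq> 0\<close>: take the
  terms that do not reduce to smaller ones with respect to a degree compatible term ordering
  (\<open>lead_order_ideal\<close>, \<open>lead_HF\<close>, \<open>lead_indep\<close>).

  The vanishing of an intersection of ideals at a point means that one of them vanishes, and the
  ideal of the locus of strictly smaller Hilbert functions does not vanish at \<open>\<Gamma>\<close>
  (\<open>bbs_Z_ideal_at\<close>).  Hence \<open>\<Gamma>\<close> avoids the zero locus exactly if some \<open>O'\<close> has \<open>\<delta> \<noteq> 0\<close> and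
  \<open>R\<^sub>\<Gamma>\<close> is strictly Gorenstein.  That the points of \<^const>\<open>bbs_HF_points\<close> have Hilbert function equal
  to \<open>H\<close> although they are defined by closures of sets of points over the algebraic closure of the ground field
  follows by specializing coordinates to that closure (\<open>specialize_point\<close>).\<close>

(* With this rule, simp would turn the numeral 1 in indices and exponents into Suc 0. *)
declare One_nat_def [simp del]

abbreviation keys :: "('v \<Rightarrow>\<^sub>0 'b::zero) \<Rightarrow> 'v set" where "keys \<equiv> Poly_Mapping.keys"
abbreviation lookup :: "('v \<Rightarrow>\<^sub>0 'b::zero) \<Rightarrow> 'v \<Rightarrow> 'b" where "lookup \<equiv> Poly_Mapping.lookup"
abbreviation single :: "'v \<Rightarrow> 'b::zero \<Rightarrow> 'v \<Rightarrow>\<^sub>0 'b" where "single \<equiv> Poly_Mapping.single"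
abbreviation terms_le :: "nat \<Rightarrow> nat \<Rightarrow> nat pp set" where
  "terms_le n i \<equiv> {u. keys u \<subseteq> {..<n} \<and> pp_deg u \<le> i}"
abbreviation value_at :: "('a::comm_ring_1 \<Rightarrow> 'b::comm_ring_1) \<Rightarrow> 'b mat \<Rightarrow> (nat \<times> nat, 'a) mpoly \<Rightarrow> 'b" where
  "value_at \<phi> \<Gamma> \<equiv> mpoly_at \<phi> (\<lambda>ij. \<Gamma> $$ ij)"
abbreviation ideal_module :: "('a, 'x) ring_scheme \<Rightarrow> 'a set \<Rightarrow> ('a, 'a) module" where
  "ideal_module R I \<equiv> (regular_module R)\<lparr>carrier := I\<rparr>"

section \<open>Local rings with a finite multiplicative chain of ideals\<close>

lemma linear_maps_ideal_iff:
  "f \<in> linear_maps R (ideal_module R I) E \<longleftrightarrow>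
     f \<in> I \<rightarrow> carrier E \<and> (\<forall>x\<in>I. \<forall>y\<in>I. f (x \<oplus>\<^bsub>R\<^esub> y) = f x \<oplus>\<^bsub>E\<^esub> f y) \<and>
     (\<forall>r\<in>carrier R. \<forall>x\<in>I. f (r \<otimes>\<^bsub>R\<^esub> x) = r \<odot>\<^bsub>E\<^esub> f x)"
  by (simp add: linear_maps_def regular_module_def)

lemma linear_maps_regular_iff:
  "f \<in> linear_maps R (regular_module R) E \<longleftrightarrow>
     f \<in> carrier R \<rightarrow> carrier E \<and>
     (\<forall>x\<in>carrier R. \<forall>y\<in>carrier R. f (x \<oplus>\<^bsub>R\<^esub> y) = f x \<oplus>\<^bsub>E\<^esub> f y) \<and>
     (\<forall>r\<in>carrier R. \<forall>x\<in>carrier R. f (r \<otimes>\<^bsub>R\<^esub> x) = r \<odot>\<^bsub>E\<^esub> f x)"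
  by (simp add: linear_maps_def regular_module_def)

text \<open>Injectivity of \<open>E\<close> relative to a submodule \<open>C\<close>: homomorphisms from an ideal into \<open>C\<close> are
  multiplications with an element of \<open>C\<close>.  A kernel in an injective resolution is such a \<open>C\<close>, and
  as a subset of \<open>E\<close> it needs no module structure of its own.\<close>

definition baer_submodule ::
  "('a, 'x) ring_scheme \<Rightarrow> ('a, 'e, 'y) module_scheme \<Rightarrow> 'e set \<Rightarrow> bool" where
  "baer_submodule R E C \<longleftrightarrow>
    (\<forall>I. ideal I R \<longrightarrow> (\<forall>f \<in> linear_maps R (ideal_module R I) E.
       f ` I \<subseteq> C \<longrightarrow> (\<exists>y\<in>C. \<forall>x\<in>I. f x = x \<odot>\<^bsub>E\<^esub> y)))"

lemma baer_submoduleD: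
  assumes "baer_submodule R E C" "ideal I R"
    "f \<in> linear_maps R (ideal_module R I) E" "f ` I \<subseteq> C"
  shows "\<exists>y\<in>C. \<forall>x\<in>I. f x = x \<odot>\<^bsub>E\<^esub> y"
  using assms unfolding baer_submodule_def by blast

lemma injective_module_baer:
  assumes "module R E"
  shows "injective_module R E \<longleftrightarrow> baer_submodule R E (carrier E)"
proof -
  interpret module R E by fact
  show ?thesis
  proof
    assume inj: "injective_module R E"
    show "baer_submodule R E (carrier E)"
      unfolding baer_submodule_def
    proof (intro allI impI ballI)
      fix I f assume I: "ideal I R" and f: "f \<in> linear_maps R (ideal_module R I) E"
      then obtain g where g: "g \<in> linear_maps R (regular_module R) E" "\<forall>x\<in>I. g x = f x"
        using inj unfolding injective_module_def by blast
      have "f x = x \<odot>\<^bsub>E\<^esub> g \<one>\<^bsub>R\<^esub>" if "x \<in> I" for x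
      proof -
        have "x \<in> carrier R" using I that ideal.Icarr by metis
        then have "g (x \<otimes>\<^bsub>R\<^esub> \<one>\<^bsub>R\<^esub>) = x \<odot>\<^bsub>E\<^esub> g \<one>\<^bsub>R\<^esub>"
          using g(1) R.one_closed unfolding linear_maps_regular_iff by blast
        then show ?thesis using g(2) that \<open>x \<in> carrier R\<close> by simp
      qed
      moreover have "g \<one>\<^bsub>R\<^esub> \<in> carrier E" using g(1) unfolding linear_maps_regular_iff by auto
      ultimately show "\<exists>y\<in>carrier E. \<forall>x\<in>I. f x = x \<odot>\<^bsub>E\<^esub> y" by blast
    qed
  next
    assume b: "baer_submodule R E (carrier E)"
    show "injective_module R E"
      unfolding injective_module_def
    proof (intro conjI allI impI ballI)
      show "module R E" by fact
      fix I f assume I: "ideal I R" and f: "f \<in> linear_maps R (ideal_module R I) E"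
      then have "f ` I \<subseteq> carrier E" unfolding linear_maps_ideal_iff by auto
      then obtain y where y: "y \<in> carrier E" "\<forall>x\<in>I. f x = x \<odot>\<^bsub>E\<^esub> y"
        using b I f unfolding baer_submodule_def by blast
      have "(\<lambda>x. x \<odot>\<^bsub>E\<^esub> y) \<in> linear_maps R (regular_module R) E"
        unfolding linear_maps_regular_iff using y(1) by (auto simp: smult_l_distr smult_assoc1)
      then show "\<exists>g\<in>linear_maps R (regular_module R) E. \<forall>x\<in>I. g x = f x"
        using y(2) by force
    qed
  qed
qed

text \<open>A local ring whose maximal ideal \<open>M 1\<close> is nilpotent; \<open>M\<close> may be the sequence of its powers, or any
  multiplicative chain with the same properties, as the one given by the grading of an associated
  graded ring.\<close>

locale local_chain = cring R for R (structure) +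
  fixes M :: "nat \<Rightarrow> 'a set" and N :: nat
  assumes M_ideal: "ideal (M i) R"
    and M_0: "M 0 = carrier R"
    and M_N: "M N = {\<zero>}"
    and M_mult: "\<lbrakk>x \<in> M i; y \<in> M j\<rbrakk> \<Longrightarrow> x \<otimes> y \<in> M (i + j)"
    and M_unit: "\<lbrakk>x \<in> carrier R; x \<notin> M 1\<rbrakk> \<Longrightarrow> x \<in> Units R"
    and M_proper: "\<one> \<notin> M 1"
begin

lemma M_carr: "x \<in> M i \<Longrightarrow> x \<in> carrier R"
  using ideal.Icarr[OF M_ideal] .

lemma M1_not_unit: "x \<in> M 1 \<Longrightarrow> x \<notin> Units R"
proof
  assume x: "x \<in> M 1" "x \<in> Units R"
  then have "inv x \<otimes> x \<in> M 1" using ideal.I_l_closed[OF M_ideal, of x 1 "inv x"] Units_inv_closed by blast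
  then show False using M_proper x by simp
qed

lemma M_pow: "x \<in> M 1 \<Longrightarrow> x [^] k \<in> M k"
proof (induction k)
  case 0 then show ?case using M_0 by simp
next
  case (Suc k)
  then have "x [^] k \<otimes> x \<in> M (k + 1)" using M_mult by blast
  then show ?case using nat_pow_Suc[of x k] by (metis Suc_eq_plus1)
qed

text \<open>A non-zero socle element of \<open>R/J\<close>: the last step of the chain that is not yet contained in \<open>J\<close> is
  killed by \<open>M 1\<close> modulo \<open>J\<close>.\<close>

lemma socle_modulo:
  assumes J: "ideal J R" "J \<noteq> carrier R"
  obtains r where "r \<in> carrier R" "r \<notin> J" "\<And>a. a \<in> M 1 \<Longrightarrow> a \<otimes> r \<in> J"
proof -
  define i where "i = (LEAST i. M i \<subseteq> J)"
  have ex: "M N \<subseteq> J" using M_N J(1) by (simp add: additive_subgroup.zero_closed ideal.axioms(1))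
  have Mi: "M i \<subseteq> J" unfolding i_def by (rule LeastI[of _ N]) (rule ex)
  have "i \<noteq> 0"
  proof
    assume "i = 0"
    then have "carrier R \<subseteq> J" using Mi M_0 by simp
    then show False using J by (auto dest: ideal.Icarr)
  qed
  then obtain k where k: "i = Suc k" by (cases i) auto
  then have "\<not> M k \<subseteq> J" using not_less_Least[of k "\<lambda>i. M i \<subseteq> J"] i_def by simp
  then obtain r where r: "r \<in> M k" "r \<notin> J" by blast
  have "a \<otimes> r \<in> J" if "a \<in> M 1" for a
    using M_mult[OF that r(1)] k Mi by (auto simp: Suc_eq_plus1_left)
  then show thesis using that r M_carr by blast
qed

text \<open>Well defined, since \<open>c s = d s\<close> forces \<open>c - d\<close> to be no unit, hence in \<open>M 1\<close>, which kills \<open>x\<close>.\<close>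

lemma socle_map:
  assumes E: "module R E" and s: "s \<in> carrier R" "s \<noteq> \<zero>" "\<And>a. a \<in> M 1 \<Longrightarrow> a \<otimes> s = \<zero>"
    and x: "x \<in> carrier E" and ax: "\<And>a. a \<in> M 1 \<Longrightarrow> a \<odot>\<^bsub>E\<^esub> x = \<zero>\<^bsub>E\<^esub>"
  obtains f where "f \<in> linear_maps R (ideal_module R (PIdl s)) E"
    "\<And>c. c \<in> carrier R \<Longrightarrow> f (c \<otimes> s) = c \<odot>\<^bsub>E\<^esub> x"
proof -
  interpret E: module R E by fact
  define f where "f t = (THE v. \<exists>c\<in>carrier R. t = c \<otimes> s \<and> v = c \<odot>\<^bsub>E\<^esub> x)" for t
  have f: "f (c \<otimes> s) = c \<odot>\<^bsub>E\<^esub> x" if c: "c \<in> carrier R" for c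
    unfolding f_def
  proof (rule the_equality)
    show "\<exists>c'\<in>carrier R. c \<otimes> s = c' \<otimes> s \<and> c \<odot>\<^bsub>E\<^esub> x = c' \<odot>\<^bsub>E\<^esub> x" using c by blast
    fix v assume "\<exists>c'\<in>carrier R. c \<otimes> s = c' \<otimes> s \<and> v = c' \<odot>\<^bsub>E\<^esub> x"
    then obtain c' where c': "c' \<in> carrier R" "c \<otimes> s = c' \<otimes> s" "v = c' \<odot>\<^bsub>E\<^esub> x" by blast
    define d where "d = c' \<ominus> c"
    have dc: "d \<in> carrier R" "c' = d \<oplus> c" using c c' d_def by (auto, algebra)
    have "d \<otimes> s = \<zero>" unfolding d_def using c c' s(1) by (simp add: minus_eq l_distr l_minus r_neg)
    have "d \<in> M 1"
    proof (rule ccontr)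
      assume "d \<notin> M 1"
      then have u: "d \<in> Units R" using M_unit dc by blast
      have "inv d \<otimes> (d \<otimes> s) = \<zero>" using \<open>d \<otimes> s = \<zero>\<close> u by simp
      then show False using u s dc by (simp add: m_assoc[symmetric])
    qed
    then show "v = c \<odot>\<^bsub>E\<^esub> x" using c' dc c x ax by (simp add: E.smult_l_distr)
  qed
  have P: "t \<in> PIdl s \<longleftrightarrow> (\<exists>c\<in>carrier R. t = c \<otimes> s)" for t unfolding cgenideal_def by auto
  have flin: "f \<in> linear_maps R (ideal_module R (PIdl s)) E"
    unfolding linear_maps_ideal_iff
  proof (intro conjI ballI)
    show "f \<in> PIdl s \<rightarrow> carrier E" using f x by (auto simp: Pi_iff P)
    fix t u assume "t \<in> PIdl s" "u \<in> PIdl s"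
    then obtain c d where "c \<in> carrier R" "t = c \<otimes> s" "d \<in> carrier R" "u = d \<otimes> s" unfolding P by blast
    moreover then have "t \<oplus> u = (c \<oplus> d) \<otimes> s" using s by (simp add: l_distr)
    ultimately show "f (t \<oplus> u) = f t \<oplus>\<^bsub>E\<^esub> f u" using f x by (simp add: E.smult_l_distr)
  next
    fix r t assume "r \<in> carrier R" "t \<in> PIdl s"
    then obtain c where "r \<in> carrier R" "c \<in> carrier R" "t = c \<otimes> s" unfolding P by blast
    moreover then have "r \<otimes> t = (r \<otimes> c) \<otimes> s" using s by (simp add: m_assoc)
    ultimately show "f (r \<otimes> t) = r \<odot>\<^bsub>E\<^esub> f t" using f x by (simp add: E.smult_assoc1)
  qed
  show thesis by (rule that[OF flin f])
qed

lemma M1_prime: "primeideal (M 1) R"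
proof (intro primeidealI M_ideal)
  show "carrier R \<noteq> M 1" using M_proper by auto
  show "cring R" by (rule is_cring)
  fix a b assume ab: "a \<in> carrier R" "b \<in> carrier R" "a \<otimes> b \<in> M 1"
  show "a \<in> M 1 \<or> b \<in> M 1"
  proof (rule ccontr)
    assume "\<not> (a \<in> M 1 \<or> b \<in> M 1)"
    then have "a \<in> Units R" "b \<in> Units R" using ab M_unit by auto
    then have "a \<otimes> b \<in> Units R" by simp
    then show False using M1_not_unit ab by blast
  qed
qed

lemma prime_unique:
  assumes p: "primeideal p R" shows "p = M 1"
proof
  interpret p: primeideal p R by fact
  have pow: "x \<in> p" if "x \<in> carrier R" "x [^] k \<in> p" for x and k :: nat
    using that
  proof (induction k)
    case 0
    then have "p = carrier R" using p.one_imp_carrier by simp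
    then show ?case using p.I_notcarr by simp
  next
    case (Suc k)
    then show ?case using p.I_prime[of "x [^] k" x] by auto
  qed
  show "M 1 \<subseteq> p"
  proof
    fix x assume x: "x \<in> M 1"
    then have "x [^] N \<in> p" using M_pow[OF x, of N] M_N p.zero_closed by simp
    then show "x \<in> p" using pow M_carr[OF x] by blast
  qed
  show "p \<subseteq> M 1"
  proof
    fix x assume x: "x \<in> p"
    show "x \<in> M 1"
    proof (rule ccontr)
      assume "x \<notin> M 1"
      then have u: "x \<in> Units R" using M_unit p.Icarr x by blast
      then have "inv x \<otimes> x \<in> p" using p.I_l_closed[OF x, of "inv x"] Units_inv_closed by blast
      then have "\<one> \<in> p" using u by simp
      then show False using p.one_imp_carrier p.I_notcarr by simp
    qed
  qed
qed

end

locale artin_chain = local_chain +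
  assumes acc: "\<lbrakk>S \<noteq> {}; \<forall>J\<in>S. ideal J R\<rbrakk> \<Longrightarrow> \<exists>J\<in>S. \<forall>J'\<in>S. J \<subseteq> J' \<longrightarrow> J' = J"
begin

text \<open>Over such a ring it suffices to extend homomorphisms from the maximal ideal: a partial extension with
  maximal domain \<open>J \<noteq> R\<close> could be enlarged by an element of the socle of \<open>R/J\<close>, because there one has to
  extend \<open>a \<mapsto> g (a r)\<close> from \<open>M 1\<close>.\<close>

lemma baer_submoduleI:
  assumes E: "module R E"
    and C: "C \<subseteq> carrier E" "\<And>x y. \<lbrakk>x \<in> C; y \<in> C\<rbrakk> \<Longrightarrow> x \<oplus>\<^bsub>E\<^esub> y \<in> C"
      "\<And>r x. \<lbrakk>r \<in> carrier R; x \<in> C\<rbrakk> \<Longrightarrow> r \<odot>\<^bsub>E\<^esub> x \<in> C"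
    and residue: "\<And>h. \<lbrakk>h \<in> linear_maps R (ideal_module R (M 1)) E; h ` M 1 \<subseteq> C\<rbrakk>
          \<Longrightarrow> \<exists>y\<in>C. \<forall>a\<in>M 1. h a = a \<odot>\<^bsub>E\<^esub> y"
  shows "baer_submodule R E C"
  unfolding baer_submodule_def
proof (intro allI impI ballI)
  interpret E: module R E by fact
  fix I f
  assume I: "ideal I R" and f: "f \<in> linear_maps R (ideal_module R I) E"
    and fC: "f ` I \<subseteq> C"
  define S where "S = {J. ideal J R \<and> I \<subseteq> J \<and> (\<exists>g \<in> linear_maps R (ideal_module R J) E.
       g ` J \<subseteq> C \<and> (\<forall>x\<in>I. g x = f x))}"
  have "I \<in> S" unfolding S_def using I f fC by auto
  moreover have "\<forall>J\<in>S. ideal J R" unfolding S_def by auto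
  ultimately obtain J where J: "J \<in> S" "\<And>J'. \<lbrakk>J' \<in> S; J \<subseteq> J'\<rbrakk> \<Longrightarrow> J' = J"
    using acc[of S] by blast
  then obtain g where g: "ideal J R" "I \<subseteq> J" "g \<in> linear_maps R (ideal_module R J) E"
    "g ` J \<subseteq> C" "\<forall>x\<in>I. g x = f x" unfolding S_def by auto
  interpret J: ideal J R by fact
  have g_add: "g (x \<oplus> y) = g x \<oplus>\<^bsub>E\<^esub> g y" if "x \<in> J" "y \<in> J" for x y
    using g(3) that unfolding linear_maps_ideal_iff by blast
  have g_smult: "g (r \<otimes> x) = r \<odot>\<^bsub>E\<^esub> g x" if "r \<in> carrier R" "x \<in> J" for x r
    using g(3) that unfolding linear_maps_ideal_iff by blast
  have gC: "g x \<in> C" if "x \<in> J" for x using g(4) that by auto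
  have gE: "g x \<in> carrier E" if "x \<in> J" for x using gC C(1) that by auto
  show "\<exists>y\<in>C. \<forall>x\<in>I. f x = x \<odot>\<^bsub>E\<^esub> y"
  proof (cases "J = carrier R")
    case True
    then have "f x = x \<odot>\<^bsub>E\<^esub> g \<one>" if "x \<in> I" for x
      using g_smult[of x \<one>] g(2,5) that by (metis one_closed r_one subsetD)
    then show ?thesis using gC[of \<one>] True by blast
  next
    case False
    obtain r where r: "r \<in> carrier R" "r \<notin> J" "\<And>a. a \<in> M 1 \<Longrightarrow> a \<otimes> r \<in> J"
      using socle_modulo[OF g(1) False] by blast
    have "(\<lambda>a. g (a \<otimes> r)) \<in> linear_maps R (ideal_module R (M 1)) E"
      unfolding linear_maps_ideal_iff
    proof (intro conjI ballI)
      show "(\<lambda>a. g (a \<otimes> r)) \<in> M 1 \<rightarrow> carrier E" using gE r(3) by auto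
      fix x y assume "x \<in> M 1" "y \<in> M 1"
      then show "g ((x \<oplus> y) \<otimes> r) = g (x \<otimes> r) \<oplus>\<^bsub>E\<^esub> g (y \<otimes> r)"
        using g_add r M_carr by (simp add: l_distr)
    next
      fix c x assume "c \<in> carrier R" "x \<in> M 1"
      then show "g (c \<otimes> x \<otimes> r) = c \<odot>\<^bsub>E\<^esub> g (x \<otimes> r)"
        using g_smult r M_carr by (simp add: m_assoc)
    qed
    moreover have "(\<lambda>a. g (a \<otimes> r)) ` M 1 \<subseteq> C" using gC r(3) by auto
    ultimately obtain y where y: "y \<in> C" "\<forall>a\<in>M 1. g (a \<otimes> r) = a \<odot>\<^bsub>E\<^esub> y"
      using residue by blast
    have yE: "y \<in> carrier E" using y C by auto
    define J' where "J' = J <+>\<^bsub>R\<^esub> PIdl r"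
    have J'_iff: "t \<in> J' \<longleftrightarrow> (\<exists>j\<in>J. \<exists>c\<in>carrier R. t = j \<oplus> c \<otimes> r)" for t
      unfolding J'_def set_add_def' cgenideal_def by auto
    have J': "ideal J' R" unfolding J'_def by (intro add_ideals g(1) cgenideal_ideal r(1))
    define g' where "g' t = (THE v. \<exists>j\<in>J. \<exists>c\<in>carrier R. t = j \<oplus> c \<otimes> r \<and> v = g j \<oplus>\<^bsub>E\<^esub> c \<odot>\<^bsub>E\<^esub> y)" for t
    have g': "g' (j \<oplus> c \<otimes> r) = g j \<oplus>\<^bsub>E\<^esub> c \<odot>\<^bsub>E\<^esub> y" if jc: "j \<in> J" "c \<in> carrier R" for j c
      unfolding g'_def
    proof (rule the_equality)
      show "\<exists>j'\<in>J. \<exists>c'\<in>carrier R. j \<oplus> c \<otimes> r = j' \<oplus> c' \<otimes> r \<and> g j \<oplus>\<^bsub>E\<^esub> c \<odot>\<^bsub>E\<^esub> y = g j' \<oplus>\<^bsub>E\<^esub> c' \<odot>\<^bsub>E\<^esub> y"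
        using jc by blast
      fix v assume "\<exists>j'\<in>J. \<exists>c'\<in>carrier R. j \<oplus> c \<otimes> r = j' \<oplus> c' \<otimes> r \<and> v = g j' \<oplus>\<^bsub>E\<^esub> c' \<odot>\<^bsub>E\<^esub> y"
      then obtain j' c' where j': "j' \<in> J" "c' \<in> carrier R" "j \<oplus> c \<otimes> r = j' \<oplus> c' \<otimes> r"
        "v = g j' \<oplus>\<^bsub>E\<^esub> c' \<odot>\<^bsub>E\<^esub> y" by blast
      define d where "d = c' \<ominus> c"
      have cc: "j \<in> carrier R" "j' \<in> carrier R" "d \<in> carrier R"
        using jc j' J.Icarr d_def by auto
      have c': "c' = d \<oplus> c" unfolding d_def using jc j' by algebra
      have e0: "j \<oplus> c \<otimes> r = (j' \<oplus> d \<otimes> r) \<oplus> c \<otimes> r"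
        using j'(3) cc r jc unfolding c' by (simp add: l_distr a_assoc)
      then have e1: "j = j' \<oplus> d \<otimes> r" using cc r jc by simp
      have e2: "d \<otimes> r = j \<ominus> j'" unfolding e1 using cc r by algebra
      have "d \<otimes> r \<in> J" unfolding e2 a_minus_def using jc j' J.a_closed J.a_inv_closed by simp
      have dM: "d \<in> M 1"
      proof (rule ccontr)
        assume "d \<notin> M 1"
        then have u: "d \<in> Units R" using M_unit cc by blast
        then have "inv d \<otimes> (d \<otimes> r) \<in> J" using J.I_l_closed \<open>d \<otimes> r \<in> J\<close> by auto
        then show False using u r cc by (simp add: m_assoc[symmetric])
      qed
      have "g j = g j' \<oplus>\<^bsub>E\<^esub> d \<odot>\<^bsub>E\<^esub> y" using e1 g_add j'(1) r(3)[OF dM] y(2) dM by simp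
      then show "v = g j \<oplus>\<^bsub>E\<^esub> c \<odot>\<^bsub>E\<^esub> y"
        using j'(4) c' cc jc yE gE[OF j'(1)] by (simp add: E.smult_l_distr E.M.a_assoc)
    qed
    have g'_lin: "g' \<in> linear_maps R ((regular_module R)\<lparr>carrier := J'\<rparr>) E"
      unfolding linear_maps_ideal_iff
    proof (intro conjI ballI)
      show "g' \<in> J' \<rightarrow> carrier E"
        using g' gE yE by (auto simp: Pi_iff J'_iff)
      fix x1 x2 assume "x1 \<in> J'" "x2 \<in> J'"
      then obtain j1 c1 j2 c2 where jc: "j1 \<in> J" "c1 \<in> carrier R" "x1 = j1 \<oplus> c1 \<otimes> r"
        "j2 \<in> J" "c2 \<in> carrier R" "x2 = j2 \<oplus> c2 \<otimes> r" unfolding J'_iff by blast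
      have "x1 \<oplus> x2 = (j1 \<oplus> j2) \<oplus> (c1 \<oplus> c2) \<otimes> r"
        unfolding jc using jc(1,2,4,5) r(1) J.Icarr by algebra
      then have "g' (x1 \<oplus> x2) = g (j1 \<oplus> j2) \<oplus>\<^bsub>E\<^esub> (c1 \<oplus> c2) \<odot>\<^bsub>E\<^esub> y"
        using g' jc by auto
      also have "\<dots> = (g j1 \<oplus>\<^bsub>E\<^esub> c1 \<odot>\<^bsub>E\<^esub> y) \<oplus>\<^bsub>E\<^esub> (g j2 \<oplus>\<^bsub>E\<^esub> c2 \<odot>\<^bsub>E\<^esub> y)"
        using jc g_add gE yE by (simp add: E.smult_l_distr E.M.a_ac)
      finally show "g' (x1 \<oplus> x2) = g' x1 \<oplus>\<^bsub>E\<^esub> g' x2" using g' jc by simp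
    next
      fix a x assume "a \<in> carrier R" "x \<in> J'"
      then obtain j c where jc: "a \<in> carrier R" "j \<in> J" "c \<in> carrier R" "x = j \<oplus> c \<otimes> r"
        unfolding J'_iff by blast
      have "a \<otimes> x = (a \<otimes> j) \<oplus> (a \<otimes> c) \<otimes> r"
        unfolding jc using jc(1-3) r(1) J.Icarr by algebra
      then have "g' (a \<otimes> x) = g (a \<otimes> j) \<oplus>\<^bsub>E\<^esub> (a \<otimes> c) \<odot>\<^bsub>E\<^esub> y"
        using g' jc J.I_l_closed by auto
      also have "\<dots> = a \<odot>\<^bsub>E\<^esub> (g j \<oplus>\<^bsub>E\<^esub> c \<odot>\<^bsub>E\<^esub> y)"
        using jc g_smult gE yE by (simp add: E.smult_r_distr E.smult_assoc1)
      finally show "g' (a \<otimes> x) = a \<odot>\<^bsub>E\<^esub> g' x" using g' jc by simp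
    qed
    have g'_J: "g' x = g x" if "x \<in> J" for x
      using g'[OF that, of \<zero>] that yE gE r J.Icarr E.smult_l_null by simp
    have "J' \<in> S"
      unfolding S_def
    proof (intro CollectI conjI bexI[OF _ g'_lin] J')
      have "J \<subseteq> J'"
      proof
        fix x assume x: "x \<in> J"
        then have "x = x \<oplus> \<zero> \<otimes> r" using J.Icarr r by simp
        then show "x \<in> J'" unfolding J'_iff using x by blast
      qed
      then show "I \<subseteq> J'" using g(2) by simp
      show "g' ` J' \<subseteq> C" 
      proof
        fix v assume "v \<in> g' ` J'"
        then obtain j c where "j \<in> J" "c \<in> carrier R" "v = g' (j \<oplus> c \<otimes> r)" using J'_iff by auto
        then show "v \<in> C" using g' gC C(2,3) y(1) by simp
      qed
      show "\<forall>x\<in>I. g' x = f x" using g'_J g(2,5) by auto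
    qed
    moreover have "J \<subseteq> J'"
    proof
      fix x assume x: "x \<in> J"
      then have "x = x \<oplus> \<zero> \<otimes> r" using J.Icarr r by simp
      then show "x \<in> J'" unfolding J'_iff using x by blast
    qed
    ultimately have "J' = J" by (rule J(2))
    moreover have "r \<in> J'" unfolding J'_iff
      by (rule bexI[of _ \<zero>], rule bexI[of _ \<one>]) (use r in auto)
    ultimately show ?thesis using r(2) by simp
  qed
qed

lemma linear_zero:
  assumes "module R E" "module R E'" "\<delta> \<in> linear_maps R E E'"
  shows "\<delta> \<zero>\<^bsub>E\<^esub> = \<zero>\<^bsub>E'\<^esub>"
proof -
  interpret E: module R E by fact
  interpret E': module R E' by fact
  have *: "\<zero>\<^bsub>E\<^esub> = \<zero> \<odot>\<^bsub>E\<^esub> \<zero>\<^bsub>E\<^esub>" using E.smult_l_null[OF E.M.zero_closed] by simp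
  have "\<delta> (\<zero> \<odot>\<^bsub>E\<^esub> \<zero>\<^bsub>E\<^esub>) = \<zero> \<odot>\<^bsub>E'\<^esub> \<delta> \<zero>\<^bsub>E\<^esub>"
    using assms(3) E.M.zero_closed zero_closed unfolding linear_maps_def by blast
  moreover have "\<delta> \<zero>\<^bsub>E\<^esub> \<in> carrier E'" using assms(3) unfolding linear_maps_def by auto
  ultimately show ?thesis using * E'.smult_l_null by simp
qed

text \<open>Going down in a resolution.  A map \<open>h\<close> from \<open>M 1\<close> to the kernel is multiplication with some \<open>e \<in> E\<close>, and
  \<open>\<delta> e\<close> is killed by \<open>M 1\<close>.  For a socle element \<open>s\<close> of the ring, \<open>s \<mapsto> \<delta> e\<close> is therefore well defined,
  so that \<open>\<delta> e = s \<delta> e'\<close>; and \<open>e - s e'\<close> lies in the kernel and induces the same \<open>h\<close>.\<close>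

lemma baer_kernel:
  assumes E: "injective_module R E" and E': "module R E'"
    and \<delta>: "\<delta> \<in> linear_maps R E E'"
    and image: "baer_submodule R E' (\<delta> ` carrier E)"
  shows "baer_submodule R E {x \<in> carrier E. \<delta> x = \<zero>\<^bsub>E'\<^esub>}" (is "baer_submodule R E ?C")
proof -
  have mE: "module R E" using E injective_module_def by blast
  interpret E: module R E by fact
  interpret E': module R E' by fact
  have \<delta>c: "\<delta> x \<in> carrier E'" if "x \<in> carrier E" for x using \<delta> that unfolding linear_maps_def by auto
  have \<delta>a: "\<delta> (x \<oplus>\<^bsub>E\<^esub> y) = \<delta> x \<oplus>\<^bsub>E'\<^esub> \<delta> y" if "x \<in> carrier E" "y \<in> carrier E" for x y
    using \<delta> that unfolding linear_maps_def by auto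
  have \<delta>s: "\<delta> (r \<odot>\<^bsub>E\<^esub> x) = r \<odot>\<^bsub>E'\<^esub> \<delta> x" if "r \<in> carrier R" "x \<in> carrier E" for r x
    using \<delta> that unfolding linear_maps_def by auto
  have "{\<zero>} \<noteq> carrier R" using M_proper ideal.Icarr additive_subgroup.zero_closed[OF ideal.axioms(1)[OF M_ideal]]
    by (metis one_closed singletonD)
  then obtain s where s: "s \<in> carrier R" "s \<noteq> \<zero>" "\<And>a. a \<in> M 1 \<Longrightarrow> a \<otimes> s = \<zero>"
    using socle_modulo[OF zeroideal] by auto
  show ?thesis
  proof (rule baer_submoduleI[OF mE])
    show "?C \<subseteq> carrier E" by auto
    show "x \<oplus>\<^bsub>E\<^esub> y \<in> ?C" if "x \<in> ?C" "y \<in> ?C" for x y using that \<delta>a by auto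
    show "r \<odot>\<^bsub>E\<^esub> x \<in> ?C" if "r \<in> carrier R" "x \<in> ?C" for r x using that \<delta>s by auto
    fix h assume h: "h \<in> linear_maps R (ideal_module R (M 1)) E" and hC: "h ` M 1 \<subseteq> ?C"
    have "h ` M 1 \<subseteq> carrier E" using hC by auto
    moreover have "baer_submodule R E (carrier E)" using E injective_module_baer[OF mE] by simp
    ultimately have "\<exists>e\<in>carrier E. \<forall>a\<in>M 1. h a = a \<odot>\<^bsub>E\<^esub> e"
      by (intro baer_submoduleD[OF _ M_ideal h])
    then obtain e where e: "e \<in> carrier E" "\<And>a. a \<in> M 1 \<Longrightarrow> h a = a \<odot>\<^bsub>E\<^esub> e" by blast
    define x where "x = \<delta> e"
    have x: "x \<in> carrier E'" "x \<in> \<delta> ` carrier E" using e \<delta>c x_def by auto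
    have ax: "a \<odot>\<^bsub>E'\<^esub> x = \<zero>\<^bsub>E'\<^esub>" if a: "a \<in> M 1" for a
    proof -
      have "\<delta> (h a) = \<zero>\<^bsub>E'\<^esub>" using hC a by auto
      then show ?thesis using e a M_carr \<delta>s x_def by simp
    qed
    obtain f where flin: "f \<in> linear_maps R (ideal_module R (PIdl s)) E'"
      and f: "\<And>c. c \<in> carrier R \<Longrightarrow> f (c \<otimes> s) = c \<odot>\<^bsub>E'\<^esub> x"
      using socle_map[OF E' s x(1) ax] by blast
    have P: "t \<in> PIdl s \<longleftrightarrow> (\<exists>c\<in>carrier R. t = c \<otimes> s)" for t unfolding cgenideal_def by auto
    have "f ` (PIdl s) \<subseteq> \<delta> ` carrier E"
    proof
      fix v assume "v \<in> f ` (PIdl s)"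
      then obtain c where c: "c \<in> carrier R" "v = c \<odot>\<^bsub>E'\<^esub> x" using f P by auto
      then have "v = \<delta> (c \<odot>\<^bsub>E\<^esub> e)" using x_def \<delta>s e by simp
      then show "v \<in> \<delta> ` carrier E" using c e by auto
    qed
    from baer_submoduleD[OF image cgenideal_ideal[OF s(1)] flin this]
    obtain z where z: "z \<in> \<delta> ` carrier E" "\<forall>t\<in>PIdl s. f t = t \<odot>\<^bsub>E'\<^esub> z" by blast
    then obtain w where w: "w \<in> carrier E" "z = \<delta> w" by blast
    have "s \<in> PIdl s" unfolding P using s by (intro bexI[of _ \<one>]) auto
    then have xz: "x = s \<odot>\<^bsub>E'\<^esub> \<delta> w" using z w f[of \<one>] s x by simp
    define y where "y = e \<ominus>\<^bsub>E\<^esub> s \<odot>\<^bsub>E\<^esub> w"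
    have y: "y \<in> carrier E" using y_def e w s by simp
    have ey: "e = y \<oplus>\<^bsub>E\<^esub> s \<odot>\<^bsub>E\<^esub> w" unfolding y_def using e w s
      by (simp add: E.M.minus_eq E.M.a_assoc E.M.l_neg)
    have "\<delta> e = \<delta> y \<oplus>\<^bsub>E'\<^esub> x" unfolding ey using \<delta>a y w s \<delta>s xz by simp
    then have "\<zero>\<^bsub>E'\<^esub> \<oplus>\<^bsub>E'\<^esub> x = \<delta> y \<oplus>\<^bsub>E'\<^esub> x" using x_def x by simp
    then have "\<delta> y = \<zero>\<^bsub>E'\<^esub>" using x \<delta>c[OF y] by (metis E'.M.add.r_cancel E'.M.zero_closed)
    moreover have "h a = a \<odot>\<^bsub>E\<^esub> y" if a: "a \<in> M 1" for a
    proof -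
      have ac: "a \<in> carrier R" using a M_carr by blast
      have "a \<odot>\<^bsub>E\<^esub> (s \<odot>\<^bsub>E\<^esub> w) = \<zero>\<^bsub>E\<^esub>"
        using E.smult_assoc1[OF ac s(1) w(1)] s(3)[OF a] E.smult_l_null w by simp
      then have "a \<odot>\<^bsub>E\<^esub> e = a \<odot>\<^bsub>E\<^esub> y" unfolding ey using y w s ac by (simp add: E.smult_r_distr)
      then show ?thesis using e(2) a by simp
    qed
    ultimately show "\<exists>y\<in>?C. \<forall>a\<in>M 1. h a = a \<odot>\<^bsub>E\<^esub> y" using y by blast
  qed
qed

end

definition self_injective :: "('a, 'x) ring_scheme \<Rightarrow> bool" where
  "self_injective R \<longleftrightarrow> (\<forall>I. ideal I R \<longrightarrow>
     (\<forall>f \<in> linear_maps R (ideal_module R I) (regular_module R).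
        \<exists>g\<in>carrier R. \<forall>x\<in>I. f x = x \<otimes>\<^bsub>R\<^esub> g))"

lemma self_injectiveD:
  assumes "self_injective R" "ideal I R"
    "f \<in> linear_maps R (ideal_module R I) (regular_module R)"
  shows "\<exists>g\<in>carrier R. \<forall>x\<in>I. f x = x \<otimes>\<^bsub>R\<^esub> g"
  using assms unfolding self_injective_def by simp

text \<open>In a bounded injective resolution the kernels beyond its end are trivially relatively injective;
  descending induction reaches the image of \<open>R\<close> itself.\<close>

lemma (in artin_chain) finite_injective_dimension_imp_self_injective:
  assumes "finite_injective_dimension R (regular_module R)"
  shows "self_injective R"
proof -
  from assms[unfolded finite_injective_dimension_def]
  obtain E :: "nat \<Rightarrow> ('a, nat \<Rightarrow> 'a) module" and \<iota> \<delta> d where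
    inj': "\<forall>i. injective_module R (E i)"
    and triv': "\<forall>i>d. carrier (E i) = {\<zero>\<^bsub>E i\<^esub>}"
    and \<iota>: "\<iota> \<in> linear_maps R (regular_module R) (E 0)" "inj_on \<iota> (carrier (regular_module R))"
    and \<delta>': "\<forall>i. \<delta> i \<in> linear_maps R (E i) (E (Suc i))"
    and ex0: "\<iota> ` carrier (regular_module R) = {x \<in> carrier (E 0). \<delta> 0 x = \<zero>\<^bsub>E 1\<^esub>}"
    and ex': "\<forall>i. \<delta> i ` carrier (E i) = {x \<in> carrier (E (Suc i)). \<delta> (Suc i) x = \<zero>\<^bsub>E (Suc (Suc i))\<^esub>}"
    by (elim exE conjE) (rule that)
  note inj = inj'[rule_format] and triv = triv'[rule_format] and \<delta> = \<delta>'[rule_format]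
    and ex = ex'[rule_format]
  have mE: "module R (E i)" for i using inj injective_module_def by blast
  define C where "C i = {x \<in> carrier (E i). \<delta> i x = \<zero>\<^bsub>E (Suc i)\<^esub>}" for i
  have top: "baer_submodule R (E i) (C i)" if "i > d" for i
  proof -
    interpret Ei: module R "E i" by (rule mE)
    have "\<zero>\<^bsub>E i\<^esub> \<in> C i" using linear_zero[OF mE mE \<delta>] C_def by simp
    then have Ci: "C i = {\<zero>\<^bsub>E i\<^esub>}" using triv[OF that] C_def by auto
    show ?thesis unfolding baer_submodule_def Ci
      using Ei.smult_r_null ideal.Icarr by fastforce
  qed
  have "baer_submodule R (E i) (C i)" for i
  proof (induction "Suc d - i" arbitrary: i)
    case 0
    then show ?case using top by simp
  next
    case (Suc k)
    have "baer_submodule R (E (Suc i)) (C (Suc i))" using Suc(1)[of "Suc i"] Suc(2) by simp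
    then have "baer_submodule R (E (Suc i)) (\<delta> i ` carrier (E i))" using ex C_def by simp
    then show ?case unfolding C_def using baer_kernel[OF inj mE \<delta>] by blast
  qed
  then have b0: "baer_submodule R (E 0) (\<iota> ` carrier R)"
    using ex0 C_def by (simp add: regular_module_def One_nat_def)
  show ?thesis
    unfolding self_injective_def
  proof (intro allI impI ballI)
    fix I f assume I: "ideal I R"
      and "f \<in> linear_maps R (ideal_module R I) (regular_module R)"
    then have f: "f \<in> I \<rightarrow> carrier R" "\<And>x y. \<lbrakk>x\<in>I; y\<in>I\<rbrakk> \<Longrightarrow> f (x \<oplus> y) = f x \<oplus> f y"
      "\<And>r x. \<lbrakk>r\<in>carrier R; x\<in>I\<rbrakk> \<Longrightarrow> f (r \<otimes> x) = r \<otimes> f x"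
      unfolding linear_maps_ideal_iff by (auto simp: regular_module_def)
    have i: "\<iota> \<in> carrier R \<rightarrow> carrier (E 0)" "\<And>x y. \<lbrakk>x\<in>carrier R; y\<in>carrier R\<rbrakk> \<Longrightarrow> \<iota> (x \<oplus> y) = \<iota> x \<oplus>\<^bsub>E 0\<^esub> \<iota> y"
      "\<And>r x. \<lbrakk>r\<in>carrier R; x\<in>carrier R\<rbrakk> \<Longrightarrow> \<iota> (r \<otimes> x) = r \<odot>\<^bsub>E 0\<^esub> \<iota> x"
      using \<iota>(1) unfolding linear_maps_regular_iff by auto
    have "(\<lambda>x. \<iota> (f x)) \<in> linear_maps R (ideal_module R I) (E 0)"
      unfolding linear_maps_ideal_iff using f i by (auto simp: Pi_iff)
    moreover have "(\<lambda>x. \<iota> (f x)) ` I \<subseteq> \<iota> ` carrier R" using f(1) by auto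
    ultimately have "\<exists>y\<in>\<iota> ` carrier R. \<forall>x\<in>I. \<iota> (f x) = x \<odot>\<^bsub>E 0\<^esub> y"
      by (rule baer_submoduleD[OF b0 I])
    then obtain g where g: "g \<in> carrier R" "\<forall>x\<in>I. \<iota> (f x) = x \<odot>\<^bsub>E 0\<^esub> \<iota> g" by blast
    have "f x = x \<otimes> g" if "x \<in> I" for x
    proof -
      have xc: "x \<in> carrier R" using I that ideal.Icarr by metis
      have "\<iota> (f x) = \<iota> (x \<otimes> g)" using g i(3)[OF xc g(1)] that by simp
      moreover have "f x \<in> carrier (regular_module R)" "x \<otimes> g \<in> carrier (regular_module R)"
        using f(1) that xc g(1) by (auto simp: regular_module_def)
      ultimately show ?thesis using \<iota>(2) by (meson inj_onD)
    qed
    then show "\<exists>g\<in>carrier R. \<forall>x\<in>I. f x = x \<otimes> g" using g(1) by blast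
  qed
qed

lemma (in cring) self_injective_imp_finite_injective_dimension:
  assumes "self_injective R"
  shows "finite_injective_dimension R (regular_module R)"
proof -
  \<comment> \<open>The resolution \<open>R \<rightarrow> R \<rightarrow> 0\<close>; its modules live in the type of sequences, so elements of \<open>R\<close> become
    constant sequences.\<close>
  define Z :: "('a, nat \<Rightarrow> 'a) module" where
    "Z = \<lparr>carrier = {\<lambda>_. \<zero>}, monoid.mult = (\<lambda>f g i. \<zero>), one = (\<lambda>_. \<zero>), zero = (\<lambda>_. \<zero>),
          add = (\<lambda>f g i. \<zero>), module.smult = (\<lambda>r f i. \<zero>)\<rparr>"
  define A :: "('a, nat \<Rightarrow> 'a) module" where
    "A = \<lparr>carrier = (\<lambda>x _. x) ` carrier R, monoid.mult = (\<lambda>f g i. f i \<otimes> g i), one = (\<lambda>_. \<one>), zero = (\<lambda>_. \<zero>),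
          add = (\<lambda>f g i. f i \<oplus> g i), module.smult = (\<lambda>r f i. r \<otimes> f i)\<rparr>"
  have mZ: "module R Z"
    by (rule moduleI[OF is_cring], rule abelian_groupI) (auto simp: Z_def)
  have mA: "module R A"
    by (rule moduleI[OF is_cring], rule abelian_groupI)
      (auto simp: A_def l_distr r_distr m_assoc a_ac intro: bexI[of _ "\<ominus> _"] l_neg)
  have iZ: "injective_module R Z"
    unfolding injective_module_baer[OF mZ] baer_submodule_def linear_maps_ideal_iff
    by (auto simp: Z_def Pi_iff)
  have iA: "injective_module R A"
    unfolding injective_module_baer[OF mA] baer_submodule_def
  proof (intro allI impI ballI)
    fix I f assume I: "ideal I R" and f: "f \<in> linear_maps R (ideal_module R I) A"
    have fc: "\<exists>y\<in>carrier R. f x = (\<lambda>_. y)" if "x \<in> I" for x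
      using f that unfolding linear_maps_ideal_iff by (auto simp: A_def Pi_iff)
    have "(\<lambda>x. f x 0) \<in> linear_maps R (ideal_module R I) (regular_module R)"
      unfolding linear_maps_ideal_iff
    proof (intro conjI ballI)
      show "(\<lambda>x. f x 0) \<in> I \<rightarrow> carrier (regular_module R)"
        using fc by (auto simp: regular_module_def Pi_iff) metis
      show "f (x \<oplus> y) 0 = f x 0 \<oplus>\<^bsub>regular_module R\<^esub> f y 0" if "x \<in> I" "y \<in> I" for x y
        using f that unfolding linear_maps_ideal_iff by (simp add: A_def regular_module_def)
      show "f (r \<otimes> x) 0 = r \<odot>\<^bsub>regular_module R\<^esub> f x 0" if "r \<in> carrier R" "x \<in> I" for r x
        using f that unfolding linear_maps_ideal_iff by (simp add: A_def regular_module_def)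
    qed
    from self_injectiveD[OF assms I this]
    obtain g where g: "g \<in> carrier R" "\<forall>x\<in>I. f x 0 = x \<otimes> g" by blast
    have "f x = (\<lambda>_. x \<otimes> g)" if "x \<in> I" for x using fc[OF that] g(2) that by force
    then show "\<exists>y\<in>carrier A. \<forall>x\<in>I. f x = x \<odot>\<^bsub>A\<^esub> y"
      using g(1) by (intro bexI[of _ "\<lambda>_. g"]) (auto simp: A_def)
  qed
  define E where "E i = (if i = 0 then A else Z)" for i :: nat
  have z0: "(\<lambda>_ _. \<zero>) \<in> linear_maps R (E i) (E (Suc i))" for i
    unfolding linear_maps_def E_def by (auto simp: Z_def)
  show ?thesis
    unfolding finite_injective_dimension_def
  proof (intro exI conjI allI impI)
    show "injective_module R (E i)" for i using iZ iA E_def by simp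
    show "carrier (E i) = {\<zero>\<^bsub>E i\<^esub>}" if "i > 0" for i using that E_def Z_def by simp
    show "(\<lambda>x _. x) \<in> linear_maps R (regular_module R) (E 0)"
      unfolding linear_maps_regular_iff by (auto simp: E_def A_def)
    show "inj_on (\<lambda>x _. x) (carrier (regular_module R))" by (auto simp: inj_on_def fun_eq_iff)
    show "(\<lambda>_ _. \<zero>) \<in> linear_maps R (E i) (E (Suc i))" for i by (rule z0)
    show "(\<lambda>x _. x) ` carrier (regular_module R) = {x \<in> carrier (E 0). (\<lambda>_. \<zero>) = \<zero>\<^bsub>E 1\<^esub>}"
      by (auto simp: E_def A_def Z_def regular_module_def)
    show "(\<lambda>_ _. \<zero>) ` carrier (E i) = {x \<in> carrier (E (Suc i)). (\<lambda>_. \<zero>) = \<zero>\<^bsub>E (Suc (Suc i))\<^esub>}" for i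
      by (auto simp: E_def A_def Z_def)
  qed
qed

lemma (in cring) regular_module_is_module: "module R (regular_module R)"
proof (rule moduleI)
  show "cring R" by (rule is_cring)
  show "abelian_group (regular_module R)"
    by (rule abelian_groupI) (auto simp: regular_module_def a_ac intro: bexI[of _ "\<ominus> _"] l_neg)
qed (auto simp: regular_module_def l_distr r_distr m_assoc)

text \<open>The map \<open>s \<mapsto> t\<close> on the ideal generated by \<open>s\<close> is a multiplication.\<close>

lemma (in local_chain) self_injective_socle:
  assumes self: "self_injective R"
    and s: "s \<in> carrier R" "s \<noteq> \<zero>" "\<And>a. a \<in> M 1 \<Longrightarrow> a \<otimes> s = \<zero>"
    and t: "t \<in> carrier R" "\<And>a. a \<in> M 1 \<Longrightarrow> a \<otimes> t = \<zero>"
  obtains r where "r \<in> carrier R" "t = s \<otimes> r"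
proof -
  have tm: "t \<in> carrier (regular_module R)"
    "\<And>a. a \<in> M 1 \<Longrightarrow> a \<odot>\<^bsub>regular_module R\<^esub> t = \<zero>\<^bsub>regular_module R\<^esub>"
    using t by (simp_all add: regular_module_def)
  obtain f where flin: "f \<in> linear_maps R (ideal_module R (PIdl s)) (regular_module R)"
    and "\<And>c. c \<in> carrier R \<Longrightarrow> f (c \<otimes> s) = c \<odot>\<^bsub>regular_module R\<^esub> t"
    using socle_map[OF regular_module_is_module s tm] by blast
  then have f: "f (c \<otimes> s) = c \<otimes> t" if "c \<in> carrier R" for c using that by (simp add: regular_module_def)
  have P: "u \<in> PIdl s \<longleftrightarrow> (\<exists>c\<in>carrier R. u = c \<otimes> s)" for u unfolding cgenideal_def by auto
  from self_injectiveD[OF self cgenideal_ideal[OF s(1)] flin]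
  obtain g where g: "g \<in> carrier R" "\<forall>x\<in>PIdl s. f x = x \<otimes> g" by blast
  have "s \<in> PIdl s" unfolding P using s by (intro bexI[of _ \<one>]) auto
  then have "f s = s \<otimes> g" using g by blast
  moreover have "f s = t" using f[of \<one>] s t by simp
  ultimately show thesis using that g by simp
qed

section \<open>Gorenstein local rings\<close>

lemma (in noetherian_ring) ideals_acc:
  assumes "S \<noteq> {}" "\<forall>J\<in>S. ideal J R"
  shows "\<exists>J\<in>S. \<forall>J'\<in>S. J \<subseteq> J' \<longrightarrow> J' = J"
proof (rule subset_Zorn_nonempty[OF assms(1)])
  fix C assume C: "C \<noteq> {}" "subset.chain S C"
  then have "subset.chain {I. ideal I R} C" using assms(2) unfolding subset.chain_def by auto
  then have "\<Union>C \<in> C" using ideal_chain_is_trivial C(1) by blast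
  then show "\<Union>C \<in> S" using C(2) unfolding subset.chain_def by auto
qed

context local_chain begin

lemma fraction_eq_iff:
  assumes "r \<in> carrier R" "s \<in> carrier R - M 1"
  shows "(r', s') \<in> fraction R (M 1) r s \<longleftrightarrow>
     r' \<in> carrier R \<and> s' \<in> carrier R - M 1 \<and> r \<otimes> s' = r' \<otimes> s"
proof -
  have "(\<exists>u \<in> carrier R - M 1. u \<otimes> (r \<otimes> s') = u \<otimes> (r' \<otimes> s)) \<longleftrightarrow> r \<otimes> s' = r' \<otimes> s"
    if "r' \<in> carrier R" "s' \<in> carrier R"
  proof
    assume "\<exists>u \<in> carrier R - M 1. u \<otimes> (r \<otimes> s') = u \<otimes> (r' \<otimes> s)"
    then obtain u where u: "u \<in> Units R" "u \<otimes> (r \<otimes> s') = u \<otimes> (r' \<otimes> s)" using M_unit by blast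
    then show "r \<otimes> s' = r' \<otimes> s" using Units_l_cancel[OF u(1)] that assms by simp
  next
    assume "r \<otimes> s' = r' \<otimes> s"
    then show "\<exists>u \<in> carrier R - M 1. u \<otimes> (r \<otimes> s') = u \<otimes> (r' \<otimes> s)"
      using M_proper by (intro bexI[of _ \<one>]) auto
  qed
  then show ?thesis unfolding fraction_def by auto
qed

lemma nonmax_mult: "s \<in> carrier R - M 1 \<Longrightarrow> t \<in> carrier R - M 1 \<Longrightarrow> s \<otimes> t \<in> carrier R - M 1"
  using M_unit M1_not_unit Units_m_closed Units_closed by (metis DiffD1 DiffD2 DiffI)

lemma fraction_cong:
  assumes "r \<in> carrier R" "s \<in> carrier R - M 1" "r' \<in> carrier R" "s' \<in> carrier R - M 1"
    and "r \<otimes> s' = r' \<otimes> s"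
  shows "fraction R (M 1) r s = fraction R (M 1) r' s'"
proof -
  have sub: "fraction R (M 1) r s \<subseteq> fraction R (M 1) r' s'"
    if "r \<in> carrier R" "s \<in> carrier R - M 1" "r' \<in> carrier R" "s' \<in> carrier R - M 1"
      "r \<otimes> s' = r' \<otimes> s" for r s r' s'
  proof
    fix x assume x: "x \<in> fraction R (M 1) r s"
    obtain a b where [simp]: "x = (a, b)" by (cases x)
    from x have ab: "a \<in> carrier R" "b \<in> carrier R - M 1" "r \<otimes> b = a \<otimes> s"
      using fraction_eq_iff that by auto
    have "s \<otimes> (r' \<otimes> b) = (r' \<otimes> s) \<otimes> b" using that ab by (simp add: m_ac)
    also have "\<dots> = (r \<otimes> s') \<otimes> b" using that(5) by simp
    also have "\<dots> = (r \<otimes> b) \<otimes> s'" using that(1-4) ab(1,2) by (simp add: m_ac)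
    also have "\<dots> = s \<otimes> (a \<otimes> s')" unfolding ab(3) using that(1-4) ab(1,2) by (simp add: m_ac)
    finally have "r' \<otimes> b = a \<otimes> s'" using Units_l_cancel[of s] M_unit that ab by auto
    then show "x \<in> fraction R (M 1) r' s'" using fraction_eq_iff that ab by auto
  qed
  show ?thesis using sub[OF assms] sub[OF assms(3,4,1,2) assms(5)[symmetric]] by blast
qed

lemma localization_iso:
  "(\<lambda>r. fraction R (M 1) r \<one>) \<in> ring_iso R (localization R (M 1))"
proof -
  let ?h = "\<lambda>r. fraction R (M 1) r \<one>"
  let ?L = "localization R (M 1)"
  have one: "\<one> \<in> carrier R - M 1" using M_proper by simp
  have mem: "(r, s) \<in> ?h a \<longleftrightarrow> r \<in> carrier R \<and> s \<in> carrier R - M 1 \<and> r = a \<otimes> s"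
    if "a \<in> carrier R" for a r s using fraction_eq_iff[OF that one] by auto
  have self: "(a, \<one>) \<in> ?h a" if "a \<in> carrier R" for a using mem that one by auto
  have mult: "?h (a \<otimes> b) = ?h a \<otimes>\<^bsub>?L\<^esub> ?h b" if ab: "a \<in> carrier R" "b \<in> carrier R" for a b
  proof -
    have eq: "fraction R (M 1) (r \<otimes> r') (s \<otimes> s') = ?h (a \<otimes> b)"
      if "(r, s) \<in> ?h a" "(r', s') \<in> ?h b" for r s r' s'
    proof -
      have *: "s \<in> carrier R - M 1" "s' \<in> carrier R - M 1" "r = a \<otimes> s" "r' = b \<otimes> s'" using that mem ab by auto
      show ?thesis using * ab one nonmax_mult[OF *(1,2)] by (intro fraction_cong) (auto simp: m_ac)
    qed
    have "?h a \<otimes>\<^bsub>?L\<^esub> ?h b = \<Union>{fraction R (M 1) (r \<otimes> r') (s \<otimes> s') | r s r' s'. (r, s) \<in> ?h a \<and> (r', s') \<in> ?h b}"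
      unfolding localization_def by simp
    also have "{fraction R (M 1) (r \<otimes> r') (s \<otimes> s') | r s r' s'. (r, s) \<in> ?h a \<and> (r', s') \<in> ?h b} = {?h (a \<otimes> b)}"
      using self ab eq by (auto; metis)
    finally show ?thesis by simp
  qed
  have add: "?h (a \<oplus> b) = ?h a \<oplus>\<^bsub>?L\<^esub> ?h b" if ab: "a \<in> carrier R" "b \<in> carrier R" for a b
  proof -
    have eq: "fraction R (M 1) ((r \<otimes> s') \<oplus> (r' \<otimes> s)) (s \<otimes> s') = ?h (a \<oplus> b)"
      if "(r, s) \<in> ?h a" "(r', s') \<in> ?h b" for r s r' s'
    proof -
      have *: "s \<in> carrier R - M 1" "s' \<in> carrier R - M 1" "r = a \<otimes> s" "r' = b \<otimes> s'" using that mem ab by auto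
      show ?thesis using * ab one nonmax_mult[OF *(1,2)] by (intro fraction_cong) (auto simp: m_ac r_distr)
    qed
    have "?h a \<oplus>\<^bsub>?L\<^esub> ?h b = \<Union>{fraction R (M 1) ((r \<otimes> s') \<oplus> (r' \<otimes> s)) (s \<otimes> s') | r s r' s'. (r, s) \<in> ?h a \<and> (r', s') \<in> ?h b}"
      unfolding localization_def by simp
    also have "{fraction R (M 1) ((r \<otimes> s') \<oplus> (r' \<otimes> s)) (s \<otimes> s') | r s r' s'. (r, s) \<in> ?h a \<and> (r', s') \<in> ?h b} = {?h (a \<oplus> b)}"
      using self ab eq by (auto; metis)
    finally show ?thesis by simp
  qed
  have carr: "carrier ?L = {fraction R (M 1) r s | r s. r \<in> carrier R \<and> s \<in> carrier R - M 1}"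
    unfolding localization_def by simp
  show ?thesis
  proof (rule ring_iso_memI)
    show "?h \<one> = \<one>\<^bsub>?L\<^esub>" unfolding localization_def by simp
    show hc: "?h a \<in> carrier ?L" if "a \<in> carrier R" for a unfolding carr using that one by blast
    show "bij_betw ?h (carrier R) (carrier ?L)"
    proof (rule bij_betwI')
      fix x y assume xy: "x \<in> carrier R" "y \<in> carrier R"
      show "(?h x = ?h y) = (x = y)" using self[OF xy(1)] mem[OF xy(2)] xy by auto
    next
      fix x assume "x \<in> carrier R" then show "?h x \<in> carrier ?L" by (rule hc)
    next
      fix y assume "y \<in> carrier ?L"
      then obtain r s where rs: "y = fraction R (M 1) r s" "r \<in> carrier R" "s \<in> carrier R - M 1"
        unfolding carr by blast
      then have u: "s \<in> Units R" using M_unit by blast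
      then have "y = ?h (r \<otimes> inv s)" unfolding rs(1)
        using rs one by (intro fraction_cong) (auto simp: m_assoc)
      then show "\<exists>x\<in>carrier R. y = ?h x" using rs u by blast
    qed
  qed (use mult add in auto)
qed

lemma localization_cring: "cring (localization R (M 1))"
  using ring_iso_imp_img_cring[OF localization_iso] unfolding localization_def by simp

end

lemma artin_chain_iso:
  assumes "artin_chain R M N" "cring S" "g \<in> ring_iso S R"
  shows "artin_chain S (\<lambda>i. {y \<in> carrier S. g y \<in> M i}) N"
proof -
  interpret R: artin_chain R M N by fact
  interpret S: cring S by fact
  interpret g: ring_hom_ring S R g
    using assms(3) by (intro ring_hom_ringI2 S.ring_axioms R.ring_axioms) (auto simp: ring_iso_def)
  define h where "h = inv_into (carrier S) g"
  have bij: "bij_betw g (carrier S) (carrier R)" using assms(3) unfolding ring_iso_def by simp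
  have h: "h \<in> ring_iso R S" unfolding h_def using ring_iso_set_sym[OF S.ring_axioms assms(3)] .
  interpret h: ring_hom_ring R S h
    using h by (intro ring_hom_ringI2 S.ring_axioms R.ring_axioms) (auto simp: ring_iso_def)
  have gh: "g (h x) = x" if "x \<in> carrier R" for x
    using that bij unfolding h_def by (metis bij_betw_imp_surj_on f_inv_into_f)
  have hg: "h (g y) = y" if "y \<in> carrier S" for y
    using that bij unfolding h_def by (metis bij_betw_imp_inj_on inv_into_f_f)
  show ?thesis
  proof (intro artin_chain.intro local_chain.intro artin_chain_axioms.intro local_chain_axioms.intro S.is_cring)
    show "ideal {y \<in> carrier S. g y \<in> M i} S" for i using g.ideal_vimage[OF R.M_ideal] .
    show "{y \<in> carrier S. g y \<in> M 0} = carrier S" unfolding R.M_0 by auto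
    show "{y \<in> carrier S. g y \<in> M N} = {\<zero>\<^bsub>S\<^esub>}"
    proof -
      have "y = \<zero>\<^bsub>S\<^esub>" if "y \<in> carrier S" "g y = \<zero>\<^bsub>R\<^esub>" for y
        using hg[OF that(1)] that(2) h.hom_zero by simp
      then show ?thesis unfolding R.M_N by auto
    qed
    show "x \<otimes>\<^bsub>S\<^esub> y \<in> {y \<in> carrier S. g y \<in> M (i + j)}"
      if "x \<in> {y \<in> carrier S. g y \<in> M i}" "y \<in> {y \<in> carrier S. g y \<in> M j}" for x i y j
      using that R.M_mult by simp
    show "x \<in> Units S" if x: "x \<in> carrier S" "x \<notin> {y \<in> carrier S. g y \<in> M 1}" for x
    proof -
      have u: "g x \<in> Units R" using x R.M_unit by simp
      let ?y = "h (inv\<^bsub>R\<^esub> (g x))"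
      have yc: "?y \<in> carrier S" using u by simp
      have "x \<otimes>\<^bsub>S\<^esub> ?y = h (g x) \<otimes>\<^bsub>S\<^esub> ?y" using hg[OF x(1)] by simp
      also have "\<dots> = h (g x \<otimes>\<^bsub>R\<^esub> inv\<^bsub>R\<^esub> (g x))"
        using h.hom_mult[OF R.Units_closed[OF u] R.Units_inv_closed[OF u]] by simp
      also have "\<dots> = \<one>\<^bsub>S\<^esub>" using R.Units_r_inv[OF u] by simp
      finally have "x \<otimes>\<^bsub>S\<^esub> ?y = \<one>\<^bsub>S\<^esub>" .
      moreover from this have "?y \<otimes>\<^bsub>S\<^esub> x = \<one>\<^bsub>S\<^esub>" using S.m_comm[OF yc x(1)] by simp
      ultimately show ?thesis using x(1) yc unfolding Units_def by blast
    qed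
    show "\<one>\<^bsub>S\<^esub> \<notin> {y \<in> carrier S. g y \<in> M 1}" using R.M_proper by simp
    fix T :: "'c set set" assume T: "T \<noteq> {}" "\<forall>J\<in>T. ideal J S"
    let ?v = "\<lambda>J. {x \<in> carrier R. h x \<in> J}"
    have "\<forall>J\<in>?v ` T. ideal J R" using T h.ideal_vimage by auto
    from R.acc[OF _ this] T(1) obtain J where J: "J \<in> T" "\<forall>J'\<in>?v ` T. ?v J \<subseteq> J' \<longrightarrow> J' = ?v J"
      by auto
    have rec: "K = {y \<in> carrier S. g y \<in> ?v K}" if "K \<in> T" for K
      using that T(2) hg ideal.Icarr[of K S] by auto
    show "\<exists>J\<in>T. \<forall>J'\<in>T. J \<subseteq> J' \<longrightarrow> J' = J"
    proof (intro bexI[OF _ J(1)] ballI impI)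
      fix J' assume J': "J' \<in> T" "J \<subseteq> J'"
      then have "?v J \<subseteq> ?v J'" "?v J' \<in> ?v ` T" by auto
      then have "?v J' = ?v J" using J(2)[rule_format, of "?v J'"] by blast
      then show "J' = J" using rec[OF J'(1)] rec[OF J(1)] by simp
    qed
  qed
qed

lemma self_injective_iso:
  assumes "cring R" "cring S" "g \<in> ring_iso S R" "self_injective R"
  shows "self_injective S"
  unfolding self_injective_def
proof (intro allI impI ballI)
  interpret R: cring R by fact
  interpret S: cring S by fact
  interpret g: ring_hom_ring S R g
    using assms(3) by (intro ring_hom_ringI2 S.ring_axioms R.ring_axioms) (auto simp: ring_iso_def)
  define h where "h = inv_into (carrier S) g"
  have bij: "bij_betw g (carrier S) (carrier R)" using assms(3) unfolding ring_iso_def by simp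
  have h: "h \<in> ring_iso R S" unfolding h_def using ring_iso_set_sym[OF S.ring_axioms assms(3)] .
  interpret h: ring_hom_ring R S h
    using h by (intro ring_hom_ringI2 S.ring_axioms R.ring_axioms) (auto simp: ring_iso_def)
  have hg: "h (g y) = y" if "y \<in> carrier S" for y
    using that bij unfolding h_def by (metis bij_betw_imp_inj_on inv_into_f_f)
  have gh: "g (h x) = x" if "x \<in> carrier R" for x
    using that bij unfolding h_def by (metis bij_betw_imp_surj_on f_inv_into_f)
  fix I f assume I: "ideal I S"
    and "f \<in> linear_maps S ((regular_module S)\<lparr>carrier := I\<rparr>) (regular_module S)"
  then have f: "\<And>x. x \<in> I \<Longrightarrow> f x \<in> carrier S"
    "\<And>x y. \<lbrakk>x \<in> I; y \<in> I\<rbrakk> \<Longrightarrow> f (x \<oplus>\<^bsub>S\<^esub> y) = f x \<oplus>\<^bsub>S\<^esub> f y"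
    "\<And>r x. \<lbrakk>r \<in> carrier S; x \<in> I\<rbrakk> \<Longrightarrow> f (r \<otimes>\<^bsub>S\<^esub> x) = r \<otimes>\<^bsub>S\<^esub> f x"
    unfolding linear_maps_ideal_iff by (auto simp: regular_module_def)
  let ?I = "{x \<in> carrier R. h x \<in> I}"
  have "ideal ?I R" using h.ideal_vimage[OF I] .
  moreover have "(\<lambda>x. g (f (h x))) \<in> linear_maps R ((regular_module R)\<lparr>carrier := ?I\<rparr>) (regular_module R)"
    unfolding linear_maps_ideal_iff using f gh by (auto simp: regular_module_def)
  ultimately have "\<exists>r\<in>carrier R. \<forall>x\<in>?I. g (f (h x)) = x \<otimes>\<^bsub>R\<^esub> r"
    by (rule self_injectiveD[OF assms(4)])
  then obtain r where r: "r \<in> carrier R" "\<forall>x\<in>?I. g (f (h x)) = x \<otimes>\<^bsub>R\<^esub> r" by blast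
  have "f y = y \<otimes>\<^bsub>S\<^esub> h r" if y: "y \<in> I" for y
  proof -
    have yc: "y \<in> carrier S" using y I ideal.Icarr by metis
    have "g y \<in> ?I" using y hg[OF yc] g.hom_closed[OF yc] by simp
    from r(2)[rule_format, OF this] have "g (f y) = g y \<otimes>\<^bsub>R\<^esub> r" unfolding hg[OF yc] .
    then have "h (g (f y)) = h (g y) \<otimes>\<^bsub>S\<^esub> h r" using yc r(1) by simp
    then show ?thesis using hg yc f(1)[OF y] by simp
  qed
  then show "\<exists>r\<in>carrier S. \<forall>x\<in>I. f x = x \<otimes>\<^bsub>S\<^esub> r" using r(1) h.hom_closed by blast
qed

text \<open>The maximal ideal is the only prime ideal, and localizing at it changes nothing.\<close>

theorem (in artin_chain) gorenstein_iff_self_injective: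
  assumes "noetherian_ring R"
  shows "gorenstein_ring R \<longleftrightarrow> self_injective R"
proof -
  let ?L = "localization R (M 1)" and ?h = "\<lambda>r. fraction R (M 1) r \<one>"
  interpret L: cring ?L by (rule localization_cring)
  have sym: "inv_into (carrier R) ?h \<in> ring_iso ?L R"
    using ring_iso_set_sym[OF ring_axioms localization_iso] .
  interpret L: artin_chain ?L "\<lambda>i. {y \<in> carrier ?L. inv_into (carrier R) ?h y \<in> M i}" N
    using artin_chain_iso[OF artin_chain_axioms localization_cring sym] .
  have "gorenstein_ring R \<longleftrightarrow> finite_injective_dimension ?L (regular_module ?L)"
    unfolding gorenstein_ring_def using prime_unique M1_prime assms is_cring by metis
  also have "\<dots> \<longleftrightarrow> self_injective ?L"
    using L.finite_injective_dimension_imp_self_injective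
      L.self_injective_imp_finite_injective_dimension by blast
  also have "\<dots> \<longleftrightarrow> self_injective R"
    using self_injective_iso[OF localization_cring is_cring localization_iso]
      self_injective_iso[OF is_cring localization_cring sym] by blast
  finally show ?thesis .
qed

section \<open>Nondegenerate bilinear forms\<close>

context vector_space begin

lemma subspace_finite_basis:
  assumes "subspace U" "U \<subseteq> span B" "finite B"
  obtains S where "finite S" "independent S" "S \<subseteq> U" "span S = U" "card S = dim U"
proof -
  obtain S where S: "S \<subseteq> U" "independent S" "U \<subseteq> span S" "card S = dim U"
    using basis_exists[of U] by blast
  have "finite S" using independent_span_bound[OF assms(3) S(2)] S(1) assms(2) by auto
  moreover have "span S = U" using S(1,3) assms(1) span_minimal by blast
  ultimately show thesis using that S by blast
qed

lemma dim_kernel_functional: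
  assumes Y: "subspace Y" "Y \<subseteq> span B" "finite B"
    and f: "\<And>x y. \<lbrakk>x \<in> Y; y \<in> Y\<rbrakk> \<Longrightarrow> f (x + y) = f x + f y"
      "\<And>c x. x \<in> Y \<Longrightarrow> f (scale c x) = c * f x"
    and x0: "x0 \<in> Y" "f x0 \<noteq> 0"
  shows "dim {x \<in> Y. f x = 0} + 1 = dim Y"
proof -
  let ?K = "{x \<in> Y. f x = 0}"
  have f0: "f 0 = 0" using f(2)[OF x0(1), of 0] by simp
  have K: "subspace ?K"
    using Y(1) f f0 unfolding subspace_def by auto
  obtain S where S: "finite S" "independent S" "S \<subseteq> ?K" "span S = ?K" "card S = dim ?K"
    using subspace_finite_basis[OF K _ Y(3)] Y(2) by blast
  have n: "x0 \<notin> span S" using S(4) x0 by simp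
  have ind: "independent (insert x0 S)" using independent_insertI[OF n S(2)] .
  have "span (insert x0 S) = Y"
  proof
    show "span (insert x0 S) \<subseteq> Y" using x0 S(3) by (intro span_minimal Y(1)) auto
    show "Y \<subseteq> span (insert x0 S)"
    proof
      fix x assume x: "x \<in> Y"
      define c where "c = f x / f x0"
      have "x - scale c x0 \<in> Y" using x x0 Y(1) subspace_diff subspace_scale by blast
      moreover have "f (x - scale c x0) = 0"
      proof -
        have "f ((x - scale c x0) + scale c x0) = f (x - scale c x0) + f (scale c x0)"
          using f(1) \<open>x - scale c x0 \<in> Y\<close> x0 Y(1) subspace_scale by blast
        then show ?thesis using f(2)[OF x0(1), of c] x0(2) c_def by simp
      qed
      ultimately have "x - scale c x0 \<in> span S" using S(4) by simp
      then show "x \<in> span (insert x0 S)" using span_breakdown_eq by blast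
    qed
  qed
  then have "dim Y = card (insert x0 S)" using ind dim_span_eq_card_independent by metis
  also have "\<dots> = card S + 1" using S(1) n span_base by (metis card_insert_disjoint Suc_eq_plus1)
  finally show ?thesis using S(5) by simp
qed

context
  fixes V U :: "'b set" and B :: "'b set" and b :: "'b \<Rightarrow> 'b \<Rightarrow> 'a"
  assumes V: "subspace V" "V \<subseteq> span B" "finite B"
    and b_add: "\<And>x y z. \<lbrakk>x \<in> V; y \<in> V; z \<in> V\<rbrakk> \<Longrightarrow> b (x + y) z = b x z + b y z"
    and b_scale: "\<And>c x z. \<lbrakk>x \<in> V; z \<in> V\<rbrakk> \<Longrightarrow> b (scale c x) z = c * b x z"
    and b_sym: "\<And>x y. \<lbrakk>x \<in> V; y \<in> V\<rbrakk> \<Longrightarrow> b x y = b y x"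
    and nondeg: "\<And>x. \<lbrakk>x \<in> V; x \<noteq> 0\<rbrakk> \<Longrightarrow> \<exists>y\<in>V. b x y \<noteq> 0"
begin

lemma bilinear_sum:
  assumes "finite A" "\<And>a. a \<in> A \<Longrightarrow> g a \<in> V" "z \<in> V"
  shows "b (\<Sum>a\<in>A. scale (c a) (g a)) z = (\<Sum>a\<in>A. c a * b (g a) z)"
  using assms(1,2)
proof (induction A)
  case empty
  have "b (scale 0 0) z = 0 * b 0 z" using b_scale assms(3) subspace_0[OF V(1)] by blast
  then show ?case by simp
next
  case (insert a A)
  have "(\<Sum>a\<in>A. scale (c a) (g a)) \<in> V" "scale (c a) (g a) \<in> V"
    using insert V(1) by (auto intro: subspace_sum subspace_scale)
  then show ?case using insert b_add[OF _ _ assms(3)] b_scale[OF _ assms(3)] by simp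
qed

text \<open>Each new vector of an independent family cuts down the orthogonal space by exactly one dimension,
  since otherwise it would be orthogonal to the whole dual system of the others.\<close>

lemma dual_system:
  assumes "finite S" "independent S" "S \<subseteq> V"
  shows "dim {v \<in> V. \<forall>w\<in>S. b v w = 0} + card S = dim V \<and>
    (\<exists>d. \<forall>s\<in>S. d s \<in> V \<and> (\<forall>t\<in>S. b (d s) t = (if s = t then 1 else 0)))"
  using assms
proof (induction S)
  case empty then show ?case by simp
next
  case (insert w S)
  have ind: "independent S" "w \<notin> span S"
    using insert.prems insert.hyps independent_insert[of w S] by auto
  from insert.IH[OF ind(1)] insert.prems obtain d where
    dimS: "dim {v \<in> V. \<forall>w\<in>S. b v w = 0} + card S = dim V" and
    d: "\<And>s. s \<in> S \<Longrightarrow> d s \<in> V" "\<And>s t. \<lbrakk>s \<in> S; t \<in> S\<rbrakk> \<Longrightarrow> b (d s) t = (if s = t then 1 else 0)"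
    by auto
  have wV: "w \<in> V" and SV: "S \<subseteq> V" using insert.prems by auto
  define y where "y = w - (\<Sum>s\<in>S. scale (b (d s) w) s)"
  have sV: "(\<Sum>s\<in>S. scale (b (d s) w) s) \<in> V"
    using SV V(1) by (intro subspace_sum subspace_scale) auto
  have yV: "y \<in> V" unfolding y_def using wV sV V(1) subspace_diff by blast
  have "y \<noteq> 0"
  proof
    assume "y = 0"
    then have "w = (\<Sum>s\<in>S. scale (b (d s) w) s)" by (simp add: y_def)
    also have "\<dots> \<in> span S" by (intro span_sum span_scale span_base)
    finally show False using ind(2) by simp
  qed
  then obtain g where g: "g \<in> V" "b y g \<noteq> 0" using nondeg yV by blast
  define v where "v = g - (\<Sum>s\<in>S. scale (b g s) (d s))"
  have dV: "(\<Sum>s\<in>S. scale (b g s) (d s)) \<in> V"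
    using d V(1) by (intro subspace_sum subspace_scale) auto
  have vV: "v \<in> V" unfolding v_def using g(1) dV V(1) subspace_diff by blast
  have bv: "b v z = b g z - (\<Sum>s\<in>S. b g s * b (d s) z)" if z: "z \<in> V" for z
  proof -
    have "b (v + (\<Sum>s\<in>S. scale (b g s) (d s))) z = b v z + b (\<Sum>s\<in>S. scale (b g s) (d s)) z"
      using b_add vV dV z by blast
    moreover have "v + (\<Sum>s\<in>S. scale (b g s) (d s)) = g" by (simp add: v_def)
    ultimately show ?thesis using bilinear_sum[OF insert.hyps(1) d(1) z] by simp
  qed
  have vS: "b v t = 0" if t: "t \<in> S" for t
  proof -
    have "(\<Sum>s\<in>S. b g s * b (d s) t) = (\<Sum>s\<in>S. if s = t then b g t else 0)"
      using d(2)[OF _ t] by (intro sum.cong) auto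
    also have "\<dots> = b g t" using insert.hyps(1) t by simp
    finally show ?thesis using bv[of t] SV t by auto
  qed
  have vw: "b v w \<noteq> 0"
  proof -
    have "b w g = b (y + (\<Sum>s\<in>S. scale (b (d s) w) s)) g" by (simp add: y_def)
    also have "\<dots> = b y g + (\<Sum>s\<in>S. b (d s) w * b s g)"
      using b_add[OF yV sV g(1)] bilinear_sum[OF insert.hyps(1) _ g(1), of "\<lambda>s. s" "\<lambda>s. b (d s) w"] SV by auto
    finally have "b y g = b g w - (\<Sum>s\<in>S. b (d s) w * b s g)" using b_sym[OF wV g(1)] by simp
    also have "(\<Sum>s\<in>S. b (d s) w * b s g) = (\<Sum>s\<in>S. b g s * b (d s) w)"
      using b_sym g(1) SV by (intro sum.cong) (auto simp: mult.commute)
    finally show ?thesis using g(2) bv[OF wV] by simp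
  qed
  have dim1: "dim {v \<in> V. \<forall>t\<in>insert w S. b v t = 0} + card (insert w S) = dim V"
  proof -
    let ?P = "{v \<in> V. \<forall>t\<in>S. b v t = 0}"
    have b0: "b 0 t = 0" if "t \<in> V" for t
      using b_scale[of 0 t 0] that subspace_0[OF V(1)] by simp
    have P: "subspace ?P"
      using V(1) b_add b_scale b0 SV unfolding subspace_def by (auto simp: subset_iff)
    have "dim {x \<in> ?P. b x w = 0} + 1 = dim ?P"
      by (rule dim_kernel_functional[OF P _ V(3), where ?x0.0 = v])
        (use V(2) b_add b_scale wV vV vS vw in auto)
    moreover have "{x \<in> ?P. b x w = 0} = {v \<in> V. \<forall>t\<in>insert w S. b v t = 0}" by auto
    ultimately show ?thesis using dimS insert.hyps by simp
  qed
  define dw where "dw = scale (1 / b v w) v"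
  define d' where "d' s = (if s = w then dw else d s - scale (b (d s) w) dw)" for s
  have dwV: "dw \<in> V" unfolding dw_def using vV V(1) subspace_scale by blast
  have dw_S: "b dw t = 0" if "t \<in> S" for t using vS[OF that] b_scale[OF vV] SV that by (auto simp: dw_def)
  have dw_w: "b dw w = 1" using b_scale[OF vV wV] vw by (simp add: dw_def)
  have d'S: "d' s \<in> V \<and> (\<forall>z\<in>V. b (d' s) z = b (d s) z - b (d s) w * b dw z)" if s: "s \<in> S" for s
  proof -
    have sw: "s \<noteq> w" using s insert.hyps(2) by blast
    have sc: "scale (b (d s) w) dw \<in> V" using dwV V(1) subspace_scale by blast
    have d'V: "d' s \<in> V" using sw d(1)[OF s] sc V(1) subspace_diff by (simp add: d'_def)
    have "b (d' s) z = b (d s) z - b (d s) w * b dw z" if z: "z \<in> V" for z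
    proof -
      have "b (d' s + scale (b (d s) w) dw) z = b (d' s) z + b (scale (b (d s) w) dw) z"
        using b_add d'V sc z by blast
      moreover have "d' s + scale (b (d s) w) dw = d s" using sw by (simp add: d'_def)
      ultimately show ?thesis using b_scale[OF dwV z] by simp
    qed
    then show ?thesis using d'V by blast
  qed
  have "\<forall>s\<in>insert w S. d' s \<in> V \<and> (\<forall>t\<in>insert w S. b (d' s) t = (if s = t then 1 else 0))"
  proof (intro ballI conjI)
    fix s assume s: "s \<in> insert w S"
    show "d' s \<in> V"
    proof (cases "s = w")
      case True then show ?thesis using dwV d'_def by simp
    next
      case False then show ?thesis using s d'S by blast
    qed
    fix t assume t: "t \<in> insert w S"
    have tV: "t \<in> V" using t wV SV by auto
    show "b (d' s) t = (if s = t then 1 else 0)"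
    proof (cases "s = w")
      case True
      then show ?thesis using t dw_S dw_w insert.hyps(2) by (auto simp: d'_def)
    next
      case False
      then have sS: "s \<in> S" using s by simp
      have e: "b (d' s) t = b (d s) t - b (d s) w * b dw t" using d'S[OF sS] tV by blast
      show ?thesis
      proof (cases "t = w")
        case True
        then show ?thesis using e dw_w False by simp
      next
        case F2: False
        then have "t \<in> S" using t by simp
        then show ?thesis using e dw_S d(2)[OF sS] by simp
      qed
    qed
  qed
  then show ?case using dim1 by blast
qed

lemma perp_dim:
  assumes U: "subspace U" "U \<subseteq> V"
  shows "dim {v \<in> V. \<forall>w\<in>U. b v w = 0} + dim U = dim V"
proof -
  obtain S where S: "finite S" "independent S" "S \<subseteq> U" "span S = U" "card S = dim U"
    using subspace_finite_basis[OF U(1) _ V(3)] U(2) V(2) by blast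
  have "{v \<in> V. \<forall>w\<in>U. b v w = 0} = {v \<in> V. \<forall>w\<in>S. b v w = 0}"
  proof (intro equalityI subsetI)
    fix v assume "v \<in> {v \<in> V. \<forall>w\<in>S. b v w = 0}"
    then have v: "v \<in> V" "\<forall>w\<in>S. b v w = 0" by auto
    let ?Y = "{w \<in> V. b w v = 0}"
    have "b 0 v = 0" using b_scale[of 0 v 0] v subspace_0[OF V(1)] by simp
    then have "subspace ?Y" using V(1) b_add b_scale v(1) unfolding subspace_def by auto
    moreover have "S \<subseteq> ?Y"
    proof
      fix x assume x: "x \<in> S"
      then have "x \<in> V" using S(3) U(2) by blast
      then show "x \<in> ?Y" using v x b_sym[of x v] by simp
    qed
    ultimately have "U \<subseteq> ?Y" using S(4) span_minimal by blast
    then show "v \<in> {v \<in> V. \<forall>w\<in>U. b v w = 0}" using v(1) b_sym U(2) by auto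
  qed (use S(3) in auto)
  then show ?thesis using dual_system[OF S(1,2)] S(3,5) U(2) by (simp add: subset_trans)
qed

text \<open>A functional on a subspace is represented by a combination of a dual system of a basis.\<close>

lemma riesz:
  assumes U: "subspace U" "U \<subseteq> V"
    and f: "\<And>x y. \<lbrakk>x \<in> U; y \<in> U\<rbrakk> \<Longrightarrow> f (x + y) = f x + f y"
      "\<And>c x. x \<in> U \<Longrightarrow> f (scale c x) = c * f x"
  obtains g where "g \<in> V" "\<And>v. v \<in> U \<Longrightarrow> b g v = f v"
proof -
  obtain S where S: "finite S" "independent S" "S \<subseteq> U" "span S = U" "card S = dim U"
    using subspace_finite_basis[OF U(1) _ V(3)] U(2) V(2) by blast
  have SV: "S \<subseteq> V" using S(3) U(2) by simp
  obtain d where "\<forall>s\<in>S. d s \<in> V \<and> (\<forall>t\<in>S. b (d s) t = (if s = t then 1 else 0))"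
    using dual_system[OF S(1,2) SV] by (elim conjE exE)
  then have d: "\<And>s. s \<in> S \<Longrightarrow> d s \<in> V"
    "\<And>s t. \<lbrakk>s \<in> S; t \<in> S\<rbrakk> \<Longrightarrow> b (d s) t = (if s = t then 1 else 0)" by simp_all
  define g where "g = (\<Sum>s\<in>S. scale (f s) (d s))"
  have gV: "g \<in> V" unfolding g_def using d(1) V(1) by (intro subspace_sum subspace_scale) auto
  let ?Y = "{v \<in> U. b g v = f v}"
  have gS: "b g t = f t" if t: "t \<in> S" for t
  proof -
    have "b g t = (\<Sum>s\<in>S. f s * b (d s) t)"
      unfolding g_def using bilinear_sum[OF S(1) d(1)] t S(3) U(2) by auto
    also have "\<dots> = (\<Sum>s\<in>S. if s = t then f t else 0)" using d(2)[OF _ t] by (intro sum.cong) auto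
    finally show ?thesis using S(1) t by simp
  qed
  have f0: "f 0 = 0" using f(2)[of 0 0] subspace_0[OF U(1)] by simp
  have b0: "b 0 g = 0" using b_scale[of 0 g 0] gV subspace_0[OF V(1)] by simp
  have bg: "b g v = b v g" if "v \<in> U" for v using b_sym[OF gV, of v] that U(2) by blast
  have "subspace ?Y"
    unfolding subspace_def
  proof (intro conjI allI ballI)
    show "0 \<in> ?Y" using f0 b0 bg subspace_0[OF U(1)] by auto
    fix x assume x: "x \<in> ?Y"
    then have bx: "b x g = f x" using bg by fastforce
    { fix y assume y: "y \<in> ?Y"
      then have bY: "b y g = f y" using bg by fastforce
      have "x + y \<in> U" using x y U(1) subspace_add by blast
      moreover have "x \<in> V" "y \<in> V" using x y U(2) by auto
      ultimately show "x + y \<in> ?Y" using x y bx bY bg[of "x + y"] b_add[of x y g] gV f(1)[of x y] by simp }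
    fix c
    have "scale c x \<in> U" using x U(1) subspace_scale by blast
    moreover have "x \<in> V" using x U(2) by auto
    ultimately show "scale c x \<in> ?Y" using x bx bg[of "scale c x"] b_scale[of x g c] gV f(2)[of x c] by simp
  qed
  moreover have "S \<subseteq> ?Y" using S(3) gS by auto
  ultimately have "U \<subseteq> ?Y" using S(4) span_minimal by blast
  then show thesis using that[OF gV] by blast
qed

end
end

section \<open>Filtered rings and their associated graded rings\<close>

lemma (in cring) hom_image_cring:
  assumes add: "\<And>x y. \<lbrakk>x \<in> carrier R; y \<in> carrier R\<rbrakk> \<Longrightarrow> h (x \<oplus> y) = h x \<oplus>\<^bsub>S\<^esub> h y"
    and mult: "\<And>x y. \<lbrakk>x \<in> carrier R; y \<in> carrier R\<rbrakk> \<Longrightarrow> h (x \<otimes> y) = h x \<otimes>\<^bsub>S\<^esub> h y"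
    and one: "h \<one> = \<one>\<^bsub>S\<^esub>" and zero: "h \<zero> = \<zero>\<^bsub>S\<^esub>"
    and surj: "carrier S = h ` carrier R"
  shows "cring S"
proof (rule cringI)
  have inv: "\<exists>y\<in>carrier S. y \<oplus>\<^bsub>S\<^esub> x = \<zero>\<^bsub>S\<^esub>" if "x \<in> carrier S" for x
  proof -
    have "x \<in> h ` carrier R" using that surj by simp
    then obtain a where a: "a \<in> carrier R" "x = h a" by blast
    then have "h (\<ominus> a) \<oplus>\<^bsub>S\<^esub> x = \<zero>\<^bsub>S\<^esub>" using add[of "\<ominus> a" a] zero by (simp add: l_neg)
    then show ?thesis using a surj by blast
  qed
  show "abelian_group S"
    by (rule abelian_groupI)
      (use inv in \<open>auto simp: surj add[symmetric] zero[symmetric] a_ac intro!: imageI\<close>)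
  show "comm_monoid S"
    by (rule comm_monoidI)
      (auto simp: surj mult[symmetric] one[symmetric] m_ac intro!: imageI)
  show "(x \<oplus>\<^bsub>S\<^esub> y) \<otimes>\<^bsub>S\<^esub> z = x \<otimes>\<^bsub>S\<^esub> z \<oplus>\<^bsub>S\<^esub> y \<otimes>\<^bsub>S\<^esub> z"
    if "x \<in> carrier S" "y \<in> carrier S" "z \<in> carrier S" for x y z
    using that by (auto simp: surj add[symmetric] mult[symmetric] l_distr)
qed

locale filtered_ring = cring R for R (structure) +
  fixes F :: "nat \<Rightarrow> 'a set"
  assumes F_sub: "additive_subgroup (F i) R"
    and F_mono: "F i \<subseteq> F (Suc i)"
    and F_mult: "\<lbrakk>x \<in> F i; y \<in> F j\<rbrakk> \<Longrightarrow> x \<otimes> y \<in> F (i + j)"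
    and F_one: "\<one> \<in> F 0"
begin

abbreviation Q :: "nat \<Rightarrow> 'a set" where "Q \<equiv> filtration_prev R F"
abbreviation gr :: "(nat \<Rightarrow> 'a set) ring" where "gr \<equiv> associated_graded_ring R F"

definition cls :: "(nat \<Rightarrow> 'a) \<Rightarrow> nat \<Rightarrow> 'a set" where "cls r = (\<lambda>i. Q i +> r i)"

definition conv :: "(nat \<Rightarrow> 'a) \<Rightarrow> (nat \<Rightarrow> 'a) \<Rightarrow> nat \<Rightarrow> 'a" where
  "conv r s = (\<lambda>k. \<Oplus>i\<in>{..k}. r i \<otimes> s (k - i))"

lemma Q_0: "Q 0 = {\<zero>}" and Q_Suc: "Q (Suc i) = F i"
  by (simp_all add: filtration_prev_def)

lemma F_carr: "x \<in> F i \<Longrightarrow> x \<in> carrier R"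
  using additive_subgroup.a_Hcarr[OF F_sub] .

lemma Q_sub: "additive_subgroup (Q i) R"
proof (cases i)
  case 0
  then show ?thesis using zeroideal ideal.axioms(1) by (simp add: Q_0)
next
  case (Suc k) then show ?thesis using F_sub Q_Suc by simp
qed

lemma Q_subset: "Q i \<subseteq> F i"
proof (cases i)
  case 0
  then show ?thesis using additive_subgroup.zero_closed[OF F_sub] by (simp add: Q_0)
next
  case (Suc k) then show ?thesis using F_mono Q_Suc by simp
qed

lemma F_mono': "i \<le> j \<Longrightarrow> F i \<subseteq> F j"
  using lift_Suc_mono_le[of F] F_mono by blast

lemma Q_carr: "x \<in> Q i \<Longrightarrow> x \<in> carrier R" using Q_subset F_carr by blast

lemma Q_abelian: "abelian_subgroup (Q i) R"
  using abelian_subgroupI3[OF Q_sub is_abelian_group] .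

lemma Q_add: "x \<in> Q i \<Longrightarrow> y \<in> Q i \<Longrightarrow> x \<oplus> y \<in> Q i"
  using additive_subgroup.a_closed[OF Q_sub] .
lemma Q_zero: "\<zero> \<in> Q i" using additive_subgroup.zero_closed[OF Q_sub] .
lemma F_add: "x \<in> F i \<Longrightarrow> y \<in> F i \<Longrightarrow> x \<oplus> y \<in> F i"
  using additive_subgroup.a_closed[OF F_sub] .
lemma F_zero: "\<zero> \<in> F i" using additive_subgroup.zero_closed[OF F_sub] .
lemma F_neg: "x \<in> F i \<Longrightarrow> \<ominus> x \<in> F i" using additive_subgroup.a_inv_closed[OF F_sub] .

lemma Q_mult: assumes "x \<in> Q i" "y \<in> F j" shows "x \<otimes> y \<in> Q (i + j)"
proof (cases i)
  case 0
  then have "x \<otimes> y = \<zero>" using assms F_carr by (simp add: Q_0)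
  then show ?thesis using Q_zero by simp
next
  case (Suc k)
  then show ?thesis using F_mult[of x k y j] assms Q_Suc by simp
qed

lemma Q_mult': assumes "x \<in> F i" "y \<in> Q j" shows "x \<otimes> y \<in> Q (i + j)"
  using Q_mult[OF assms(2,1)] assms F_carr Q_carr by (simp add: m_comm add.commute)

lemma coset_eq_iff:
  assumes "x \<in> carrier R" "y \<in> carrier R"
  shows "Q i +> x = Q i +> y \<longleftrightarrow> x \<ominus> y \<in> Q i"
proof -
  interpret q: abelian_subgroup "Q i" R by (rule Q_abelian)
  have m: "x \<in> Q i +> y \<longleftrightarrow> x \<ominus> y \<in> Q i" using q.a_rcos_module[OF assms(2,1)] by (simp add: minus_eq)
  have "subgroup (Q i) (add_monoid R)" using Q_sub additive_subgroup.a_subgroup by blast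
  then show ?thesis
    using m q.a_rcos_self[OF assms(1)] a_repr_independence[of x "Q i" y] assms by auto
qed

lemma coset_mem:
  assumes "y \<in> carrier R" "x \<in> Q i +> y"
  shows "x \<in> carrier R" "x \<ominus> y \<in> Q i"
proof -
  interpret q: abelian_subgroup "Q i" R by (rule Q_abelian)
  show x: "x \<in> carrier R" using assms q.a_elemrcos_carrier by blast
  show "x \<ominus> y \<in> Q i" using q.a_rcos_module[OF assms(1) x] assms(2) by (simp add: minus_eq)
qed

lemma coset_trivial_iff:
  assumes "x \<in> carrier R" shows "Q i +> x = Q i \<longleftrightarrow> x \<in> Q i"
proof -
  interpret q: abelian_subgroup "Q i" R by (rule Q_abelian)
  have "subgroup (Q i) (add_monoid R)" using Q_sub additive_subgroup.a_subgroup by blast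
  then show ?thesis using assms a_coset_join1[of "Q i" x] a_coset_join2[of x "Q i"] by blast
qed

lemma cls_eq_iff:
  assumes "\<And>i. r i \<in> F i" "\<And>i. s i \<in> F i"
  shows "cls r = cls s \<longleftrightarrow> (\<forall>i. r i \<ominus> s i \<in> Q i)"
  unfolding cls_def fun_eq_iff by (simp add: coset_eq_iff F_carr[OF assms(1)] F_carr[OF assms(2)])

lemma finsum_diff_closed:
  assumes "finite A" "\<And>i. i \<in> A \<Longrightarrow> a i \<in> carrier R" "\<And>i. i \<in> A \<Longrightarrow> b i \<in> carrier R"
    "\<And>i. i \<in> A \<Longrightarrow> a i \<ominus> b i \<in> Q k"
  shows "(\<Oplus>i\<in>A. a i) \<ominus> (\<Oplus>i\<in>A. b i) \<in> Q k"
  using assms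
proof (induction A)
  case empty then show ?case using Q_zero by (simp add: minus_eq)
next
  case (insert x A)
  have c: "(\<Oplus>i\<in>A. a i) \<in> carrier R" "(\<Oplus>i\<in>A. b i) \<in> carrier R" "a x \<in> carrier R" "b x \<in> carrier R"
    using insert by (auto intro!: finsum_closed)
  have "(a x \<ominus> b x) \<oplus> ((\<Oplus>i\<in>A. a i) \<ominus> (\<Oplus>i\<in>A. b i)) \<in> Q k"
    using insert by (intro Q_add) auto
  moreover have "(a x \<ominus> b x) \<oplus> ((\<Oplus>i\<in>A. a i) \<ominus> (\<Oplus>i\<in>A. b i)) =
      (a x \<oplus> (\<Oplus>i\<in>A. a i)) \<ominus> (b x \<oplus> (\<Oplus>i\<in>A. b i))" using c by algebra
  ultimately show ?case using insert c by (simp add: finsum_insert Pi_iff)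
qed

lemma finsum_F: "finite A \<Longrightarrow> (\<And>i. i \<in> A \<Longrightarrow> a i \<in> F k) \<Longrightarrow> (\<Oplus>i\<in>A. a i) \<in> F k"
proof (induction A rule: finite_induct)
  case empty then show ?case using F_zero by simp
next
  case (insert x A)
  then have "finsum R a (insert x A) = a x \<oplus> (\<Oplus>i\<in>A. a i)"
    using F_carr by (intro finsum_insert) auto
  then show ?case using insert F_add by simp
qed

lemma conv_F: assumes "\<And>i. r i \<in> F i" "\<And>i. s i \<in> F i" shows "conv r s k \<in> F k"
  unfolding conv_def
proof (rule finsum_F)
  fix i assume "i \<in> {..k}"
  then show "r i \<otimes> s (k - i) \<in> F k" using F_mult[OF assms(1)[of i] assms(2)[of "k - i"]] by simp
qed simp

lemma cls_mult:
  assumes r: "\<And>i. r i \<in> F i" and s: "\<And>i. s i \<in> F i"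
  shows "cls r \<otimes>\<^bsub>gr\<^esub> cls s = cls (conv r s)"
proof
  fix k
  let ?t = "\<lambda>r s. Q k +> (\<Oplus>i\<in>{..k}. r i \<otimes> s (k - i))"
  have eq: "?t r' s' = ?t r s" if r': "\<forall>i\<le>k. r' i \<in> cls r i" and s': "\<forall>i\<le>k. s' i \<in> cls s i" for r' s'
  proof -
    have rc: "r' i \<in> carrier R" "r' i \<ominus> r i \<in> Q i" if "i \<le> k" for i
      using coset_mem[OF F_carr[OF r]] r' that unfolding cls_def by blast+
    have sc: "s' i \<in> carrier R" "s' i \<ominus> s i \<in> Q i" if "i \<le> k" for i
      using coset_mem[OF F_carr[OF s]] s' that unfolding cls_def by blast+
    have "(\<Oplus>i\<in>{..k}. r' i \<otimes> s' (k - i)) \<ominus> (\<Oplus>i\<in>{..k}. r i \<otimes> s (k - i)) \<in> Q k"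
    proof (rule finsum_diff_closed)
      fix i assume i: "i \<in> {..k}"
      note c = rc[of i] sc[of "k - i"] F_carr[OF r[of i]] F_carr[OF s[of "k - i"]]
      show "r' i \<otimes> s' (k - i) \<in> carrier R" "r i \<otimes> s (k - i) \<in> carrier R" using c i by auto
      have "s' (k - i) = (s' (k - i) \<ominus> s (k - i)) \<oplus> s (k - i)" using c i by (simp add: minus_eq a_assoc l_neg)
      then have "s' (k - i) \<in> F (k - i)" using c(4) i F_add s Q_subset by (metis diff_le_self in_mono)
      then have "(r' i \<ominus> r i) \<otimes> s' (k - i) \<in> Q (i + (k - i))"
        using i by (intro Q_mult c(2)) auto
      moreover have "r i \<otimes> (s' (k - i) \<ominus> s (k - i)) \<in> Q (i + (k - i))"
        using i by (intro Q_mult' c(4) r) auto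
      ultimately have "(r' i \<ominus> r i) \<otimes> s' (k - i) \<oplus> r i \<otimes> (s' (k - i) \<ominus> s (k - i)) \<in> Q k"
        using Q_add i by simp
      moreover have "(r' i \<ominus> r i) \<otimes> s' (k - i) \<oplus> r i \<otimes> (s' (k - i) \<ominus> s (k - i)) =
         r' i \<otimes> s' (k - i) \<ominus> r i \<otimes> s (k - i)"
      proof -
        have "r' i \<in> carrier R" "s' (k - i) \<in> carrier R" using c i by auto
        then show ?thesis using c(5,6) by algebra
      qed
      ultimately show "r' i \<otimes> s' (k - i) \<ominus> r i \<otimes> s (k - i) \<in> Q k" by simp
    qed simp
    moreover have "(\<Oplus>i\<in>{..k}. r' i \<otimes> s' (k - i)) \<in> carrier R" "(\<Oplus>i\<in>{..k}. r i \<otimes> s (k - i)) \<in> carrier R"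
      using rc sc F_carr[OF r] F_carr[OF s] by (auto intro!: finsum_closed)
    ultimately show ?thesis using coset_eq_iff by blast
  qed
  have self: "\<forall>i\<le>k. r i \<in> cls r i" "\<forall>i\<le>k. s i \<in> cls s i"
    unfolding cls_def using abelian_subgroup.a_rcos_self[OF Q_abelian] F_carr r s by blast+
  have "(cls r \<otimes>\<^bsub>gr\<^esub> cls s) k = \<Union>{?t r' s' | r' s'. (\<forall>i\<le>k. r' i \<in> cls r i) \<and> (\<forall>i\<le>k. s' i \<in> cls s i)}"
    by (simp add: associated_graded_ring_def)
  also have "{?t r' s' | r' s'. (\<forall>i\<le>k. r' i \<in> cls r i) \<and> (\<forall>i\<le>k. s' i \<in> cls s i)} = {?t r s}"
  proof (intro equalityI subsetI)
    fix x assume "x \<in> {?t r' s' | r' s'. (\<forall>i\<le>k. r' i \<in> cls r i) \<and> (\<forall>i\<le>k. s' i \<in> cls s i)}"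
    then obtain r' s' where *: "x = ?t r' s'" "\<forall>i\<le>k. r' i \<in> cls r i" "\<forall>i\<le>k. s' i \<in> cls s i" by auto
    show "x \<in> {?t r s}" using eq[OF *(2,3)] *(1) by simp
  next
    fix x assume x: "x \<in> {?t r s}"
    show "x \<in> {?t r' s' | r' s'. (\<forall>i\<le>k. r' i \<in> cls r i) \<and> (\<forall>i\<le>k. s' i \<in> cls s i)}"
      using x self by (intro CollectI exI[of _ r] exI[of _ s]) simp
  qed
  finally show "(cls r \<otimes>\<^bsub>gr\<^esub> cls s) k = cls (conv r s) k" by (simp add: cls_def conv_def)
qed

lemma cls_add:
  assumes r: "\<And>i. r i \<in> F i" and s: "\<And>i. s i \<in> F i"
  shows "cls r \<oplus>\<^bsub>gr\<^esub> cls s = cls (\<lambda>i. r i \<oplus> s i)"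
  by (simp add: associated_graded_ring_def cls_def
      abelian_subgroup.a_rcos_sum[OF Q_abelian F_carr[OF r] F_carr[OF s]])

lemma gr_zero: "\<zero>\<^bsub>gr\<^esub> = cls (\<lambda>_. \<zero>)"
  using coset_trivial_iff[OF zero_closed] Q_zero by (simp add: associated_graded_ring_def cls_def fun_eq_iff)

lemma gr_one: "\<one>\<^bsub>gr\<^esub> = cls (\<lambda>i. if i = 0 then \<one> else \<zero>)"
  using coset_trivial_iff[OF zero_closed] Q_zero by (auto simp: associated_graded_ring_def cls_def fun_eq_iff)

lemma gr_carrier:
  "carrier gr = cls ` {r. (\<forall>i. r i \<in> F i) \<and> (\<exists>n. bound \<zero> n r)}"
proof (intro equalityI subsetI)
  fix u assume "u \<in> carrier gr"
  then have u: "\<forall>i. \<exists>r\<in>F i. u i = Q i +> r" "finite {i. u i \<noteq> Q i}"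
    by (auto simp: associated_graded_ring_def)
  define r where "r i = (if u i = Q i then \<zero> else SOME x. x \<in> F i \<and> u i = Q i +> x)" for i
  have r: "r i \<in> F i \<and> u i = Q i +> r i" for i
  proof (cases "u i = Q i")
    case True
    then show ?thesis using F_zero coset_trivial_iff[OF zero_closed] Q_zero by (simp add: r_def)
  next
    case False
    then have "r i = (SOME x. x \<in> F i \<and> u i = Q i +> x)" by (simp add: r_def)
    then show ?thesis using someI_ex[of "\<lambda>x. x \<in> F i \<and> u i = Q i +> x"] u(1) by auto
  qed
  obtain n where "\<forall>i\<in>{i. u i \<noteq> Q i}. i \<le> n" using u(2) finite_nat_set_iff_bounded_le by blast
  then have "bound \<zero> n r" by (intro bound.intro) (auto simp: r_def not_le[symmetric])
  moreover have "u = cls r" using r by (auto simp: cls_def)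
  ultimately show "u \<in> cls ` {r. (\<forall>i. r i \<in> F i) \<and> (\<exists>n. bound \<zero> n r)}" using r by blast
next
  fix u assume "u \<in> cls ` {r. (\<forall>i. r i \<in> F i) \<and> (\<exists>n. bound \<zero> n r)}"
  then obtain r n where r: "u = cls r" "\<forall>i. r i \<in> F i" "bound \<zero> n r" by blast
  have "u i = Q i" if "i > n" for i
    using bound.bound[OF r(3) that] r(1) coset_trivial_iff[OF zero_closed] Q_zero by (simp add: cls_def)
  then have "{i. u i \<noteq> Q i} \<subseteq> {..n}" by (auto simp: not_le[symmetric])
  then have "finite {i. u i \<noteq> Q i}" using finite_subset by blast
  moreover have "\<forall>i. \<exists>x\<in>F i. u i = Q i +> x" using r by (auto simp: cls_def)
  ultimately show "u \<in> carrier gr" by (simp add: associated_graded_ring_def)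
qed

text \<open>The associated graded ring is a quotient of the Rees ring, a subring of the polynomial ring.\<close>
lemma gr_cring: "cring gr"
proof -
  let ?S = "{p \<in> carrier (UP R). \<forall>i. p i \<in> F i}"
  have carr: "p \<in> carrier (UP R) \<longleftrightarrow> (\<forall>i. p i \<in> carrier R) \<and> (\<exists>n. bound \<zero> n p)" for p
    by (simp add: UP_def up_def Pi_iff)
  have Seq: "?S = {r. (\<forall>i. r i \<in> F i) \<and> (\<exists>n. bound \<zero> n r)}" using carr F_carr by auto
  have UPc: "carrier (UP R) = up R" by (simp add: UP_def)
  have mult: "p \<otimes>\<^bsub>UP R\<^esub> q = conv p q" if "p \<in> carrier (UP R)" "q \<in> carrier (UP R)" for p q
    using that unfolding UPc UP_def conv_def by simp
  have add: "p \<oplus>\<^bsub>UP R\<^esub> q = (\<lambda>i. p i \<oplus> q i)" if "p \<in> carrier (UP R)" "q \<in> carrier (UP R)" for p q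
    using that unfolding UPc UP_def by simp
  have one: "\<one>\<^bsub>UP R\<^esub> = (\<lambda>i. if i = 0 then \<one> else \<zero>)" and zero: "\<zero>\<^bsub>UP R\<^esub> = (\<lambda>_. \<zero>)"
    by (simp_all add: UP_def)
  interpret UP: UP_cring R "UP R" by (unfold_locales, simp)
  have neg: "(\<ominus>\<^bsub>UP R\<^esub> p) i = \<ominus> p i" if p: "p \<in> carrier (UP R)" for p i
  proof -
    have n: "\<ominus>\<^bsub>UP R\<^esub> p \<in> carrier (UP R)" using p by simp
    have "(\<lambda>i. (\<ominus>\<^bsub>UP R\<^esub> p) i \<oplus> p i) = (\<lambda>_. \<zero>)" using UP.P.l_neg[OF p] add[OF n p] zero by simp
    then have "(\<ominus>\<^bsub>UP R\<^esub> p) i \<oplus> p i = \<zero>" by metis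
    then show ?thesis using n p carr minus_equality by metis
  qed
  have "subring ?S (UP R)"
  proof (rule UP.P.subringI)
    show "?S \<subseteq> carrier (UP R)" by auto
    show "\<one>\<^bsub>UP R\<^esub> \<in> ?S" using UP.P.one_closed one F_one F_zero by auto
    fix p q assume p: "p \<in> ?S" 
    show "\<ominus>\<^bsub>UP R\<^esub> p \<in> ?S" using p neg F_neg UP.P.a_inv_closed by auto
    assume q: "q \<in> ?S"
    have pq: "p \<in> carrier (UP R)" "q \<in> carrier (UP R)" using p q by auto
    have "(p \<otimes>\<^bsub>UP R\<^esub> q) i \<in> F i" for i using mult[OF pq] conv_F p q by simp
    then show "p \<otimes>\<^bsub>UP R\<^esub> q \<in> ?S" using UP.P.m_closed[OF pq] by simp
    have "(p \<oplus>\<^bsub>UP R\<^esub> q) i \<in> F i" for i using add[OF pq] F_add p q by simp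
    then show "p \<oplus>\<^bsub>UP R\<^esub> q \<in> ?S" using UP.P.a_closed[OF pq] by simp
  qed
  then interpret S: cring "(UP R)\<lparr>carrier := ?S\<rparr>"
    using UP.P.subcringI' UP.P.subcring_iff[of ?S] by auto
  show ?thesis
  proof (rule S.hom_image_cring[where h = cls])
    fix p q assume "p \<in> carrier ((UP R)\<lparr>carrier := ?S\<rparr>)" "q \<in> carrier ((UP R)\<lparr>carrier := ?S\<rparr>)"
    then have pq: "p \<in> carrier (UP R)" "q \<in> carrier (UP R)" "\<And>i. p i \<in> F i" "\<And>i. q i \<in> F i" by auto
    show "cls (p \<oplus>\<^bsub>(UP R)\<lparr>carrier := ?S\<rparr>\<^esub> q) = cls p \<oplus>\<^bsub>gr\<^esub> cls q"
      using cls_add[OF pq(3,4)] add[OF pq(1,2)] by simp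
    show "cls (p \<otimes>\<^bsub>(UP R)\<lparr>carrier := ?S\<rparr>\<^esub> q) = cls p \<otimes>\<^bsub>gr\<^esub> cls q"
      using cls_mult[OF pq(3,4)] mult[OF pq(1,2)] by simp
  qed (simp_all add: gr_one gr_zero one zero gr_carrier Seq)
qed

end

section \<open>Gorenstein associated graded rings\<close>

lemma (in cring) ideal_by_closure:
  assumes "I \<subseteq> carrier R" "\<zero> \<in> I" "\<And>x y. \<lbrakk>x \<in> I; y \<in> I\<rbrakk> \<Longrightarrow> x \<oplus> y \<in> I"
    "\<And>a x. \<lbrakk>a \<in> I; x \<in> carrier R\<rbrakk> \<Longrightarrow> x \<otimes> a \<in> I"
  shows "ideal I R"
proof (rule idealI[OF ring_axioms])
  show "subgroup I (add_monoid R)"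
  proof (rule add.subgroupI)
    fix a assume a: "a \<in> I"
    then have "\<ominus> a = (\<ominus> \<one>) \<otimes> a" using assms(1) by (auto simp: l_minus)
    then show "\<ominus> a \<in> I" using assms(4)[OF a, of "\<ominus> \<one>"] by simp
  qed (use assms in auto)
  show "x \<otimes> a \<in> I" "a \<otimes> x \<in> I" if "a \<in> I" "x \<in> carrier R" for a x
    using assms(4)[OF that] that assms(1) by (auto simp: m_comm)
qed

text \<open>Units lift along a nilpotent chain of ideals: if \<open>x z = 1 + e\<close>, then
  \<open>x z (1 - e) = 1 - e\<^sup>2\<close>.\<close>
lemma (in cring) unit_lift:
  assumes M: "\<And>i :: nat. ideal (M i) R"
    "\<And>x y i j. \<lbrakk>x \<in> M i; y \<in> M j\<rbrakk> \<Longrightarrow> x \<otimes> y \<in> M (i + j)" "M N = {\<zero>}" "N > 0"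
    and x: "x \<in> carrier R" and z: "z \<in> carrier R" "x \<otimes> z \<ominus> \<one> \<in> M 1"
  shows "x \<in> Units R"
proof -
  have "\<exists>z\<in>carrier R. x \<otimes> z \<ominus> \<one> \<in> M 1 \<and> x \<otimes> z \<ominus> \<one> \<in> M (Suc k)" for k
  proof (induction k)
    case 0 then show ?case using z by (auto simp: One_nat_def)
  next
    case (Suc k)
    then obtain z where z: "z \<in> carrier R" "x \<otimes> z \<ominus> \<one> \<in> M 1" "x \<otimes> z \<ominus> \<one> \<in> M (Suc k)" by blast
    define e where "e = x \<otimes> z \<ominus> \<one>"
    have ec: "e \<in> carrier R" "e \<in> M 1" "e \<in> M (Suc k)" using e_def z x by auto
    have "x \<otimes> (z \<otimes> (\<one> \<ominus> e)) \<ominus> \<one> = \<ominus> (e \<otimes> e)"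
      unfolding e_def using x z(1) by algebra
    moreover have "e \<otimes> e \<in> M (Suc (Suc k))" using M(2)[OF ec(3,2)] by (simp add: One_nat_def)
    moreover have "e \<otimes> e \<in> M 1" using ideal.I_l_closed[OF M(1) ec(2,1)] .
    ultimately have "x \<otimes> (z \<otimes> (\<one> \<ominus> e)) \<ominus> \<one> \<in> M 1 \<and> x \<otimes> (z \<otimes> (\<one> \<ominus> e)) \<ominus> \<one> \<in> M (Suc (Suc k))"
      using additive_subgroup.a_inv_closed[OF ideal.axioms(1)[OF M(1)]] by simp
    then show ?case using z(1) ec(1) by (intro bexI[of _ "z \<otimes> (\<one> \<ominus> e)"]) auto
  qed
  from this[of "N - 1"] obtain z where z: "z \<in> carrier R" "x \<otimes> z \<ominus> \<one> \<in> {\<zero>}"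
    using M(3,4) by auto
  then have "x \<otimes> z \<ominus> \<one> = \<zero>" by simp
  then have "x \<otimes> z = \<one>" using x z(1) by (meson m_closed one_closed r_right_minus_eq)
  moreover from this have "z \<otimes> x = \<one>" using m_comm[OF z(1) x] by simp
  ultimately show ?thesis using x z(1) unfolding Units_def by blast
qed

lemma (in filtered_ring) finsum_Q: "finite A \<Longrightarrow> (\<And>i. i \<in> A \<Longrightarrow> a i \<in> Q k) \<Longrightarrow> (\<Oplus>i\<in>A. a i) \<in> Q k"
proof (induction A rule: finite_induct)
  case empty then show ?case using Q_zero by simp
next
  case (insert x A)
  then have "finsum R a (insert x A) = a x \<oplus> (\<Oplus>i\<in>A. a i)"
    using Q_carr by (intro finsum_insert) auto
  then show ?case using insert Q_add by simp
qed

text \<open>The filtration is exhausted at \<open>\<rho>\<close> and not before, and its degree zero part is a field.\<close>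

locale filtered_artin = filtered_ring R F for R (structure) and F +
  fixes \<rho> :: nat
  assumes F_top: "F \<rho> = carrier R" and Q_top: "Q \<rho> \<noteq> carrier R"
    and F_field: "\<lbrakk>x \<in> F 0; x \<noteq> \<zero>\<rbrakk> \<Longrightarrow> \<exists>y\<in>F 0. x \<otimes> y = \<one>"
begin

lemma F_above: "\<rho> \<le> i \<Longrightarrow> F i = carrier R"
  using F_mono'[of \<rho> i] F_top F_carr by blast

lemma Q_above: "\<rho> < i \<Longrightarrow> Q i = carrier R"
  using F_above[of "i - 1"] Q_Suc[of "i - 1"] by simp

lemma one_neq_zero: "\<one> \<noteq> \<zero>"
proof
  assume "\<one> = \<zero>"
  then have "carrier R = {\<zero>}" using one_zeroD by simp
  moreover have "Q \<rho> \<subseteq> carrier R" "\<zero> \<in> Q \<rho>" using Q_zero Q_carr by auto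
  ultimately show False using Q_top by auto
qed

lemma degree_bound: "f \<in> F i \<Longrightarrow> f \<notin> Q i \<Longrightarrow> i \<le> \<rho>"
  using Q_above[of i] F_carr[of f i] by (cases "i \<le> \<rho>") auto

lemma cls_carrier:
  assumes "\<And>i. r i \<in> F i" shows "cls r \<in> carrier gr"
proof -
  define r' where "r' i = (if i \<le> \<rho> then r i else \<zero>)" for i
  have r': "r' i \<in> F i" for i using assms F_zero by (simp add: r'_def)
  have "r i \<ominus> r' i \<in> Q i" for i
  proof (cases "i \<le> \<rho>")
    case True
    then show ?thesis using F_carr[OF assms] Q_zero by (simp add: r'_def minus_eq r_neg)
  next
    case False
    then show ?thesis using Q_above F_carr[OF assms] F_carr[OF r'] by simp
  qed
  then have "cls r = cls r'" using cls_eq_iff[OF assms r'] by simp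
  moreover have "bound \<zero> \<rho> r'" by (intro bound.intro) (simp add: r'_def)
  ultimately show ?thesis using r' unfolding gr_carrier by blast
qed

lemma gr_rep:
  assumes "u \<in> carrier gr" obtains r where "\<And>i. r i \<in> F i" "u = cls r"
  using assms unfolding gr_carrier by blast

text \<open>The ideal of all elements without components of degree below \<open>i\<close>; \<open>gM 1\<close> is the maximal ideal.\<close>

definition gM :: "nat \<Rightarrow> (nat \<Rightarrow> 'a set) set" where
  "gM i = {cls r | r. (\<forall>j. r j \<in> F j) \<and> (\<forall>j<i. r j \<in> Q j)}"

lemma gM_iff:
  assumes "\<And>j. r j \<in> F j" shows "cls r \<in> gM i \<longleftrightarrow> (\<forall>j<i. r j \<in> Q j)"
proof
  assume "cls r \<in> gM i"
  then obtain s where s: "cls r = cls s" "\<And>j. s j \<in> F j" "\<forall>j<i. s j \<in> Q j" unfolding gM_def by auto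
  show "\<forall>j<i. r j \<in> Q j"
  proof (intro allI impI)
    fix j assume "j < i"
    then have "(r j \<ominus> s j) \<oplus> s j \<in> Q j" using s cls_eq_iff[OF assms s(2)] Q_add by simp
    moreover have "(r j \<ominus> s j) \<oplus> s j = r j" using F_carr[OF assms] F_carr[OF s(2)]
      by (simp add: minus_eq a_assoc l_neg)
    ultimately show "r j \<in> Q j" by simp
  qed
qed (use assms gM_def in auto)

lemma gM_rep:
  assumes "u \<in> gM i" obtains r where "\<And>j. r j \<in> F j" "\<And>j. j < i \<Longrightarrow> r j \<in> Q j" "u = cls r"
  using assms unfolding gM_def by auto

definition hm :: "nat \<Rightarrow> 'a \<Rightarrow> nat \<Rightarrow> 'a" where "hm i f = (\<lambda>j. if j = i then f else \<zero>)"

lemma hm_F: "f \<in> F i \<Longrightarrow> hm i f j \<in> F j" using F_zero by (simp add: hm_def)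

lemma conv_hm:
  assumes r: "\<And>i. r i \<in> F i" and f: "f \<in> F i"
  shows "conv r (hm i f) k = (if k < i then \<zero> else r (k - i) \<otimes> f)"
proof (cases "k < i")
  case True
  then have "conv r (hm i f) k = (\<Oplus>a\<in>{..k}. \<zero>)"
    unfolding conv_def hm_def using F_carr[OF r] by (intro finsum_cong') auto
  then show ?thesis using True by simp
next
  case False
  have "conv r (hm i f) k = (\<Oplus>a\<in>{..k}. if k - i = a then r a \<otimes> f else \<zero>)"
    unfolding conv_def hm_def using F_carr[OF r] F_carr[OF f] False by (intro finsum_cong') auto
  also have "\<dots> = r (k - i) \<otimes> f"
    using F_carr[OF r] F_carr[OF f] False by (intro add.finprod_singleton) auto
  finally show ?thesis using False by simp
qed

lemma gM_ideal: "ideal (gM i) gr"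
proof -
  interpret G: cring gr by (rule gr_cring)
  show ?thesis
  proof (rule G.ideal_by_closure)
    show "gM i \<subseteq> carrier gr" unfolding gM_def using cls_carrier by auto
    show "\<zero>\<^bsub>gr\<^esub> \<in> gM i" unfolding gr_zero using gM_iff[of "\<lambda>_. \<zero>" i] F_zero Q_zero by simp
    fix x y assume x: "x \<in> gM i"
    then obtain r where r: "\<And>j. r j \<in> F j" "\<And>j. j < i \<Longrightarrow> r j \<in> Q j" "x = cls r" using gM_rep by blast
    { assume "y \<in> gM i"
      then obtain s where s: "\<And>j. s j \<in> F j" "\<And>j. j < i \<Longrightarrow> s j \<in> Q j" "y = cls s" using gM_rep by blast
      show "x \<oplus>\<^bsub>gr\<^esub> y \<in> gM i"
        using gM_iff[of "\<lambda>j. r j \<oplus> s j" i] F_add r s Q_add cls_add[OF r(1) s(1)] by simp }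
    assume "y \<in> carrier gr"
    then obtain s where s: "\<And>j. s j \<in> F j" "y = cls s" using gr_rep by blast
    have "conv s r k \<in> Q k" if k: "k < i" for k
      unfolding conv_def
    proof (rule finsum_Q)
      fix a assume "a \<in> {..k}"
      then show "s a \<otimes> r (k - a) \<in> Q k" using Q_mult'[OF s(1)[of a] r(2)[of "k - a"]] k by simp
    qed simp
    then show "y \<otimes>\<^bsub>gr\<^esub> x \<in> gM i"
      using gM_iff[of "conv s r" i] conv_F[OF s(1) r(1)] cls_mult[OF s(1) r(1)] r s by simp
  qed
qed

lemma gM_mult: "x \<in> gM i \<Longrightarrow> y \<in> gM j \<Longrightarrow> x \<otimes>\<^bsub>gr\<^esub> y \<in> gM (i + j)"
proof -
  assume "x \<in> gM i" "y \<in> gM j"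
  then obtain r s where r: "\<And>j. r j \<in> F j" "\<And>j. j < i \<Longrightarrow> r j \<in> Q j" "x = cls r"
    and s: "\<And>j. s j \<in> F j" "\<And>k. k < j \<Longrightarrow> s k \<in> Q k" "y = cls s" using gM_rep by metis
  have "conv r s k \<in> Q k" if k: "k < i + j" for k
    unfolding conv_def
  proof (rule finsum_Q)
    fix a assume a: "a \<in> {..k}"
    show "r a \<otimes> s (k - a) \<in> Q k"
    proof (cases "a < i")
      case True
      then show ?thesis using Q_mult[OF r(2)[of a] s(1)[of "k - a"]] a by simp
    next
      case False
      then have "k - a < j" using a k by auto
      then show ?thesis using Q_mult'[OF r(1)[of a] s(2)[of "k - a"]] a by simp
    qed
  qed simp
  then show "x \<otimes>\<^bsub>gr\<^esub> y \<in> gM (i + j)"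
    using gM_iff[of "conv r s" "i + j"] conv_F[OF r(1) s(1)] cls_mult[OF r(1) s(1)] r(3) s(3) by simp
qed

text \<open>Modulo \<open>gM 1\<close> an element is its component in the field \<open>F 0\<close>, so that units lift, and the chain
  ends because degrees above \<open>\<rho>\<close> do not occur.\<close>

lemma gr_local_chain: "local_chain gr gM (Suc \<rho>)"
proof (intro local_chain.intro local_chain_axioms.intro gr_cring gM_ideal gM_mult)
  interpret G: cring gr by (rule gr_cring)
  show "gM 0 = carrier gr"
  proof (intro equalityI subsetI)
    fix u assume "u \<in> carrier gr"
    then obtain r where "\<And>i. r i \<in> F i" "u = cls r" using gr_rep by blast
    then show "u \<in> gM 0" using gM_iff[of r 0] by simp
  qed (use ideal.Icarr[OF gM_ideal] in blast)
  show top: "gM (Suc \<rho>) = {\<zero>\<^bsub>gr\<^esub>}"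
  proof (intro equalityI subsetI)
    fix u assume "u \<in> gM (Suc \<rho>)"
    then obtain r where r: "\<And>j. r j \<in> F j" "\<And>j. j < Suc \<rho> \<Longrightarrow> r j \<in> Q j" "u = cls r"
      using gM_rep by blast
    have "r j \<in> Q j" for j using r(2)[of j] Q_above[of j] F_carr[OF r(1)] by (cases "j < Suc \<rho>") auto
    then have "r j \<ominus> \<zero> \<in> Q j" for j using F_carr[OF r(1)] by (simp add: minus_eq)
    then show "u \<in> {\<zero>\<^bsub>gr\<^esub>}" using cls_eq_iff[OF r(1), of "\<lambda>_. \<zero>"] F_zero r(3) gr_zero by simp
  next
    fix u assume "u \<in> {\<zero>\<^bsub>gr\<^esub>}"
    then show "u \<in> gM (Suc \<rho>)"
      using additive_subgroup.zero_closed[OF ideal.axioms(1)[OF gM_ideal]] by simp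
  qed
  show "\<one>\<^bsub>gr\<^esub> \<notin> gM 1"
    unfolding gr_one using gM_iff[of "\<lambda>i. if i = 0 then \<one> else \<zero>" 1] F_zero F_one one_neq_zero Q_0 by auto
  fix x assume x: "x \<in> carrier gr" "x \<notin> gM 1"
  obtain r where r: "\<And>i. r i \<in> F i" "x = cls r" using gr_rep x(1) by blast
  have "r 0 \<noteq> \<zero>" using x(2) gM_iff[OF r(1), of 1] r(2) Q_0 by auto
  then obtain y where y: "y \<in> F 0" "r 0 \<otimes> y = \<one>" using F_field r(1) by blast
  have yh: "hm 0 y j \<in> F j" for j using hm_F y(1) .
  have c: "conv r (hm 0 y) k \<in> F k" for k using conv_F[OF r(1) yh] .
  have o: "(if i = 0 then \<one> else \<zero>) \<in> F i" for i using F_one F_zero by simp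
  have e: "x \<otimes>\<^bsub>gr\<^esub> cls (hm 0 y) \<ominus>\<^bsub>gr\<^esub> \<one>\<^bsub>gr\<^esub> \<in> gM 1"
  proof -
    define d where "d k = conv r (hm 0 y) k \<ominus> (if k = 0 then \<one> else \<zero>)" for k
    have dF: "d k \<in> F k" for k unfolding d_def minus_eq using c F_add F_neg o by blast
    have "cls d \<oplus>\<^bsub>gr\<^esub> \<one>\<^bsub>gr\<^esub> = cls (conv r (hm 0 y))"
    proof -
      have "cls d \<oplus>\<^bsub>gr\<^esub> \<one>\<^bsub>gr\<^esub> = cls (\<lambda>k. d k \<oplus> (if k = 0 then \<one> else \<zero>))"
        unfolding gr_one using cls_add[OF dF o] by simp
      also have "(\<lambda>k. d k \<oplus> (if k = 0 then \<one> else \<zero>)) = conv r (hm 0 y)"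
        using F_carr[OF c] by (auto simp: d_def minus_eq a_assoc l_neg)
      finally show ?thesis .
    qed
    then have "cls d \<oplus>\<^bsub>gr\<^esub> \<one>\<^bsub>gr\<^esub> = x \<otimes>\<^bsub>gr\<^esub> cls (hm 0 y)" using cls_mult[OF r(1) yh] r(2) by simp
    then have "x \<otimes>\<^bsub>gr\<^esub> cls (hm 0 y) \<ominus>\<^bsub>gr\<^esub> \<one>\<^bsub>gr\<^esub> = cls d"
      using cls_carrier[OF dF] by (metis G.add.inv_solve_right' G.minus_eq G.one_closed G.add.m_closed)
    moreover have "d 0 = \<zero>" unfolding d_def using conv_hm[OF r(1) y(1)] y(2) by (simp add: minus_eq r_neg)
    then have "cls d \<in> gM 1" using gM_iff[OF dF, of 1] Q_zero by auto
    ultimately show ?thesis by simp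
  qed
  show "x \<in> Units gr"
    by (rule G.unit_lift[OF gM_ideal gM_mult top _ x(1) cls_carrier[OF yh] e]) auto
qed

lemma gr_gorenstein_iff:
  assumes "noetherian_ring gr" shows "gorenstein_ring gr \<longleftrightarrow> self_injective gr"
proof -
  interpret N: noetherian_ring gr by fact
  interpret C: local_chain gr gM "Suc \<rho>" by (rule gr_local_chain)
  interpret A: artin_chain gr gM "Suc \<rho>"
    by (intro artin_chain.intro gr_local_chain artin_chain_axioms.intro N.ideals_acc)
  show ?thesis by (rule A.gorenstein_iff_self_injective[OF assms])
qed

lemma hm_socle:
  assumes f: "f \<in> F i" and kill: "\<And>j g. \<lbrakk>j \<ge> 1; g \<in> F j\<rbrakk> \<Longrightarrow> g \<otimes> f \<in> Q (j + i)"
    and a: "a \<in> gM 1"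
  shows "a \<otimes>\<^bsub>gr\<^esub> cls (hm i f) = \<zero>\<^bsub>gr\<^esub>"
proof -
  obtain r where r: "\<And>j. r j \<in> F j" "\<And>j. j < 1 \<Longrightarrow> r j \<in> Q j" "a = cls r" using gM_rep[OF a] by blast
  have h: "hm i f j \<in> F j" for j using hm_F f .
  have "conv r (hm i f) k \<in> Q k" for k
  proof -
    consider "k < i" | "k = i" | "k > i" by linarith
    then show ?thesis
    proof cases
      case 1 then show ?thesis using conv_hm[OF r(1) f] Q_zero by simp
    next
      case 2
      then have "r (k - i) = \<zero>" using r(2)[of 0] Q_0 by simp
      then show ?thesis using conv_hm[OF r(1) f] Q_zero F_carr[OF f] 2 by simp
    next
      case 3 then show ?thesis using conv_hm[OF r(1) f] kill[OF _ r(1), of "k - i"] by simp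
    qed
  qed
  then have "conv r (hm i f) k \<ominus> \<zero> \<in> Q k" for k using Q_carr[of _ k] by (simp add: minus_eq)
  then show ?thesis
    using cls_eq_iff[OF conv_F[OF r(1) h], of "\<lambda>_. \<zero>"] F_zero cls_mult[OF r(1) h] r(3) gr_zero by simp
qed

context
  assumes gor: "gorenstein_ring gr"
begin

text \<open>The class of \<open>f\<close> and the class of \<open>t\<close> in top degree both lie in the socle, which has rank one.\<close>

lemma gorenstein_top_multiple:
  assumes f: "f \<in> F i" "f \<notin> Q i" "\<And>j g. \<lbrakk>j \<ge> 1; g \<in> F j\<rbrakk> \<Longrightarrow> g \<otimes> f \<in> Q (j + i)"
    and t: "t \<in> carrier R"
  obtains g where "i \<le> \<rho>" "g \<in> F (\<rho> - i)" "t \<ominus> f \<otimes> g \<in> Q \<rho>"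
proof -
  interpret C: local_chain gr gM "Suc \<rho>" by (rule gr_local_chain)
  have self: "self_injective gr"
    using gor gr_gorenstein_iff gorenstein_ring_def by blast
  have i: "i \<le> \<rho>" using degree_bound f(1,2) by blast
  have tF: "t \<in> F \<rho>" using t F_top by simp
  have h: "hm i f j \<in> F j" for j using hm_F f(1) .
  have ht: "hm \<rho> t j \<in> F j" for j using hm_F tF .
  have ne: "cls (hm i f) \<noteq> \<zero>\<^bsub>gr\<^esub>"
  proof
    assume "cls (hm i f) = \<zero>\<^bsub>gr\<^esub>"
    then have "\<forall>j. hm i f j \<ominus> \<zero> \<in> Q j" using gr_zero cls_eq_iff[OF h, of "\<lambda>_. \<zero>"] F_zero by simp
    then have "hm i f i \<ominus> \<zero> \<in> Q i" by blast
    then show False using f(2) F_carr[OF f(1)] by (simp add: hm_def minus_eq)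
  qed
  have kt: "g \<otimes> t \<in> Q (j + \<rho>)" if "j \<ge> 1" "g \<in> F j" for j g
    using Q_above[of "j + \<rho>"] F_carr[OF that(2)] t that(1) by simp
  obtain v where v: "v \<in> carrier gr" "cls (hm \<rho> t) = cls (hm i f) \<otimes>\<^bsub>gr\<^esub> v"
    using C.self_injective_socle[OF self cls_carrier[OF h] ne hm_socle[OF f(1,3)]
        cls_carrier[OF ht] hm_socle[OF tF kt]] by blast
  obtain s where s: "\<And>j. s j \<in> F j" "v = cls s" using gr_rep v(1) by blast
  have "cls (hm \<rho> t) = cls s \<otimes>\<^bsub>gr\<^esub> cls (hm i f)"
    using v s(2) C.m_comm cls_carrier[OF h] by simp
  then have "cls (hm \<rho> t) = cls (conv s (hm i f))" using cls_mult[OF s(1) h] by simp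
  then have "hm \<rho> t \<rho> \<ominus> conv s (hm i f) \<rho> \<in> Q \<rho>" using cls_eq_iff[OF ht conv_F[OF s(1) h]] by simp
  then have "t \<ominus> s (\<rho> - i) \<otimes> f \<in> Q \<rho>" using conv_hm[OF s(1) f(1)] i by (simp add: hm_def)
  then show thesis using that[OF i s(1)] m_comm F_carr[OF s(1)] F_carr[OF f(1)] by simp
qed

text \<open>Multiplying \<open>f\<close> by elements of positive degree as long as the product survives in the graded ring leads
  to the socle, that is, to a divisor of every element of top degree.\<close>

lemma gorenstein_nondegenerate:
  assumes "f \<in> F i" "f \<notin> Q i"
  shows "i \<le> \<rho> \<and> (\<exists>g\<in>F (\<rho> - i). f \<otimes> g \<notin> Q \<rho>)"
  using assms
proof (induction "\<rho> - i" arbitrary: i f rule: less_induct)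
  case less
  have i: "i \<le> \<rho>" using degree_bound less.prems by blast
  have fc: "f \<in> carrier R" using less.prems F_carr by blast
  show ?case
  proof (cases "\<exists>j g. j \<ge> 1 \<and> g \<in> F j \<and> g \<otimes> f \<notin> Q (j + i)")
    case True
    then obtain j g where g: "j \<ge> 1" "g \<in> F j" "g \<otimes> f \<notin> Q (j + i)" by blast
    have gc: "g \<in> carrier R" using g F_carr by blast
    have gf: "g \<otimes> f \<in> F (j + i)" using F_mult g less.prems by blast
    have ji: "j + i \<le> \<rho>" using degree_bound gf g(3) by blast
    have "\<rho> - (j + i) < \<rho> - i" using ji g(1) by simp
    then obtain h where h: "h \<in> F (\<rho> - (j + i))" "(g \<otimes> f) \<otimes> h \<notin> Q \<rho>"
      using less.hyps[OF _ gf g(3)] by blast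
    have hc: "h \<in> carrier R" using h F_carr by blast
    have "g \<otimes> h \<in> F (j + (\<rho> - (j + i)))" using F_mult g h by blast
    then have "g \<otimes> h \<in> F (\<rho> - i)" using ji by simp
    moreover have "f \<otimes> (g \<otimes> h) = (g \<otimes> f) \<otimes> h" using fc gc hc by (simp add: m_ac)
    ultimately have "g \<otimes> h \<in> F (\<rho> - i) \<and> f \<otimes> (g \<otimes> h) \<notin> Q \<rho>" using h(2) by simp
    then show ?thesis using i by blast
  next
    case False
    have "Q \<rho> \<subseteq> carrier R" using Q_carr by blast
    then obtain t where t: "t \<in> carrier R" "t \<notin> Q \<rho>" using Q_top by blast
    obtain g where g: "g \<in> F (\<rho> - i)" "t \<ominus> f \<otimes> g \<in> Q \<rho>"
      using gorenstein_top_multiple[OF less.prems _ t(1)] False by blast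
    have gc: "g \<in> carrier R" using g F_carr by blast
    have "f \<otimes> g \<notin> Q \<rho>"
    proof
      assume "f \<otimes> g \<in> Q \<rho>"
      then have "(t \<ominus> f \<otimes> g) \<oplus> f \<otimes> g \<in> Q \<rho>" using g Q_add by blast
      then show False using t fc gc by (simp add: minus_eq a_assoc l_neg)
    qed
    then show ?thesis using g(1) i by blast
  qed
qed

lemma gorenstein_top_rank:
  assumes "s \<in> carrier R" "s \<notin> Q \<rho>" "t \<in> carrier R"
  obtains c where "c \<in> F 0" "t \<ominus> c \<otimes> s \<in> Q \<rho>"
proof -
  have k: "g \<otimes> s \<in> Q (j + \<rho>)" if "j \<ge> 1" "g \<in> F j" for j g
    using Q_above[of "j + \<rho>"] F_carr[OF that(2)] assms(1) that(1) by simp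
  have "s \<in> F \<rho>" using assms F_top by simp
  then obtain g where g: "g \<in> F (\<rho> - \<rho>)" "t \<ominus> s \<otimes> g \<in> Q \<rho>"
    using gorenstein_top_multiple[OF _ assms(2) k assms(3)] by blast
  then show thesis using that[of g] assms(1) F_carr[of g 0] by (simp add: m_comm)
qed

end

end

section \<open>Filtered algebras over a field\<close>

interpretation funs: vector_space "\<lambda>(c::'l::field) (f::'i \<Rightarrow> 'l) i. c * f i"
  by unfold_locales (auto simp: fun_eq_iff algebra_simps plus_fun_def)

lemma funs_finite_support_span:
  fixes A :: "'i set"
  assumes "finite A" "\<And>i. i \<notin> A \<Longrightarrow> f i = (0::'l::field)"
  shows "f \<in> funs.span ((\<lambda>j i. if i = j then 1 else 0) ` A)"
proof -
  have "f = (\<Sum>j\<in>A. (\<lambda>i. f j * (if i = j then 1 else 0)))"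
  proof
    fix i
    have "(\<Sum>j\<in>A. (\<lambda>i. f j * (if i = j then 1 else 0))) i = (\<Sum>j\<in>A. f j * (if i = j then 1 else 0))"
      using assms(1) by (induction A rule: finite_induct) auto
    also have "\<dots> = (\<Sum>j\<in>A. if i = j then f i else 0)" by (intro sum.cong) auto
    also have "\<dots> = f i" using assms by simp
    finally show "f i = (\<Sum>j\<in>A. (\<lambda>i. f j * (if i = j then 1 else 0))) i" by simp
  qed
  also have "\<dots> \<in> funs.span ((\<lambda>j i. if i = j then 1 else 0) ` A)"
    by (intro funs.span_sum) (rule funs.span_scale, rule funs.span_base, blast)
  finally show ?thesis .
qed

lemma (in vector_space) subspace_eq_of_dim:
  assumes "subspace U" "subspace W" "U \<subseteq> W" "W \<subseteq> span B" "finite B" "dim U = dim W"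
  shows "U = W"
proof (rule ccontr)
  assume "U \<noteq> W"
  then obtain x where x: "x \<in> W" "x \<notin> U" using assms(3) by blast
  obtain S where S: "finite S" "independent S" "S \<subseteq> U" "span S = U" "card S = dim U"
    using subspace_finite_basis[OF assms(1) _ assms(5)] assms(3,4) by blast
  obtain T where T: "finite T" "independent T" "T \<subseteq> W" "span T = W" "card T = dim W"
    using subspace_finite_basis[OF assms(2,4,5)] by blast
  have n: "x \<notin> span S" using S(4) x(2) by simp
  have "independent (insert x S)" using independent_insertI[OF n S(2)] .
  moreover have "insert x S \<subseteq> span T" using x S(3) assms(3) T(4) by auto
  ultimately have "card (insert x S) \<le> card T" using independent_span_bound[OF T(1)] by blast
  moreover have "x \<notin> S" using n span_base by blast
  ultimately show False using S(1,5) T(5) assms(6) by simp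
qed

lemma (in vector_space) subspace_dim_mono:
  assumes "subspace U" "subspace W" "U \<subseteq> W" "W \<subseteq> span B" "finite B"
  shows "dim U \<le> dim W"
proof -
  obtain S where S: "finite S" "independent S" "S \<subseteq> U" "span S = U" "card S = dim U"
    using subspace_finite_basis[OF assms(1) _ assms(5)] assms(3,4) by blast
  obtain T where T: "finite T" "independent T" "T \<subseteq> W" "span T = W" "card T = dim W"
    using subspace_finite_basis[OF assms(2,4,5)] by blast
  have "S \<subseteq> span T" using S(3) assms(3) T(4) by auto
  then show ?thesis using independent_span_bound[OF T(1) S(2)] S(5) T(5) by simp
qed

text \<open>A coordinate map identifies a ring with a finite-dimensional space of functions.\<close>
locale coordinatized_ring = cring R for R (structure) +
  fixes \<kappa> :: "'l::field \<Rightarrow> 'a" and E :: "'a \<Rightarrow> 'i \<Rightarrow> 'l" and B :: "('i \<Rightarrow> 'l) set"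
  assumes \<kappa>_carr: "\<kappa> c \<in> carrier R"
    and E_add: "\<lbrakk>x \<in> carrier R; y \<in> carrier R\<rbrakk> \<Longrightarrow> E (x \<oplus> y) = E x + E y"
    and E_smult: "x \<in> carrier R \<Longrightarrow> E (\<kappa> c \<otimes> x) = (\<lambda>i. c * E x i)"
    and E_inj: "\<lbrakk>x \<in> carrier R; E x = 0\<rbrakk> \<Longrightarrow> x = \<zero>"
    and E_span: "E ` carrier R \<subseteq> funs.span B" and B_finite: "finite B"
begin

lemma E_zero: "E \<zero> = 0" using E_add[of \<zero> \<zero>] by simp

lemma E_minus: assumes "x \<in> carrier R" "y \<in> carrier R" shows "E (x \<ominus> y) = E x - E y"
proof -
  have "E ((x \<ominus> y) \<oplus> y) = E (x \<ominus> y) + E y" using E_add assms by simp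
  moreover have "(x \<ominus> y) \<oplus> y = x" using assms by (simp add: minus_eq a_assoc l_neg)
  ultimately show ?thesis by (simp add: algebra_simps)
qed

lemma E_eq: assumes "x \<in> carrier R" "y \<in> carrier R" "E x = E y" shows "x = y"
proof -
  have "E (x \<ominus> y) = 0" using E_minus assms by simp
  then have "x \<ominus> y = \<zero>" using E_inj assms by simp
  then show ?thesis using assms by (meson r_right_minus_eq)
qed

definition ksub :: "'a set \<Rightarrow> bool" where
  "ksub U \<longleftrightarrow> U \<subseteq> carrier R \<and> \<zero> \<in> U \<and> (\<forall>x\<in>U. \<forall>y\<in>U. x \<oplus> y \<in> U) \<and> (\<forall>c. \<forall>x\<in>U. \<kappa> c \<otimes> x \<in> U)"

lemma ksubD:
  assumes "ksub U"
  shows "x \<in> U \<Longrightarrow> x \<in> carrier R" "\<zero> \<in> U" "\<lbrakk>x \<in> U; y \<in> U\<rbrakk> \<Longrightarrow> x \<oplus> y \<in> U"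
    "x \<in> U \<Longrightarrow> \<kappa> c \<otimes> x \<in> U"
  using assms unfolding ksub_def by auto

lemma ksub_subspace: assumes "ksub U" shows "funs.subspace (E ` U)"
proof (rule funs.subspaceI)
  note U = ksubD[OF assms]
  show "0 \<in> E ` U" using imageI[OF U(2), of E] unfolding E_zero .
  show "x + y \<in> E ` U" if "x \<in> E ` U" "y \<in> E ` U" for x y
  proof -
    from that obtain a b where ab: "a \<in> U" "x = E a" "b \<in> U" "y = E b" by blast
    have "x + y = E (a \<oplus> b)" unfolding ab using E_add[OF U(1) U(1)] ab(1,3) by simp
    then show ?thesis using U(3)[OF ab(1,3)] by simp
  qed
  show "(\<lambda>i. k * x i) \<in> E ` U" if "x \<in> E ` U" for x k
  proof -
    from that obtain a where a: "a \<in> U" "x = E a" by blast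
    have "(\<lambda>i. k * x i) = E (\<kappa> k \<otimes> a)" unfolding a(2) using E_smult[OF U(1)[OF a(1)]] by simp
    then show ?thesis using U(4)[OF a(1)] by simp
  qed
qed

lemma ksub_carrier: "ksub (carrier R)" unfolding ksub_def using \<kappa>_carr by auto

lemma ksub_ideal: "ideal I R \<Longrightarrow> ksub I"
proof -
  assume "ideal I R"
  then interpret ideal I R .
  show "ksub I" unfolding ksub_def using a_subset zero_closed a_closed I_l_closed \<kappa>_carr by simp
qed

lemma ksub_image_mem: "ksub U \<Longrightarrow> x \<in> carrier R \<Longrightarrow> E x \<in> E ` U \<longleftrightarrow> x \<in> U"
proof
  assume U: "ksub U" and x: "x \<in> carrier R" and "E x \<in> E ` U"
  then obtain y where y: "y \<in> U" "E x = E y" by blast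
  show "x \<in> U" using E_eq[OF x ksubD(1)[OF U y(1)] y(2)] y(1) by simp
qed simp

end

text \<open>A finite-dimensional algebra with a linear form \<open>\<Lambda>\<close> whose kernel contains no non-zero ideal, i.e. a
  Frobenius algebra.\<close>

locale paired_ring = coordinatized_ring +
  fixes \<Lambda> :: "'a \<Rightarrow> 'c"
  assumes \<Lambda>_add: "\<lbrakk>x \<in> carrier R; y \<in> carrier R\<rbrakk> \<Longrightarrow> \<Lambda> (x \<oplus> y) = \<Lambda> x + \<Lambda> y"
    and \<Lambda>_smult: "x \<in> carrier R \<Longrightarrow> \<Lambda> (\<kappa> c \<otimes> x) = c * \<Lambda> x"
    and nondeg: "\<lbrakk>x \<in> carrier R; x \<noteq> \<zero>\<rbrakk> \<Longrightarrow> \<exists>y\<in>carrier R. \<Lambda> (x \<otimes> y) \<noteq> 0"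
begin

definition D where "D = inv_into (carrier R) E"

lemma D_E: "x \<in> carrier R \<Longrightarrow> D (E x) = x"
  unfolding D_def using E_eq by (intro inv_into_f_f) (auto simp: inj_on_def)

definition form where "form v w = \<Lambda> (D v \<otimes> D w)"

lemma form_E: "x \<in> carrier R \<Longrightarrow> y \<in> carrier R \<Longrightarrow> form (E x) (E y) = \<Lambda> (x \<otimes> y)"
  by (simp add: form_def D_E)

lemma form_add:
  assumes "x \<in> E ` carrier R" "y \<in> E ` carrier R" "z \<in> E ` carrier R"
  shows "form (x + y) z = form x z + form y z"
proof -
  obtain a b c where "a \<in> carrier R" "x = E a" "b \<in> carrier R" "y = E b" "c \<in> carrier R" "z = E c"
    using assms by blast
  then have abc: "a \<in> carrier R" "b \<in> carrier R" "c \<in> carrier R" "x = E a" "y = E b" "z = E c" by auto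
  have "form (E (a \<oplus> b)) (E c) = form (E a) (E c) + form (E b) (E c)"
    using form_E abc(1-3) \<Lambda>_add[of "a \<otimes> c" "b \<otimes> c"] by (simp add: l_distr)
  then show ?thesis using E_add[OF abc(1,2)] abc(4-6) by simp
qed

lemma form_scale:
  assumes "x \<in> E ` carrier R" "z \<in> E ` carrier R"
  shows "form (\<lambda>i. k * x i) z = k * form x z"
proof -
  obtain a c where ac: "a \<in> carrier R" "x = E a" "c \<in> carrier R" "z = E c"
    using assms by blast
  have "form (E (\<kappa> k \<otimes> a)) (E c) = \<Lambda> ((\<kappa> k \<otimes> a) \<otimes> c)" using ac form_E \<kappa>_carr by simp
  also have "\<dots> = k * \<Lambda> (a \<otimes> c)" using ac \<kappa>_carr \<Lambda>_smult[of "a \<otimes> c" k] by (simp add: m_assoc)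
  finally show ?thesis using E_smult[OF ac(1)] ac form_E by simp
qed

lemma form_sym:
  assumes "x \<in> E ` carrier R" "z \<in> E ` carrier R" shows "form x z = form z x"
  using assms form_E by (auto simp: m_comm)

lemma form_nondeg:
  assumes "x \<in> E ` carrier R" "x \<noteq> 0" shows "\<exists>y\<in>E ` carrier R. form x y \<noteq> 0"
proof -
  obtain a where a: "a \<in> carrier R" "x = E a" using assms by blast
  then have "a \<noteq> \<zero>" using assms(2) E_zero by auto
  then obtain y where y: "y \<in> carrier R" "\<Lambda> (a \<otimes> y) \<noteq> 0" using nondeg a by blast
  then show ?thesis using a form_E by auto
qed

lemmas form_facts = ksub_subspace[OF ksub_carrier] E_span B_finite form_add form_scale form_sym form_nondeg

lemma perp_dim:
  assumes "ksub U"
  shows "funs.dim (E ` {x \<in> carrier R. \<forall>y\<in>U. \<Lambda> (x \<otimes> y) = 0}) + funs.dim (E ` U) = funs.dim (E ` carrier R)"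
proof -
  have U: "U \<subseteq> carrier R" using ksubD(1)[OF assms] by blast
  have "{v \<in> E ` carrier R. \<forall>w\<in>E ` U. form v w = 0} = E ` {x \<in> carrier R. \<forall>y\<in>U. \<Lambda> (x \<otimes> y) = 0}"
    using form_E U by (auto simp: subset_iff)
  then show ?thesis
    using funs.perp_dim[OF form_facts ksub_subspace[OF assms]] U by (simp add: image_mono)
qed

text \<open>The functional \<open>\<Lambda> \<circ> f\<close> on the ideal is \<open>\<Lambda> (g _)\<close> for some \<open>g\<close>.  Then \<open>x g - f x\<close> is orthogonal to all \<open>y\<close>,
  because \<open>y x\<close> lies again in the ideal.\<close>

lemma riesz_ideal:
  assumes I: "ideal I R" and f: "f \<in> linear_maps R (ideal_module R I) (regular_module R)"
  shows "\<exists>g\<in>carrier R. \<forall>x\<in>I. f x = x \<otimes> g"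
proof -
  have Ic: "I \<subseteq> carrier R" using ideal.Icarr[OF I] by blast
  have f: "\<And>x. x \<in> I \<Longrightarrow> f x \<in> carrier R"
    "\<And>x y. \<lbrakk>x \<in> I; y \<in> I\<rbrakk> \<Longrightarrow> f (x \<oplus> y) = f x \<oplus> f y"
    "\<And>r x. \<lbrakk>r \<in> carrier R; x \<in> I\<rbrakk> \<Longrightarrow> f (r \<otimes> x) = r \<otimes> f x"
    using f unfolding linear_maps_ideal_iff by (simp_all add: regular_module_def Pi_iff)
  obtain gv where gv: "gv \<in> E ` carrier R" "\<And>v. v \<in> E ` I \<Longrightarrow> form gv v = \<Lambda> (f (D v))"
  proof (rule funs.riesz[OF form_facts ksub_subspace[OF ksub_ideal[OF I]], where f = "\<lambda>v. \<Lambda> (f (D v))"])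
    show "E ` I \<subseteq> E ` carrier R" using Ic by auto
    fix x assume "x \<in> E ` I"
    then obtain a where a: "a \<in> I" "x = E a" by blast
    have ac: "a \<in> carrier R" using a Ic by auto
    { fix y assume "y \<in> E ` I"
      then obtain b where b: "b \<in> I" "y = E b" by blast
      have bc: "b \<in> carrier R" using b Ic by auto
      have "x + y = E (a \<oplus> b)" using E_add a b ac bc by simp
      then show "\<Lambda> (f (D (x + y))) = \<Lambda> (f (D x)) + \<Lambda> (f (D y))"
        using D_E[OF ac] D_E[OF bc] D_E[of "a \<oplus> b"] ac bc a(2) b(2) f(2)[OF a(1) b(1)]
          \<Lambda>_add[OF f(1)[OF a(1)] f(1)[OF b(1)]] by simp }
    fix c
    have "(\<lambda>i. c * x i) = E (\<kappa> c \<otimes> a)" using E_smult a ac by simp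
    then show "\<Lambda> (f (D (\<lambda>i. c * x i))) = c * \<Lambda> (f (D x))"
      using D_E[OF ac] D_E[of "\<kappa> c \<otimes> a"] ac a(2) f(3)[OF \<kappa>_carr a(1)]
        \<Lambda>_smult[OF f(1)[OF a(1)]] \<kappa>_carr by simp
  qed ((assumption | (use that in blast))+)
  obtain g where g: "g \<in> carrier R" "gv = E g" using gv(1) by blast
  have gf: "\<Lambda> (g \<otimes> x) = \<Lambda> (f x)" if "x \<in> I" for x
  proof -
    have "x \<in> carrier R" using that Ic by auto
    then show ?thesis using gv(2)[OF imageI[OF that]] form_E[OF g(1)] D_E unfolding g(2) by simp
  qed
  have "f x = x \<otimes> g" if x: "x \<in> I" for x
  proof -
    have xc: "x \<in> carrier R" using x Ic by auto
    have "\<Lambda> ((x \<otimes> g \<ominus> f x) \<otimes> y) = 0" if y: "y \<in> carrier R" for y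
    proof -
      have yx: "y \<otimes> x \<in> I" using ideal.I_l_closed[OF I x y] .
      have c: "g \<otimes> (y \<otimes> x) \<in> carrier R" "y \<otimes> f x \<in> carrier R" "f x \<in> carrier R" using g y xc f(1)[OF x] by auto
      have "\<Lambda> (g \<otimes> (y \<otimes> x)) = \<Lambda> (y \<otimes> f x)" using gf[OF yx] f(3)[OF y x] by simp
      moreover have "(x \<otimes> g \<ominus> f x) \<otimes> y \<oplus> y \<otimes> f x = g \<otimes> (y \<otimes> x)"
        using xc g y c(3) by algebra
      then have "\<Lambda> ((x \<otimes> g \<ominus> f x) \<otimes> y) + \<Lambda> (y \<otimes> f x) = \<Lambda> (g \<otimes> (y \<otimes> x))"
        using \<Lambda>_add[of "(x \<otimes> g \<ominus> f x) \<otimes> y" "y \<otimes> f x"] xc g(1) y c by simp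
      ultimately show ?thesis by simp
    qed
    moreover have c: "f x \<in> carrier R" "x \<otimes> g \<in> carrier R" using xc g(1) f(1)[OF x] by auto
    ultimately have "x \<otimes> g \<ominus> f x = \<zero>" using nondeg[of "x \<otimes> g \<ominus> f x"] by blast
    then show ?thesis using c r_right_minus_eq by metis
  qed
  then show ?thesis using g(1) by blast
qed

lemma self_injective: "self_injective R"
  unfolding self_injective_def by (intro allI impI ballI riesz_ideal)

end

lemma (in coordinatized_ring) noetherian: "noetherian_ring R"
proof (intro noetherian_ring.intro ring_axioms noetherian_ring_axioms.intro)
  fix I assume I: "ideal I R"
  have Ic: "I \<subseteq> carrier R" using ideal.Icarr[OF I] by blast
  obtain S where S: "finite S" "funs.independent S" "S \<subseteq> E ` I" "funs.span S = E ` I"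
    using funs.subspace_finite_basis[OF ksub_subspace[OF ksub_ideal[OF I]] _ B_finite] Ic E_span
    by (metis (no_types, lifting) image_mono order_trans)
  obtain A where A: "finite A" "A \<subseteq> I" "S = E ` A" using finite_subset_image[OF S(1,3)] by blast
  have Ac: "A \<subseteq> carrier R" using A(2) Ic by simp
  have "ideal (Idl A) R" using genideal_ideal[OF Ac] .
  have "E ` A \<subseteq> E ` (Idl A)" using genideal_self[OF Ac] by blast
  then have sub: "E ` I \<subseteq> E ` (Idl A)"
    using S(4) A(3) funs.span_minimal[OF _ ksub_subspace[OF ksub_ideal[OF \<open>ideal (Idl A) R\<close>]]] by blast
  have "I \<subseteq> Idl A"
  proof
    fix x assume x: "x \<in> I"
    then have "E x \<in> E ` (Idl A)" using sub by blast
    then show "x \<in> Idl A" using ksub_image_mem[OF ksub_ideal[OF \<open>ideal (Idl A) R\<close>]] x Ic by blast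
  qed
  moreover have "Idl A \<subseteq> I" using genideal_minimal[OF I A(2)] .
  ultimately show "\<exists>A\<subseteq>carrier R. finite A \<and> I = Idl A" using A(1) Ac by blast
qed

section \<open>Symmetry, the Cayley-Bacharach condition and the Gorenstein property\<close>

locale filtered_algebra = filtered_artin R F \<rho> + coordinatized_ring R \<kappa> E B
  for R :: "('a, 'b) ring_scheme" (structure) and F \<rho> and \<kappa> :: "'l::field \<Rightarrow> 'a"
    and E :: "'a \<Rightarrow> 'i \<Rightarrow> 'l" and B +
  assumes F_0: "F 0 = range \<kappa>"
begin

lemma E_one: "E \<one> \<noteq> 0" using E_inj[of \<one>] one_neq_zero by auto

lemma E_\<kappa>: "E (\<kappa> c) = (\<lambda>i. c * E \<one> i)"
  using E_smult[of \<one> c] \<kappa>_carr[of c] by simp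

lemma \<kappa>_add: "\<kappa> c \<oplus> \<kappa> d = \<kappa> (c + d)"
  by (rule E_eq) (auto simp: \<kappa>_carr E_add E_\<kappa> fun_eq_iff algebra_simps)

lemma \<kappa>_mult: "\<kappa> c \<otimes> \<kappa> d = \<kappa> (c * d)"
proof (rule E_eq)
  show "E (\<kappa> c \<otimes> \<kappa> d) = E (\<kappa> (c * d))"
    by (subst E_smult[OF \<kappa>_carr], subst (1 2) E_\<kappa>, rule ext, rule mult.assoc[symmetric])
qed (rule m_closed[OF \<kappa>_carr \<kappa>_carr] \<kappa>_carr)+

lemma \<kappa>_one: "\<kappa> 1 = \<one>"
proof (rule E_eq)
  show "E (\<kappa> 1) = E \<one>" by (subst E_\<kappa>) simp
qed (rule \<kappa>_carr one_closed)+

lemma \<kappa>_F: "\<kappa> c \<in> F 0" using F_0 by simp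

lemma F_smult: "x \<in> F i \<Longrightarrow> \<kappa> c \<otimes> x \<in> F i" using F_mult[OF \<kappa>_F, of x i c] by simp
lemma Q_smult: "x \<in> Q i \<Longrightarrow> \<kappa> c \<otimes> x \<in> Q i" using Q_mult'[OF \<kappa>_F, of x i c] by simp

lemma ksub_F: "ksub (F i)"
  unfolding ksub_def using F_carr F_zero F_add F_smult by blast

definition cayley_bacharach :: bool where
  "cayley_bacharach \<longleftrightarrow> (\<forall>x\<in>carrier R. x \<noteq> \<zero> \<longrightarrow> (\<exists>y\<in>carrier R. x \<otimes> y \<notin> Q \<rho>))"

definition hilbert :: "nat \<Rightarrow> nat" where "hilbert i = funs.dim (E ` F i)"

text \<open>The cumulative form of \<open>h\<^sub>i = h\<^bsub>\<rho>-i\<^esub>\<close>, which is the one that counting dimensions produces.\<close>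

definition symmetric :: bool where
  "symmetric \<longleftrightarrow> (\<forall>i<\<rho>. hilbert i + hilbert (\<rho> - 1 - i) = hilbert \<rho>)"

text \<open>A linear form with kernel \<open>F\<^bsub>\<rho>-1\<^esub>\<close>; it exists if and only if that subspace has codimension one.\<close>

definition top_functional :: "('a \<Rightarrow> 'l) \<Rightarrow> bool" where
  "top_functional \<tau> \<longleftrightarrow>
     (\<forall>x\<in>carrier R. \<forall>y\<in>carrier R. \<tau> (x \<oplus> y) = \<tau> x + \<tau> y) \<and>
     (\<forall>c. \<forall>x\<in>carrier R. \<tau> (\<kappa> c \<otimes> x) = c * \<tau> x) \<and>
     (\<forall>x\<in>carrier R. \<tau> x = 0 \<longleftrightarrow> x \<in> Q \<rho>)"

lemma top_functionalD:
  assumes "top_functional \<tau>"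
  shows "\<lbrakk>x \<in> carrier R; y \<in> carrier R\<rbrakk> \<Longrightarrow> \<tau> (x \<oplus> y) = \<tau> x + \<tau> y"
    "x \<in> carrier R \<Longrightarrow> \<tau> (\<kappa> c \<otimes> x) = c * \<tau> x"
    "x \<in> carrier R \<Longrightarrow> \<tau> x = 0 \<longleftrightarrow> x \<in> Q \<rho>"
  using assms unfolding top_functional_def by auto

lemma top_element: obtains s where "s \<in> carrier R" "s \<notin> Q \<rho>"
proof -
  have "Q \<rho> \<subseteq> carrier R" using Q_carr by blast
  then show thesis using Q_top that by blast
qed

lemma Q_cancel:
  assumes "s \<in> carrier R" "s \<notin> Q \<rho>" "\<kappa> c \<otimes> s \<in> Q \<rho>" shows "c = 0"
proof (rule ccontr)
  assume c: "c \<noteq> 0"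
  have "\<kappa> (1 / c) \<otimes> (\<kappa> c \<otimes> s) \<in> Q \<rho>" using Q_smult assms(3) by blast
  moreover have "\<kappa> (1 / c) \<otimes> (\<kappa> c \<otimes> s) = (\<kappa> (1 / c) \<otimes> \<kappa> c) \<otimes> s"
    using \<kappa>_carr assms(1) by (simp add: m_assoc)
  ultimately show False using assms(1,2) c \<kappa>_mult \<kappa>_one by simp
qed

lemma top_functional_exists:
  assumes top: "\<And>s t. \<lbrakk>s \<in> carrier R; s \<notin> Q \<rho>; t \<in> carrier R\<rbrakk> \<Longrightarrow> \<exists>c. t \<ominus> \<kappa> c \<otimes> s \<in> Q \<rho>"
  obtains \<tau> where "top_functional \<tau>"
proof -
  obtain s where s: "s \<in> carrier R" "s \<notin> Q \<rho>" by (rule top_element)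
  define l where "l t = (SOME c. t \<ominus> \<kappa> c \<otimes> s \<in> Q \<rho>)" for t
  have l: "t \<ominus> \<kappa> (l t) \<otimes> s \<in> Q \<rho>" if "t \<in> carrier R" for t
    unfolding l_def using someI_ex[OF top[OF s that]] .
  have uniq: "l t = c" if t: "t \<in> carrier R" and c: "t \<ominus> \<kappa> c \<otimes> s \<in> Q \<rho>" for t c
  proof -
    have m: "\<kappa> (- 1) \<otimes> (t \<ominus> \<kappa> (l t) \<otimes> s) \<in> Q \<rho>" using Q_smult l[OF t] by blast
    have e: "\<kappa> (l t - c) = \<kappa> (l t) \<oplus> \<kappa> (- 1) \<otimes> \<kappa> c" by (simp add: \<kappa>_mult \<kappa>_add)
    have mo: "\<kappa> (- 1) = \<ominus> \<one>"
    proof -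
      have "\<kappa> (- 1) \<oplus> \<one> = \<kappa> 0" using \<kappa>_add[of "- 1" 1] \<kappa>_one by simp
      also have "\<kappa> 0 = \<zero>" using \<kappa>_add[of 0 0] \<kappa>_carr[of 0] by simp
      finally show ?thesis using \<kappa>_carr minus_equality[of "\<kappa> (- 1)" \<one>] by simp
    qed
    have "\<kappa> (l t - c) \<otimes> s = (t \<ominus> \<kappa> c \<otimes> s) \<oplus> \<kappa> (- 1) \<otimes> (t \<ominus> \<kappa> (l t) \<otimes> s)"
      unfolding e mo using \<kappa>_carr[of "l t"] \<kappa>_carr[of c] t s(1) by algebra
    then have "\<kappa> (l t - c) \<otimes> s \<in> Q \<rho>" using m c Q_add by simp
    then show ?thesis using Q_cancel[OF s] by force
  qed
  have "top_functional l"
    unfolding top_functional_def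
  proof (intro conjI ballI allI)
    fix x assume x: "x \<in> carrier R"
    { fix y assume y: "y \<in> carrier R"
      have "(x \<oplus> y) \<ominus> (\<kappa> (l x) \<oplus> \<kappa> (l y)) \<otimes> s = (x \<ominus> \<kappa> (l x) \<otimes> s) \<oplus> (y \<ominus> \<kappa> (l y) \<otimes> s)"
        using x y s(1) \<kappa>_carr[of "l x"] \<kappa>_carr[of "l y"] by algebra
      then have "(x \<oplus> y) \<ominus> \<kappa> (l x + l y) \<otimes> s \<in> Q \<rho>" using Q_add l[OF x] l[OF y] \<kappa>_add by simp
      then show "l (x \<oplus> y) = l x + l y" using uniq x y by simp }
    { fix c
      have "\<kappa> c \<otimes> x \<ominus> (\<kappa> c \<otimes> \<kappa> (l x)) \<otimes> s = \<kappa> c \<otimes> (x \<ominus> \<kappa> (l x) \<otimes> s)"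
        using x s(1) \<kappa>_carr[of "l x"] \<kappa>_carr[of c] by algebra
      then have "\<kappa> c \<otimes> x \<ominus> \<kappa> (c * l x) \<otimes> s \<in> Q \<rho>" using Q_smult[OF l[OF x]] \<kappa>_mult by simp
      then show "l (\<kappa> c \<otimes> x) = c * l x" using uniq x \<kappa>_carr by simp }
    have z: "\<kappa> 0 = \<zero>" using \<kappa>_add[of 0 0] \<kappa>_carr[of 0] by simp
    show "l x = 0 \<longleftrightarrow> x \<in> Q \<rho>"
    proof
      assume "l x = 0" then show "x \<in> Q \<rho>" using l[OF x] z x s(1) by (simp add: minus_eq)
    next
      assume "x \<in> Q \<rho>"
      then have "x \<ominus> \<kappa> 0 \<otimes> s \<in> Q \<rho>" using z x s(1) by (simp add: minus_eq)
      then show "l x = 0" using uniq[OF x] by blast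
    qed
  qed
  then show thesis by (rule that)
qed

lemma paired:
  assumes l: "top_functional \<tau>" and cb: cayley_bacharach
  shows "paired_ring R \<kappa> E B \<tau>"
proof
  fix x assume x: "x \<in> carrier R" "x \<noteq> \<zero>"
  then obtain y where y: "y \<in> carrier R" "x \<otimes> y \<notin> Q \<rho>" using cb cayley_bacharach_def by blast
  then show "\<exists>y\<in>carrier R. \<tau> (x \<otimes> y) \<noteq> 0"
    using top_functionalD(3)[OF l, of "x \<otimes> y"] x(1) by (intro bexI[of _ y]) auto
qed (use top_functionalD(1,2)[OF l] in auto)

abbreviation perp :: "('a \<Rightarrow> 'l) \<Rightarrow> 'a set \<Rightarrow> 'a set" where
  "perp \<tau> U \<equiv> {x \<in> carrier R. \<forall>y\<in>U. \<tau> (x \<otimes> y) = 0}"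

text \<open>The product of the two subspaces lies in \<open>F\<^bsub>\<rho>-1\<^esub>\<close>.\<close>

lemma F_le_perp:
  assumes l: "top_functional \<tau>" and i: "i < \<rho>"
  shows "F i \<subseteq> perp \<tau> (F (\<rho> - 1 - i))"
proof
  fix x assume x: "x \<in> F i"
  have "\<tau> (x \<otimes> y) = 0" if y: "y \<in> F (\<rho> - 1 - i)" for y
  proof -
    have "x \<otimes> y \<in> F (i + (\<rho> - 1 - i))" using F_mult x y by blast
    moreover have "i + (\<rho> - 1 - i) = \<rho> - 1" using i by simp
    moreover have "Q \<rho> = F (\<rho> - 1)" using Q_Suc[of "\<rho> - 1"] i by simp
    ultimately have "x \<otimes> y \<in> Q \<rho>" by simp
    then show ?thesis using top_functionalD(3)[OF l] Q_carr by blast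
  qed
  then show "x \<in> perp \<tau> (F (\<rho> - 1 - i))" using x F_carr by simp
qed

lemma ksub_perp:
  assumes l: "top_functional \<tau>" and U: "U \<subseteq> carrier R"
  shows "ksub (perp \<tau> U)"
proof -
  note L = top_functionalD[OF l]
  have "\<tau> \<zero> = 0" using L(3)[of \<zero>] Q_zero by simp
  then show ?thesis unfolding ksub_def using U L(1,2) \<kappa>_carr
    by (auto simp: subset_iff l_distr m_assoc)
qed

text \<open>Non-degeneracy of the pairings of the homogeneous components of complementary degrees.\<close>

definition graded_nondegenerate :: bool where
  "graded_nondegenerate \<longleftrightarrow> (\<forall>i f. f \<in> F i \<longrightarrow> f \<notin> Q i \<longrightarrow> (\<exists>g\<in>F (\<rho> - i). f \<otimes> g \<notin> Q \<rho>))"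

lemma first_degree:
  assumes "x \<in> carrier R" "x \<noteq> \<zero>" obtains i where "x \<in> F i" "x \<notin> Q i"
proof -
  define i where "i = (LEAST i. x \<in> F i)"
  have i: "x \<in> F i" unfolding i_def by (rule LeastI[of _ \<rho>]) (use assms F_top in simp)
  have "x \<notin> Q i"
  proof (cases i)
    case 0 then show ?thesis using assms(2) Q_0 by simp
  next
    case (Suc k)
    then have "x \<notin> F k" using not_less_Least[of k "\<lambda>i. x \<in> F i"] i_def by simp
    then show ?thesis using Suc Q_Suc by simp
  qed
  then show thesis using that i by blast
qed

lemma nondegenerate_imp_cb:
  assumes graded_nondegenerate shows cayley_bacharach
  unfolding cayley_bacharach_def
proof (intro ballI impI)
  fix x assume "x \<in> carrier R" "x \<noteq> \<zero>"
  then obtain i where "x \<in> F i" "x \<notin> Q i" using first_degree by blast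
  then obtain g where "g \<in> F (\<rho> - i)" "x \<otimes> g \<notin> Q \<rho>" using assms graded_nondegenerate_def by blast
  then show "\<exists>y\<in>carrier R. x \<otimes> y \<notin> Q \<rho>" using F_carr by blast
qed

text \<open>Non-degeneracy makes \<open>F i\<close> the full orthogonal space of \<open>F (\<rho> - 1 - i)\<close>; the dimensions of a
  subspace and of its orthogonal space add up.\<close>

lemma nondegenerate_imp_symmetric:
  assumes nd: graded_nondegenerate and l: "top_functional \<tau>"
  shows symmetric
  unfolding symmetric_def
proof (intro allI impI)
  fix i assume i: "i < \<rho>"
  interpret P: paired_ring R \<kappa> E B \<tau> by (rule paired[OF l nondegenerate_imp_cb[OF nd]])
  have "perp \<tau> (F (\<rho> - 1 - i)) \<subseteq> F i"
  proof
    fix x assume x: "x \<in> perp \<tau> (F (\<rho> - 1 - i))"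
    show "x \<in> F i"
    proof (rule ccontr)
      assume n: "x \<notin> F i"
      then have "x \<noteq> \<zero>" using F_zero by auto
      then obtain k where k: "x \<in> F k" "x \<notin> Q k" using first_degree x by blast
      then have "i < k" using n F_mono'[of k i] by (meson in_mono not_le)
      obtain g where g: "g \<in> F (\<rho> - k)" "x \<otimes> g \<notin> Q \<rho>" using nd k graded_nondegenerate_def by blast
      have "\<rho> - k \<le> \<rho> - 1 - i" using \<open>i < k\<close> i by simp
      then have "g \<in> F (\<rho> - 1 - i)" using F_mono' g(1) by blast
      then have "\<tau> (x \<otimes> g) = 0" using x by blast
      then show False using g(2) top_functionalD(3)[OF l, of "x \<otimes> g"] x F_carr[OF g(1)] by simp
    qed
  qed
  then have "perp \<tau> (F (\<rho> - 1 - i)) = F i" using F_le_perp[OF l i] by blast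
  then show "hilbert i + hilbert (\<rho> - 1 - i) = hilbert \<rho>"
    using P.perp_dim[OF ksub_F[of "\<rho> - 1 - i"]] F_top by (simp add: hilbert_def)
qed

text \<open>Symmetry of the dimensions turns the inclusion of \<open>F (i - 1)\<close> in the orthogonal space of \<open>F (\<rho> - i)\<close>
  into an equality, so that \<open>f\<close> outside of \<open>F (i - 1)\<close> is not orthogonal to \<open>F (\<rho> - i)\<close>.\<close>

lemma cb_symmetric_imp_nondegenerate:
  assumes cb: cayley_bacharach and sym: symmetric and l: "top_functional \<tau>"
  shows graded_nondegenerate
  unfolding graded_nondegenerate_def
proof (intro allI impI)
  interpret P: paired_ring R \<kappa> E B \<tau> by (rule paired[OF l cb])
  fix i f assume f: "f \<in> F i" "f \<notin> Q i"
  have fc: "f \<in> carrier R" using F_carr f by blast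
  have i: "i \<le> \<rho>" using degree_bound f by blast
  show "\<exists>g\<in>F (\<rho> - i). f \<otimes> g \<notin> Q \<rho>"
  proof (cases i)
    case 0
    then have "f \<noteq> \<zero>" using f(2) Q_0 by auto
    then show ?thesis using cb fc F_top 0 unfolding cayley_bacharach_def by simp
  next
    case (Suc k)
    then have k: "k < \<rho>" "\<rho> - 1 - k = \<rho> - i" using i by auto
    let ?P = "perp \<tau> (F (\<rho> - i))"
    have Fc: "F (\<rho> - i) \<subseteq> carrier R" using F_carr by blast
    have "funs.dim (E ` ?P) + hilbert (\<rho> - i) = hilbert \<rho>"
      using P.perp_dim[OF ksub_F] F_top by (simp add: hilbert_def)
    moreover have "hilbert k + hilbert (\<rho> - i) = hilbert \<rho>" using sym k unfolding symmetric_def by metis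
    ultimately have "funs.dim (E ` F k) = funs.dim (E ` ?P)" by (simp add: hilbert_def)
    moreover have "F k \<subseteq> ?P" using F_le_perp[OF l k(1)] k(2) by simp
    moreover have "E ` ?P \<subseteq> funs.span B" using E_span by blast
    ultimately have "E ` F k = E ` ?P"
      using funs.subspace_eq_of_dim[OF ksub_subspace[OF ksub_F] ksub_subspace[OF ksub_perp[OF l Fc]] _ _ B_finite]
      by (simp add: image_mono)
    moreover have "f \<notin> F k" using f(2) Suc Q_Suc by simp
    then have "E f \<notin> E ` F k" using ksub_image_mem[OF ksub_F fc] by blast
    ultimately have "f \<notin> ?P" by blast
    then obtain g where g: "g \<in> F (\<rho> - i)" "\<tau> (f \<otimes> g) \<noteq> 0" using fc by blast
    then have "f \<otimes> g \<notin> Q \<rho>" using top_functionalD(3)[OF l, of "f \<otimes> g"] fc F_carr[OF g(1)] by simp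
    then show ?thesis using g(1) by blast
  qed
qed

text \<open>Symmetry at \<open>i = 0\<close> says that \<open>F (\<rho> - 1)\<close> has codimension \<open>dim F 0 = 1\<close>.\<close>

lemma symmetric_imp_top_functional:
  assumes sym: symmetric obtains \<tau> where "top_functional \<tau>"
proof (rule top_functional_exists)
  fix s t assume st: "s \<in> carrier R" "s \<notin> Q \<rho>" "t \<in> carrier R"
  show "\<exists>c. t \<ominus> \<kappa> c \<otimes> s \<in> Q \<rho>"
  proof (cases \<rho>)
    case 0
    then have sF: "s \<in> F 0" "t \<in> F 0" "s \<noteq> \<zero>" using st F_top Q_zero by auto
    then obtain y where y: "y \<in> F 0" "s \<otimes> y = \<one>" using F_field by blast
    have yc: "y \<in> carrier R" using y F_carr by blast
    have "t \<otimes> y \<in> F 0" using F_mult[OF sF(2) y(1)] by simp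
    then obtain c where c: "t \<otimes> y = \<kappa> c" using F_0 by auto
    have "\<kappa> c \<otimes> s = t \<otimes> (s \<otimes> y)" unfolding c[symmetric] using st yc by (simp add: m_ac)
    then have "t \<ominus> \<kappa> c \<otimes> s = \<zero>" using y(2) st by (simp add: minus_eq r_neg)
    then show ?thesis using Q_zero by metis
  next
    case (Suc k)
    have QF: "Q \<rho> = F k" using Q_Suc Suc by simp
    have one: "hilbert 0 = 1"
    proof -
      have "E ` F 0 = range (\<lambda>c i. c * E \<one> i)" unfolding F_0 image_image E_\<kappa> by simp
      also have "\<dots> = funs.span {E \<one>}" by (simp add: funs.span_singleton)
      finally have "hilbert 0 = funs.dim (funs.span {E \<one>})" by (simp add: hilbert_def)
      also have "\<dots> = card {E \<one>}"
        by (rule funs.dim_span_eq_card_independent) (simp add: E_one)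
      finally show ?thesis by simp
    qed
    have "hilbert 0 + hilbert (\<rho> - 1 - 0) = hilbert \<rho>" using sym Suc unfolding symmetric_def by blast
    then have dim: "hilbert k + 1 = hilbert \<rho>" using one Suc by simp
    have Eb: "E ` F k \<subseteq> funs.span B" using E_span F_carr by blast
    obtain S where S: "finite S" "funs.independent S" "S \<subseteq> E ` F k" "funs.span S = E ` F k" "card S = hilbert k"
      using funs.subspace_finite_basis[OF ksub_subspace[OF ksub_F] Eb B_finite] unfolding hilbert_def by blast
    have n: "E s \<notin> funs.span S" using S(4) ksub_image_mem[OF ksub_F st(1)] st(2) QF by simp
    have ind: "funs.independent (insert (E s) S)" using funs.independent_insertI[OF n S(2)] .
    have cS: "card (insert (E s) S) = hilbert \<rho>"
      using S(1,5) n dim funs.span_base by (metis card_insert_disjoint Suc_eq_plus1)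
    have sub: "insert (E s) S \<subseteq> E ` carrier R" using st(1) S(3) F_carr by blast
    have subC: "funs.subspace (E ` carrier R)" by (rule ksub_subspace[OF ksub_carrier])
    have "funs.span (insert (E s) S) = E ` carrier R"
    proof (rule funs.subspace_eq_of_dim[OF funs.subspace_span subC _ E_span B_finite])
      show "funs.span (insert (E s) S) \<subseteq> E ` carrier R" by (rule funs.span_minimal[OF sub subC])
      show "funs.dim (funs.span (insert (E s) S)) = funs.dim (E ` carrier R)"
        using funs.dim_span_eq_card_independent[OF ind] cS F_top by (simp add: hilbert_def)
    qed
    then have "E t \<in> funs.span (insert (E s) S)" using st(3) by simp
    then obtain c where "E t - (\<lambda>i. c * E s i) \<in> funs.span S" using funs.span_breakdown_eq by blast
    then have "E (t \<ominus> \<kappa> c \<otimes> s) \<in> E ` F k"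
      using S(4) E_minus[of t "\<kappa> c \<otimes> s"] E_smult st \<kappa>_carr by simp
    then have "t \<ominus> \<kappa> c \<otimes> s \<in> F k" using ksub_image_mem[OF ksub_F] st \<kappa>_carr by simp
    then show ?thesis using QF by auto
  qed
qed (rule that)

context
  fixes \<tau> :: "'a \<Rightarrow> 'l"
  assumes tf: "top_functional \<tau>" and nd: graded_nondegenerate
begin

text \<open>The top functional read off the component of degree \<open>\<rho>\<close>; it depends only on the class.\<close>

definition \<Lambda>G :: "(nat \<Rightarrow> 'a set) \<Rightarrow> 'l" where
  "\<Lambda>G u = (THE c. \<exists>r. (\<forall>i. r i \<in> F i) \<and> u = cls r \<and> c = \<tau> (r \<rho>))"

lemma \<Lambda>G: assumes r: "\<And>i. r i \<in> F i" shows "\<Lambda>G (cls r) = \<tau> (r \<rho>)"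
  unfolding \<Lambda>G_def
proof (rule the_equality)
  show "\<exists>r'. (\<forall>i. r' i \<in> F i) \<and> cls r = cls r' \<and> \<tau> (r \<rho>) = \<tau> (r' \<rho>)" using r by blast
  fix c assume "\<exists>r'. (\<forall>i. r' i \<in> F i) \<and> cls r = cls r' \<and> c = \<tau> (r' \<rho>)"
  then obtain r' where r': "\<And>i. r' i \<in> F i" "cls r = cls r'" "c = \<tau> (r' \<rho>)" by blast
  then have q: "r \<rho> \<ominus> r' \<rho> \<in> Q \<rho>" using cls_eq_iff[OF r r'(1)] by blast
  have c: "r \<rho> \<in> carrier R" "r' \<rho> \<in> carrier R" using F_carr r r'(1) by blast+
  have "\<tau> ((r \<rho> \<ominus> r' \<rho>) \<oplus> r' \<rho>) = \<tau> (r \<rho> \<ominus> r' \<rho>) + \<tau> (r' \<rho>)"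
    using top_functionalD(1)[OF tf] c by simp
  moreover have "(r \<rho> \<ominus> r' \<rho>) \<oplus> r' \<rho> = r \<rho>" using c by (simp add: minus_eq a_assoc l_neg)
  moreover have "\<tau> (r \<rho> \<ominus> r' \<rho>) = 0" using top_functionalD(3)[OF tf] q c by simp
  ultimately show "c = \<tau> (r \<rho>)" using r'(3) by simp
qed

lemma \<Lambda>G_hm:
  assumes r: "\<And>i. r i \<in> F i" and f: "f \<in> F i" and i: "i \<le> \<rho>"
  shows "\<Lambda>G (cls r \<otimes>\<^bsub>gr\<^esub> cls (hm i f)) = \<tau> (r (\<rho> - i) \<otimes> f)"
proof -
  have h: "hm i f j \<in> F j" for j using hm_F f .
  show ?thesis
    unfolding cls_mult[OF r h] using \<Lambda>G[OF conv_F[OF r h]] conv_hm[OF r f, of \<rho>] i by simp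
qed

lemma gr_smult:
  assumes r: "\<And>i. r i \<in> F i"
  shows "cls (hm 0 (\<kappa> c)) \<otimes>\<^bsub>gr\<^esub> cls r = cls (\<lambda>i. \<kappa> c \<otimes> r i)"
proof -
  interpret G: cring gr by (rule gr_cring)
  have h: "hm 0 (\<kappa> c) j \<in> F j" for j using hm_F \<kappa>_F .
  have "cls (hm 0 (\<kappa> c)) \<otimes>\<^bsub>gr\<^esub> cls r = cls r \<otimes>\<^bsub>gr\<^esub> cls (hm 0 (\<kappa> c))"
    using G.m_comm cls_carrier r h by simp
  also have "\<dots> = cls (conv r (hm 0 (\<kappa> c)))" by (rule cls_mult[OF r h])
  also have "conv r (hm 0 (\<kappa> c)) = (\<lambda>i. \<kappa> c \<otimes> r i)"
    by (rule ext) (simp add: conv_hm[OF r \<kappa>_F] m_comm[OF F_carr[OF r] \<kappa>_carr])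
  finally show ?thesis .
qed

definition spanning :: "nat \<Rightarrow> 'a set" where
  "spanning j = (SOME A. finite A \<and> A \<subseteq> F j \<and> E ` F j \<subseteq> funs.span (E ` A))"

lemma spanning: "finite (spanning j)" "spanning j \<subseteq> F j" "E ` F j \<subseteq> funs.span (E ` spanning j)"
proof -
  have Eb: "E ` F j \<subseteq> funs.span B" using E_span F_carr by blast
  obtain S where S: "finite S" "S \<subseteq> E ` F j" "funs.span S = E ` F j"
    by (rule funs.subspace_finite_basis[OF ksub_subspace[OF ksub_F] Eb B_finite]) (rule that)
  obtain A where A: "finite A" "A \<subseteq> F j" "S = E ` A" using finite_subset_image[OF S(1,2)] by blast
  then have "\<exists>A. finite A \<and> A \<subseteq> F j \<and> E ` F j \<subseteq> funs.span (E ` A)" using S(3) by auto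
  from someI_ex[OF this]
  show "finite (spanning j)" "spanning j \<subseteq> F j" "E ` F j \<subseteq> funs.span (E ` spanning j)"
    unfolding spanning_def by auto
qed

lemma test_spanning:
  assumes f: "f \<in> F i" "f \<notin> Q i"
  shows "\<exists>b\<in>spanning (\<rho> - i). \<tau> (f \<otimes> b) \<noteq> 0"
proof (rule ccontr)
  assume "\<not> (\<exists>b\<in>spanning (\<rho> - i). \<tau> (f \<otimes> b) \<noteq> 0)"
  then have z: "\<tau> (f \<otimes> b) = 0" if "b \<in> spanning (\<rho> - i)" for b using that by blast
  have fc: "f \<in> carrier R" using F_carr f by blast
  let ?P = "perp \<tau> {f}"
  have P: "ksub ?P" by (rule ksub_perp[OF tf]) (use fc in simp)
  have "spanning (\<rho> - i) \<subseteq> ?P"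
  proof
    fix b assume b: "b \<in> spanning (\<rho> - i)"
    then have bc: "b \<in> carrier R" using spanning(2) F_carr by blast
    then show "b \<in> ?P" using z[OF b] m_comm[OF bc fc] by simp
  qed
  then have "funs.span (E ` spanning (\<rho> - i)) \<subseteq> E ` ?P"
    by (intro funs.span_minimal ksub_subspace[OF P] image_mono)
  then have sub: "E ` F (\<rho> - i) \<subseteq> E ` ?P" using spanning(3) by blast
  obtain g where g: "g \<in> F (\<rho> - i)" "f \<otimes> g \<notin> Q \<rho>" using nd f graded_nondegenerate_def by blast
  have gc: "g \<in> carrier R" using g F_carr by blast
  have "E g \<in> E ` ?P" using sub g(1) by blast
  then have "g \<in> ?P" using ksub_image_mem[OF P gc] by blast
  then have "\<tau> (f \<otimes> g) = 0" using fc gc by (simp add: m_comm)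
  then show False using g(2) top_functionalD(3)[OF tf, of "f \<otimes> g"] fc gc by simp
qed

text \<open>Finitely many homogeneous elements that detect every non-zero element through \<open>\<Lambda>G\<close>; the values
  on their multiples are used as coordinates, which spares choosing bases of the graded pieces.\<close>

definition tests :: "(nat \<Rightarrow> 'a set) set" where
  "tests = (\<Union>j\<in>{..\<rho>}. (\<lambda>b. cls (hm j b)) ` spanning j)"

definition EG :: "(nat \<Rightarrow> 'a set) \<Rightarrow> (nat \<Rightarrow> 'a set) \<Rightarrow> 'l" where
  "EG u = (\<lambda>x. if x \<in> tests then \<Lambda>G (u \<otimes>\<^bsub>gr\<^esub> x) else 0)"

lemma gr_test:
  assumes u: "u \<in> carrier gr" "u \<noteq> \<zero>\<^bsub>gr\<^esub>"
  obtains x where "x \<in> tests" "x \<in> carrier gr" "\<Lambda>G (u \<otimes>\<^bsub>gr\<^esub> x) \<noteq> 0"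
proof -
  obtain r where r: "\<And>i. r i \<in> F i" "u = cls r" using gr_rep u(1) by blast
  have "\<exists>i. r i \<notin> Q i"
  proof (rule ccontr)
    assume "\<nexists>i. r i \<notin> Q i"
    then have "\<forall>i. r i \<ominus> \<zero> \<in> Q i" using F_carr[OF r(1)] by (simp add: minus_eq)
    then show False using cls_eq_iff[OF r(1), of "\<lambda>_. \<zero>"] F_zero u(2) r(2) gr_zero by simp
  qed
  then obtain i where i: "r i \<notin> Q i" by blast
  have le: "i \<le> \<rho>" using degree_bound r(1) i by blast
  obtain b where b: "b \<in> spanning (\<rho> - i)" "\<tau> (r i \<otimes> b) \<noteq> 0" using test_spanning[OF r(1) i] by blast
  have bF: "b \<in> F (\<rho> - i)" using b spanning(2) by blast
  have "\<Lambda>G (u \<otimes>\<^bsub>gr\<^esub> cls (hm (\<rho> - i) b)) = \<tau> (r i \<otimes> b)"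
    using \<Lambda>G_hm[OF r(1) bF] r(2) le by simp
  moreover have "cls (hm (\<rho> - i) b) \<in> tests" unfolding tests_def using b(1) by auto
  moreover have "cls (hm (\<rho> - i) b) \<in> carrier gr" using cls_carrier hm_F[OF bF] by blast
  ultimately show thesis using that b(2) by simp
qed

lemma \<Lambda>G_add:
  assumes "u \<in> carrier gr" "v \<in> carrier gr" shows "\<Lambda>G (u \<oplus>\<^bsub>gr\<^esub> v) = \<Lambda>G u + \<Lambda>G v"
proof -
  obtain r s where r: "\<And>i. r i \<in> F i" "u = cls r" and s: "\<And>i. s i \<in> F i" "v = cls s"
    using gr_rep assms by metis
  have "\<Lambda>G (cls (\<lambda>i. r i \<oplus> s i)) = \<tau> (r \<rho> \<oplus> s \<rho>)" using \<Lambda>G[of "\<lambda>i. r i \<oplus> s i"] F_add r(1) s(1) by simp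
  then show ?thesis unfolding r(2) s(2) cls_add[OF r(1) s(1)]
    using \<Lambda>G[OF r(1)] \<Lambda>G[OF s(1)] top_functionalD(1)[OF tf] F_carr[OF r(1)] F_carr[OF s(1)] by simp
qed

lemma \<Lambda>G_smult:
  assumes "u \<in> carrier gr" shows "\<Lambda>G (cls (hm 0 (\<kappa> c)) \<otimes>\<^bsub>gr\<^esub> u) = c * \<Lambda>G u"
proof -
  obtain r where r: "\<And>i. r i \<in> F i" "u = cls r" using gr_rep assms by blast
  show ?thesis unfolding r(2) gr_smult[OF r(1)]
    using \<Lambda>G[OF r(1)] \<Lambda>G[of "\<lambda>i. \<kappa> c \<otimes> r i"] F_smult r(1) top_functionalD(2)[OF tf] F_carr[OF r(1)] by simp
qed

lemma gr_paired: "paired_ring gr (\<lambda>c. cls (hm 0 (\<kappa> c))) EG ((\<lambda>j i. if i = j then 1 else 0) ` tests) \<Lambda>G"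
proof (intro paired_ring.intro coordinatized_ring.intro paired_ring_axioms.intro
    coordinatized_ring_axioms.intro gr_cring)
  interpret G: cring gr by (rule gr_cring)
  have kc: "cls (hm 0 (\<kappa> c)) \<in> carrier gr" for c using cls_carrier hm_F[OF \<kappa>_F] by blast
  have tc: "x \<in> carrier gr" if xt: "x \<in> tests" for x
  proof -
    obtain j b where "b \<in> spanning j" "x = cls (hm j b)" using xt by (auto simp: tests_def)
    then show ?thesis using cls_carrier hm_F spanning(2) by blast
  qed
  have fin: "finite tests" unfolding tests_def using spanning(1) by auto
  show "cls (hm 0 (\<kappa> c)) \<in> carrier gr" for c by (rule kc)
  show "EG (x \<oplus>\<^bsub>gr\<^esub> y) = EG x + EG y" if "x \<in> carrier gr" "y \<in> carrier gr" for x y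
    using that tc \<Lambda>G_add by (auto simp: EG_def fun_eq_iff G.l_distr)
  show "EG (cls (hm 0 (\<kappa> c)) \<otimes>\<^bsub>gr\<^esub> x) = (\<lambda>i. c * EG x i)" if "x \<in> carrier gr" for c x
    using that tc kc \<Lambda>G_smult by (auto simp: EG_def fun_eq_iff G.m_assoc)
  show "x = \<zero>\<^bsub>gr\<^esub>" if x: "x \<in> carrier gr" "EG x = 0" for x
  proof (rule ccontr)
    assume "x \<noteq> \<zero>\<^bsub>gr\<^esub>"
    then obtain y where "y \<in> tests" "\<Lambda>G (x \<otimes>\<^bsub>gr\<^esub> y) \<noteq> 0" using gr_test x(1) by blast
    then have "EG x y \<noteq> 0" by (simp add: EG_def)
    then show False using x(2) by simp
  qed
  show "EG ` carrier gr \<subseteq> funs.span ((\<lambda>j i. if i = j then 1 else 0) ` tests)"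
    by (rule image_subsetI, rule funs_finite_support_span[OF fin]) (simp add: EG_def)
  show "finite ((\<lambda>j i. if i = j then (1::'l) else 0) ` tests)" using fin by simp
  show "\<Lambda>G (x \<oplus>\<^bsub>gr\<^esub> y) = \<Lambda>G x + \<Lambda>G y" if "x \<in> carrier gr" "y \<in> carrier gr" for x y
    using \<Lambda>G_add that by blast
  show "\<Lambda>G (cls (hm 0 (\<kappa> c)) \<otimes>\<^bsub>gr\<^esub> x) = c * \<Lambda>G x" if "x \<in> carrier gr" for c x
    using \<Lambda>G_smult that by blast
  show "\<exists>y\<in>carrier gr. \<Lambda>G (x \<otimes>\<^bsub>gr\<^esub> y) \<noteq> 0" if "x \<in> carrier gr" "x \<noteq> \<zero>\<^bsub>gr\<^esub>" for x
    using gr_test[OF that] by blast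
qed

lemma nondegenerate_imp_gorenstein: "gorenstein_ring gr"
proof -
  interpret G: paired_ring gr "\<lambda>c. cls (hm 0 (\<kappa> c))" EG "(\<lambda>j i. if i = j then 1 else 0) ` tests" \<Lambda>G
    by (rule gr_paired)
  show ?thesis using gr_gorenstein_iff[OF G.noetherian] G.self_injective by simp
qed

end

text \<open>For a Gorenstein graded ring the socle provides the top functional; in the other direction it comes
  from symmetry.  In between stands the non-degeneracy of the graded pairings.\<close>

theorem gorenstein_iff: "gorenstein_ring gr \<longleftrightarrow> cayley_bacharach \<and> symmetric"
proof
  assume g: "gorenstein_ring gr"
  have nd: graded_nondegenerate
    unfolding graded_nondegenerate_def using gorenstein_nondegenerate[OF g] by blast
  obtain \<tau> where l: "top_functional \<tau>"
  proof (rule top_functional_exists)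
    fix s t assume "s \<in> carrier R" "s \<notin> Q \<rho>" "t \<in> carrier R"
    then obtain c where "c \<in> F 0" "t \<ominus> c \<otimes> s \<in> Q \<rho>" by (rule gorenstein_top_rank[OF g])
    then show "\<exists>c. t \<ominus> \<kappa> c \<otimes> s \<in> Q \<rho>" unfolding F_0 by blast
  qed (rule that)
  show "cayley_bacharach \<and> symmetric"
    using nondegenerate_imp_cb[OF nd] nondegenerate_imp_symmetric[OF nd l] by simp
next
  assume cs: "cayley_bacharach \<and> symmetric"
  then obtain \<tau> where l: "top_functional \<tau>" using symmetric_imp_top_functional by blast
  show "gorenstein_ring gr"
    using nondegenerate_imp_gorenstein[OF l] cb_symmetric_imp_nondegenerate[OF _ _ l] cs by blast
qed

end

section \<open>Polynomials and their evaluation\<close>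

lemma sum_keys_superset:
  assumes "finite A" "keys p \<subseteq> A" "\<And>m. g m 0 = 0"
  shows "(\<Sum>m\<in>keys p. g m (lookup p m)) = (\<Sum>m\<in>A. g m (lookup p m))"
  using assms by (intro sum.mono_neutral_left) (auto simp: in_keys_iff)

lemma sum_keys_add:
  fixes g :: "'m \<Rightarrow> 'a::comm_monoid_add \<Rightarrow> 'b::comm_monoid_add"
  assumes "\<And>m. g m 0 = 0" "\<And>m a b. g m (a + b) = g m a + g m b"
  shows "(\<Sum>m\<in>keys (p + q). g m (lookup (p + q) m)) =
    (\<Sum>m\<in>keys p. g m (lookup p m)) +
    (\<Sum>m\<in>keys q. g m (lookup q m))"
proof -
  let ?A = "keys p \<union> keys q"
  have f: "finite ?A" by simp
  have k: "keys (p + q) \<subseteq> ?A" by (rule keys_add)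
  show ?thesis
    unfolding sum_keys_superset[where p = "p + q" and g = g, OF f k assms(1)]
      sum_keys_superset[where p = "p" and g = g, OF f Un_upper1 assms(1)]
      sum_keys_superset[where p = "q" and g = g, OF f Un_upper2 assms(1)]
    by (simp add: lookup_add assms(2) sum.distrib)
qed

lemma poly_mapping_sum_single:
  fixes p :: "'m \<Rightarrow>\<^sub>0 'a::comm_monoid_add"
  shows "(\<Sum>m\<in>keys p. single m (lookup p m)) = p"
proof (rule poly_mapping_eqI)
  fix k
  have "lookup (\<Sum>m\<in>keys p. single m (lookup p m)) k
      = (\<Sum>m\<in>keys p. if m = k then lookup p k else 0)"
    unfolding lookup_sum by (intro sum.cong) (auto simp: lookup_single)
  also have "\<dots> = lookup p k" by (simp add: in_keys_iff)
  finally show "lookup (\<Sum>m\<in>keys p. single m (lookup p m)) k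
      = lookup p k" .
qed

lemma mpoly_induct [case_names zero single add]:
  fixes p :: "'m \<Rightarrow>\<^sub>0 'a::comm_monoid_add"
  assumes "P 0" "\<And>m c. m \<in> keys p \<Longrightarrow> P (single m c)"
    "\<And>q r. P q \<Longrightarrow> P r \<Longrightarrow> P (q + r)"
  shows "P p"
proof -
  have "P (\<Sum>m\<in>A. single m (lookup p m))"
    if "finite A" "A \<subseteq> keys p" for A
    using that by (induction A rule: finite_induct) (auto intro: assms)
  from this[OF finite_keys subset_refl] show ?thesis unfolding poly_mapping_sum_single .
qed

definition monomial_at :: "('v \<Rightarrow> 'b::comm_ring_1) \<Rightarrow> 'v pp \<Rightarrow> 'b" where
  "monomial_at a m = (\<Prod>v \<in> keys m. a v ^ lookup m v)"

lemma monomial_at_superset: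
  assumes "finite A" "keys m \<subseteq> A"
  shows "monomial_at a m = (\<Prod>v\<in>A. a v ^ lookup m v)"
  unfolding monomial_at_def using assms by (intro prod.mono_neutral_left) (auto simp: in_keys_iff)

lemma monomial_at_add: "monomial_at a (m + m') = monomial_at a m * monomial_at a m'"
proof -
  let ?A = "keys m \<union> keys m'"
  have f: "finite ?A" by simp
  have k: "keys (m + m') \<subseteq> ?A" by (rule keys_add)
  show ?thesis
    unfolding monomial_at_superset[OF f k] monomial_at_superset[OF f Un_upper1] monomial_at_superset[OF f Un_upper2]
    by (simp add: lookup_add power_add prod.distrib)
qed

lemma mpoly_at_alt: "mpoly_at \<phi> a p = (\<Sum>m\<in>keys p. \<phi> (lookup p m) * monomial_at a m)"
  by (simp add: mpoly_at_def monomial_at_def)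

context
  fixes \<phi> :: "'a::comm_ring_1 \<Rightarrow> 'b::comm_ring_1"
  assumes hom: "comm_ring_hom \<phi>"
begin

interpretation comm_ring_hom \<phi> by (rule hom)

lemma mpoly_at_add: "mpoly_at \<phi> a (p + q) = mpoly_at \<phi> a p + mpoly_at \<phi> a q"
  unfolding mpoly_at_alt by (rule sum_keys_add) (simp_all add: hom_add algebra_simps)

lemma mpoly_at_single: "mpoly_at \<phi> a (single m c) = \<phi> c * monomial_at a m"
  by (cases "c = 0") (simp_all add: mpoly_at_alt)

lemma mpoly_at_mult: "mpoly_at \<phi> a (p * q) = mpoly_at \<phi> a p * mpoly_at \<phi> a q"
proof (induction p rule: mpoly_induct)
  case zero then show ?case by (simp add: mpoly_at_alt)
next
  case (single m c)
  show ?case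
  proof (induction q rule: mpoly_induct)
    case zero then show ?case by (simp add: mpoly_at_alt)
  next
    case (single m' c')
    then show ?case by (simp add: mult_single mpoly_at_single hom_mult monomial_at_add algebra_simps)
  next
    case (add q r)
    then show ?case by (simp add: mpoly_at_add distrib_left)
  qed
next
  case (add q r)
  then show ?case by (simp add: mpoly_at_add distrib_right)
qed

lemma mpoly_at_comm_ring_hom: "comm_ring_hom (mpoly_at \<phi> a)"
proof
  show "mpoly_at \<phi> a 1 = 1"
    using mpoly_at_single[of a 0 1] by (simp add: monomial_at_def)
  show "mpoly_at \<phi> a 0 = 0" by (simp add: mpoly_at_alt)
qed (simp_all add: mpoly_at_add mpoly_at_mult)

lemma mpoly_at_indet: "mpoly_at \<phi> a (indet v) = a v"
  by (simp add: indet_def mpoly_at_single monomial_at_def)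

end

lemma mpoly_ring_simps [simp]:
  "x \<otimes>\<^bsub>mpoly_ring V\<^esub> y = x * y" "x \<oplus>\<^bsub>mpoly_ring V\<^esub> y = x + y"
  "\<one>\<^bsub>mpoly_ring V\<^esub> = 1" "\<zero>\<^bsub>mpoly_ring V\<^esub> = 0"
  by (simp_all add: mpoly_ring_def)

lemma mpoly_ring_carrier:
  "p \<in> carrier (mpoly_ring V) \<longleftrightarrow> (\<forall>m \<in> keys p. keys m \<subseteq> V)"
  by (simp add: mpoly_ring_def)

lemma mpoly_ring_add_closed:
  "p \<in> carrier (mpoly_ring V) \<Longrightarrow> q \<in> carrier (mpoly_ring V) \<Longrightarrow> p + q \<in> carrier (mpoly_ring V)"
  using keys_add[of p q] by (auto simp: mpoly_ring_carrier)

lemma mpoly_ring_mult_closed: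
  assumes "p \<in> carrier (mpoly_ring V)" "q \<in> carrier (mpoly_ring V)"
  shows "p * q \<in> carrier (mpoly_ring V)"
  unfolding mpoly_ring_carrier
proof
  fix m assume "m \<in> keys (p * q)"
  then obtain a b where "m = a + b" "a \<in> keys p" "b \<in> keys q"
    using keys_mult[of p q] by blast
  then show "keys m \<subseteq> V" using assms keys_add[of a b] by (fastforce simp: mpoly_ring_carrier)
qed

lemma mpoly_ring_single_closed:
  "keys m \<subseteq> V \<Longrightarrow> single m c \<in> carrier (mpoly_ring V)"
  by (simp add: mpoly_ring_carrier)

lemma mpoly_ring_const_closed: "const c \<in> carrier (mpoly_ring V)"
  by (simp add: const_def mpoly_ring_single_closed)

lemma mpoly_ring_cring: "cring (mpoly_ring V :: ('v, 'a::comm_ring_1) mpoly ring)"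
proof (rule cringI)
  let ?P = "mpoly_ring V :: ('v, 'a) mpoly ring"
  have u: "- p \<in> carrier ?P" if "p \<in> carrier ?P" for p
    using that by (simp add: mpoly_ring_carrier in_keys_iff)
  show "abelian_group ?P"
    by (rule abelian_groupI)
      (use u mpoly_ring_add_closed in \<open>auto simp: add_ac mpoly_ring_carrier[of 0] intro!: bexI[of _ "- _"]\<close>)
  show "comm_monoid ?P"
    by (rule comm_monoidI)
      (auto simp: mult_ac mpoly_ring_carrier[of 1] intro: mpoly_ring_mult_closed)
qed (simp add: distrib_right)

lemma mpoly_ring_uminus: "p \<in> carrier (mpoly_ring V) \<Longrightarrow> \<ominus>\<^bsub>mpoly_ring V\<^esub> p = - p"
proof -
  assume p: "p \<in> carrier (mpoly_ring V)"
  interpret cring "mpoly_ring V :: ('a, 'b) mpoly ring" by (rule mpoly_ring_cring)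
  have "- p \<in> carrier (mpoly_ring V)" using p by (simp add: mpoly_ring_carrier in_keys_iff)
  then show ?thesis using minus_equality[of "- p" p] p by simp
qed

lemma mpoly_ideal:
  assumes "ideal I (mpoly_ring V)"
  shows "p \<in> I \<Longrightarrow> p \<in> carrier (mpoly_ring V)" "0 \<in> I"
    "\<lbrakk>p \<in> I; q \<in> I\<rbrakk> \<Longrightarrow> p + q \<in> I" "\<lbrakk>p \<in> I; q \<in> carrier (mpoly_ring V)\<rbrakk> \<Longrightarrow> q * p \<in> I"
    "p \<in> I \<Longrightarrow> - p \<in> I" "\<lbrakk>p \<in> I; q \<in> I\<rbrakk> \<Longrightarrow> p - q \<in> I"
proof -
  interpret ideal I "mpoly_ring V" by fact
  show c: "p \<in> I \<Longrightarrow> p \<in> carrier (mpoly_ring V)" for p by (rule Icarr)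
  show "0 \<in> I" using additive_subgroup.zero_closed[OF ideal.axioms(1)[OF assms]] by simp
  show a: "\<lbrakk>p \<in> I; q \<in> I\<rbrakk> \<Longrightarrow> p + q \<in> I" for p q
    using additive_subgroup.a_closed[OF ideal.axioms(1)[OF assms], of p q] by simp
  show "\<lbrakk>p \<in> I; q \<in> carrier (mpoly_ring V)\<rbrakk> \<Longrightarrow> q * p \<in> I" using I_l_closed by simp
  show u: "p \<in> I \<Longrightarrow> - p \<in> I" for p using additive_subgroup.a_inv_closed[OF ideal.axioms(1)[OF assms], of p] mpoly_ring_uminus[OF c] by simp
  show "\<lbrakk>p \<in> I; q \<in> I\<rbrakk> \<Longrightarrow> p - q \<in> I" using a[of p "- q"] u[of q] by simp
qed

lemma const_mult: "const (a * b) = const a * const b" by (simp add: const_def mult_single)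
lemma const_one: "const 1 = 1" by (simp add: const_def)
lemma const_zero: "const 0 = 0" by (simp add: const_def)
lemma const_mult_single: "const c * single m d = single m (c * d)"
  by (simp add: const_def mult_single)

lemma pp_deg_superset:
  assumes "finite A" "keys m \<subseteq> A"
  shows "pp_deg m = (\<Sum>v\<in>A. lookup m v)"
  unfolding pp_deg_def using assms by (intro sum.mono_neutral_left) (auto simp: in_keys_iff)

lemma pp_deg_add: "pp_deg (m + m') = pp_deg m + pp_deg m'"
proof -
  let ?A = "keys m \<union> keys m'"
  have f: "finite ?A" by simp
  have k: "keys (m + m') \<subseteq> ?A" by (rule keys_add)
  show ?thesis
    unfolding pp_deg_superset[OF f k] pp_deg_superset[OF f Un_upper1] pp_deg_superset[OF f Un_upper2]
    by (simp add: lookup_add sum.distrib)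
qed

lemma pp_deg_single: "pp_deg (single v k) = k"
  by (simp add: pp_deg_def)

lemma pp_deg_zero: "pp_deg 0 = 0" by (simp add: pp_deg_def)

lemma pp_deg_eq_0: "pp_deg m = 0 \<longleftrightarrow> m = 0"
  by (auto simp: pp_deg_def in_keys_iff intro: poly_mapping_eqI)

lemma finite_terms: "finite {u :: nat pp. keys u \<subseteq> {..<n} \<and> pp_deg u \<le> i}"
proof -
  let ?T = "{u :: nat pp. keys u \<subseteq> {..<n} \<and> pp_deg u \<le> i}"
  have inj: "inj_on lookup ?T" by (auto simp: inj_on_def lookup_inject)
  have "lookup ` ?T \<subseteq> {f. \<forall>x. (x \<in> {..<n} \<longrightarrow> f x \<in> {..i}) \<and> (x \<notin> {..<n} \<longrightarrow> f x = 0)}"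
  proof
    fix f assume "f \<in> lookup ` ?T"
    then obtain u where u: "f = lookup u" "keys u \<subseteq> {..<n}" "pp_deg u \<le> i" by blast
    have "lookup u x \<le> i" for x
    proof (cases "x \<in> keys u")
      case True
      then have "lookup u x \<le> pp_deg u" unfolding pp_deg_def by (intro member_le_sum) auto
      then show ?thesis using u(3) by simp
    qed (simp add: in_keys_iff)
    moreover have "lookup u x = 0" if "x \<notin> {..<n}" for x
      using u(2) that by (metis in_keys_iff subsetD)
    ultimately show "f \<in> {f. \<forall>x. (x \<in> {..<n} \<longrightarrow> f x \<in> {..i}) \<and> (x \<notin> {..<n} \<longrightarrow> f x = 0)}"
      using u(1) by simp
  qed
  moreover have "finite {f :: nat \<Rightarrow> nat. \<forall>x. (x \<in> {..<n} \<longrightarrow> f x \<in> {..i}) \<and> (x \<notin> {..<n} \<longrightarrow> f x = 0)}"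
    by (rule finite_set_of_finite_funs) simp_all
  ultimately show ?thesis using inj finite_imageD finite_subset by blast
qed

section \<open>Coordinate rings presented by a linear map\<close>

lemma (in filtered_algebra) \<kappa>_subfield: "subfield (range \<kappa>) R"
proof (rule subfieldI)
  have z: "\<kappa> 0 = \<zero>" using \<kappa>_add[of 0 0] \<kappa>_carr[of 0] by simp
  have neg: "\<ominus> \<kappa> c = \<kappa> (- c)" for c
    using minus_equality[of "\<kappa> (- c)" "\<kappa> c"] \<kappa>_add[of "- c" c] z \<kappa>_carr by simp
  show "subcring (range \<kappa>) R"
  proof (rule subcringI')
    show "subring (range \<kappa>) R"
    proof (rule subringI)
      show "range \<kappa> \<subseteq> carrier R" using \<kappa>_carr by auto
      show "\<one> \<in> range \<kappa>" using \<kappa>_one by (metis rangeI)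
      fix h assume "h \<in> range \<kappa>"
      then show "\<ominus> h \<in> range \<kappa>" using neg by auto
      fix k assume "k \<in> range \<kappa>"
      then show "h \<otimes> k \<in> range \<kappa>" "h \<oplus> k \<in> range \<kappa>"
        using \<open>h \<in> range \<kappa>\<close> \<kappa>_mult \<kappa>_add by auto
    qed
  qed
  show "Units (R\<lparr>carrier := range \<kappa>\<rparr>) = range \<kappa> - {\<zero>}"
  proof (intro equalityI subsetI)
    fix x assume x: "x \<in> Units (R\<lparr>carrier := range \<kappa>\<rparr>)"
    then obtain y where y: "x \<in> range \<kappa>" "y \<in> range \<kappa>" "y \<otimes> x = \<one>" unfolding Units_def by auto
    have "x \<noteq> \<zero>"
    proof
      assume "x = \<zero>"
      then have "y \<otimes> \<zero> = \<one>" using y(3) by simp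
      moreover have "y \<in> carrier R" using y(2) \<kappa>_carr by auto
      ultimately show False using one_neq_zero by simp
    qed
    then show "x \<in> range \<kappa> - {\<zero>}" using y(1) by simp
  next
    fix x assume "x \<in> range \<kappa> - {\<zero>}"
    then obtain c where c: "x = \<kappa> c" "c \<noteq> 0" using z by auto
    have "\<kappa> (1 / c) \<otimes> x = \<one>" "x \<otimes> \<kappa> (1 / c) = \<one>" using c \<kappa>_mult \<kappa>_one by simp_all
    then show "x \<in> Units (R\<lparr>carrier := range \<kappa>\<rparr>)" unfolding Units_def using c by auto
  qed
qed

lemma (in filtered_algebra) E_combine:
  assumes "set Us \<subseteq> carrier R" "length cs = length Us"
  shows "combine (map \<kappa> cs) Us \<in> carrier R \<and>
    E (combine (map \<kappa> cs) Us) = (\<Sum>j<length Us. (\<lambda>i. cs ! j * E (Us ! j) i))"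
  using assms(2,1)
proof (induction cs Us rule: list_induct2)
  case Nil then show ?case using E_zero by simp
next
  case (Cons c cs u Us)
  have u: "u \<in> carrier R" using Cons.prems by simp
  have IH: "combine (map \<kappa> cs) Us \<in> carrier R"
    "E (combine (map \<kappa> cs) Us) = (\<Sum>j<length Us. (\<lambda>i. cs ! j * E (Us ! j) i))"
    using Cons by auto
  have "(\<Sum>j<length (u # Us). (\<lambda>i. (c # cs) ! j * E ((u # Us) ! j) i)) =
    (\<lambda>i. c * E u i) + (\<Sum>j<length Us. (\<lambda>i. cs ! j * E (Us ! j) i))"
    by (simp add: sum.lessThan_Suc_shift del: sum.lessThan_Suc)
  then show ?case using IH u \<kappa>_carr E_add[of "\<kappa> c \<otimes> u" "combine (map \<kappa> cs) Us"] E_smult[OF u] by simp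
qed

lemma (in filtered_algebra) dim_eq: "dim (range \<kappa>) (F j) = hilbert j"
proof -
  have Eb: "E ` F j \<subseteq> funs.span B" using E_span F_carr by blast
  obtain S where S: "finite S" "funs.independent S" "S \<subseteq> E ` F j" "funs.span S = E ` F j"
    "card S = funs.dim (E ` F j)"
    by (rule funs.subspace_finite_basis[OF ksub_subspace[OF ksub_F] Eb B_finite]) (rule that)
  obtain ss where ss: "set ss = S" "distinct ss" using finite_distinct_list[OF S(1)] by blast
  have "\<exists>Us. set Us \<subseteq> F j \<and> map E Us = ss"
  proof -
    have "\<forall>s\<in>set ss. \<exists>x\<in>F j. E x = s" using S(3) ss(1) by auto
    then obtain g where "\<forall>s\<in>set ss. g s \<in> F j \<and> E (g s) = s" by metis
    then show ?thesis by (intro exI[of _ "map g ss"]) (auto intro: map_idI)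
  qed
  then obtain Us where Us: "set Us \<subseteq> F j" "map E Us = ss" by blast
  have Uc: "set Us \<subseteq> carrier R" using Us(1) F_carr by blast
  have len: "length Us = card S" using ss Us(2) by (metis distinct_card length_map)
  have EU: "E (Us ! i) = ss ! i" if "i < length Us" for i using Us(2) that by (metis nth_map)
  note K = \<kappa>_subfield
  have ind: "independent (range \<kappa>) Us"
  proof (rule trivial_combine_imp_independent[OF K Uc])
    fix Ks assume Ks: "set Ks \<subseteq> range \<kappa>" "combine Ks Us = \<zero>"
    define ds where "ds = map (\<lambda>k. SOME c. k = \<kappa> c) (take (length Us) Ks @ replicate (length Us - length Ks) \<zero>)"
    have zr: "\<zero> \<in> range \<kappa>" using F_zero[of 0] unfolding F_0 .
    have dk: "map \<kappa> ds = take (length Us) Ks @ replicate (length Us - length Ks) \<zero>"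
    proof -
      have "\<kappa> (SOME c. k = \<kappa> c) = k" if "k \<in> range \<kappa>" for k
        by (rule sym, rule someI_ex) (use that in auto)
      moreover have "set (take (length Us) Ks @ replicate (length Us - length Ks) \<zero>) \<subseteq> range \<kappa>"
        using Ks(1) zr set_take_subset[of "length Us" Ks] by auto
      ultimately show ?thesis unfolding ds_def map_map by (intro map_idI) (auto simp: subset_iff)
    qed
    have ld: "length ds = length Us" unfolding ds_def by simp
    have Kc: "set Ks \<subseteq> carrier R" using Ks(1) \<kappa>_carr by auto
    have "combine (map \<kappa> ds) Us = combine (take (length Us) Ks) Us"
      unfolding dk by (rule combine_append_replicate[OF Uc])
    also have "\<dots> = \<zero>" using Ks(2) combine_take[of Us Ks] by simp
    finally have "combine (map \<kappa> ds) Us = \<zero>" .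
    then have "(\<Sum>i<length Us. (\<lambda>x. ds ! i * E (Us ! i) x)) = 0"
      using E_combine[OF Uc ld] E_zero by simp
    then have z: "(\<Sum>i<length Us. (\<lambda>x. ds ! i * (ss ! i) x)) = 0" using EU by simp
    have bij: "bij_betw ((!) ss) {..<length Us} S"
      using ss Us(2) bij_betw_nth[of ss "{..<length Us}" S] by (metis length_map)
    define u where "u s = ds ! (inv_into {..<length Us} ((!) ss) s)" for s
    have ui: "u (ss ! i) = ds ! i" if "i < length Us" for i
      unfolding u_def using bij that by (simp add: bij_betw_def inv_into_f_f)
    have "(\<Sum>s\<in>S. (\<lambda>x. u s * s x)) = (\<Sum>i<length Us. (\<lambda>x. u (ss ! i) * (ss ! i) x))"
      using sum.reindex_bij_betw[OF bij, of "\<lambda>s x. u s * s x"] by simp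
    also have "\<dots> = 0" using z ui by simp
    finally have us: "u s = 0" if "s \<in> S" for s
      using S(2) funs.independentD[OF S(2,1) subset_refl, of u] that by blast
    have "ds ! i = 0" if "i < length Us" for i
      using us[of "ss ! i"] ui[OF that] bij that by (auto simp: bij_betw_def)
    then have "set ds \<subseteq> {0}" using ld by (auto simp: in_set_conv_nth)
    then have "set (map \<kappa> ds) \<subseteq> {\<kappa> 0}" by auto
    moreover have "\<kappa> 0 = \<zero>" using \<kappa>_add[of 0 0] \<kappa>_carr[of 0] by simp
    ultimately show "set (take (length Us) Ks) \<subseteq> {\<zero>}" unfolding dk by auto
  qed
  have "Span (range \<kappa>) Us = F j"
  proof (intro equalityI)
    show "Span (range \<kappa>) Us \<subseteq> F j"
    proof (rule Span_min[OF K Uc])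
      show "range \<kappa> <#> set Us \<subseteq> F j"
        using Us(1) F_smult unfolding set_mult_def by auto
      show "subgroup (F j) (add_monoid R)" using F_sub additive_subgroup.a_subgroup by blast
    qed
    show "F j \<subseteq> Span (range \<kappa>) Us"
    proof
      fix x assume x: "x \<in> F j"
      let ?T = "Span (range \<kappa>) Us"
      have T: "ksub ?T"
        unfolding ksub_def
      proof (intro conjI ballI allI)
        show "?T \<subseteq> carrier R" by (rule Span_in_carrier[OF _ Uc]) (use \<kappa>_carr in auto)
        show "\<zero> \<in> ?T" using Span_subgroup_props(2)[OF K Uc] .
        show "x \<oplus> y \<in> ?T" if "x \<in> ?T" "y \<in> ?T" for x y using Span_subgroup_props(3)[OF K Uc] that by blast
        show "\<kappa> c \<otimes> x \<in> ?T" if "x \<in> ?T" for c x using Span_smult_closed[OF K Uc] that by blast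
      qed
      have "S = E ` set Us" using ss(1) Us(2) by auto
      then have "S \<subseteq> E ` ?T" using Span_base_incl[OF K Uc] by (simp only: image_mono)
      then have "E ` F j \<subseteq> E ` ?T" using funs.span_minimal[OF _ ksub_subspace[OF T]] S(4) by blast
      then show "x \<in> ?T" using ksub_image_mem[OF T] x F_carr by blast
    qed
  qed
  then have "dimension (length Us) (range \<kappa>) (F j)" using dimension_independent[OF ind] by simp
  then show ?thesis using dimI[OF K] len S(5) by (simp add: hilbert_def over_def)
qed

text \<open>The coordinate ring \<open>P/I\<close> with \<open>I\<close> given as the kernel of a linear map to a space of functions,
  which replaces dimensions of subspaces of the quotient by dimensions of spaces of functions.\<close>

locale presented_algebra =
  fixes n :: nat and I :: "(nat, 'l::field) mpoly set" and ev :: "(nat, 'l) mpoly \<Rightarrow> (nat \<Rightarrow> 'l)" and \<mu> :: nat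
  assumes I_ideal: "ideal I (mpoly_ring {..<n})"
    and ev_add: "ev (p + q) = ev p + ev q"
    and ev_smult: "ev (const c * p) = (\<lambda>i. c * ev p i)"
    and ev_kernel: "p \<in> carrier (mpoly_ring {..<n}) \<Longrightarrow> ev p = 0 \<longleftrightarrow> p \<in> I"
    and ev_support: "i \<ge> \<mu> \<Longrightarrow> ev p i = 0"
    and one_notin: "1 \<notin> I"
    and bounded: "\<exists>k. \<forall>p\<in>carrier (mpoly_ring {..<n}). \<exists>q\<in>carrier (mpoly_ring {..<n}).
       (\<forall>m \<in> keys q. pp_deg m \<le> k) \<and> p - q \<in> I"
begin

abbreviation P :: "(nat, 'l) mpoly ring" where "P \<equiv> mpoly_ring {..<n}"
abbreviation A :: "(nat, 'l) mpoly set ring" where "A \<equiv> coord_ring n I"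
abbreviation Fil :: "nat \<Rightarrow> (nat, 'l) mpoly set set" where "Fil \<equiv> degree_filtration n I"

definition P_le :: "nat \<Rightarrow> (nat, 'l) mpoly set" where
  "P_le i = {p \<in> carrier P. \<forall>m \<in> keys p. pp_deg m \<le> i}"

definition cl :: "(nat, 'l) mpoly \<Rightarrow> (nat, 'l) mpoly set" where "cl p = I +>\<^bsub>P\<^esub> p"
definition kap :: "'l \<Rightarrow> (nat, 'l) mpoly set" where "kap c = cl (const c)"
definition rho :: nat where "rho = (LEAST k. Fil k = carrier A)"
definition coord :: "(nat, 'l) mpoly set \<Rightarrow> (nat \<Rightarrow> 'l)" where
  "coord Y = ev (SOME p. p \<in> carrier P \<and> Y = cl p)"

lemma A_carrier: "carrier A = cl ` carrier P"
  unfolding coord_ring_def FactRing_def A_RCOSETS_def' cl_def by auto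

lemma ev_diff: "ev (p - q) = ev p - ev q"
  using ev_add[of "p - q" q] by (simp add: algebra_simps)

lemma cl_eq_iff:
  assumes "p \<in> carrier P" "q \<in> carrier P" shows "cl p = cl q \<longleftrightarrow> p - q \<in> I"
proof -
  interpret P: cring P by (rule mpoly_ring_cring)
  interpret a: abelian_subgroup I P
    using abelian_subgroupI3[OF ideal.axioms(1)[OF I_ideal] P.is_abelian_group] .
  have s: "subgroup I (add_monoid P)" using a.a_subgroup .
  have "p \<in> cl q \<longleftrightarrow> p - q \<in> I"
    unfolding cl_def using a.a_rcos_module[OF assms(2,1)] mpoly_ring_uminus[OF assms(2)] by simp
  then show ?thesis
    using a.a_rcos_self[OF assms(1)] P.a_repr_independence[of p I q] s assms unfolding cl_def by auto
qed

lemma cl_add: "p \<in> carrier P \<Longrightarrow> q \<in> carrier P \<Longrightarrow> cl p \<oplus>\<^bsub>A\<^esub> cl q = cl (p + q)"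
proof -
  interpret P: cring P by (rule mpoly_ring_cring)
  interpret a: abelian_subgroup I P
    using abelian_subgroupI3[OF ideal.axioms(1)[OF I_ideal] P.is_abelian_group] .
  show "p \<in> carrier P \<Longrightarrow> q \<in> carrier P \<Longrightarrow> cl p \<oplus>\<^bsub>A\<^esub> cl q = cl (p + q)"
    using a.a_rcos_sum[of p q] unfolding cl_def coord_ring_def FactRing_def by simp
qed

lemma cl_mult: "p \<in> carrier P \<Longrightarrow> q \<in> carrier P \<Longrightarrow> cl p \<otimes>\<^bsub>A\<^esub> cl q = cl (p * q)"
  using ideal.rcoset_mult_add[OF I_ideal, of p q] unfolding cl_def coord_ring_def FactRing_def by simp

lemma cl_one: "\<one>\<^bsub>A\<^esub> = cl 1"
  unfolding cl_def coord_ring_def FactRing_def by simp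

lemma cl_zero: "\<zero>\<^bsub>A\<^esub> = cl 0"
proof -
  interpret P: cring P by (rule mpoly_ring_cring)
  have "subgroup I (add_monoid P)"
    using ideal.axioms(1)[OF I_ideal] additive_subgroup.a_subgroup by blast
  then have "I +>\<^bsub>P\<^esub> 0 = I" using P.a_coset_join2[of 0 I] mpoly_ideal(2)[OF I_ideal] P.zero_closed by simp
  then show ?thesis unfolding cl_def coord_ring_def FactRing_def by simp
qed

lemma A_cring: "cring A"
  using ideal.quotient_is_cring[OF I_ideal mpoly_ring_cring] unfolding coord_ring_def .

lemma coord_cl: assumes "p \<in> carrier P" shows "coord (cl p) = ev p"
proof -
  define q where "q = (SOME q. q \<in> carrier P \<and> cl p = cl q)"
  have "q \<in> carrier P \<and> cl p = cl q" unfolding q_def using someI[of "\<lambda>q. q \<in> carrier P \<and> cl p = cl q"] assms by blast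
  then have "p - q \<in> I" "q \<in> carrier P" using cl_eq_iff[OF assms] by auto
  then have "ev (p - q) = 0" using ev_kernel[of "p - q"] mpoly_ideal(1)[OF I_ideal] by blast
  then show ?thesis unfolding coord_def q_def[symmetric] using ev_diff by simp
qed

lemma Fil_eq: "Fil i = cl ` P_le i"
  unfolding degree_filtration_def P_le_def cl_def by auto

lemma P_le_sub: "P_le i \<subseteq> carrier P" unfolding P_le_def by auto

lemma P_le_add: "p \<in> P_le i \<Longrightarrow> q \<in> P_le i \<Longrightarrow> p + q \<in> P_le i"
  unfolding P_le_def using mpoly_ring_add_closed[of p "{..<n}" q] keys_add[of p q] by blast

lemma P_le_mult: assumes "p \<in> P_le i" "q \<in> P_le j" shows "p * q \<in> P_le (i + j)"
proof -
  have "pp_deg m \<le> i + j" if m: "m \<in> keys (p * q)" for m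
  proof -
    obtain a b where "m = a + b" "a \<in> keys p" "b \<in> keys q"
      using keys_mult[of p q] m by blast
    then show ?thesis using assms by (auto simp: P_le_def pp_deg_add add_mono)
  qed
  then show ?thesis using assms mpoly_ring_mult_closed by (auto simp: P_le_def)
qed

lemma P_le_uminus: "p \<in> P_le i \<Longrightarrow> - p \<in> P_le i"
  by (simp add: P_le_def mpoly_ring_carrier in_keys_iff)

lemma P_le_mono: "i \<le> j \<Longrightarrow> P_le i \<subseteq> P_le j"
  unfolding P_le_def by auto

lemma P_le_const: "const c \<in> P_le i"
  by (simp add: P_le_def mpoly_ring_const_closed) (simp add: const_def pp_deg_zero)

lemma P_le_0: "P_le 0 = range const"
proof (intro equalityI subsetI)
  fix p assume "p \<in> P_le 0"
  then have "\<forall>m\<in>keys p. m = 0" by (auto simp: P_le_def pp_deg_eq_0)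
  then have "p = const (lookup p 0)"
    by (intro poly_mapping_eqI) (auto simp: const_def lookup_single when_def in_keys_iff)
  then show "p \<in> range const" by blast
qed (use P_le_const in auto)

lemma A_minus: "p \<in> carrier P \<Longrightarrow> \<ominus>\<^bsub>A\<^esub> cl p = cl (- p)"
proof -
  assume p: "p \<in> carrier P"
  interpret A: cring A by (rule A_cring)
  have u: "- p \<in> carrier P" using p by (simp add: mpoly_ring_carrier in_keys_iff)
  have "cl (- p) \<oplus>\<^bsub>A\<^esub> cl p = \<zero>\<^bsub>A\<^esub>" using cl_add[OF u p] cl_zero by simp
  then show ?thesis using A.minus_equality[of "cl (- p)" "cl p"] A_carrier p u by auto
qed

lemma Fil_stable: "\<exists>k. Fil k = carrier A"
proof -
  obtain k where k: "\<forall>p\<in>carrier P. \<exists>q\<in>carrier P. (\<forall>m \<in> keys q. pp_deg m \<le> k) \<and> p - q \<in> I"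
    using bounded by blast
  have "carrier A \<subseteq> Fil k"
  proof
    fix x assume "x \<in> carrier A"
    then obtain p where p: "p \<in> carrier P" "x = cl p" unfolding A_carrier by blast
    then obtain q where "q \<in> carrier P" "\<forall>m \<in> keys q. pp_deg m \<le> k" "p - q \<in> I" using k by blast
    then have "q \<in> P_le k" "x = cl q" using cl_eq_iff p by (auto simp: P_le_def)
    then show "x \<in> Fil k" unfolding Fil_eq by blast
  qed
  moreover have "Fil k \<subseteq> carrier A" unfolding Fil_eq A_carrier using P_le_sub by blast
  ultimately show ?thesis by blast
qed

lemma filtered: "filtered_algebra A Fil rho kap coord ((\<lambda>j i. if i = j then 1 else 0) ` {..<\<mu>})"
proof -
  interpret A: cring A by (rule A_cring)
  have cP: "cl p \<in> carrier A" if "p \<in> carrier P" for p using that A_carrier by blast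
  have sub: "additive_subgroup (Fil i) A" for i
  proof (intro additive_subgroup.intro A.add.subgroupI)
    show "Fil i \<subseteq> carrier A" unfolding Fil_eq A_carrier using P_le_sub by blast
    show "Fil i \<noteq> {}" unfolding Fil_eq using P_le_const by blast
    fix a assume "a \<in> Fil i"
    then obtain p where p: "p \<in> P_le i" "a = cl p" unfolding Fil_eq by blast
    have pP: "p \<in> carrier P" using p(1) P_le_sub by blast
    show "\<ominus>\<^bsub>A\<^esub> a \<in> Fil i" unfolding p(2) A_minus[OF pP] Fil_eq using P_le_uminus[OF p(1)] by simp
    fix b assume "b \<in> Fil i"
    then obtain q where q: "q \<in> P_le i" "b = cl q" unfolding Fil_eq by blast
    have qP: "q \<in> carrier P" using q(1) P_le_sub by blast
    show "a \<oplus>\<^bsub>A\<^esub> b \<in> Fil i" unfolding p(2) q(2) cl_add[OF pP qP] Fil_eq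
      using P_le_add[OF p(1) q(1)] by simp
  qed
  have mono: "Fil i \<subseteq> Fil (Suc i)" for i unfolding Fil_eq by (intro image_mono P_le_mono) simp
  have mult: "x \<otimes>\<^bsub>A\<^esub> y \<in> Fil (i + j)" if xy: "x \<in> Fil i" "y \<in> Fil j" for x y i j
  proof -
    obtain p q where pq: "p \<in> P_le i" "x = cl p" "q \<in> P_le j" "y = cl q"
      using xy unfolding Fil_eq by blast
    have "p \<in> carrier P" "q \<in> carrier P" using pq P_le_sub by auto
    then have "x \<otimes>\<^bsub>A\<^esub> y = cl (p * q)" using cl_mult[of p q] pq(2,4) by simp
    then show ?thesis unfolding Fil_eq using P_le_mult[OF pq(1,3)] by simp
  qed
  have one: "\<one>\<^bsub>A\<^esub> \<in> Fil 0" unfolding cl_one Fil_eq P_le_0 const_one[symmetric] by blast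
  have ne: "\<one>\<^bsub>A\<^esub> \<noteq> \<zero>\<^bsub>A\<^esub>"
    unfolding cl_one cl_zero using cl_eq_iff[of 1 0] one_notin by (simp add: mpoly_ring_carrier)
  have top: "Fil rho = carrier A" unfolding rho_def using LeastI_ex[OF Fil_stable] .
  have q: "filtration_prev A Fil rho \<noteq> carrier A"
  proof (cases rho)
    case 0
    then show ?thesis using ne A.one_closed by (auto simp: filtration_prev_def)
  next
    case (Suc k)
    then show ?thesis using not_less_Least[of k "\<lambda>k. Fil k = carrier A"] rho_def by (simp add: filtration_prev_def)
  qed
  have F0: "Fil 0 = range kap" unfolding Fil_eq P_le_0 kap_def by auto
  have field: "\<exists>y\<in>Fil 0. x \<otimes>\<^bsub>A\<^esub> y = \<one>\<^bsub>A\<^esub>" if x: "x \<in> Fil 0" "x \<noteq> \<zero>\<^bsub>A\<^esub>" for x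
  proof -
    obtain c where c: "x = cl (const c)" using x(1) F0 kap_def by auto
    have "c \<noteq> 0"
    proof
      assume "c = 0"
      then have "x = cl 0" unfolding c by (simp only: const_zero)
      then show False using x(2) unfolding cl_zero by simp
    qed
    then have "x \<otimes>\<^bsub>A\<^esub> cl (const (1 / c)) = \<one>\<^bsub>A\<^esub>"
      unfolding c cl_one using cl_mult[OF mpoly_ring_const_closed mpoly_ring_const_closed, of c "1 / c"]
      by (simp add: const_mult[symmetric] const_one)
    then show ?thesis unfolding F0 kap_def by blast
  qed
  show ?thesis
  proof (intro filtered_algebra.intro filtered_artin.intro filtered_ring.intro coordinatized_ring.intro
      filtered_ring_axioms.intro filtered_artin_axioms.intro coordinatized_ring_axioms.intro
      filtered_algebra_axioms.intro A_cring sub mono mult one top q field F0)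
    show "kap c \<in> carrier A" for c unfolding kap_def by (rule cP[OF mpoly_ring_const_closed])
    show "coord (x \<oplus>\<^bsub>A\<^esub> y) = coord x + coord y" if xy: "x \<in> carrier A" "y \<in> carrier A" for x y
    proof -
      obtain p q where pq: "p \<in> carrier P" "x = cl p" "q \<in> carrier P" "y = cl q"
        using xy unfolding A_carrier by blast
      show ?thesis unfolding pq(2,4) cl_add[OF pq(1,3)] coord_cl[OF mpoly_ring_add_closed[OF pq(1,3)]]
          coord_cl[OF pq(1)] coord_cl[OF pq(3)] by (rule ev_add)
    qed
    show "coord (kap c \<otimes>\<^bsub>A\<^esub> x) = (\<lambda>i. c * coord x i)" if xA: "x \<in> carrier A" for c x
    proof -
      obtain p where p: "p \<in> carrier P" "x = cl p" using xA unfolding A_carrier by blast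
      show ?thesis
        unfolding p(2) kap_def cl_mult[OF mpoly_ring_const_closed p(1)]
          coord_cl[OF mpoly_ring_mult_closed[OF mpoly_ring_const_closed p(1)]] coord_cl[OF p(1)] by (rule ev_smult)
    qed
    show "x = \<zero>\<^bsub>A\<^esub>" if xA: "x \<in> carrier A" "coord x = 0" for x
    proof -
      obtain p where p: "p \<in> carrier P" "x = cl p" using xA unfolding A_carrier by blast
      then have "p \<in> I" using xA(2) coord_cl ev_kernel by simp
      then show ?thesis unfolding p(2) cl_zero using cl_eq_iff[of p 0] p(1) by (simp add: mpoly_ring_carrier)
    qed
    show "coord ` carrier A \<subseteq> funs.span ((\<lambda>j i. if i = j then 1 else 0) ` {..<\<mu>})"
    proof (rule image_subsetI)
      fix x assume "x \<in> carrier A"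
      then obtain p where p: "p \<in> carrier P" "x = cl p" unfolding A_carrier by blast
      show "coord x \<in> funs.span ((\<lambda>j i. if i = j then 1 else 0) ` {..<\<mu>})"
        unfolding p(2) coord_cl[OF p(1)]
        by (rule funs_finite_support_span) (use ev_support in auto)
    qed
  qed (assumption | rule finite_imageI[OF finite_lessThan])+
qed

lemma coord_Fil: "coord ` Fil i = ev ` P_le i"
  unfolding Fil_eq image_image using coord_cl P_le_sub by (intro image_cong) auto

lemma affine_HF_eq: "affine_HF n I i = funs.dim (ev ` P_le i)"
proof -
  interpret f: filtered_algebra A Fil rho kap coord "(\<lambda>j i. if i = j then 1 else 0) ` {..<\<mu>}" by (rule filtered)
  have "coord_consts n I = range kap" unfolding coord_consts_def kap_def cl_def by auto
  then show ?thesis unfolding affine_HF_def using f.dim_eq f.hilbert_def coord_Fil by simp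
qed

text \<open>The preimage of \<open>F\<^bsub>\<rho>-1\<^esub>\<close> in the polynomial ring.\<close>

definition low :: "(nat, 'l) mpoly set" where
  "low = (if rho = 0 then I else {p \<in> carrier P. ev p \<in> ev ` P_le (rho - 1)})"

lemma prev_iff: "p \<in> carrier P \<Longrightarrow> cl p \<in> filtration_prev A Fil rho \<longleftrightarrow> p \<in> low"
proof (cases "rho = 0")
  case True
  assume p: "p \<in> carrier P"
  show ?thesis using True cl_eq_iff[OF p, of 0] cl_zero by (simp add: filtration_prev_def low_def mpoly_ring_carrier[of 0])
next
  case False
  assume p: "p \<in> carrier P"
  have "cl p \<in> cl ` P_le (rho - 1) \<longleftrightarrow> ev p \<in> ev ` P_le (rho - 1)"
  proof
    assume "ev p \<in> ev ` P_le (rho - 1)"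
    then obtain q where q: "q \<in> P_le (rho - 1)" "ev p = ev q" by blast
    have qP: "q \<in> carrier P" using q(1) P_le_sub by blast
    have "p - q \<in> carrier P" using mpoly_ring_add_closed[OF p, of "- q"] qP
      by (simp add: mpoly_ring_carrier[of "- q"] mpoly_ring_carrier[of q] in_keys_iff)
    moreover have "ev (p - q) = 0" using q(2) by (simp add: ev_diff)
    ultimately have "p - q \<in> I" using ev_kernel[of "p - q"] by blast
    then show "cl p \<in> cl ` P_le (rho - 1)" using cl_eq_iff[OF p qP] q(1) by blast
  next
    assume "cl p \<in> cl ` P_le (rho - 1)"
    then obtain q where q: "q \<in> P_le (rho - 1)" "cl p = cl q" by blast
    have "ev p = ev q" using q coord_cl[OF p] coord_cl[of q] P_le_sub by auto
    then show "ev p \<in> ev ` P_le (rho - 1)" using q(1) by blast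
  qed
  then show ?thesis using False p by (simp add: filtration_prev_def low_def Fil_eq)
qed

text \<open>The criterion for the graded ring, expressed by polynomials.\<close>

theorem strictly_gorenstein_iff:
  "strictly_gorenstein n I \<longleftrightarrow>
     (\<forall>f\<in>carrier P. f \<notin> I \<longrightarrow> (\<exists>g\<in>carrier P. f * g \<notin> low)) \<and>
     (\<forall>i<rho. affine_HF n I i + affine_HF n I (rho - 1 - i) = affine_HF n I rho)"
proof -
  interpret f: filtered_algebra A Fil rho kap coord "(\<lambda>j i. if i = j then 1 else 0) ` {..<\<mu>}" by (rule filtered)
  have h: "f.hilbert = affine_HF n I" using affine_HF_eq f.hilbert_def coord_Fil by auto
  have "f.cayley_bacharach \<longleftrightarrow> (\<forall>f\<in>carrier P. f \<notin> I \<longrightarrow> (\<exists>g\<in>carrier P. f * g \<notin> low))"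
  proof -
    have z: "cl p = \<zero>\<^bsub>A\<^esub> \<longleftrightarrow> p \<in> I" if "p \<in> carrier P" for p
      unfolding cl_zero using cl_eq_iff[OF that, of 0] by (simp add: mpoly_ring_carrier[of 0])
    have m: "cl p \<otimes>\<^bsub>A\<^esub> cl q \<notin> filtration_prev A Fil rho \<longleftrightarrow> p * q \<notin> low"
      if "p \<in> carrier P" "q \<in> carrier P" for p q
      using cl_mult[OF that] prev_iff[OF mpoly_ring_mult_closed[OF that]] by simp
    show ?thesis unfolding f.cayley_bacharach_def A_carrier ball_simps bex_simps using z m by simp
  qed
  then show ?thesis
    unfolding strictly_gorenstein_def f.gorenstein_iff f.symmetric_def h by simp
qed

lemma affine_HF_eq_top_iff: "affine_HF n I i = affine_HF n I rho \<longleftrightarrow> rho \<le> i"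
proof -
  interpret f: filtered_algebra A Fil rho kap coord "(\<lambda>j i. if i = j then 1 else 0) ` {..<\<mu>}" by (rule filtered)
  have h: "f.hilbert = affine_HF n I" using affine_HF_eq f.hilbert_def coord_Fil by auto
  show ?thesis
  proof
    assume "rho \<le> i"
    then have "Fil i = Fil rho" using f.F_above[of i] f.F_top by simp
    then show "affine_HF n I i = affine_HF n I rho" unfolding h[symmetric] f.hilbert_def by simp
  next
    assume e: "affine_HF n I i = affine_HF n I rho"
    have sub: "coord ` Fil i \<subseteq> coord ` Fil rho" unfolding f.F_top using f.F_carr by blast
    have sp: "coord ` Fil rho \<subseteq> funs.span ((\<lambda>j i. if i = j then 1 else 0) ` {..<\<mu>})"
      unfolding f.F_top using f.E_span .
    have "coord ` Fil i = coord ` Fil rho"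
      by (rule funs.subspace_eq_of_dim[OF f.ksub_subspace[OF f.ksub_F] f.ksub_subspace[OF f.ksub_F] sub sp f.B_finite])
        (use e in \<open>simp add: h[symmetric] f.hilbert_def\<close>)
    then have "Fil i = Fil rho"
      using f.ksub_image_mem[OF f.ksub_F] f.F_carr by blast
    then have "Fil i = carrier A" using f.F_top by simp
    then show "rho \<le> i" unfolding rho_def by (rule Least_le)
  qed
qed

lemma affine_HF_zero: "affine_HF n I 0 = 1"
proof -
  have "ev ` P_le 0 = range (\<lambda>c i. c * ev 1 i)"
    unfolding P_le_0 image_image using ev_smult[of _ 1] by simp
  also have "\<dots> = funs.span {ev 1}" by (simp add: funs.span_singleton)
  finally have "affine_HF n I 0 = funs.dim (funs.span {ev 1})" unfolding affine_HF_eq by simp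
  also have "\<dots> = card {ev 1}"
    by (rule funs.dim_span_eq_card_independent) (use ev_kernel[of 1] one_notin in \<open>simp add: mpoly_ring_carrier\<close>)
  finally show ?thesis by simp
qed

lemma symmetric_HF_iff:
  assumes "affine_HF n I rho = N"
  shows "symmetric_HF N (affine_HF n I) \<longleftrightarrow>
     (\<forall>i<rho. affine_HF n I i + affine_HF n I (rho - 1 - i) = affine_HF n I rho)"
proof -
  let ?H = "affine_HF n I"
  have least: "(LEAST i. ?H i = N) = rho"
    using affine_HF_eq_top_iff assms by (intro Least_equality) auto
  have d: "hf_diff ?H (Suc i) = int (?H (Suc i)) - int (?H i)" for i by (simp add: hf_diff_def)
  have d0: "hf_diff ?H 0 = int (?H 0)" by (simp add: hf_diff_def)
  have "(\<forall>i\<in>{1..rho}. hf_diff ?H i = hf_diff ?H (rho - i)) \<longleftrightarrow>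
      (\<forall>i<rho. ?H i + ?H (rho - 1 - i) = ?H rho)"
  proof
    assume s: "\<forall>i\<in>{1..rho}. hf_diff ?H i = hf_diff ?H (rho - i)"
    show "\<forall>i<rho. ?H i + ?H (rho - 1 - i) = ?H rho"
    proof (intro allI impI)
      fix i assume "i < rho"
      then show "?H i + ?H (rho - 1 - i) = ?H rho"
      proof (induction i)
        case 0
        then obtain k where k: "rho = Suc k" by (cases rho) auto
        have mem: "rho \<in> {1..rho}" using k by simp
        have "hf_diff ?H rho = hf_diff ?H 0" using s[rule_format, OF mem] by simp
        then show ?case using d[of k] d0 k by simp
      next
        case (Suc i)
        then obtain k where k: "rho - 1 - i = Suc k" by (cases "rho - 1 - i") auto
        have k2: "rho - Suc i = Suc k" "rho - 1 - Suc i = k" using k by auto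
        have mem: "Suc i \<in> {1..rho}" using Suc.prems by simp
        have "hf_diff ?H (Suc i) = hf_diff ?H (rho - Suc i)" by (rule s[rule_format, OF mem])
        then have "int (?H (Suc i)) - int (?H i) = int (?H (Suc k)) - int (?H k)" using d k2 by simp
        moreover have "?H i + ?H (Suc k) = ?H rho" using Suc.IH Suc.prems k by simp
        ultimately show ?case using k2 by simp
      qed
    qed
  next
    assume s: "\<forall>i<rho. ?H i + ?H (rho - 1 - i) = ?H rho"
    show "\<forall>i\<in>{1..rho}. hf_diff ?H i = hf_diff ?H (rho - i)"
    proof
      fix i assume i: "i \<in> {1..rho}"
      then obtain k where k: "i = Suc k" by (cases i) auto
      have a: "?H k + ?H (rho - 1 - k) = ?H rho" using s i k by simp
      have e: "rho - 1 - k = rho - i" using k by simp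
      show "hf_diff ?H i = hf_diff ?H (rho - i)"
      proof (cases "rho - i")
        case 0
        then have "i = rho" using i by simp
        then show ?thesis using a e k d[of k] d0 0 by simp
      next
        case (Suc j)
        then have "i < rho" "rho - 1 - i = j" by auto
        then have "?H i + ?H j = ?H rho" using s by metis
        then show ?thesis using a e k d[of k] d[of j] Suc by simp
      qed
    qed
  qed
  then show ?thesis unfolding symmetric_HF_def least Let_def .
qed

end

section \<open>The algebra of a point of a border basis scheme\<close>

lemma mat_pow_commute:
  fixes A B :: "'a::comm_ring_1 mat"
  assumes A: "A \<in> carrier_mat n n" and B: "B \<in> carrier_mat n n" and AB: "A * B = B * A"
  shows "A ^\<^sub>m k * B = B * A ^\<^sub>m k"
proof (induction k)
  case 0 then show ?case using A B by simp
next
  case (Suc k)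
  have P: "A ^\<^sub>m k \<in> carrier_mat n n" using A by simp
  have "A ^\<^sub>m Suc k * B = A ^\<^sub>m k * (A * B)" using assoc_mult_mat[OF P A B] by simp
  also have "\<dots> = (A ^\<^sub>m k * B) * A" unfolding AB using assoc_mult_mat[OF P B A] by simp
  also have "\<dots> = B * A ^\<^sub>m Suc k" unfolding Suc using assoc_mult_mat[OF B P A] by simp
  finally show ?case .
qed

lemma term_foldr_carrier:
  fixes M :: "nat \<Rightarrow> 'a::comm_ring_1 mat"
  assumes "\<And>r. r \<in> set xs \<Longrightarrow> M r \<in> carrier_mat k k"
  shows "foldr (\<lambda>r B. M r ^\<^sub>m e r * B) xs (1\<^sub>m k) \<in> carrier_mat k k"
  using assms by (induction xs) (auto intro!: mult_carrier_mat)

lemma term_at_carrier: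
  assumes "\<And>r. r < n \<Longrightarrow> M r \<in> carrier_mat k k"
  shows "term_at n k M t \<in> carrier_mat k k"
  unfolding term_at_def using term_foldr_carrier[of "[0..<n]" M k "lookup t"] assms by simp

text \<open>In the product that evaluates a term one more factor can be moved to the front, because all
  matrices commute.\<close>

lemma term_foldr_update:
  fixes M :: "nat \<Rightarrow> 'a::comm_ring_1 mat"
  assumes M: "\<And>s. s \<in> insert r (set xs) \<Longrightarrow> M s \<in> carrier_mat k k"
    and comm: "\<And>s. s \<in> set xs \<Longrightarrow> M s * M r = M r * M s"
    and dist: "distinct xs"
    and e: "e' r = Suc (e r)" "\<And>s. s \<noteq> r \<Longrightarrow> e' s = e s"
  shows "foldr (\<lambda>s B. M s ^\<^sub>m e' s * B) xs (1\<^sub>m k) =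
    (if r \<in> set xs then M r * foldr (\<lambda>s B. M s ^\<^sub>m e s * B) xs (1\<^sub>m k)
     else foldr (\<lambda>s B. M s ^\<^sub>m e s * B) xs (1\<^sub>m k))"
  using M comm dist
proof (induction xs)
  case Nil then show ?case by simp
next
  case (Cons x xs)
  let ?B = "foldr (\<lambda>s B. M s ^\<^sub>m e s * B) xs (1\<^sub>m k)"
  let ?B' = "foldr (\<lambda>s B. M s ^\<^sub>m e' s * B) xs (1\<^sub>m k)"
  have IH: "?B' = (if r \<in> set xs then M r * ?B else ?B)"
    by (rule Cons.IH) (use Cons.prems in auto)
  have B: "?B \<in> carrier_mat k k" using term_foldr_carrier[of xs M k e] Cons.prems(1) by simp
  have Mr: "M r \<in> carrier_mat k k" and Mx: "M x \<in> carrier_mat k k" using Cons.prems(1) by auto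
  have Pr: "M r ^\<^sub>m e r \<in> carrier_mat k k" using Mr by simp
  have Px: "M x ^\<^sub>m e x \<in> carrier_mat k k" using Mx by simp
  show ?case
  proof (cases "x = r")
    case True
    then have n: "r \<notin> set xs" using Cons.prems(3) by simp
    have "M r ^\<^sub>m Suc (e r) * ?B = M r * (M r ^\<^sub>m e r * ?B)"
      using mat_pow_commute[OF Mr Mr refl, of "e r"] assoc_mult_mat[OF Mr Pr B] by simp
    then show ?thesis using True n IH e(1) by simp
  next
    case False
    have "M x ^\<^sub>m e x * (M r * ?B) = M r * (M x ^\<^sub>m e x * ?B)"
      using assoc_mult_mat[OF Px Mr B] assoc_mult_mat[OF Mr Px B]
        mat_pow_commute[OF Mx Mr Cons.prems(2)[of x], of "e x"] by simp
    then show ?thesis using False IH e(2) by simp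
  qed
qed

lemma term_at_add_single:
  fixes M :: "nat \<Rightarrow> 'a::comm_ring_1 mat"
  assumes M: "\<And>s. s < n \<Longrightarrow> M s \<in> carrier_mat k k"
    and comm: "\<And>s s'. s < n \<Longrightarrow> s' < n \<Longrightarrow> M s * M s' = M s' * M s" and r: "r < n"
  shows "term_at n k M (single r 1 + t) = M r * term_at n k M t"
proof -
  have "foldr (\<lambda>s B. M s ^\<^sub>m lookup (single r 1 + t) s * B) [0..<n] (1\<^sub>m k) =
    (if r \<in> set [0..<n] then M r * foldr (\<lambda>s B. M s ^\<^sub>m lookup t s * B) [0..<n] (1\<^sub>m k)
     else foldr (\<lambda>s B. M s ^\<^sub>m lookup t s * B) [0..<n] (1\<^sub>m k))"
    by (rule term_foldr_update) (use M comm r in \<open>auto simp: lookup_add lookup_single\<close>)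
  then show ?thesis unfolding term_at_def using r by simp
qed

lemma pp_split:
  assumes "r \<in> keys (t :: nat pp)"
  obtains t' where "t = single r 1 + t'"
proof (rule that[of "t - single r 1"])
  show "t = single r 1 + (t - single r 1)"
    using assms by (intro poly_mapping_eqI) (auto simp: lookup_add lookup_minus lookup_single when_def in_keys_iff)
qed

lemma pp_induct [consumes 1, case_names zero step]:
  fixes t :: "nat pp"
  assumes "keys t \<subseteq> {..<n}" and "Q 0"
    and step: "\<And>r t. \<lbrakk>r < n; keys t \<subseteq> {..<n}; Q t\<rbrakk> \<Longrightarrow> Q (single r 1 + t)"
  shows "Q t"
  using assms(1)
proof (induction "pp_deg t" arbitrary: t rule: less_induct)
  case less
  show ?case
  proof (cases "t = 0")
    case False
    then obtain r where r: "r \<in> keys t" by fastforce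
    obtain t' where t': "t = single r 1 + t'" using pp_split[OF r] .
    have k: "keys t' \<subseteq> {..<n}"
    proof
      fix x assume "x \<in> keys t'"
      then have "x \<in> keys t" unfolding t' by (simp add: in_keys_iff lookup_add)
      then show "x \<in> {..<n}" using less.prems by blast
    qed
    have "pp_deg t' < pp_deg t" unfolding t' by (simp add: pp_deg_add pp_deg_single)
    then show ?thesis unfolding t' using step[OF _ k less.hyps[OF _ k]] r less.prems t' by auto
  qed (simp add: assms(2))
qed

text \<open>A rational point of the border basis scheme: its multiplication matrices commute.\<close>

locale border_point =
  fixes n :: nat and ts bs :: "nat pp list" and \<Gamma> :: "'l::field mat"
  assumes enum: "order_ideal_enum n ts bs"
    and \<Gamma>_carr: "\<Gamma> \<in> carrier_mat (length ts) (length bs)"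
    and commute: "\<And>r s. r < n \<Longrightarrow> s < n \<Longrightarrow>
       mult_matrix ts bs (\<lambda>ij. \<Gamma> $$ ij) r * mult_matrix ts bs (\<lambda>ij. \<Gamma> $$ ij) s =
       mult_matrix ts bs (\<lambda>ij. \<Gamma> $$ ij) s * mult_matrix ts bs (\<lambda>ij. \<Gamma> $$ ij) r"
begin

abbreviation \<mu> :: nat where "\<mu> \<equiv> length ts"
abbreviation Am :: "nat \<Rightarrow> 'l mat" where "Am \<equiv> mult_matrix ts bs (\<lambda>ij. \<Gamma> $$ ij)"
abbreviation PR :: "(nat, 'l) mpoly ring" where "PR \<equiv> mpoly_ring {..<n}"

lemma Am_carr: "Am r \<in> carrier_mat \<mu> \<mu>" by (simp add: mult_matrix_def)

text \<open>The coordinates of a term in the basis \<open>ts\<close>, to be obtained by applying the multiplication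
  matrices to the first unit vector, the coordinates of \<open>1\<close>.\<close>

definition v :: "nat pp \<Rightarrow> nat \<Rightarrow> 'l" where
  "v t = (\<lambda>i. if i < \<mu> then term_at n \<mu> Am t $$ (i, 0) else 0)"

definition op :: "nat \<Rightarrow> (nat \<Rightarrow> 'l) \<Rightarrow> nat \<Rightarrow> 'l" where
  "op r x = (\<lambda>i. if i < \<mu> then \<Sum>j<\<mu>. Am r $$ (i, j) * x j else 0)"

definition unit :: "nat \<Rightarrow> nat \<Rightarrow> 'l" where "unit j = (\<lambda>i. if i = j then 1 else 0)"

definition ev :: "(nat, 'l) mpoly \<Rightarrow> nat \<Rightarrow> 'l" where
  "ev p = (\<Sum>m\<in>keys p. (\<lambda>i. lookup p m * v m i))"

abbreviation tm :: "nat pp \<Rightarrow> (nat, 'l) mpoly" where "tm t \<equiv> single t 1"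

lemma oi: "finite (set ts)" "set ts \<noteq> {}" "distinct ts" "sorted (map pp_deg ts)"
  "t \<in> set ts \<Longrightarrow> keys t \<subseteq> {..<n}" "s + s' \<in> set ts \<Longrightarrow> s \<in> set ts"
  "set bs = border n (set ts)" "distinct bs"
  using enum unfolding order_ideal_enum_def order_ideal_def by auto

lemma \<mu>_pos: "0 < \<mu>" using oi(2) by auto

lemma zero_mem: "0 \<in> set ts"
  using oi(6)[of 0 "ts ! 0"] \<mu>_pos by simp

lemma first_term: "ts ! 0 = 0"
proof -
  obtain j where j: "j < \<mu>" "ts ! j = 0" using zero_mem by (auto simp: in_set_conv_nth)
  have "map pp_deg ts ! 0 \<le> map pp_deg ts ! j" using sorted_nth_mono[OF oi(4), of 0 j] j(1) by simp
  then have "pp_deg (ts ! 0) = 0" using j \<mu>_pos by (simp add: pp_deg_zero)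
  then show ?thesis using pp_deg_eq_0 by blast
qed

lemma op_add: "op r (x + y) = op r x + op r y"
  by (auto simp: op_def fun_eq_iff distrib_left sum.distrib)

lemma op_scale: "op r (\<lambda>i. c * x i) = (\<lambda>i. c * op r x i)"
  by (auto simp: op_def fun_eq_iff sum_distrib_left mult_ac)

lemma op_zero: "op r 0 = 0" by (auto simp: op_def fun_eq_iff)

lemma v_support: "i \<ge> \<mu> \<Longrightarrow> v t i = 0" by (simp add: v_def)

lemma v_step: assumes "r < n" shows "v (single r 1 + t) = op r (v t)"
proof
  fix i
  have T: "term_at n \<mu> Am t \<in> carrier_mat \<mu> \<mu>" using term_at_carrier[OF Am_carr] .
  have e: "term_at n \<mu> Am (single r 1 + t) = Am r * term_at n \<mu> Am t"
    by (rule term_at_add_single[OF Am_carr commute assms])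
  show "v (single r 1 + t) i = op r (v t) i"
    using T Am_carr[of r] \<mu>_pos
    by (auto simp: v_def op_def e scalar_prod_def atLeast0LessThan intro!: sum.cong)
qed

lemma v_zero: "v 0 = unit 0"
proof -
  have "foldr (\<lambda>r B. Am r ^\<^sub>m 0 * B) xs (1\<^sub>m \<mu>) = 1\<^sub>m \<mu>" for xs
    by (induction xs) (simp_all add: carrier_matD(1)[OF Am_carr])
  then have "term_at n \<mu> Am 0 = 1\<^sub>m \<mu>" unfolding term_at_def by simp
  then show ?thesis using \<mu>_pos by (auto simp: v_def unit_def)
qed

lemma op_unit: "j < \<mu> \<Longrightarrow> op r (unit j) = (\<lambda>i. if i < \<mu> then Am r $$ (i, j) else 0)"
proof
  fix i assume j: "j < \<mu>"
  have "(\<Sum>j'<\<mu>. Am r $$ (i, j') * unit j j') = (\<Sum>j'<\<mu>. if j' = j then Am r $$ (i, j) else 0)"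
    by (intro sum.cong) (auto simp: unit_def)
  then show "op r (unit j) i = (if i < \<mu> then Am r $$ (i, j) else 0)" using j by (simp add: op_def)
qed

lemma op_unit_inner:
  assumes "j < \<mu>" "k < \<mu>" "single r 1 + ts ! j = ts ! k"
  shows "op r (unit j) = unit k"
proof -
  have "single r 1 + ts ! j \<in> set ts" using assms by simp
  then show ?thesis unfolding op_unit[OF assms(1)]
    using assms nth_eq_iff_index_eq[OF oi(3)] by (auto simp: mult_matrix_def unit_def fun_eq_iff)
qed

lemma op_unit_border:
  assumes "j < \<mu>" "k < length bs" "single r 1 + ts ! j = bs ! k"
  shows "op r (unit j) = (\<lambda>i. if i < \<mu> then \<Gamma> $$ (i, k) else 0)"
proof -
  have nin: "single r 1 + ts ! j \<notin> set ts"
    using assms oi(7) nth_mem[OF assms(2)] unfolding border_def by auto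
  have "(THE m. m < length bs \<and> bs ! m = single r 1 + ts ! j) = k"
    using assms(2,3) nth_eq_iff_index_eq[OF oi(8)] by (intro the_equality) auto
  then show ?thesis unfolding op_unit[OF assms(1)] using nin assms by (auto simp: mult_matrix_def fun_eq_iff Let_def)
qed

lemma border_cases:
  assumes "r < n" "j < \<mu>"
  obtains k where "k < \<mu>" "single r 1 + ts ! j = ts ! k"
  | k where "k < length bs" "single r 1 + ts ! j = bs ! k"
proof (cases "single r 1 + ts ! j \<in> set ts")
  case True
  then show thesis using that(1) by (metis in_set_conv_nth)
next
  case False
  then have "single r 1 + ts ! j \<in> set bs" using oi(7) assms nth_mem[OF assms(2)] unfolding border_def by blast
  then show thesis using that(2) by (metis in_set_conv_nth)
qed

text \<open>Divisors of elements of the order ideal lie in it, so every term \<open>ts ! j\<close> is reached from \<open>1\<close> along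
  columns of the multiplication matrices which are unit vectors.\<close>

lemma v_ts: "j < \<mu> \<Longrightarrow> v (ts ! j) = unit j"
proof (induction "pp_deg (ts ! j)" arbitrary: j rule: less_induct)
  case less
  show ?case
  proof (cases "ts ! j = 0")
    case True
    then have "j = 0" using first_term nth_eq_iff_index_eq[OF oi(3)] less.prems \<mu>_pos by metis
    then show ?thesis using True v_zero by simp
  next
    case False
    then obtain r where r: "r \<in> keys (ts ! j)" by fastforce
    obtain t' where t': "ts ! j = single r 1 + t'" using pp_split[OF r] .
    have "t' + single r 1 \<in> set ts" using t' less.prems by (metis add.commute nth_mem)
    then have "t' \<in> set ts" by (rule oi(6))
    then obtain k where k: "k < \<mu>" "ts ! k = t'" by (auto simp: in_set_conv_nth)
    have rn: "r < n" using oi(5)[OF nth_mem[OF less.prems]] r by auto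
    have "pp_deg (ts ! k) < pp_deg (ts ! j)" unfolding k(2) t' by (simp add: pp_deg_add pp_deg_single)
    then have "v (ts ! k) = unit k" using less.hyps k(1) by blast
    then have "v (ts ! j) = op r (unit k)" using v_step[OF rn, of t'] t' k(2) by simp
    then show ?thesis using op_unit_inner[OF k(1) less.prems, of r] t' k(2) by simp
  qed
qed

lemma bs_split:
  assumes "l < length bs"
  obtains r j where "r < n" "j < \<mu>" "single r 1 + ts ! j = bs ! l"
proof -
  have "bs ! l \<in> border n (set ts)" using assms oi(7) nth_mem by blast
  then show thesis using that unfolding border_def by (auto simp: in_set_conv_nth)
qed

lemma v_bs: assumes "l < length bs" shows "v (bs ! l) = (\<lambda>i. if i < \<mu> then \<Gamma> $$ (i, l) else 0)"
proof -
  obtain r j where rj: "r < n" "j < \<mu>" "single r 1 + ts ! j = bs ! l" using bs_split[OF assms] .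
  have "v (bs ! l) = op r (unit j)" using v_step[OF rj(1), of "ts ! j"] rj v_ts by simp
  then show ?thesis using op_unit_border[OF rj(2) assms rj(3)] by simp
qed

lemma ev_add: "ev (p + q) = ev p + ev q"
  unfolding ev_def by (rule sum_keys_add) (auto simp: fun_eq_iff distrib_right)

lemma ev_zero: "ev 0 = 0" by (simp add: ev_def)

lemma ev_single: "ev (single m c) = (\<lambda>i. c * v m i)"
  by (cases "c = 0") (auto simp: ev_def fun_eq_iff)

lemma ev_tm: "ev (tm m) = v m" by (simp add: ev_single)

lemma ev_sum: "ev (sum f A) = (\<Sum>a\<in>A. ev (f a))"
  by (induction A rule: infinite_finite_induct) (auto simp: ev_zero ev_add)

lemma ev_smult: "ev (const c * p) = (\<lambda>i. c * ev p i)"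
proof (induction p rule: mpoly_induct)
  case zero then show ?case by (auto simp: ev_zero fun_eq_iff)
next
  case (single m d) then show ?case by (simp only: const_mult_single ev_single mult.assoc)
next
  case (add q r) then show ?case by (auto simp: distrib_left ev_add fun_eq_iff)
qed

lemma ev_diff: "ev (p - q) = ev p - ev q"
  using ev_add[of "p - q" q] by (simp add: algebra_simps)

lemma ev_support: "i \<ge> \<mu> \<Longrightarrow> ev p i = 0"
proof (induction p rule: mpoly_induct)
  case (single m c) then show ?case by (simp add: ev_single v_support)
qed (auto simp: ev_zero ev_add)

lemma ev_var: assumes "r < n" shows "ev (tm (single r 1) * p) = op r (ev p)"
proof (induction p rule: mpoly_induct)
  case zero then show ?case unfolding mult_zero_right ev_zero op_zero by (rule refl)
next
  case (single m d)
  then show ?case using v_step[OF assms, of m] by (simp add: mult_single ev_single op_scale)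
next
  case (add q s)
  show ?case unfolding distrib_left ev_add op_add add.IH by (rule refl)
qed

text \<open>Multiplication by a variable acts on coordinates, hence the kernel is an ideal.\<close>

lemma ev_mult_zero:
  assumes p: "ev p = 0" and q: "q \<in> carrier PR" shows "ev (q * p) = 0"
proof -
  have t: "ev (tm t * p) = 0" if "keys t \<subseteq> {..<n}" for t
    using that
  proof (induction t rule: pp_induct)
    case zero then show ?case using p by simp
  next
    case (step r t)
    have "tm (single r 1 + t) * p = tm (single r 1) * (tm t * p)"
      by (simp only: mult_single mult.assoc[symmetric] mult_1)
    then show ?case by (simp only: ev_var[OF step(1)] step(3) op_zero)
  qed
  have "ev ((\<Sum>m\<in>A. single m (lookup q m)) * p) = 0"
    if "finite A" "A \<subseteq> keys q" for A
    using that
  proof (induction A rule: finite_induct)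
    case empty then show ?case by (simp add: ev_zero)
  next
    case (insert m A)
    have "single m (lookup q m) = const (lookup q m) * tm m"
      by (simp add: const_mult_single)
    then have "ev (single m (lookup q m) * p) = (\<lambda>i. lookup q m * ev (tm m * p) i)"
      using ev_smult[of _ "tm m * p"] by (simp add: mult.assoc)
    moreover have "ev (tm m * p) = 0" using t[of m] q insert.prems by (simp add: mpoly_ring_carrier)
    ultimately have "ev (single m (lookup q m) * p) = 0" by (simp add: fun_eq_iff)
    then show ?case using insert by (simp add: distrib_right ev_add)
  qed
  from this[OF finite_keys subset_refl] show ?thesis unfolding poly_mapping_sum_single .
qed

definition gen :: "nat \<Rightarrow> (nat, 'l) mpoly" where
  "gen j = tm (bs ! j) - (\<Sum>i<\<mu>. single (ts ! i) (\<Gamma> $$ (i, j)))"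

definition nf :: "(nat \<Rightarrow> 'l) \<Rightarrow> (nat, 'l) mpoly" where
  "nf x = (\<Sum>i<\<mu>. single (ts ! i) (x i))"

lemma bs_keys: "l < length bs \<Longrightarrow> keys (bs ! l) \<subseteq> {..<n}"
proof -
  assume "l < length bs"
  then obtain r j where rj: "r < n" "j < \<mu>" "single r 1 + ts ! j = bs ! l" using bs_split by blast
  have "keys (single r 1 + ts ! j) \<subseteq> {r} \<union> keys (ts ! j)"
    using keys_add[of "single r (1::nat)" "ts ! j"] by simp
  then show ?thesis using rj oi(5)[OF nth_mem[OF rj(2)]] by auto
qed

lemma carrier_sum: "(\<And>a. a \<in> A \<Longrightarrow> f a \<in> carrier PR) \<Longrightarrow> sum f A \<in> carrier PR"
  by (induction A rule: infinite_finite_induct) (auto intro: mpoly_ring_add_closed simp: mpoly_ring_carrier[of 0])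

lemma carrier_diff: "p \<in> carrier PR \<Longrightarrow> q \<in> carrier PR \<Longrightarrow> p - q \<in> carrier PR"
  using mpoly_ring_add_closed[of p "{..<n}" "- q"] by (simp add: mpoly_ring_carrier[of "- q"] mpoly_ring_carrier[of q] in_keys_iff)

lemma nf_carrier: "nf x \<in> carrier PR"
  unfolding nf_def by (intro carrier_sum mpoly_ring_single_closed oi(5)) auto

lemma gen_carrier: "j < length bs \<Longrightarrow> gen j \<in> carrier PR"
  unfolding gen_def
  by (intro carrier_diff carrier_sum mpoly_ring_single_closed oi(5) bs_keys) auto

lemma point_ideal_eq: "point_ideal n ts bs \<Gamma> = Idl\<^bsub>PR\<^esub> (gen ` {..<length bs})"
  unfolding point_ideal_def gen_def by (rule arg_cong[where f = "genideal PR"]) auto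

lemma point_ideal: "ideal (point_ideal n ts bs \<Gamma>) PR"
proof -
  interpret cring PR by (rule mpoly_ring_cring)
  show ?thesis unfolding point_ideal_eq by (rule genideal_ideal) (use gen_carrier in auto)
qed

lemma gen_mem: "j < length bs \<Longrightarrow> gen j \<in> point_ideal n ts bs \<Gamma>"
proof -
  interpret cring PR by (rule mpoly_ring_cring)
  assume "j < length bs"
  then show ?thesis unfolding point_ideal_eq using genideal_self[of "gen ` {..<length bs}"] gen_carrier by auto
qed

lemma ev_nf: assumes "\<And>i. i \<ge> \<mu> \<Longrightarrow> x i = 0" shows "ev (nf x) = x"
proof
  fix k
  have "ev (nf x) k = (\<Sum>i<\<mu>. (\<lambda>k. x i * unit i k)) k"
    unfolding nf_def ev_sum using v_ts by (simp add: ev_single)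
  also have "\<dots> = (\<Sum>i<\<mu>. x i * unit i k)"
  proof -
    have "(\<Sum>i\<in>S. (\<lambda>k. x i * unit i k)) k = (\<Sum>i\<in>S. x i * unit i k)" if "finite S" for S
      using that by (induction S rule: finite_induct) auto
    then show ?thesis by simp
  qed
  also have "\<dots> = (\<Sum>i<\<mu>. if i = k then x k else 0)" by (intro sum.cong) (auto simp: unit_def)
  also have "\<dots> = x k" using assms[of k] by auto
  finally show "ev (nf x) k = x k" .
qed

lemma nf_add: "nf (x + y) = nf x + nf y"
  by (simp add: nf_def single_add sum.distrib)

lemma ideal_sum: "(\<And>a. a \<in> A \<Longrightarrow> f a \<in> point_ideal n ts bs \<Gamma>) \<Longrightarrow> sum f A \<in> point_ideal n ts bs \<Gamma>"
  by (induction A rule: infinite_finite_induct) (auto simp: mpoly_ideal[OF point_ideal])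

text \<open>Modulo the generators, multiplying a normal form by a variable is described by the multiplication
  matrix: a product in the border is rewritten by the corresponding generator.\<close>

lemma nf_step:
  assumes "r < n"
  shows "tm (single r 1) * nf x - nf (op r x) \<in> point_ideal n ts bs \<Gamma>"
proof -
  have u: "tm (single r 1) * tm (ts ! j) - nf (op r (unit j)) \<in> point_ideal n ts bs \<Gamma>" if j: "j < \<mu>" for j
  proof (cases rule: border_cases[OF assms j])
    case (1 k)
    have "nf (unit k) = tm (ts ! k)"
    proof -
      have "nf (unit k) = (\<Sum>i<\<mu>. if i = k then tm (ts ! k) else 0)"
        unfolding nf_def by (intro sum.cong) (auto simp: unit_def)
      then show ?thesis using 1(1) by simp
    qed
    then show ?thesis using op_unit_inner[OF j 1] 1(2) mpoly_ideal(2)[OF point_ideal] by (simp add: mult_single)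
  next
    case (2 k)
    have "nf (op r (unit j)) = (\<Sum>i<\<mu>. single (ts ! i) (\<Gamma> $$ (i, k)))"
      unfolding op_unit_border[OF j 2] nf_def by (intro sum.cong) auto
    then have "tm (single r 1) * tm (ts ! j) - nf (op r (unit j)) = gen k"
      using 2(2) by (simp add: gen_def mult_single)
    then show ?thesis using gen_mem[OF 2(1)] by simp
  qed
  have "nf (op r x) = (\<Sum>j<\<mu>. const (x j) * nf (op r (unit j)))"
  proof -
    have "(\<Sum>j<\<mu>. const (x j) * nf (op r (unit j))) =
        (\<Sum>j<\<mu>. \<Sum>i<\<mu>. single (ts ! i) (x j * Am r $$ (i, j)))"
      unfolding nf_def sum_distrib_left by (intro sum.cong) (auto simp: const_mult_single op_unit)
    also have "\<dots> = (\<Sum>i<\<mu>. \<Sum>j<\<mu>. single (ts ! i) (x j * Am r $$ (i, j)))" by (rule sum.swap)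
    also have "\<dots> = (\<Sum>i<\<mu>. single (ts ! i) (\<Sum>j<\<mu>. x j * Am r $$ (i, j)))"
    proof -
      have "(\<Sum>j\<in>S. single t (f j)) = single t (\<Sum>j\<in>S. f j)"
        for S and t :: "nat pp" and f :: "nat \<Rightarrow> 'l"
        by (induction S rule: infinite_finite_induct) (auto simp: single_add)
      then show ?thesis by simp
    qed
    also have "\<dots> = nf (op r x)" unfolding nf_def op_def by (intro sum.cong) (auto simp: mult.commute)
    finally show ?thesis by simp
  qed
  moreover have "tm (single r 1) * nf x = (\<Sum>j<\<mu>. const (x j) * (tm (single r 1) * tm (ts ! j)))"
    unfolding nf_def sum_distrib_left by (intro sum.cong) (auto simp: mult_single const_mult_single)
  ultimately have "tm (single r 1) * nf x - nf (op r x) =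
     (\<Sum>j<\<mu>. const (x j) * (tm (single r 1) * tm (ts ! j) - nf (op r (unit j))))"
    by (simp add: sum_subtractf right_diff_distrib)
  also have "\<dots> \<in> point_ideal n ts bs \<Gamma>"
    by (intro ideal_sum mpoly_ideal(4)[OF point_ideal] u mpoly_ring_const_closed) auto
  finally show ?thesis .
qed

lemma tm_reduce: "keys t \<subseteq> {..<n} \<Longrightarrow> tm t - nf (v t) \<in> point_ideal n ts bs \<Gamma>"
proof (induction t rule: pp_induct)
  case zero
  have "nf (v 0) = (\<Sum>i<\<mu>. if i = 0 then tm 0 else 0)"
    unfolding nf_def v_zero by (intro sum.cong) (auto simp: unit_def first_term)
  then show ?case using \<mu>_pos mpoly_ideal(2)[OF point_ideal] by simp
next
  case (step r t)
  let ?x = "tm (single r 1)"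
  have "?x * (tm t - nf (v t)) + (?x * nf (v t) - nf (op r (v t))) \<in> point_ideal n ts bs \<Gamma>"
    using step(1,3) by (intro mpoly_ideal(3,4)[OF point_ideal] nf_step mpoly_ring_single_closed) auto
  then show ?case using v_step[OF step(1), of t] by (simp add: right_diff_distrib mult_single)
qed

text \<open>The generators lie in the kernel, and modulo them every polynomial equals its normal form, which
  the coordinates determine.  This is the border basis property: the terms \<open>ts\<close> are a basis of the quotient.\<close>

lemma kernel:
  assumes p: "p \<in> carrier PR"
  shows "ev p = 0 \<longleftrightarrow> p \<in> point_ideal n ts bs \<Gamma>" "p - nf (ev p) \<in> point_ideal n ts bs \<Gamma>"
proof -
  interpret cring PR by (rule mpoly_ring_cring)
  have nf0: "nf 0 = 0" by (simp add: nf_def)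
  have nfs: "nf (\<lambda>i. c * x i) = const c * nf x" for c x
    unfolding nf_def sum_distrib_left by (intro sum.cong) (auto simp: const_mult_single)
  have "(\<Sum>m\<in>A. single m (lookup p m)) -
      nf (ev (\<Sum>m\<in>A. single m (lookup p m))) \<in> point_ideal n ts bs \<Gamma>"
    if "finite A" "A \<subseteq> keys p" for A
    using that
  proof (induction A rule: finite_induct)
    case empty
    show ?case unfolding sum.empty ev_zero nf0 diff_zero by (rule mpoly_ideal(2)[OF point_ideal])
  next
    case (insert m A)
    let ?c = "lookup p m"
    have "const ?c * (tm m - nf (v m)) \<in> point_ideal n ts bs \<Gamma>"
      using p insert.prems by (intro mpoly_ideal(4)[OF point_ideal] tm_reduce mpoly_ring_const_closed) (auto simp: mpoly_ring_carrier)
    then have "single m ?c - nf (ev (single m ?c)) \<in> point_ideal n ts bs \<Gamma>"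
      by (simp add: ev_single nfs right_diff_distrib const_mult_single)
    moreover have "A \<subseteq> keys p" using insert.prems by simp
    ultimately show ?case
      unfolding sum.insert[OF insert.hyps(1,2)] ev_add nf_add add_diff_add
      by (intro mpoly_ideal(3)[OF point_ideal] insert.IH)
  qed
  from this[OF finite_keys subset_refl]
  show red: "p - nf (ev p) \<in> point_ideal n ts bs \<Gamma>" unfolding poly_mapping_sum_single .
  let ?K = "{p \<in> carrier PR. ev p = 0}"
  have "ideal ?K PR"
  proof (rule ideal_by_closure)
    show "\<zero>\<^bsub>PR\<^esub> \<in> ?K" by (simp add: ev_zero mpoly_ring_carrier[of 0])
    show "x \<oplus>\<^bsub>PR\<^esub> y \<in> ?K" if "x \<in> ?K" "y \<in> ?K" for x y
      using that by (simp add: ev_add mpoly_ring_add_closed)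
    show "x \<otimes>\<^bsub>PR\<^esub> a \<in> ?K" if "a \<in> ?K" "x \<in> carrier PR" for a x
      using that by (simp add: ev_mult_zero mpoly_ring_mult_closed)
  qed auto
  moreover have "gen ` {..<length bs} \<subseteq> ?K"
  proof
    fix g assume "g \<in> gen ` {..<length bs}"
    then obtain j where j: "g = gen j" "j < length bs" by auto
    have "ev g = v (bs ! j) - ev (nf (\<lambda>i. if i < \<mu> then \<Gamma> $$ (i, j) else 0))"
      unfolding j(1) gen_def ev_diff ev_tm nf_def by simp
    also have "\<dots> = 0" using v_bs[OF j(2)] ev_nf[of "\<lambda>i. if i < \<mu> then \<Gamma> $$ (i, j) else 0"] by simp
    finally show "g \<in> ?K" using gen_carrier j by simp
  qed
  ultimately have "point_ideal n ts bs \<Gamma> \<subseteq> ?K" unfolding point_ideal_eq by (rule genideal_minimal)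
  then show "ev p = 0 \<longleftrightarrow> p \<in> point_ideal n ts bs \<Gamma>" using red nf0 by auto
qed

lemma presented: "presented_algebra n (point_ideal n ts bs \<Gamma>) ev \<mu>"
proof (rule presented_algebra.intro)
  show "ideal (point_ideal n ts bs \<Gamma>) PR" by (rule point_ideal)
  have "ev 1 \<noteq> 0"
  proof
    assume "ev 1 = 0"
    then have "unit 0 = 0" using ev_tm[of 0] v_zero by simp
    then have "unit 0 0 = 0" by simp
    then show False by (simp add: unit_def)
  qed
  then show "1 \<notin> point_ideal n ts bs \<Gamma>" using kernel(1)[of 1] by (simp add: mpoly_ring_carrier)
  show "\<exists>k. \<forall>p\<in>carrier PR. \<exists>q\<in>carrier PR. (\<forall>m\<in>keys q. pp_deg m \<le> k) \<and> p - q \<in> point_ideal n ts bs \<Gamma>"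
  proof (intro exI ballI)
    fix p assume p: "p \<in> carrier PR"
    have "pp_deg m \<le> Max (pp_deg ` set ts)" if m: "m \<in> keys (nf (ev p))" for m
    proof -
      have "m \<in> (\<Union>i<\<mu>. keys (single (ts ! i) (ev p i)))"
        using m keys_sum[of "\<lambda>i. single (ts ! i) (ev p i)" "{..<\<mu>}"] unfolding nf_def by blast
      then have "m \<in> set ts" by (auto split: if_splits)
      then show ?thesis by simp
    qed
    then show "\<exists>q\<in>carrier PR. (\<forall>m\<in>keys q. pp_deg m \<le> Max (pp_deg ` set ts)) \<and> p - q \<in> point_ideal n ts bs \<Gamma>"
      using kernel(2)[OF p] nf_carrier by blast
  qed
qed (use ev_add ev_smult kernel(1) ev_support in auto)

end

section \<open>Specialization of points\<close>

definition subring_on :: "'l::field set \<Rightarrow> bool" where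
  "subring_on A \<longleftrightarrow> 1 \<in> A \<and> (\<forall>x\<in>A. \<forall>y\<in>A. x + y \<in> A \<and> x * y \<in> A \<and> - x \<in> A)"

definition hom_on :: "'l::field set \<Rightarrow> ('l \<Rightarrow> 'o::field) \<Rightarrow> bool" where
  "hom_on A \<psi> \<longleftrightarrow> \<psi> 1 = 1 \<and> (\<forall>x\<in>A. \<forall>y\<in>A. \<psi> (x + y) = \<psi> x + \<psi> y \<and> \<psi> (x * y) = \<psi> x * \<psi> y)"

definition polys_on :: "'l::field set \<Rightarrow> 'l poly set" where
  "polys_on A = {p. \<forall>i. coeff p i \<in> A}"

text \<open>The subring generated by \<open>A\<close> and \<open>x\<close>.\<close>

definition adjoin :: "'l::field set \<Rightarrow> 'l \<Rightarrow> 'l set" where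
  "adjoin A x = (\<lambda>p. poly p x) ` polys_on A"

lemma subring_onD:
  assumes "subring_on A"
  shows "1 \<in> A" "0 \<in> A" "\<lbrakk>x \<in> A; y \<in> A\<rbrakk> \<Longrightarrow> x + y \<in> A" "\<lbrakk>x \<in> A; y \<in> A\<rbrakk> \<Longrightarrow> x * y \<in> A"
    "x \<in> A \<Longrightarrow> - x \<in> A" "x \<in> A \<Longrightarrow> x ^ k \<in> A"
proof -
  show one: "1 \<in> A" and add: "\<lbrakk>x \<in> A; y \<in> A\<rbrakk> \<Longrightarrow> x + y \<in> A"
    and mult: "\<lbrakk>x \<in> A; y \<in> A\<rbrakk> \<Longrightarrow> x * y \<in> A" and neg: "x \<in> A \<Longrightarrow> - x \<in> A" for x y
    using assms unfolding subring_on_def by auto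
  show "0 \<in> A" using add[OF one neg[OF one]] by simp
  show "x \<in> A \<Longrightarrow> x ^ k \<in> A" by (induction k) (auto simp: one mult)
qed

lemma subring_on_sum: "subring_on A \<Longrightarrow> (\<And>i. i \<in> I \<Longrightarrow> f i \<in> A) \<Longrightarrow> sum f I \<in> A"
  by (induction I rule: infinite_finite_induct) (auto simp: subring_onD)

lemma subring_on_prod: "subring_on A \<Longrightarrow> (\<And>i. i \<in> I \<Longrightarrow> f i \<in> A) \<Longrightarrow> prod f I \<in> A"
  by (induction I rule: infinite_finite_induct) (auto simp: subring_onD)

lemma hom_onD:
  assumes "hom_on A \<psi>" "subring_on A"
  shows "\<psi> 1 = 1" "\<psi> 0 = 0" "\<lbrakk>x \<in> A; y \<in> A\<rbrakk> \<Longrightarrow> \<psi> (x + y) = \<psi> x + \<psi> y"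
    "\<lbrakk>x \<in> A; y \<in> A\<rbrakk> \<Longrightarrow> \<psi> (x * y) = \<psi> x * \<psi> y" "x \<in> A \<Longrightarrow> \<psi> (x ^ k) = \<psi> x ^ k"
proof -
  show one: "\<psi> 1 = 1" and add: "\<lbrakk>x \<in> A; y \<in> A\<rbrakk> \<Longrightarrow> \<psi> (x + y) = \<psi> x + \<psi> y"
    and mult: "\<lbrakk>x \<in> A; y \<in> A\<rbrakk> \<Longrightarrow> \<psi> (x * y) = \<psi> x * \<psi> y" for x y
    using assms unfolding hom_on_def by auto
  have "\<psi> 0 + \<psi> 0 = \<psi> 0 + 0" using add[of 0 0] subring_onD(2)[OF assms(2)] by simp
  then show "\<psi> 0 = 0" by (rule add_left_imp_eq)
  show "x \<in> A \<Longrightarrow> \<psi> (x ^ k) = \<psi> x ^ k"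
    by (induction k) (auto simp: one mult subring_onD[OF assms(2)])
qed

lemma hom_on_sum:
  assumes "hom_on A \<psi>" "subring_on A" "\<And>i. i \<in> I \<Longrightarrow> f i \<in> A"
  shows "\<psi> (sum f I) = (\<Sum>i\<in>I. \<psi> (f i))"
  using assms(3)
  by (induction I rule: infinite_finite_induct)
    (auto simp: hom_onD[OF assms(1,2)] subring_on_sum[OF assms(2)])

lemma hom_on_prod:
  assumes "hom_on A \<psi>" "subring_on A" "\<And>i. i \<in> I \<Longrightarrow> f i \<in> A"
  shows "\<psi> (prod f I) = (\<Prod>i\<in>I. \<psi> (f i))"
  using assms(3)
  by (induction I rule: infinite_finite_induct)
    (auto simp: hom_onD[OF assms(1,2)] subring_on_prod[OF assms(2)])

lemma polys_onD: "p \<in> polys_on A \<Longrightarrow> coeff p i \<in> A" by (simp add: polys_on_def)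

lemma polys_on_closed:
  assumes A: "subring_on A"
  shows "\<lbrakk>p \<in> polys_on A; q \<in> polys_on A\<rbrakk> \<Longrightarrow> p + q \<in> polys_on A"
    "\<lbrakk>p \<in> polys_on A; q \<in> polys_on A\<rbrakk> \<Longrightarrow> p - q \<in> polys_on A"
    "\<lbrakk>p \<in> polys_on A; q \<in> polys_on A\<rbrakk> \<Longrightarrow> p * q \<in> polys_on A"
    "\<lbrakk>c \<in> A; p \<in> polys_on A\<rbrakk> \<Longrightarrow> smult c p \<in> polys_on A"
    "c \<in> A \<Longrightarrow> monom c k \<in> polys_on A" "c \<in> A \<Longrightarrow> [:c:] \<in> polys_on A" "0 \<in> polys_on A"
    "p \<in> polys_on A \<Longrightarrow> - p \<in> polys_on A"
proof -
  show add: "\<lbrakk>p \<in> polys_on A; q \<in> polys_on A\<rbrakk> \<Longrightarrow> p + q \<in> polys_on A" for p q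
    by (simp add: polys_on_def subring_onD[OF A])
  show neg: "p \<in> polys_on A \<Longrightarrow> - p \<in> polys_on A" for p
    by (simp add: polys_on_def subring_onD[OF A])
  show "\<lbrakk>p \<in> polys_on A; q \<in> polys_on A\<rbrakk> \<Longrightarrow> p - q \<in> polys_on A" using add[of p "- q"] neg[of q] by simp
  show "\<lbrakk>p \<in> polys_on A; q \<in> polys_on A\<rbrakk> \<Longrightarrow> p * q \<in> polys_on A"
    unfolding polys_on_def mem_Collect_eq coeff_mult
    by (intro allI subring_on_sum[OF A] subring_onD(4)[OF A]) auto
  show "\<lbrakk>c \<in> A; p \<in> polys_on A\<rbrakk> \<Longrightarrow> smult c p \<in> polys_on A"
    by (simp add: polys_on_def subring_onD[OF A])
  show "c \<in> A \<Longrightarrow> monom c k \<in> polys_on A" by (simp add: polys_on_def subring_onD[OF A])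
  show "c \<in> A \<Longrightarrow> [:c:] \<in> polys_on A"
    by (auto simp: polys_on_def subring_onD[OF A] coeff_pCons split: nat.split)
  show "0 \<in> polys_on A" by (simp add: polys_on_def subring_onD[OF A])
qed

lemma adjoin_subring: assumes A: "subring_on A" shows "subring_on (adjoin A x)"
proof -
  note c = polys_on_closed[OF A]
  have one: "1 \<in> adjoin A x"
    unfolding adjoin_def using c(6)[OF subring_onD(1)[OF A]] by (intro image_eqI[of _ _ "[:1:]"]) auto
  show ?thesis unfolding subring_on_def
  proof (intro conjI ballI one)
    fix u v assume "u \<in> adjoin A x" "v \<in> adjoin A x"
    then obtain p q where pq: "p \<in> polys_on A" "u = poly p x" "q \<in> polys_on A" "v = poly q x"
      unfolding adjoin_def by blast
    show "u + v \<in> adjoin A x" unfolding adjoin_def using c(1)[OF pq(1,3)] pq by (intro image_eqI[of _ _ "p + q"]) auto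
    show "u * v \<in> adjoin A x" unfolding adjoin_def using c(3)[OF pq(1,3)] pq by (intro image_eqI[of _ _ "p * q"]) auto
    show "- u \<in> adjoin A x" unfolding adjoin_def using c(8)[OF pq(1)] pq by (intro image_eqI[of _ _ "- p"]) auto
  qed
qed

lemma adjoin_base: assumes A: "subring_on A" shows "A \<subseteq> adjoin A x"
proof
  fix c assume "c \<in> A"
  then show "c \<in> adjoin A x"
    unfolding adjoin_def using polys_on_closed(6)[OF A] by (intro image_eqI[of _ _ "[:c:]"]) auto
qed

lemma adjoin_self: assumes A: "subring_on A" shows "x \<in> adjoin A x"
  unfolding adjoin_def using polys_on_closed(5)[OF A subring_onD(1)[OF A], of 1]
  by (intro image_eqI[of _ _ "monom 1 1"]) (auto simp: poly_monom)

lemma pseudo_division: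
  assumes A: "subring_on A" and q: "q \<in> polys_on A" "q \<noteq> 0" and p: "p \<in> polys_on A"
  shows "\<exists>k s r. s \<in> polys_on A \<and> r \<in> polys_on A \<and> smult (lead_coeff q ^ k) p = q * s + r \<and>
     (r = 0 \<or> degree r < degree q)"
  using p
proof (induction "if p = 0 then 0 else Suc (degree p)" arbitrary: p rule: less_induct)
  case less
  note c = polys_on_closed[OF A]
  show ?case
  proof (cases "p = 0 \<or> degree p < degree q")
    case True
    then show ?thesis using less.prems c(7) by (intro exI[of _ 0] exI[of _ p]) auto
  next
    case False
    define d where "d = degree p - degree q"
    define p' where "p' = smult (lead_coeff q) p - monom (lead_coeff p) d * q"
    have p': "p' \<in> polys_on A"
      unfolding p'_def
      by (rule c(2)[OF c(4)[OF polys_onD[OF q(1)] less.prems] c(3)[OF c(5)[OF polys_onD[OF less.prems]] q(1)]])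
    have deg: "degree p' \<le> degree p"
      unfolding p'_def
    proof (rule degree_diff_le)
      show "degree (smult (lead_coeff q) p) \<le> degree p" by simp
      have "degree (monom (lead_coeff p) d * q) \<le> d + degree q"
        using degree_mult_le[of "monom (lead_coeff p) d" q] degree_monom_le[of "lead_coeff p" d] by linarith
      then show "degree (monom (lead_coeff p) d * q) \<le> degree p" using False d_def by simp
    qed
    have "coeff p' (degree p) = 0"
    proof -
      have "degree p = d + degree q" using False d_def by simp
      then have "coeff (monom (lead_coeff p) d * q) (degree p) = lead_coeff p * lead_coeff q"
        by (simp add: coeff_monom_mult)
      then show ?thesis unfolding p'_def by simp
    qed
    then have "p' = 0 \<or> degree p' < degree p" using eq_zero_or_degree_less[OF deg] by blast
    then have lt: "(if p' = 0 then 0 else Suc (degree p')) < (if p = 0 then 0 else Suc (degree p))"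
      using False by auto
    obtain k s r where ksr: "s \<in> polys_on A" "r \<in> polys_on A"
      "smult (lead_coeff q ^ k) p' = q * s + r" "r = 0 \<or> degree r < degree q"
      using less.hyps[OF lt p'] by blast
    let ?m = "smult (lead_coeff q ^ k) (monom (lead_coeff p) d)"
    have "smult (lead_coeff q ^ Suc k) p = smult (lead_coeff q ^ k) (p' + monom (lead_coeff p) d * q)"
      unfolding p'_def by (simp add: mult.commute)
    also have "\<dots> = q * (s + ?m) + r"
      using ksr(3) by (simp add: smult_add_right algebra_simps)
    finally have "smult (lead_coeff q ^ Suc k) p = q * (s + ?m) + r" .
    moreover have "s + ?m \<in> polys_on A"
      by (rule c(1)[OF ksr(1) c(4)[OF subring_onD(6)[OF A polys_onD[OF q(1)]] c(5)[OF polys_onD[OF less.prems]]]])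
    ultimately show ?thesis using ksr(2,4) by blast
  qed
qed

context
  fixes A :: "'l::field set" and \<psi> :: "'l \<Rightarrow> 'o::field"
  assumes A: "subring_on A" and h: "hom_on A \<psi>"
begin

lemma map_on_coeff: "coeff (map_poly \<psi> p) i = \<psi> (coeff p i)"
  by (rule coeff_map_poly) (rule hom_onD(2)[OF h A])

lemma map_on_add:
  "p \<in> polys_on A \<Longrightarrow> q \<in> polys_on A \<Longrightarrow> map_poly \<psi> (p + q) = map_poly \<psi> p + map_poly \<psi> q"
  by (rule poly_eqI) (simp add: map_on_coeff hom_onD[OF h A] polys_onD)

lemma map_on_mult:
  assumes p: "p \<in> polys_on A" and q: "q \<in> polys_on A"
  shows "map_poly \<psi> (p * q) = map_poly \<psi> p * map_poly \<psi> q"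
proof (rule poly_eqI)
  fix i
  have "\<psi> (\<Sum>k\<le>i. coeff p k * coeff q (i - k)) = (\<Sum>k\<le>i. \<psi> (coeff p k * coeff q (i - k)))"
    by (rule hom_on_sum[OF h A]) (intro subring_onD(4)[OF A] polys_onD p q)
  also have "\<dots> = (\<Sum>k\<le>i. \<psi> (coeff p k) * \<psi> (coeff q (i - k)))"
    by (intro sum.cong hom_onD(4)[OF h A] polys_onD p q refl)
  finally show "coeff (map_poly \<psi> (p * q)) i = coeff (map_poly \<psi> p * map_poly \<psi> q) i"
    unfolding map_on_coeff coeff_mult .
qed

text \<open>Sending \<open>x\<close> to \<open>y\<close> is well defined if \<open>y\<close> satisfies the images of all polynomial relations of \<open>x\<close>.\<close>

lemma extend_by_value:
  assumes y: "\<And>p. p \<in> polys_on A \<Longrightarrow> poly p x = 0 \<Longrightarrow> poly (map_poly \<psi> p) y = 0"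
  shows "\<exists>\<psi>'. hom_on (adjoin A x) \<psi>' \<and> (\<forall>c\<in>A. \<psi>' c = \<psi> c) \<and>
    (\<forall>p\<in>polys_on A. \<psi>' (poly p x) = poly (map_poly \<psi> p) y)"
proof -
  define \<psi>' where "\<psi>' z = poly (map_poly \<psi> (SOME p. p \<in> polys_on A \<and> poly p x = z)) y" for z
  note c = polys_on_closed[OF A]
  have val: "\<psi>' (poly p x) = poly (map_poly \<psi> p) y" if p: "p \<in> polys_on A" for p
  proof -
    define q where "q = (SOME q. q \<in> polys_on A \<and> poly q x = poly p x)"
    have q: "q \<in> polys_on A \<and> poly q x = poly p x"
      unfolding q_def using someI[of "\<lambda>q. q \<in> polys_on A \<and> poly q x = poly p x" p] p by blast
    have "poly (map_poly \<psi> (q - p)) y = 0" using y[OF c(2)] q p by simp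
    moreover have "map_poly \<psi> ((q - p) + p) = map_poly \<psi> (q - p) + map_poly \<psi> p"
      using map_on_add c(2) q p by blast
    ultimately show ?thesis unfolding \<psi>'_def q_def[symmetric] by simp
  qed
  have base: "\<psi>' a = \<psi> a" if "a \<in> A" for a
    using val[OF c(6)[OF that]] hom_onD(2)[OF h A] by (simp add: map_poly_pCons)
  have "hom_on (adjoin A x) \<psi>'"
    unfolding hom_on_def
  proof (intro conjI ballI)
    show "\<psi>' 1 = 1" using base[OF subring_onD(1)[OF A]] hom_onD(1)[OF h A] by simp
    fix u v assume "u \<in> adjoin A x" "v \<in> adjoin A x"
    then obtain p q where pq: "p \<in> polys_on A" "u = poly p x" "q \<in> polys_on A" "v = poly q x"
      unfolding adjoin_def by blast
    show "\<psi>' (u + v) = \<psi>' u + \<psi>' v"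
      using val[OF c(1)[OF pq(1,3)]] val[OF pq(1)] val[OF pq(3)] map_on_add[OF pq(1,3)] pq(2,4) by simp
    show "\<psi>' (u * v) = \<psi>' u * \<psi>' v"
      using val[OF c(3)[OF pq(1,3)]] val[OF pq(1)] val[OF pq(3)] map_on_mult[OF pq(1,3)] pq(2,4) by simp
  qed
  then show ?thesis using base val by (intro exI[of _ \<psi>'] conjI ballI)
qed

end

lemma alg_closed_nonroot:
  fixes p :: "'o::alg_closed_field poly" assumes "p \<noteq> 0" shows "\<exists>y. poly p y \<noteq> 0"
proof (cases "degree p = 0")
  case True
  then obtain a where "p = [:a:]" by (rule degree_eq_zeroE)
  then show ?thesis using assms by simp
next
  case False
  then have "degree (p + (- 1)) = degree p" by (intro degree_add_eq_left) simp
  then have "degree (p - 1) > 0" using False by simp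
  then obtain y where "poly (p - 1) y = 0" using alg_closed_imp_poly_has_root by blast
  then show ?thesis by (intro exI[of _ y]) simp
qed

text \<open>If \<open>x\<close> is transcendental, any value works that is not a root of the image of the polynomial giving
  \<open>b\<close>, and \<open>a\<close> is the leading coefficient of that polynomial.  If \<open>x\<close> is algebraic, it is sent to a root of the image of a
  relation \<open>q\<close> of minimal degree; pseudo-division shows that this respects all relations as soon as the
  leading coefficient of \<open>q\<close> does not become zero, and that \<open>b\<close> divides a non-zero element of \<open>A\<close> in the
  ring generated by \<open>A\<close> and \<open>x\<close>.  The product of both is \<open>a\<close>.\<close>

lemma extend_hom:
  assumes A: "subring_on A" and b: "b \<in> adjoin A x" "b \<noteq> 0"
  shows "\<exists>a\<in>A. a \<noteq> 0 \<and> (\<forall>\<psi> :: 'l::field \<Rightarrow> 'o::alg_closed_field. hom_on A \<psi> \<longrightarrow> \<psi> a \<noteq> 0 \<longrightarrow>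
     (\<exists>\<psi>'. hom_on (adjoin A x) \<psi>' \<and> (\<forall>c\<in>A. \<psi>' c = \<psi> c) \<and> \<psi>' b \<noteq> 0))"
proof -
  obtain Bp where Bp: "Bp \<in> polys_on A" "b = poly Bp x" using b(1) unfolding adjoin_def by blast
  note c = polys_on_closed[OF A]
  show ?thesis
  proof (cases "\<exists>p\<in>polys_on A. p \<noteq> 0 \<and> poly p x = 0")
    case False
    have "Bp \<noteq> 0" using Bp b(2) by auto
    show ?thesis
    proof (intro bexI[of _ "lead_coeff Bp"] conjI allI impI)
      show "lead_coeff Bp \<noteq> 0" using \<open>Bp \<noteq> 0\<close> by simp
      show "lead_coeff Bp \<in> A" using polys_onD[OF Bp(1)] .
      fix \<psi> :: "'l \<Rightarrow> 'o" assume h: "hom_on A \<psi>" "\<psi> (lead_coeff Bp) \<noteq> 0"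
      then have "coeff (map_poly \<psi> Bp) (degree Bp) \<noteq> 0" using map_on_coeff[OF A h(1)] by simp
      then have "map_poly \<psi> Bp \<noteq> 0" by auto
      then obtain y where y: "poly (map_poly \<psi> Bp) y \<noteq> 0" using alg_closed_nonroot by blast
      have "poly (map_poly \<psi> p) y = 0" if "p \<in> polys_on A" "poly p x = 0" for p
        using that False by auto
      from extend_by_value[OF A h(1) this]
      obtain \<psi>' where p': "hom_on (adjoin A x) \<psi>'" "\<forall>c\<in>A. \<psi>' c = \<psi> c"
        "\<forall>p\<in>polys_on A. \<psi>' (poly p x) = poly (map_poly \<psi> p) y" by blast
      then have "\<psi>' b \<noteq> 0" using y Bp by simp
      then show "\<exists>\<psi>'. hom_on (adjoin A x) \<psi>' \<and> (\<forall>c\<in>A. \<psi>' c = \<psi> c) \<and> \<psi>' b \<noteq> 0"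
        using p'(1,2) by blast
    qed
  next
    case True
    define N where "N = {p \<in> polys_on A. p \<noteq> 0 \<and> poly p x = 0}"
    obtain q where q: "q \<in> N" "\<And>p. p \<in> N \<Longrightarrow> degree q \<le> degree p"
      using ex_has_least_nat[of "\<lambda>p. p \<in> N" _ degree] True N_def by blast
    have qA: "q \<in> polys_on A" "q \<noteq> 0" "poly q x = 0" using q(1) N_def by auto
    have small: "r = 0" if "r \<in> polys_on A" "poly r x = 0" "r = 0 \<or> degree r < degree q" for r
      using q(2)[of r] that N_def by fastforce
    define lq where "lq = lead_coeff q"
    have lq: "lq \<in> A" "lq \<noteq> 0" using polys_onD[OF qA(1)] qA(2) by (auto simp: lq_def)
    have degq: "degree q > 0"
    proof (rule ccontr)
      assume "\<not> degree q > 0"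
      then obtain a where "q = [:a:]" by (metis degree_eq_zeroE neq0_conv)
      then show False using qA by simp
    qed
    \<comment> \<open>A multiple of \<open>b\<close> of least degree in \<open>x\<close> has degree zero, hence is an element of \<open>A\<close>.\<close>
    define T where "T = {s \<in> polys_on A. s \<noteq> 0 \<and> degree s < degree q \<and> (\<exists>e\<in>polys_on A. poly s x = b * poly e x)}"
    have "T \<noteq> {}"
    proof -
      obtain k s r where ksr: "s \<in> polys_on A" "r \<in> polys_on A"
        "smult (lq ^ k) Bp = q * s + r" "r = 0 \<or> degree r < degree q"
        using pseudo_division[OF A qA(1,2) Bp(1)] unfolding lq_def by blast
      have "poly (smult (lq ^ k) Bp) x = poly r x" unfolding ksr(3) using qA(3) by simp
      then have rx: "poly r x = b * poly [:lq ^ k:] x" using Bp(2) by (simp add: mult.commute)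
      then have "r \<noteq> 0" using b(2) lq(2) by auto
      then have "r \<in> T" unfolding T_def
        using ksr(2,4) rx c(6)[OF subring_onD(6)[OF A lq(1), of k]] by (auto simp del: poly_pCons)
      then show ?thesis by blast
    qed
    then obtain s where s: "s \<in> T" "\<And>p. p \<in> T \<Longrightarrow> degree s \<le> degree p"
      using ex_has_least_nat[of "\<lambda>p. p \<in> T" _ degree] by blast
    obtain e where e: "e \<in> polys_on A" "poly s x = b * poly e x" using s(1) T_def by blast
    have sA: "s \<in> polys_on A" "s \<noteq> 0" "degree s < degree q" using s(1) T_def by auto
    have sx: "poly s x \<noteq> 0" using small[OF sA(1)] sA by blast
    have degs: "degree s = 0"
    proof (rule ccontr)
      assume ds: "degree s \<noteq> 0"
      obtain k t u where ktu: "t \<in> polys_on A" "u \<in> polys_on A"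
        "smult (lead_coeff s ^ k) q = s * t + u" "u = 0 \<or> degree u < degree s"
        using pseudo_division[OF A sA(1,2) qA(1)] by blast
      have ux: "poly u x = - poly s x * poly t x"
      proof -
        have "poly (smult (lead_coeff s ^ k) q) x = 0" using qA(3) by simp
        then show ?thesis unfolding ktu(3) by (simp add: add_eq_0_iff)
      qed
      show False
      proof (cases "u = 0")
        case True
        then have "poly t x = 0" using ux sx by simp
        have lk: "lead_coeff s ^ k \<noteq> 0" using sA(2) by simp
        have eq: "smult (lead_coeff s ^ k) q = s * t" using ktu(3) True by simp
        then have "t \<noteq> 0" using qA(2) lk by auto
        then have "degree q = degree s + degree t"
          using arg_cong[OF eq, of degree] sA(2) lk by (simp add: degree_mult_eq)
        then have "degree t < degree q" using ds by simp
        then show False using small[OF ktu(1) \<open>poly t x = 0\<close>] \<open>t \<noteq> 0\<close> by blast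
      next
        case False
        then have du: "degree u < degree s" using ktu(4) by blast
        have "poly u x = b * poly (- (e * t)) x" unfolding ux e(2) by simp
        moreover have "- (e * t) \<in> polys_on A" by (rule c(8)[OF c(3)[OF e(1) ktu(1)]])
        ultimately have "\<exists>e\<in>polys_on A. poly u x = b * poly e x" by (rule bexI)
        then have "u \<in> T" unfolding T_def using ktu(2) False du sA(3) by simp
        then show False using s(2) du by fastforce
      qed
    qed
    then obtain a0 where a0: "s = [:a0:]" by (metis degree_eq_zeroE)
    have a0A: "a0 \<in> A" "a0 \<noteq> 0" using polys_onD[OF sA(1), of 0] sA(2) a0 by auto
    show ?thesis
    proof (intro bexI[of _ "lq * a0"] conjI allI impI)
      show "lq * a0 \<noteq> 0" using lq a0A by simp
      show "lq * a0 \<in> A" using subring_onD(4)[OF A] lq a0A by blast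
      fix \<psi> :: "'l \<Rightarrow> 'o" assume h: "hom_on A \<psi>" "\<psi> (lq * a0) \<noteq> 0"
      then have nz: "\<psi> lq \<noteq> 0" "\<psi> a0 \<noteq> 0" using hom_onD(4)[OF h(1) A lq(1) a0A(1)] by auto
      have "coeff (map_poly \<psi> q) (degree q) \<noteq> 0" using map_on_coeff[OF A h(1)] nz(1) lq_def by simp
      then have "degree (map_poly \<psi> q) > 0" using degq le_degree by fastforce
      then obtain y where y: "poly (map_poly \<psi> q) y = 0" using alg_closed_imp_poly_has_root by blast
      have "poly (map_poly \<psi> p) y = 0" if p: "p \<in> polys_on A" "poly p x = 0" for p
      proof -
        obtain k t r where ktr: "t \<in> polys_on A" "r \<in> polys_on A"
          "smult (lq ^ k) p = q * t + r" "r = 0 \<or> degree r < degree q"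
          using pseudo_division[OF A qA(1,2) p(1)] unfolding lq_def by blast
        have "poly (smult (lq ^ k) p) x = poly r x" unfolding ktr(3) using qA(3) by simp
        then have "r = 0" using small[OF ktr(2) _ ktr(4)] p(2) by simp
        then have "[:lq ^ k:] * p = q * t" using ktr(3) by simp
        then have "map_poly \<psi> [:lq ^ k:] * map_poly \<psi> p = map_poly \<psi> q * map_poly \<psi> t"
          using map_on_mult[OF A h(1) c(6)[OF subring_onD(6)[OF A lq(1)]] p(1)] map_on_mult[OF A h(1) qA(1) ktr(1)]
          by metis
        then have "poly (map_poly \<psi> [:lq ^ k:]) y * poly (map_poly \<psi> p) y = 0"
          using y by (metis mult_zero_left poly_mult)
        moreover have "poly (map_poly \<psi> [:lq ^ k:]) y = \<psi> lq ^ k"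
          using hom_onD(2,5)[OF h(1) A] lq(1) by (simp add: map_poly_pCons)
        ultimately show ?thesis using nz(1) by simp
      qed
      from extend_by_value[OF A h(1) this]
      obtain \<psi>' where p': "hom_on (adjoin A x) \<psi>'" "\<forall>c\<in>A. \<psi>' c = \<psi> c" by blast
      have ex: "poly e x \<in> adjoin A x" using e(1) unfolding adjoin_def by blast
      have "\<psi>' a0 = \<psi>' b * \<psi>' (poly e x)"
        using hom_onD(4)[OF p'(1) adjoin_subring[OF A] b(1) ex] e(2) a0 by simp
      moreover have "\<psi>' a0 = \<psi> a0" using p'(2) a0A(1) by blast
      ultimately have "\<psi>' b \<noteq> 0" using nz(2) by auto
      then show "\<exists>\<psi>'. hom_on (adjoin A x) \<psi>' \<and> (\<forall>c\<in>A. \<psi>' c = \<psi> c) \<and> \<psi>' b \<noteq> 0"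
        using p' by blast
    qed
  qed
qed

fun adjoin_list :: "'l::field set \<Rightarrow> 'l list \<Rightarrow> 'l set" where
  "adjoin_list A [] = A"
| "adjoin_list A (x # xs) = adjoin_list (adjoin A x) xs"

lemma adjoin_list_subring: "subring_on A \<Longrightarrow> subring_on (adjoin_list A xs)"
  by (induction xs arbitrary: A) (auto simp: adjoin_subring)

lemma adjoin_list_base: "subring_on A \<Longrightarrow> A \<subseteq> adjoin_list A xs"
proof (induction xs arbitrary: A)
  case (Cons x xs)
  then show ?case using adjoin_base[OF Cons.prems, of x] Cons.IH[OF adjoin_subring[OF Cons.prems]] by (metis adjoin_list.simps(2) order_trans)
qed simp

lemma adjoin_list_set: "subring_on A \<Longrightarrow> set xs \<subseteq> adjoin_list A xs"
proof (induction xs arbitrary: A)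
  case (Cons x xs)
  have s: "subring_on (adjoin A x)" using adjoin_subring Cons.prems .
  show ?case using Cons.IH[OF s] adjoin_list_base[OF s, of xs] adjoin_self[OF Cons.prems, of x] by auto
qed simp

lemma extend_hom_list:
  assumes "subring_on A" "b \<in> adjoin_list A xs" "b \<noteq> 0"
  shows "\<exists>a\<in>A. a \<noteq> 0 \<and> (\<forall>\<psi> :: 'l::field \<Rightarrow> 'o::alg_closed_field. hom_on A \<psi> \<longrightarrow> \<psi> a \<noteq> 0 \<longrightarrow>
     (\<exists>\<psi>'. hom_on (adjoin_list A xs) \<psi>' \<and> (\<forall>c\<in>A. \<psi>' c = \<psi> c) \<and> \<psi>' b \<noteq> 0))"
  using assms
proof (induction xs arbitrary: A)
  case Nil
  then show ?case by (intro bexI[of _ b]) auto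
next
  case (Cons x xs)
  have s: "subring_on (adjoin A x)" using adjoin_subring Cons.prems(1) .
  obtain b' where b': "b' \<in> adjoin A x" "b' \<noteq> 0"
    "\<And>\<psi> :: 'l \<Rightarrow> 'o. hom_on (adjoin A x) \<psi> \<Longrightarrow> \<psi> b' \<noteq> 0 \<Longrightarrow>
     \<exists>\<psi>'. hom_on (adjoin_list (adjoin A x) xs) \<psi>' \<and> (\<forall>c\<in>adjoin A x. \<psi>' c = \<psi> c) \<and> \<psi>' b \<noteq> 0"
    using Cons.IH[OF s] Cons.prems by auto
  obtain a where a: "a \<in> A" "a \<noteq> 0"
    "\<And>\<psi> :: 'l \<Rightarrow> 'o. hom_on A \<psi> \<Longrightarrow> \<psi> a \<noteq> 0 \<Longrightarrow>
     \<exists>\<psi>'. hom_on (adjoin A x) \<psi>' \<and> (\<forall>c\<in>A. \<psi>' c = \<psi> c) \<and> \<psi>' b' \<noteq> 0"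
    using extend_hom[OF Cons.prems(1) b'(1,2)] by metis
  show ?case
  proof (intro bexI[OF _ a(1)] conjI a(2) allI impI)
    fix \<psi> :: "'l \<Rightarrow> 'o" assume h: "hom_on A \<psi>" "\<psi> a \<noteq> 0"
    obtain p1 where p1: "hom_on (adjoin A x) p1" "\<forall>c\<in>A. p1 c = \<psi> c" "p1 b' \<noteq> 0" using a(3)[OF h] by blast
    obtain p2 where p2: "hom_on (adjoin_list (adjoin A x) xs) p2" "\<forall>c\<in>adjoin A x. p2 c = p1 c" "p2 b \<noteq> 0"
      using b'(3)[OF p1(1,3)] by blast
    have "\<forall>c\<in>A. p2 c = \<psi> c" using p1(2) p2(2) adjoin_base[OF Cons.prems(1), of x] by auto
    then show "\<exists>\<psi>'. hom_on (adjoin_list A (x # xs)) \<psi>' \<and> (\<forall>c\<in>A. \<psi>' c = \<psi> c) \<and> \<psi>' b \<noteq> 0"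
      using p2(1,3) by auto
  qed
qed

text \<open>A weak form of Hilbert's Nullstellensatz: the coordinates \<open>c\<close> generate a ring over the ground field,
  and a homomorphism from it to an algebraically closed field can be built one generator at
  a time while keeping the value of \<open>f\<close> different from zero.\<close>

theorem specialize_point:
  fixes \<phi> :: "'k::field \<Rightarrow> 'l::field" and \<eta> :: "'k \<Rightarrow> 'o::alg_closed_field" and c :: "'v \<Rightarrow> 'l"
  assumes \<phi>: "field_hom \<phi>" and \<eta>: "field_hom \<eta>" and V: "finite V"
    and f: "f \<in> carrier (mpoly_ring V)" "mpoly_at \<phi> c f \<noteq> 0"
  obtains d :: "'v \<Rightarrow> 'o" where "mpoly_at \<eta> d f \<noteq> 0"
    "\<And>g. g \<in> carrier (mpoly_ring V) \<Longrightarrow> mpoly_at \<phi> c g = 0 \<Longrightarrow> mpoly_at \<eta> d g = 0"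
proof -
  interpret \<phi>: field_hom \<phi> by fact
  interpret \<eta>: field_hom \<eta> by fact
  define A where "A = range \<phi>"
  have A: "subring_on A"
    unfolding subring_on_def A_def
    by (auto simp: \<phi>.hom_add[symmetric] \<phi>.hom_mult[symmetric] \<phi>.hom_uminus[symmetric]
        intro: range_eqI[of _ _ 1])
  define \<psi> where "\<psi> x = \<eta> (inv_into UNIV \<phi> x)" for x
  have inj: "inj \<phi>" using \<phi>.inj_f .
  have \<psi>\<phi>: "\<psi> (\<phi> x) = \<eta> x" for x unfolding \<psi>_def using inj by simp
  have h: "hom_on A \<psi>"
    unfolding hom_on_def A_def
    using \<psi>\<phi>[of 1] by (auto simp: \<phi>.hom_add[symmetric] \<phi>.hom_mult[symmetric] \<psi>\<phi> \<eta>.hom_add \<eta>.hom_mult)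
  obtain xs where xs: "set xs = c ` V" using finite_list[OF finite_imageI[OF V, of c]] by blast
  define T where "T = adjoin_list A xs"
  have T: "subring_on T" unfolding T_def using adjoin_list_subring[OF A] .
  have AT: "A \<subseteq> T" unfolding T_def using adjoin_list_base[OF A] .
  have cT: "c v \<in> T" if "v \<in> V" for v using adjoin_list_set[OF A, of xs] xs that T_def by auto
  have monT: "monomial_at c m \<in> T" if "keys m \<subseteq> V" for m
    unfolding monomial_at_def using that by (intro subring_on_prod[OF T] subring_onD(6)[OF T] cT) auto
  have termT: "\<phi> (lookup g m) * monomial_at c m \<in> T"
    if "g \<in> carrier (mpoly_ring V)" "m \<in> keys g" for g m
  proof (rule subring_onD(4)[OF T])
    show "\<phi> (lookup g m) \<in> T" using AT A_def by auto
    show "monomial_at c m \<in> T" using monT that by (simp add: mpoly_ring_carrier)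
  qed
  have "mpoly_at \<phi> c f \<in> T" unfolding mpoly_at_alt by (rule subring_on_sum[OF T termT[OF f(1)]])
  then obtain a where a: "a \<in> A" "a \<noteq> 0" "\<And>\<psi> :: 'l \<Rightarrow> 'o. hom_on A \<psi> \<Longrightarrow> \<psi> a \<noteq> 0 \<Longrightarrow>
     (\<exists>\<psi>'. hom_on T \<psi>' \<and> (\<forall>c\<in>A. \<psi>' c = \<psi> c) \<and> \<psi>' (mpoly_at \<phi> c f) \<noteq> 0)"
    using extend_hom_list[OF A _ f(2), of xs] unfolding T_def by metis
  have "\<psi> a \<noteq> 0" using a(1,2) \<psi>\<phi> unfolding A_def by auto
  then obtain \<psi>' where p: "hom_on T \<psi>'" "\<forall>c\<in>A. \<psi>' c = \<psi> c" "\<psi>' (mpoly_at \<phi> c f) \<noteq> 0"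
    using a(3)[OF h] by blast
  define d where "d v = \<psi>' (c v)" for v
  have val: "mpoly_at \<eta> d g = \<psi>' (mpoly_at \<phi> c g)" if g: "g \<in> carrier (mpoly_ring V)" for g
  proof -
    have "\<psi>' (mpoly_at \<phi> c g) = (\<Sum>m\<in>keys g. \<psi>' (\<phi> (lookup g m) * monomial_at c m))"
      unfolding mpoly_at_alt by (rule hom_on_sum[OF p(1) T termT[OF g]])
    also have "\<dots> = (\<Sum>m\<in>keys g. \<eta> (lookup g m) * monomial_at d m)"
    proof (rule sum.cong[OF refl])
      fix m assume m: "m \<in> keys g"
      have mV: "keys m \<subseteq> V" using g m by (simp add: mpoly_ring_carrier)
      have "\<psi>' (monomial_at c m) = (\<Prod>v\<in>keys m. \<psi>' (c v ^ lookup m v))"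
        unfolding monomial_at_def using mV by (intro hom_on_prod[OF p(1) T] subring_onD(6)[OF T] cT) auto
      also have "\<dots> = monomial_at d m"
        unfolding monomial_at_def d_def using mV by (intro prod.cong hom_onD(5)[OF p(1) T] cT) auto
      finally have "\<psi>' (monomial_at c m) = monomial_at d m" .
      moreover have "\<psi>' (\<phi> z) = \<eta> z" for z using p(2) \<psi>\<phi> by (simp add: A_def)
      moreover have "\<phi> z \<in> T" for z using AT A_def by auto
      ultimately show "\<psi>' (\<phi> (lookup g m) * monomial_at c m) =
         \<eta> (lookup g m) * monomial_at d m"
        using hom_onD(4)[OF p(1) T _ monT[OF mV]] by simp
    qed
    finally show ?thesis unfolding mpoly_at_alt by simp
  qed
  show thesis
  proof (rule that[of d])
    show "mpoly_at \<eta> d f \<noteq> 0" using val[OF f(1)] p(3) by simp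
    show "mpoly_at \<eta> d g = 0" if "g \<in> carrier (mpoly_ring V)" "mpoly_at \<phi> c g = 0" for g
      using val[OF that(1)] that(2) hom_onD(2)[OF p(1) T] by simp
  qed
qed

section \<open>Minors and dimensions\<close>

lemma fun_sum_apply: "(\<Sum>j\<in>J. g j) i = (\<Sum>j\<in>J. g j i :: 'b::comm_monoid_add)"
  by (induction J rule: infinite_finite_induct) auto

text \<open>Independence of a family, so that repeated columns of a matrix count as dependent.\<close>

definition fam_indep :: "('j \<Rightarrow> 'i \<Rightarrow> 'l::field) \<Rightarrow> 'j set \<Rightarrow> bool" where
  "fam_indep f J \<longleftrightarrow> (\<forall>c. (\<forall>i. (\<Sum>j\<in>J. c j * f j i) = 0) \<longrightarrow> (\<forall>j\<in>J. c j = 0))"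

lemma fam_indepD: "fam_indep f J \<Longrightarrow> (\<And>i. (\<Sum>j\<in>J. c j * f j i) = 0) \<Longrightarrow> j \<in> J \<Longrightarrow> c j = 0"
  unfolding fam_indep_def by blast

lemma fam_indep_iff:
  assumes "finite J" "inj_on f J"
  shows "fam_indep f J \<longleftrightarrow> funs.independent (f ` J)"
proof
  assume f: "fam_indep f J"
  show "funs.independent (f ` J)"
  proof (rule funs.independent_if_scalars_zero)
    show "finite (f ` J)" using assms(1) by simp
    fix u x assume z: "(\<Sum>x\<in>f ` J. (\<lambda>i. u x * x i)) = 0" and x: "x \<in> f ` J"
    obtain j where j: "j \<in> J" "x = f j" using x by blast
    have "(\<Sum>j\<in>J. u (f j) * f j i) = 0" for i
    proof -
      have "(\<Sum>j\<in>J. u (f j) * f j i) = (\<Sum>x\<in>f ` J. (\<lambda>i. u x * x i)) i"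
        unfolding fun_sum_apply by (simp add: sum.reindex[OF assms(2)])
      then show ?thesis using z by simp
    qed
    from fam_indepD[OF f this j(1)] show "u x = 0" using j(2) by simp
  qed
next
  assume ind: "funs.independent (f ` J)"
  show "fam_indep f J"
    unfolding fam_indep_def
  proof (intro allI impI ballI)
    fix c j assume z: "\<forall>i. (\<Sum>j\<in>J. c j * f j i) = 0" and j: "j \<in> J"
    define u where "u x = c (inv_into J f x)" for x
    have uf: "u (f j) = c j" if "j \<in> J" for j using that assms(2) by (simp add: u_def)
    have "(\<Sum>x\<in>f ` J. (\<lambda>i. u x * x i)) = 0"
    proof
      fix i
      have "(\<Sum>x\<in>f ` J. (\<lambda>i. u x * x i)) i = (\<Sum>j\<in>J. u (f j) * f j i)"
        unfolding fun_sum_apply by (simp add: sum.reindex[OF assms(2)])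
      also have "\<dots> = (\<Sum>j\<in>J. c j * f j i)" by (intro sum.cong) (auto simp: uf)
      finally show "(\<Sum>x\<in>f ` J. (\<lambda>i. u x * x i)) i = 0 i" using z by simp
    qed
    then have "u (f j) = 0"
      using funs.independentD[OF ind, of "f ` J" u "f j"] assms(1) j by simp
    then show "c j = 0" using uf[OF j] by simp
  qed
qed

lemma fam_indep_inj:
  assumes "finite J" "fam_indep f J" shows "inj_on f J"
proof (rule inj_onI)
  fix a b assume ab: "a \<in> J" "b \<in> J" "f a = f b"
  show "a = b"
  proof (rule ccontr)
    assume n: "a \<noteq> b"
    define c where "c j = (if j = a then 1 else if j = b then - 1 else (0::'c))" for j
    have "(\<Sum>j\<in>J. c j * f j i) = 0" for i
    proof -
      have "(\<Sum>j\<in>J. c j * f j i) = (\<Sum>j\<in>J. if j = a then f a i else 0) + (\<Sum>j\<in>J. if j = b then - f b i else 0)"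
        unfolding sum.distrib[symmetric] using n by (intro sum.cong) (auto simp: c_def)
      then show ?thesis using assms(1) ab by simp
    qed
    from fam_indepD[OF assms(2) this ab(1)] show False by (simp add: c_def)
  qed
qed

lemma dim_ge_iff:
  assumes "finite A"
  shows "k \<le> funs.dim (funs.span (f ` A)) \<longleftrightarrow> (\<exists>J\<subseteq>A. card J = k \<and> fam_indep f J)"
proof
  assume k: "k \<le> funs.dim (funs.span (f ` A))"
  obtain S where S: "S \<subseteq> f ` A" "funs.independent S" "f ` A \<subseteq> funs.span S" "card S = funs.dim (f ` A)"
    using funs.basis_exists by blast
  have "k \<le> card S" using k S(4) by simp
  then obtain S' where S': "S' \<subseteq> S" "card S' = k" by (meson obtain_subset_with_card_n)
  obtain J where J: "J \<subseteq> A" "inj_on f J" "S' = f ` J"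
    using subset_image_inj[of S' f A] S' S(1) by blast
  have fJ: "finite J" using J(1) assms finite_subset by blast
  have "fam_indep f J" using fam_indep_iff[OF fJ J(2)] funs.independent_mono[OF S(2) S'(1)] J(3) by simp
  moreover have "card J = k" using card_image[OF J(2)] J(3) S'(2) by simp
  ultimately show "\<exists>J\<subseteq>A. card J = k \<and> fam_indep f J" using J(1) by blast
next
  assume "\<exists>J\<subseteq>A. card J = k \<and> fam_indep f J"
  then obtain J where J: "J \<subseteq> A" "card J = k" "fam_indep f J" by blast
  have fJ: "finite J" using J(1) assms finite_subset by blast
  have inj: "inj_on f J" using fam_indep_inj[OF fJ J(3)] .
  have ind: "funs.independent (f ` J)" using fam_indep_iff[OF fJ inj] J(3) by simp
  obtain S where S: "S \<subseteq> f ` A" "funs.independent S" "f ` A \<subseteq> funs.span S" "card S = funs.dim (f ` A)"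
    using funs.basis_exists by blast
  have "finite S" using S(1) assms finite_subset by blast
  moreover have "f ` J \<subseteq> funs.span S" using J(1) S(3) by blast
  ultimately have "card (f ` J) \<le> card S" using funs.independent_span_bound[OF _ ind] by blast
  then show "k \<le> funs.dim (funs.span (f ` A))" using S(4) card_image[OF inj] J(2) by simp
qed

lemma pick_bij: assumes "finite I" shows "bij_betw (pick I) {..<card I} I"
proof -
  have sub: "I \<subseteq> pick I ` {..<card I}"
  proof
    fix i assume i: "i \<in> I"
    have "card {a \<in> I. a < i} < card I" using assms i by (intro psubset_card_mono) auto
    then have "pick I (card {a \<in> I. a < i}) \<in> pick I ` {..<card I}" by simp
    then show "i \<in> pick I ` {..<card I}" unfolding pick_card_in_set[OF i] .
  qed
  moreover have "pick I ` {..<card I} \<subseteq> I" using pick_in_set_le by auto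
  ultimately have "pick I ` {..<card I} = I" by blast
  then show ?thesis unfolding bij_betw_def using eq_card_imp_inj_on[of "{..<card I}" "pick I"] by simp
qed

lemma det_nonzero_iff:
  fixes A :: "'l::field mat" assumes A: "A \<in> carrier_mat k k"
  shows "det A \<noteq> 0 \<longleftrightarrow> (\<forall>c. (\<forall>i<k. (\<Sum>j<k. A $$ (i, j) * c j) = 0) \<longrightarrow> (\<forall>j<k. c j = 0))"
proof -
  have mv: "A *\<^sub>v vec k c = 0\<^sub>v k \<longleftrightarrow> (\<forall>i<k. (\<Sum>j<k. A $$ (i, j) * c j) = 0)" for c
    using A by (auto simp: vec_eq_iff scalar_prod_def atLeast0LessThan)
  have z: "vec k c = 0\<^sub>v k \<longleftrightarrow> (\<forall>j<k. c j = 0)" for c :: "nat \<Rightarrow> 'l" by (auto simp: vec_eq_iff)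
  have "det A = 0 \<longleftrightarrow> (\<exists>c. vec k c \<noteq> 0\<^sub>v k \<and> A *\<^sub>v vec k c = 0\<^sub>v k)"
    unfolding det_0_iff_vec_prod_zero_field[OF A]
  proof
    assume "\<exists>v. v \<in> carrier_vec k \<and> v \<noteq> 0\<^sub>v k \<and> A *\<^sub>v v = 0\<^sub>v k"
    then obtain v where v: "v \<in> carrier_vec k" "v \<noteq> 0\<^sub>v k" "A *\<^sub>v v = 0\<^sub>v k" by blast
    have "vec k (\<lambda>i. v $ i) = v" using v(1) by (intro eq_vecI) auto
    then show "\<exists>c. vec k c \<noteq> 0\<^sub>v k \<and> A *\<^sub>v vec k c = 0\<^sub>v k" using v by metis
  next
    assume "\<exists>c. vec k c \<noteq> 0\<^sub>v k \<and> A *\<^sub>v vec k c = 0\<^sub>v k"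
    then obtain c where "vec k c \<noteq> 0\<^sub>v k" "A *\<^sub>v vec k c = 0\<^sub>v k" by blast
    then show "\<exists>v. v \<in> carrier_vec k \<and> v \<noteq> 0\<^sub>v k \<and> A *\<^sub>v v = 0\<^sub>v k"
      by (intro exI[of _ "vec k c"]) simp
  qed
  then show ?thesis unfolding mv z by blast
qed

lemma det_nonzero_iff_rows:
  fixes A :: "'l::field mat" assumes A: "A \<in> carrier_mat k k"
  shows "det A \<noteq> 0 \<longleftrightarrow> (\<forall>c. (\<forall>j<k. (\<Sum>i<k. A $$ (i, j) * c i) = 0) \<longrightarrow> (\<forall>i<k. c i = 0))"
  using det_nonzero_iff[of "transpose_mat A" k] A det_transpose[OF A] by simp

definition colf :: "'l::field mat \<Rightarrow> nat \<Rightarrow> nat \<Rightarrow> 'l" where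
  "colf M j = (\<lambda>i. if i < dim_row M then M $$ (i, j) else 0)"

lemma submatrix_carrier:
  assumes "I \<subseteq> {..<dim_row M}" "J \<subseteq> {..<dim_col M}"
  shows "submatrix M I J \<in> carrier_mat (card I) (card J)"
    "\<And>a b. a < card I \<Longrightarrow> b < card J \<Longrightarrow> submatrix M I J $$ (a, b) = M $$ (pick I a, pick J b)"
proof -
  have e: "{i. i < dim_row M \<and> i \<in> I} = I" "{j. j < dim_col M \<and> j \<in> J} = J" using assms by auto
  show "submatrix M I J \<in> carrier_mat (card I) (card J)" unfolding submatrix_def e by simp
  show "submatrix M I J $$ (a, b) = M $$ (pick I a, pick J b)" if "a < card I" "b < card J" for a b
    unfolding submatrix_def e using that by simp
qed

lemma minor_columns:
  fixes M :: "'l::field mat"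
  assumes I: "I \<subseteq> {..<dim_row M}" "card I = k" and J: "J \<subseteq> {..<dim_col M}" "card J = k"
    and d: "det (submatrix M I J) \<noteq> 0"
  shows "fam_indep (colf M) J"
  unfolding fam_indep_def
proof (intro allI impI ballI)
  fix c j assume z: "\<forall>i. (\<Sum>j\<in>J. c j * colf M j i) = 0" and j: "j \<in> J"
  note s = submatrix_carrier[OF I(1) J(1), unfolded I(2) J(2)]
  have fJ: "finite J" and fI: "finite I" using J(1) I(1) finite_subset by blast+
  have bJ: "bij_betw (pick J) {..<k} J" and bI: "bij_betw (pick I) {..<k} I"
    using pick_bij[OF fJ] pick_bij[OF fI] J(2) I(2) by auto
  have "(\<Sum>b<k. submatrix M I J $$ (a, b) * c (pick J b)) = 0" if a: "a < k" for a
  proof -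
    have "pick I a \<in> I" using bI a by (auto simp: bij_betw_def)
    then have pa: "pick I a < dim_row M" using I(1) by auto
    have "(\<Sum>b<k. submatrix M I J $$ (a, b) * c (pick J b)) = (\<Sum>b<k. c (pick J b) * colf M (pick J b) (pick I a))"
      using s(2)[OF a] pa by (intro sum.cong) (auto simp: colf_def mult.commute)
    also have "\<dots> = (\<Sum>j\<in>J. c j * colf M j (pick I a))"
      by (rule sum.reindex_bij_betw[OF bJ])
    finally show ?thesis using z by simp
  qed
  then have "\<forall>b<k. c (pick J b) = 0" 
    using d[unfolded det_nonzero_iff[OF s(1)], THEN spec, of "\<lambda>b. c (pick J b)"] by blast
  moreover have "j \<in> pick J ` {..<k}" using bJ j unfolding bij_betw_def by simp
  ultimately show "c j = 0" by auto
qed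

lemma coordinate_space:
  fixes k :: nat
  defines "V \<equiv> {x :: nat \<Rightarrow> 'l::field. \<forall>j\<ge>k. x j = 0}"
  shows "V \<subseteq> funs.span ((\<lambda>j i. if i = j then 1 else 0) ` {..<k})" "funs.dim V = k"
proof -
  let ?u = "\<lambda>j i. if i = j then (1::'l) else 0"
  have V: "funs.subspace V" unfolding V_def by (rule funs.subspaceI) auto
  show Vs: "V \<subseteq> funs.span (?u ` {..<k})"
  proof
    fix x assume "x \<in> V"
    then show "x \<in> funs.span (?u ` {..<k})" unfolding V_def by (intro funs_finite_support_span) auto
  qed
  have uind: "fam_indep ?u {..<k}"
    unfolding fam_indep_def
  proof (intro allI impI ballI)
    fix c :: "nat \<Rightarrow> 'l" and j assume z: "\<forall>i. (\<Sum>j<k. c j * ?u j i) = 0" and j: "j \<in> {..<k}"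
    have "(\<Sum>j'<k. c j' * ?u j' j) = (\<Sum>j'<k. if j' = j then c j else 0)" by (intro sum.cong) auto
    then show "c j = 0" using z j by simp
  qed
  have "funs.span (?u ` {..<k}) \<subseteq> V" by (rule funs.span_minimal[OF _ V]) (auto simp: V_def)
  then have e: "V = funs.span (?u ` {..<k})" using Vs by blast
  have "k \<le> funs.dim V" unfolding e using dim_ge_iff[of "{..<k}" k ?u] uind by auto
  moreover have "funs.dim V \<le> card (?u ` {..<k})" by (rule funs.dim_le_card[OF Vs]) simp
  moreover have "card (?u ` {..<k}) \<le> k" using card_image_le[of "{..<k}" ?u] by simp
  ultimately show "funs.dim V = k" by simp
qed

text \<open>Independent columns have a non-vanishing minor: the rows of the selected columns span a space of full dimension,
  and a basis of it can be chosen among the rows.\<close>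

lemma columns_minor:
  fixes M :: "'l::field mat"
  assumes J: "J \<subseteq> {..<dim_col M}" "card J = k" and ind: "fam_indep (colf M) J"
  obtains I where "I \<subseteq> {..<dim_row M}" "card I = k" "det (submatrix M I J) \<noteq> 0"
proof -
  have fJ: "finite J" using J(1) finite_subset by blast
  have bJ: "bij_betw (pick J) {..<k} J" using pick_bij[OF fJ] J(2) by auto
  define rowf where "rowf i = (\<lambda>b. if b < k then M $$ (i, pick J b) else 0)" for i
  let ?V = "{x :: nat \<Rightarrow> 'l. \<forall>j\<ge>k. x j = 0}"
  let ?b = "\<lambda>x y :: nat \<Rightarrow> 'l. \<Sum>j<k. x j * y j"
  let ?u = "\<lambda>j i. if i = j then (1::'l) else 0"
  let ?W = "funs.span (rowf ` {..<dim_row M})"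
  have V: "funs.subspace ?V" by (rule funs.subspaceI) auto
  have Vs: "?V \<subseteq> funs.span (?u ` {..<k})" by (rule coordinate_space(1))
  have dV: "k \<le> funs.dim ?V" using coordinate_space(2)[of k, where 'l = 'l] by simp
  have WV: "?W \<subseteq> ?V" by (rule funs.span_minimal[OF _ V]) (auto simp: rowf_def)
  have perp: "funs.dim {v \<in> ?V. \<forall>w\<in>?W. ?b v w = 0} + funs.dim ?W = funs.dim ?V"
  proof (rule funs.perp_dim[OF V Vs])
    show "finite (?u ` {..<k})" by (rule finite_imageI) simp
    show "\<exists>y\<in>?V. ?b x y \<noteq> 0" if x: "x \<in> ?V" "x \<noteq> 0" for x
    proof -
      obtain j where j: "x j \<noteq> 0" using x(2) by (auto simp: fun_eq_iff)
      have jk: "j < k"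
      proof (rule ccontr)
        assume "\<not> j < k"
        then have "x j = 0" using x(1) by simp
        then show False using j by simp
      qed
      have "?b x (?u j) = (\<Sum>i<k. if i = j then x j else 0)" by (intro sum.cong) auto
      then have "?b x (?u j) = x j" using jk by simp
      then show ?thesis using j jk by (intro bexI[of _ "?u j"]) auto
    qed
  qed (use WV in \<open>auto simp: algebra_simps sum.distrib sum_distrib_left\<close>)
  have "{v \<in> ?V. \<forall>w\<in>?W. ?b v w = 0} \<subseteq> {0}"
  proof
    fix x assume x: "x \<in> {v \<in> ?V. \<forall>w\<in>?W. ?b v w = 0}"
    define c where "c j = x (inv_into {..<k} (pick J) j)" for j
    have cp: "c (pick J b) = x b" if "b < k" for b
      using bJ that by (simp add: c_def bij_betw_def inv_into_f_f)
    have "(\<Sum>j\<in>J. c j * colf M j i) = 0" for i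
    proof (cases "i < dim_row M")
      case True
      have "(\<Sum>j\<in>J. c j * colf M j i) = (\<Sum>b<k. c (pick J b) * colf M (pick J b) i)"
        by (rule sum.reindex_bij_betw[OF bJ, symmetric])
      also have "\<dots> = ?b x (rowf i)" using True by (intro sum.cong) (auto simp: cp colf_def rowf_def)
      also have "\<dots> = 0"
      proof -
        have "rowf i \<in> ?W" using True by (intro funs.span_base) auto
        moreover have "\<forall>w\<in>?W. ?b x w = 0" using x by simp
        ultimately show ?thesis by (rule bspec[rotated])
      qed
      finally show ?thesis .
    qed (simp add: colf_def)
    then have "\<forall>j\<in>J. c j = 0" using ind[unfolded fam_indep_def, THEN spec, of c] by blast
    then have "x b = 0" if "b < k" for b using cp[OF that] bij_betwE[OF bJ] that by auto
    then show "x \<in> {0}" using x by (auto simp: fun_eq_iff not_le[symmetric])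
  qed
  then have "funs.dim {v \<in> ?V. \<forall>w\<in>?W. ?b v w = 0} \<le> 0"
    using funs.dim_le_card[of _ "{}"] by simp
  then have "k \<le> funs.dim ?W" using perp dV by simp
  then obtain I where I: "I \<subseteq> {..<dim_row M}" "card I = k" "fam_indep rowf I"
    using dim_ge_iff[of "{..<dim_row M}" k rowf] by auto
  note s = submatrix_carrier[OF I(1) J(1), unfolded I(2) J(2)]
  have fI: "finite I" using I(1) finite_subset by blast
  have bI: "bij_betw (pick I) {..<k} I" using pick_bij[OF fI] I(2) by auto
  have "det (submatrix M I J) \<noteq> 0"
    unfolding det_nonzero_iff_rows[OF s(1)]
  proof (intro allI impI)
    fix c i assume z: "\<forall>b<k. (\<Sum>a<k. submatrix M I J $$ (a, b) * c a) = 0" and i: "i < k"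
    define e where "e j = c (inv_into {..<k} (pick I) j)" for j
    have ep: "e (pick I a) = c a" if "a < k" for a
      using bI that by (simp add: e_def bij_betw_def inv_into_f_f)
    have "(\<Sum>j\<in>I. e j * rowf j b) = 0" for b
    proof (cases "b < k")
      case True
      have "(\<Sum>j\<in>I. e j * rowf j b) = (\<Sum>a<k. e (pick I a) * rowf (pick I a) b)"
        by (rule sum.reindex_bij_betw[OF bI, symmetric])
      also have "\<dots> = (\<Sum>a<k. submatrix M I J $$ (a, b) * c a)"
        using True s(2) by (intro sum.cong) (auto simp: ep rowf_def mult.commute)
      finally show ?thesis using z True by simp
    qed (simp add: rowf_def)
    moreover have "pick I i \<in> I" using bij_betwE[OF bI] i by simp
    ultimately have "e (pick I i) = 0" by (rule fam_indepD[OF I(3)])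
    then show "c i = 0" using ep[OF i] by simp
  qed
  then show thesis using that I(1,2) by blast
qed

lemma minors_vanish_iff:
  fixes M :: "'l::field mat"
  shows "(\<forall>d\<in>minors (k + 1) M. d = 0) \<longleftrightarrow> funs.dim (funs.span (colf M ` {..<dim_col M})) \<le> k"
proof -
  have "(\<exists>d\<in>minors (k + 1) M. d \<noteq> 0) \<longleftrightarrow> (\<exists>J\<subseteq>{..<dim_col M}. card J = k + 1 \<and> fam_indep (colf M) J)"
  proof
    assume "\<exists>d\<in>minors (k + 1) M. d \<noteq> 0"
    then show "\<exists>J\<subseteq>{..<dim_col M}. card J = k + 1 \<and> fam_indep (colf M) J"
      unfolding minors_def using minor_columns by blast
  next
    assume "\<exists>J\<subseteq>{..<dim_col M}. card J = k + 1 \<and> fam_indep (colf M) J"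
    then obtain J where J: "J \<subseteq> {..<dim_col M}" "card J = k + 1" "fam_indep (colf M) J" by blast
    obtain I where "I \<subseteq> {..<dim_row M}" "card I = k + 1" "det (submatrix M I J) \<noteq> 0"
      using columns_minor[OF J] .
    then show "\<exists>d\<in>minors (k + 1) M. d \<noteq> 0" unfolding minors_def using J by blast
  qed
  also have "\<dots> \<longleftrightarrow> k + 1 \<le> funs.dim (funs.span (colf M ` {..<dim_col M}))"
    using dim_ge_iff[of "{..<dim_col M}" "k + 1" "colf M"] by simp
  finally show ?thesis by auto
qed

section \<open>Zero sets of ideals and specialized matrices\<close>

context
  fixes h :: "('v, 'k::field) mpoly \<Rightarrow> 'l::field" and V :: "'v set"
  assumes hom: "comm_ring_hom h"
begin

interpretation h: comm_ring_hom h by (rule hom)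

lemma kernel_ideal: "ideal {f \<in> carrier (mpoly_ring V). h f = 0} (mpoly_ring V)"
proof -
  interpret cring "mpoly_ring V :: ('v, 'k) mpoly ring" by (rule mpoly_ring_cring)
  show ?thesis
    by (rule ideal_by_closure)
      (auto simp: h.hom_add h.hom_mult mpoly_ring_add_closed mpoly_ring_mult_closed mpoly_ring_carrier[of 0])
qed

lemma vanish_Idl:
  assumes "S \<subseteq> carrier (mpoly_ring V)"
  shows "(\<forall>f\<in>Idl\<^bsub>mpoly_ring V\<^esub> S. h f = 0) \<longleftrightarrow> (\<forall>f\<in>S. h f = 0)"
proof
  interpret cring "mpoly_ring V :: ('v, 'k) mpoly ring" by (rule mpoly_ring_cring)
  show "\<forall>f\<in>Idl\<^bsub>mpoly_ring V\<^esub> S. h f = 0 \<Longrightarrow> \<forall>f\<in>S. h f = 0" using genideal_self[OF assms] by blast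
  assume "\<forall>f\<in>S. h f = 0"
  then have "S \<subseteq> {f \<in> carrier (mpoly_ring V). h f = 0}" using assms by blast
  then have "Idl\<^bsub>mpoly_ring V\<^esub> S \<subseteq> {f \<in> carrier (mpoly_ring V). h f = 0}"
    by (rule genideal_minimal[OF kernel_ideal])
  then show "\<forall>f\<in>Idl\<^bsub>mpoly_ring V\<^esub> S. h f = 0" by blast
qed

lemma vanish_sum:
  assumes "ideal I (mpoly_ring V)" "ideal J (mpoly_ring V)"
  shows "(\<forall>f\<in>I <+>\<^bsub>mpoly_ring V\<^esub> J. h f = 0) \<longleftrightarrow> (\<forall>f\<in>I. h f = 0) \<and> (\<forall>f\<in>J. h f = 0)"
proof -
  have e: "I <+>\<^bsub>mpoly_ring V\<^esub> J = {a + b | a b. a \<in> I \<and> b \<in> J}"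
    unfolding set_add_def' by auto
  have "a \<in> I <+>\<^bsub>mpoly_ring V\<^esub> J" if "a \<in> I" for a
    unfolding e using that mpoly_ideal(2)[OF assms(2)] by (intro CollectI exI[of _ a] exI[of _ 0]) simp
  moreover have "b \<in> I <+>\<^bsub>mpoly_ring V\<^esub> J" if "b \<in> J" for b
    unfolding e using that mpoly_ideal(2)[OF assms(1)] by (intro CollectI exI[of _ 0] exI[of _ b]) simp
  moreover have "h f = 0" if "f \<in> I <+>\<^bsub>mpoly_ring V\<^esub> J" "\<forall>f\<in>I. h f = 0" "\<forall>f\<in>J. h f = 0" for f
    using that unfolding e by (auto simp: h.hom_add)
  ultimately show ?thesis by blast
qed

lemma vanish_inter:
  assumes "ideal I (mpoly_ring V)" "ideal J (mpoly_ring V)"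
  shows "(\<forall>f\<in>I \<inter> J. h f = 0) \<longleftrightarrow> (\<forall>f\<in>I. h f = 0) \<or> (\<forall>f\<in>J. h f = 0)"
proof
  assume z: "\<forall>f\<in>I \<inter> J. h f = 0"
  show "(\<forall>f\<in>I. h f = 0) \<or> (\<forall>f\<in>J. h f = 0)"
  proof (rule ccontr)
    assume "\<not> ?thesis"
    then obtain a b where ab: "a \<in> I" "h a \<noteq> 0" "b \<in> J" "h b \<noteq> 0" by blast
    have "a * b \<in> J" using mpoly_ideal(4)[OF assms(2) ab(3)] mpoly_ideal(1)[OF assms(1) ab(1)] by blast
    moreover have "b * a \<in> I" using mpoly_ideal(4)[OF assms(1) ab(1)] mpoly_ideal(1)[OF assms(2) ab(3)] by blast
    then have "a * b \<in> I" by (simp add: mult.commute)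
    ultimately have "h (a * b) = 0" using z by blast
    then show False using ab by (simp add: h.hom_mult)
  qed
qed auto

lemma vanish_Inter:
  assumes "finite K" "\<And>i. i \<in> K \<Longrightarrow> ideal (J i) (mpoly_ring V)"
  shows "ideal (carrier (mpoly_ring V) \<inter> (\<Inter>i\<in>K. J i)) (mpoly_ring V) \<and>
   ((\<forall>f\<in>carrier (mpoly_ring V) \<inter> (\<Inter>i\<in>K. J i). h f = 0) \<longleftrightarrow> (\<exists>i\<in>K. \<forall>f\<in>J i. h f = 0))"
  using assms
proof (induction K rule: finite_induct)
  case empty
  interpret cring "mpoly_ring V :: ('v, 'k) mpoly ring" by (rule mpoly_ring_cring)
  have "1 \<in> carrier (mpoly_ring V :: ('v, 'k) mpoly ring)" using one_closed by simp
  then show ?case using oneideal by (auto intro!: bexI[of _ 1])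
next
  case (insert i K)
  interpret cring "mpoly_ring V :: ('v, 'k) mpoly ring" by (rule mpoly_ring_cring)
  have e: "carrier (mpoly_ring V) \<inter> (\<Inter>i\<in>insert i K. J i) = J i \<inter> (carrier (mpoly_ring V) \<inter> (\<Inter>i\<in>K. J i))"
    by auto
  have Ji: "ideal (J i) (mpoly_ring V)" using insert.prems by simp
  have IH: "ideal (carrier (mpoly_ring V) \<inter> (\<Inter>i\<in>K. J i)) (mpoly_ring V)"
    "(\<forall>f\<in>carrier (mpoly_ring V) \<inter> (\<Inter>i\<in>K. J i). h f = 0) \<longleftrightarrow> (\<exists>i\<in>K. \<forall>f\<in>J i. h f = 0)"
    using insert by auto
  show ?case unfolding e vanish_inter[OF Ji IH(1)] IH(2) using i_intersect[OF Ji IH(1)] by simp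
qed

end

lemma mpoly_sum_ideal:
  assumes "ideal I (mpoly_ring V)" "ideal J (mpoly_ring V)"
  shows "ideal (I <+>\<^bsub>mpoly_ring V\<^esub> J) (mpoly_ring V :: ('v, 'k::comm_ring_1) mpoly ring)"
proof -
  interpret cring "mpoly_ring V :: ('v, 'k) mpoly ring" by (rule mpoly_ring_cring)
  show ?thesis by (rule add_ideals[OF assms])
qed

lemma mpoly_Idl_ideal:
  "S \<subseteq> carrier (mpoly_ring V) \<Longrightarrow> ideal (Idl\<^bsub>mpoly_ring V\<^esub> S) (mpoly_ring V :: ('v, 'k::comm_ring_1) mpoly ring)"
proof -
  interpret cring "mpoly_ring V :: ('v, 'k) mpoly ring" by (rule mpoly_ring_cring)
  show "S \<subseteq> carrier (mpoly_ring V) \<Longrightarrow> ?thesis" by (rule genideal_ideal)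
qed

text \<open>The indeterminates of a polynomial ring are a set and not a type, so it has to be recorded that the
  entries of a matrix belong to the ring.\<close>

definition mat_over :: "'v set \<Rightarrow> ('v, 'a::comm_ring_1) mpoly mat \<Rightarrow> bool" where
  "mat_over V A \<longleftrightarrow> (\<forall>i<dim_row A. \<forall>j<dim_col A. A $$ (i, j) \<in> carrier (mpoly_ring V))"

lemma carr_0: "0 \<in> carrier (mpoly_ring V)" and carr_1: "1 \<in> carrier (mpoly_ring V)"
  by (simp_all add: mpoly_ring_carrier)

lemma carr_uminus: "p \<in> carrier (mpoly_ring V) \<Longrightarrow> - p \<in> carrier (mpoly_ring V)"
  by (simp add: mpoly_ring_carrier in_keys_iff)

lemma carr_diff: "p \<in> carrier (mpoly_ring V) \<Longrightarrow> q \<in> carrier (mpoly_ring V) \<Longrightarrow> p - q \<in> carrier (mpoly_ring V)"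
  using mpoly_ring_add_closed[of p V "- q"] carr_uminus[of q V] by simp

lemma carr_sum: "(\<And>a. a \<in> A \<Longrightarrow> f a \<in> carrier (mpoly_ring V)) \<Longrightarrow> sum f A \<in> carrier (mpoly_ring V)"
  by (induction A rule: infinite_finite_induct) (auto intro: mpoly_ring_add_closed simp: carr_0)

lemma carr_prod: "(\<And>a. a \<in> A \<Longrightarrow> f a \<in> carrier (mpoly_ring V)) \<Longrightarrow> prod f A \<in> carrier (mpoly_ring V)"
  by (induction A rule: infinite_finite_induct) (auto intro: mpoly_ring_mult_closed simp: carr_1)

lemma carr_power: "p \<in> carrier (mpoly_ring V) \<Longrightarrow> p ^ k \<in> carrier (mpoly_ring V)"
  by (induction k) (auto intro: mpoly_ring_mult_closed simp: carr_1)

lemma carr_indet: "x \<in> V \<Longrightarrow> indet x \<in> carrier (mpoly_ring V)"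
  unfolding indet_def by (intro mpoly_ring_single_closed) simp

lemma mat_over_mult:
  assumes "A \<in> carrier_mat m k" "B \<in> carrier_mat k l" "mat_over V A" "mat_over V B"
  shows "mat_over V (A * B)"
  unfolding mat_over_def
proof (intro allI impI)
  fix i j assume "i < dim_row (A * B)" "j < dim_col (A * B)"
  then have ij: "i < m" "j < l" using assms by auto
  have "(A * B) $$ (i, j) = (\<Sum>a<k. A $$ (i, a) * B $$ (a, j))"
    using assms(1,2) ij by (auto simp: scalar_prod_def atLeast0LessThan intro!: sum.cong)
  also have "\<dots> \<in> carrier (mpoly_ring V)"
    using assms ij by (intro carr_sum mpoly_ring_mult_closed) (auto simp: mat_over_def)
  finally show "(A * B) $$ (i, j) \<in> carrier (mpoly_ring V)" .
qed

lemma mat_over_one: "mat_over V (1\<^sub>m k)" by (auto simp: mat_over_def carr_0 carr_1)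

lemma mat_over_pow: "A \<in> carrier_mat k k \<Longrightarrow> mat_over V A \<Longrightarrow> mat_over V (A ^\<^sub>m e)"
  by (induction e) (auto intro!: mat_over_mult[of _ k k _ k] mat_over_one simp: carrier_matD(1))

lemma mat_over_det: assumes "mat_over V A" shows "det A \<in> carrier (mpoly_ring V)"
proof (cases "dim_row A = dim_col A")
  case True
  have "signof p \<in> carrier (mpoly_ring V)" for p :: "nat \<Rightarrow> nat"
    unfolding sign_def by (simp add: carr_1 carr_uminus)
  moreover have "(\<Prod>i = 0..<dim_row A. A $$ (i, p i)) \<in> carrier (mpoly_ring V)"
    if "p permutes {0..<dim_row A}" for p
  proof (rule carr_prod)
    fix i assume "i \<in> {0..<dim_row A}"
    then have "p i \<in> {0..<dim_row A}" using permutes_in_image[OF that] by blast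
    then show "A $$ (i, p i) \<in> carrier (mpoly_ring V)"
      using assms True \<open>i \<in> _\<close> by (simp add: mat_over_def)
  qed
  ultimately show ?thesis unfolding det_def using True by (auto intro!: carr_sum mpoly_ring_mult_closed)
qed (simp add: det_def carr_0)

lemma mat_over_submatrix: "mat_over V M \<Longrightarrow> I \<subseteq> {..<dim_row M} \<Longrightarrow> J \<subseteq> {..<dim_col M} \<Longrightarrow> mat_over V (submatrix M I J)"
proof -
  assume M: "mat_over V M" and I: "I \<subseteq> {..<dim_row M}" and J: "J \<subseteq> {..<dim_col M}"
  have e: "{i. i < dim_row M \<and> i \<in> I} = I" "{j. j < dim_col M \<and> j \<in> J} = J" using I J by auto
  have "pick I a < dim_row M" if "a < card I" for a using pick_in_set_le[OF that] I by auto
  moreover have "pick J a < dim_col M" if "a < card J" for a using pick_in_set_le[OF that] J by auto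
  ultimately show "mat_over V (submatrix M I J)" using M unfolding mat_over_def submatrix_def e by simp
qed

lemma minors_carrier: "mat_over V M \<Longrightarrow> minors k M \<subseteq> carrier (mpoly_ring V)"
  unfolding minors_def using mat_over_det mat_over_submatrix by blast

lemma minors_hom:
  assumes "comm_ring_hom h" shows "minors k (map_mat h M) = h ` minors k M"
proof -
  interpret comm_ring_hom h by fact
  have "submatrix (map_mat h M) I J = map_mat h (submatrix M I J)"
    if "I \<subseteq> {..<dim_row M}" "J \<subseteq> {..<dim_col M}" for I J
  proof -
    have e: "{i. i < dim_row M \<and> i \<in> I} = I" "{j. j < dim_col M \<and> j \<in> J} = J" using that by auto
    have "pick I a < dim_row M" if "a < card I" for a using pick_in_set_le[OF that] \<open>I \<subseteq> _\<close> by auto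
    moreover have "pick J a < dim_col M" if "a < card J" for a using pick_in_set_le[OF that] \<open>J \<subseteq> _\<close> by auto
    ultimately show ?thesis by (intro eq_matI) (auto simp: submatrix_def e)
  qed
  then have *: "det (submatrix (map_mat h M) I J) = h (det (submatrix M I J))"
    if "I \<subseteq> {..<dim_row M}" "J \<subseteq> {..<dim_col M}" for I J using that by simp
  show ?thesis
  proof (intro equalityI subsetI)
    fix d assume "d \<in> minors k (map_mat h M)"
    then obtain I J where IJ: "I \<subseteq> {..<dim_row M}" "J \<subseteq> {..<dim_col M}" "card I = k" "card J = k"
      "d = det (submatrix (map_mat h M) I J)" unfolding minors_def by auto
    then show "d \<in> h ` minors k M" unfolding IJ(5) *[OF IJ(1,2)] minors_def by blast
  next
    fix d assume "d \<in> h ` minors k M"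
    then obtain I J where IJ: "I \<subseteq> {..<dim_row M}" "J \<subseteq> {..<dim_col M}" "card I = k" "card J = k"
      "d = h (det (submatrix M I J))" unfolding minors_def by auto
    then show "d \<in> minors k (map_mat h M)" unfolding IJ(5) *[OF IJ(1,2), symmetric] minors_def by auto
  qed
qed

lemma mult_matrix_carrier: "mult_matrix ts bs c r \<in> carrier_mat (length ts) (length ts)"
  by (simp add: mult_matrix_def)

lemma mult_matrix_hom:
  assumes "comm_ring_hom h"
  shows "map_mat h (mult_matrix ts bs c r) = mult_matrix ts bs (\<lambda>ij. h (c ij)) r"
proof -
  interpret comm_ring_hom h by fact
  show ?thesis by (intro eq_matI) (auto simp: mult_matrix_def Let_def)
qed

lemma term_at_hom:
  assumes "comm_ring_hom h" "\<And>r. r < n \<Longrightarrow> M r \<in> carrier_mat k k"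
  shows "map_mat h (term_at n k M t) = term_at n k (\<lambda>r. map_mat h (M r)) t"
proof -
  interpret comm_ring_hom h by fact
  have "map_mat h (foldr (\<lambda>r B. M r ^\<^sub>m lookup t r * B) xs (1\<^sub>m k)) =
     foldr (\<lambda>r B. map_mat h (M r) ^\<^sub>m lookup t r * B) xs (1\<^sub>m k)"
    if "set xs \<subseteq> {..<n}" for xs
    using that
  proof (induction xs)
    case Nil then show ?case by (simp add: mat_hom_one)
  next
    case (Cons x xs)
    have Mx: "M x \<in> carrier_mat k k" using Cons.prems assms(2) by simp
    have B: "foldr (\<lambda>r B. M r ^\<^sub>m lookup t r * B) xs (1\<^sub>m k) \<in> carrier_mat k k"
      using Cons.prems assms(2) by (intro term_foldr_carrier) auto
    show ?case using Cons mat_hom_mult[OF pow_carrier_mat[OF Mx] B] mat_hom_pow[OF Mx] by simp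
  qed
  then show ?thesis unfolding term_at_def by (simp add: atLeast0LessThan)
qed

lemma term_at_mat_over:
  assumes "\<And>r. r < n \<Longrightarrow> M r \<in> carrier_mat k k" "\<And>r. r < n \<Longrightarrow> mat_over V (M r)"
  shows "mat_over V (term_at n k M t)"
proof -
  have "mat_over V (foldr (\<lambda>r B. M r ^\<^sub>m lookup t r * B) xs (1\<^sub>m k))" if "set xs \<subseteq> {..<n}" for xs
    using that
  proof (induction xs)
    case Nil then show ?case by (simp add: mat_over_one)
  next
    case (Cons x xs)
    have Mx: "M x \<in> carrier_mat k k" "mat_over V (M x)" using Cons.prems assms by simp_all
    have B: "foldr (\<lambda>r B. M r ^\<^sub>m lookup t r * B) xs (1\<^sub>m k) \<in> carrier_mat k k"
      using Cons.prems assms(1) by (intro term_foldr_carrier) auto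
    show ?case using mat_over_mult[OF pow_carrier_mat[OF Mx(1)] B mat_over_pow[OF Mx]] Cons by simp
  qed
  then show ?thesis unfolding term_at_def by (simp add: atLeast0LessThan)
qed

lemma enum_the:
  assumes "order_ideal_enum n ts bs" "r < n" "j < length ts" "single r 1 + ts ! j \<notin> set ts"
  shows "(THE m. m < length bs \<and> bs ! m = single r 1 + ts ! j) < length bs"
proof -
  have "single r 1 + ts ! j \<in> set bs"
    using assms nth_mem[OF assms(3)] unfolding order_ideal_enum_def border_def by blast
  then obtain k where k: "k < length bs" "bs ! k = single r 1 + ts ! j"
    by (auto simp: in_set_conv_nth)
  have d: "distinct bs" using assms(1) order_ideal_enum_def by blast
  have "(THE m. m < length bs \<and> bs ! m = single r 1 + ts ! j) = k"
  proof (rule the_equality)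
    show "k < length bs \<and> bs ! k = single r 1 + ts ! j" using k by blast
    fix m assume "m < length bs \<and> bs ! m = single r 1 + ts ! j"
    then have "m < length bs" "bs ! m = bs ! k" using k(2) by simp_all
    then show "m = k" using nth_eq_iff_index_eq[OF d \<open>m < length bs\<close> k(1)] by blast
  qed
  then show ?thesis using k by simp
qed

lemma mult_matrix_over:
  assumes "order_ideal_enum n ts bs" "r < n"
    "\<And>k l. k < length ts \<Longrightarrow> l < length bs \<Longrightarrow> c (k, l) \<in> carrier (mpoly_ring V)"
  shows "mat_over V (mult_matrix ts bs c r)"
  unfolding mat_over_def
proof (intro allI impI)
  fix i j assume ij: "i < dim_row (mult_matrix ts bs c r)" "j < dim_col (mult_matrix ts bs c r)"
  then have i: "i < length ts" "j < length ts" by (auto simp: mult_matrix_def)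
  show "mult_matrix ts bs c r $$ (i, j) \<in> carrier (mpoly_ring V)"
    using i enum_the[OF assms(1,2) i(2)] assms(3)[OF i(1)] by (auto simp: mult_matrix_def Let_def carr_0 carr_1)
qed

abbreviation cvars :: "nat pp list \<Rightarrow> nat pp list \<Rightarrow> (nat \<times> nat) set" where
  "cvars ts bs \<equiv> {..<length ts} \<times> {..<length bs}"

lemma generic_over:
  "order_ideal_enum n ts bs \<Longrightarrow> r < n \<Longrightarrow> mat_over (cvars ts bs) (generic_matrix ts bs r)"
  by (rule mult_matrix_over) (auto intro: carr_indet)

lemma first_columns_over:
  assumes "order_ideal_enum n ts bs"
  shows "mat_over (cvars ts bs) (first_columns n ts bs us :: (nat \<times> nat, 'a::field) mpoly mat)"
proof -
  let ?T = "\<lambda>u. term_at n (length ts) (generic_matrix ts bs) u :: (nat \<times> nat, 'a) mpoly mat"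
  have p: "length ts > 0" using assms unfolding order_ideal_enum_def order_ideal_def by auto
  have o: "mat_over (cvars ts bs) (?T u)" for u
    by (rule term_at_mat_over) (use generic_over[OF assms] mult_matrix_carrier in auto)
  have c: "?T u \<in> carrier_mat (length ts) (length ts)" for u
    by (rule term_at_carrier) (rule mult_matrix_carrier)
  have "col (?T u) 0 $ i \<in> carrier (mpoly_ring (cvars ts bs))" if "i < length ts" for u i
    using o[of u] c[of u] p that unfolding mat_over_def by simp
  then show ?thesis unfolding mat_over_def first_columns_def mat_of_cols_def by simp
qed

lemma mpoly_at_cong:
  assumes "f \<in> carrier (mpoly_ring V)" "\<And>x. x \<in> V \<Longrightarrow> a x = b x"
  shows "mpoly_at \<phi> a f = mpoly_at \<phi> b f"
proof -
  have "monomial_at a m = monomial_at b m" if "m \<in> keys f" for m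
    unfolding monomial_at_def
  proof (intro prod.cong refl)
    fix x assume "x \<in> keys m"
    then have "x \<in> V" using assms(1) that unfolding mpoly_ring_carrier by blast
    then show "a x ^ lookup m x = b x ^ lookup m x" using assms(2) by simp
  qed
  then show ?thesis unfolding mpoly_at_alt by (intro sum.cong) auto
qed

section \<open>Points and their affine Hilbert functions\<close>

lemma C_ring_eq: "C_ring ts bs = mpoly_ring (cvars ts bs)" by (simp add: C_ring_def)

lemma bbs_gens_carrier:
  assumes "order_ideal_enum n ts bs"
  shows "{(generic_matrix ts bs r * generic_matrix ts bs s
       - generic_matrix ts bs s * generic_matrix ts bs r) $$ (i, j) | r s i j.
     r < n \<and> s < n \<and> i < length ts \<and> j < length ts} \<subseteq> carrier (mpoly_ring (cvars ts bs) :: (nat \<times> nat, 'k::field) mpoly ring)"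
proof
  let ?A = "generic_matrix ts bs :: nat \<Rightarrow> (nat \<times> nat, 'k) mpoly mat"
  fix f :: "(nat \<times> nat, 'k) mpoly"
  assume "f \<in> {(?A r * ?A s - ?A s * ?A r) $$ (i, j) | r s i j. r < n \<and> s < n \<and> i < length ts \<and> j < length ts}"
  then obtain r s i j where f: "f = (?A r * ?A s - ?A s * ?A r) $$ (i, j)"
    and rs: "r < n" "s < n" and ij: "i < length ts" "j < length ts" by blast
  have c: "?A q \<in> carrier_mat (length ts) (length ts)" for q by (rule mult_matrix_carrier)
  have m: "mat_over (cvars ts bs) (?A p * ?A q)" if "p < n" "q < n" for p q
    using mat_over_mult[OF c c generic_over[OF assms that(1)] generic_over[OF assms that(2)]] .
  have d: "(?A p * ?A q) $$ (i, j) \<in> carrier (mpoly_ring (cvars ts bs))" if "p < n" "q < n" for p q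
    using m[OF that] ij carrier_matD[OF c] unfolding mat_over_def by simp
  have "f = (?A r * ?A s) $$ (i, j) - (?A s * ?A r) $$ (i, j)"
    unfolding f using ij carrier_matD[OF c] by simp
  then show "f \<in> carrier (mpoly_ring (cvars ts bs))" using carr_diff[OF d d] rs by simp
qed

lemma bbs_ideal_ideal:
  "order_ideal_enum n ts bs \<Longrightarrow> ideal (bbs_ideal n ts bs) (mpoly_ring (cvars ts bs) :: (nat \<times> nat, 'k::field) mpoly ring)"
  unfolding bbs_ideal_def C_ring_eq by (rule mpoly_Idl_ideal[OF bbs_gens_carrier])

abbreviation terms_upto :: "nat \<Rightarrow> nat \<Rightarrow> nat pp list" where
  "terms_upto n i \<equiv> sorted_list_of_set (terms_le n i)"

lemma HF_gens_carrier:
  assumes "order_ideal_enum n ts bs"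
  shows "(\<Union>i\<in>K. minors (G i + 1) (first_columns n ts bs (us i))) \<subseteq>
    carrier (mpoly_ring (cvars ts bs) :: (nat \<times> nat, 'k::field) mpoly ring)"
  using minors_carrier[OF first_columns_over[OF assms]] by (intro UN_least)

lemma bbs_HF_ideal_ideal:
  assumes "order_ideal_enum n ts bs"
  shows "ideal (bbs_HF_ideal n ts bs G) (mpoly_ring (cvars ts bs) :: (nat \<times> nat, 'k::field) mpoly ring)"
  unfolding bbs_HF_ideal_def Let_def C_ring_eq
  by (rule mpoly_sum_ideal[OF bbs_ideal_ideal[OF assms] mpoly_Idl_ideal[OF HF_gens_carrier[OF assms]]])

lemma field_hom_comm_ring_hom: "field_hom \<phi> \<Longrightarrow> comm_ring_hom \<phi>"
proof -
  assume "field_hom \<phi>"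
  then interpret field_hom \<phi> .
  show ?thesis by (rule comm_ring_hom_axioms)
qed

context
  fixes \<phi> :: "'k::field \<Rightarrow> 'l::field" and h :: "(nat \<times> nat, 'k) mpoly \<Rightarrow> 'l" and \<Gamma> :: "'l mat"
  assumes phi: "field_hom \<phi>"
  defines "h \<equiv> value_at \<phi> \<Gamma>"
begin

lemma h_hom: "comm_ring_hom h"
  unfolding h_def by (rule mpoly_at_comm_ring_hom[OF field_hom_comm_ring_hom[OF phi]])

interpretation h: comm_ring_hom h by (rule h_hom)

lemma generic_at: "map_mat h (generic_matrix ts bs r) = mult_matrix ts bs (\<lambda>ij. \<Gamma> $$ ij) r"
  unfolding mult_matrix_hom[OF h_hom] by (simp add: h_def mpoly_at_indet[OF field_hom_comm_ring_hom[OF phi]])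

lemma bbs_ideal_vanishes_iff:
  assumes enum: "order_ideal_enum n ts bs" and car: "\<Gamma> \<in> carrier_mat (length ts) (length bs)"
  shows "(\<forall>f\<in>bbs_ideal n ts bs. h f = 0) \<longleftrightarrow> border_point n ts bs \<Gamma>"
proof -
  let ?A = "generic_matrix ts bs :: nat \<Rightarrow> (nat \<times> nat, 'k) mpoly mat"
  let ?B = "mult_matrix ts bs (\<lambda>ij. \<Gamma> $$ ij)"
  let ?m = "length ts"
  have c: "?A q \<in> carrier_mat ?m ?m" for q by (rule mult_matrix_carrier)
  have cB: "?B q \<in> carrier_mat ?m ?m" for q by (rule mult_matrix_carrier)
  have p: "h ((?A r * ?A s) $$ (i, j)) = (?B r * ?B s) $$ (i, j)" if "i < ?m" "j < ?m" for r s i j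
  proof -
    have "h ((?A r * ?A s) $$ (i, j)) = map_mat h (?A r * ?A s) $$ (i, j)"
      using that carrier_matD[OF c] by simp
    then show ?thesis unfolding h.mat_hom_mult[OF c c] generic_at .
  qed
  have e: "h ((?A r * ?A s - ?A s * ?A r) $$ (i, j)) = (?B r * ?B s) $$ (i, j) - (?B s * ?B r) $$ (i, j)"
    if "i < ?m" "j < ?m" for r s i j
    using that carrier_matD[OF c] by (simp add: h.hom_minus p del: index_mult_mat(1))
  have "(\<forall>f\<in>bbs_ideal n ts bs. h f = 0) \<longleftrightarrow>
    (\<forall>r s i j. r < n \<longrightarrow> s < n \<longrightarrow> i < ?m \<longrightarrow> j < ?m \<longrightarrow> (?B r * ?B s) $$ (i, j) = (?B s * ?B r) $$ (i, j))"
    (is "?L \<longleftrightarrow> ?R")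
    unfolding bbs_ideal_def C_ring_eq vanish_Idl[OF h_hom bbs_gens_carrier[OF enum]]
  proof
    assume a: "\<forall>f\<in>{(?A r * ?A s - ?A s * ?A r) $$ (i, j) | r s i j. r < n \<and> s < n \<and> i < ?m \<and> j < ?m}. h f = 0"
    show ?R
    proof (intro allI impI)
      fix r s i j assume x: "r < n" "s < n" "i < ?m" "j < ?m"
      then have "h ((?A r * ?A s - ?A s * ?A r) $$ (i, j)) = 0" by (intro bspec[OF a]) auto
      then show "(?B r * ?B s) $$ (i, j) = (?B s * ?B r) $$ (i, j)" unfolding e[OF x(3,4)] by simp
    qed
  next
    assume R: ?R
    show "\<forall>f\<in>{(?A r * ?A s - ?A s * ?A r) $$ (i, j) | r s i j. r < n \<and> s < n \<and> i < ?m \<and> j < ?m}. h f = 0"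
    proof
      fix f assume "f \<in> {(?A r * ?A s - ?A s * ?A r) $$ (i, j) | r s i j. r < n \<and> s < n \<and> i < ?m \<and> j < ?m}"
      then obtain r s i j where f: "f = (?A r * ?A s - ?A s * ?A r) $$ (i, j)"
        and x: "r < n" "s < n" "i < ?m" "j < ?m" by blast
      show "h f = 0" unfolding f e[OF x(3,4)] using R x by simp
    qed
  qed
  also have "\<dots> \<longleftrightarrow> border_point n ts bs \<Gamma>"
  proof
    assume R: ?R
    show "border_point n ts bs \<Gamma>"
    proof (rule border_point.intro[OF enum car])
      fix r s assume "r < n" "s < n"
      then show "?B r * ?B s = ?B s * ?B r"
        using R carrier_matD[OF cB] by (intro eq_matI) auto
    qed
  next
    assume "border_point n ts bs \<Gamma>"
    then show ?R using border_point.commute by metis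
  qed
  finally show ?thesis .
qed

text \<open>At a point, the first columns of the evaluated terms are the coordinates of the terms.\<close>

lemma first_columns_at:
  assumes "border_point n ts bs \<Gamma>"
  shows "i < length ts \<Longrightarrow> j < length us \<Longrightarrow>
      map_mat h (first_columns n ts bs us) $$ (i, j) = border_point.v n ts bs \<Gamma> (us ! j) i"
    "j < length us \<Longrightarrow> colf (map_mat h (first_columns n ts bs us)) j = border_point.v n ts bs \<Gamma> (us ! j)"
proof -
  interpret border_point n ts bs \<Gamma> by fact
  let ?T = "\<lambda>u. term_at n \<mu> (generic_matrix ts bs) u :: (nat \<times> nat, 'k) mpoly mat"
  have c: "?T u \<in> carrier_mat \<mu> \<mu>" for u by (rule term_at_carrier) (rule mult_matrix_carrier)
  have T: "map_mat h (?T u) = term_at n \<mu> Am u" for u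
    using term_at_hom[OF h_hom mult_matrix_carrier] generic_at by simp
  have T': "h (?T u $$ (i, 0)) = v u i" if "i < \<mu>" for u i
  proof -
    have "h (?T u $$ (i, 0)) = map_mat h (?T u) $$ (i, 0)" using that \<mu>_pos carrier_matD[OF c] by simp
    then show ?thesis unfolding T using that by (simp add: v_def)
  qed
  show *: "i < \<mu> \<Longrightarrow> j < length us \<Longrightarrow> map_mat h (first_columns n ts bs us) $$ (i, j) = v (us ! j) i" for i j
    unfolding first_columns_def mat_of_cols_def using carrier_matD[OF c] \<mu>_pos T' by simp
  show "j < length us \<Longrightarrow> colf (map_mat h (first_columns n ts bs us)) j = v (us ! j)"
    using * v_support by (auto simp: colf_def fun_eq_iff first_columns_def)
qed

end

context border_point begin

abbreviation HF :: "nat \<Rightarrow> nat" where "HF \<equiv> affine_HF n (point_ideal n ts bs \<Gamma>)"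

abbreviation V_le :: "nat \<Rightarrow> (nat \<Rightarrow> 'l) set" where
  "V_le i \<equiv> funs.span (v ` terms_le n i)"

interpretation pa: presented_algebra n "point_ideal n ts bs \<Gamma>" ev \<mu> by (rule presented)

lemma ev_P_le: "ev ` pa.P_le i = V_le i"
proof
  show "ev ` pa.P_le i \<subseteq> V_le i"
  proof
    fix x assume "x \<in> ev ` pa.P_le i"
    then obtain p where p: "p \<in> pa.P_le i" "x = ev p" by blast
    have "(\<lambda>i. lookup p m * v m i) \<in> V_le i" if "m \<in> keys p" for m
      using p(1) that unfolding pa.P_le_def mpoly_ring_carrier
      by (intro funs.span_scale funs.span_base imageI) auto
    then show "x \<in> V_le i" unfolding p(2) ev_def by (intro funs.span_sum)
  qed
  show "V_le i \<subseteq> ev ` pa.P_le i"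
  proof (rule funs.span_minimal)
    show "v ` terms_le n i \<subseteq> ev ` pa.P_le i"
    proof
      fix x assume "x \<in> v ` terms_le n i"
      then obtain u where u: "keys u \<subseteq> {..<n}" "pp_deg u \<le> i" "x = v u" by blast
      have "tm u \<in> pa.P_le i" unfolding pa.P_le_def using u mpoly_ring_single_closed by simp
      moreover have "x = ev (tm u)" using u by (simp only: ev_tm)
      ultimately show "x \<in> ev ` pa.P_le i" by (rule rev_image_eqI)
    qed
    show "funs.subspace (ev ` pa.P_le i)"
    proof (rule funs.subspaceI)
      have "0 \<in> pa.P_le i" by (simp add: pa.P_le_def mpoly_ring_carrier)
      then show "0 \<in> ev ` pa.P_le i" by (rule rev_image_eqI) (rule ev_zero[symmetric])
    next
      fix x y assume "x \<in> ev ` pa.P_le i" "y \<in> ev ` pa.P_le i"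
      then obtain p q where pq: "p \<in> pa.P_le i" "q \<in> pa.P_le i" and xy: "x = ev p" "y = ev q" by blast
      have "x + y = ev (p + q)" unfolding xy by (rule ev_add[symmetric])
      then show "x + y \<in> ev ` pa.P_le i" by (rule image_eqI) (rule pa.P_le_add[OF pq])
    next
      fix c x assume "x \<in> ev ` pa.P_le i"
      then obtain p where p: "p \<in> pa.P_le i" and x: "x = ev p" by blast
      have "(\<lambda>i. c * x i) = ev (const c * p)" unfolding x by (rule ev_smult[symmetric])
      moreover have "const c * p \<in> pa.P_le i" using pa.P_le_mult[OF pa.P_le_const[of c 0] p] by simp
      ultimately show "(\<lambda>i. c * x i) \<in> ev ` pa.P_le i" by (rule image_eqI)
    qed
  qed
qed

lemma HF_eq: "HF i = funs.dim (V_le i)"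
  unfolding pa.affine_HF_eq ev_P_le ..

lemma ev_rho: "ev ` pa.P_le pa.rho = {x. \<forall>j\<ge>\<mu>. x j = 0}"
proof
  show "ev ` pa.P_le pa.rho \<subseteq> {x. \<forall>j\<ge>\<mu>. x j = 0}" using ev_support by blast
  have F: "pa.Fil pa.rho = carrier pa.A" unfolding pa.rho_def by (rule LeastI_ex[OF pa.Fil_stable])
  show "{x. \<forall>j\<ge>\<mu>. x j = 0} \<subseteq> ev ` pa.P_le pa.rho"
  proof
    fix x :: "nat \<Rightarrow> 'l" assume "x \<in> {x. \<forall>j\<ge>\<mu>. x j = 0}"
    then have "x = pa.coord (pa.cl (nf x))" unfolding pa.coord_cl[OF nf_carrier] using ev_nf[of x] by simp
    moreover have "pa.cl (nf x) \<in> pa.Fil pa.rho" unfolding F pa.A_carrier using nf_carrier by blast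
    ultimately have "x \<in> pa.coord ` pa.Fil pa.rho" by (rule image_eqI)
    then show "x \<in> ev ` pa.P_le pa.rho" unfolding pa.coord_Fil .
  qed
qed

lemma HF_rho: "HF pa.rho = \<mu>"
  unfolding pa.affine_HF_eq ev_rho by (rule coordinate_space(2))

lemma HF_eq_top_iff: "HF i = \<mu> \<longleftrightarrow> pa.rho \<le> i"
  using pa.affine_HF_eq_top_iff unfolding HF_rho .

lemma Least_HF: "(LEAST i. HF i = \<mu>) = pa.rho"
  unfolding HF_eq_top_iff by (rule Least_equality) auto

text \<open>The minors bound the rank of the coordinate vectors of the terms of degree at most \<open>i\<close>, that is,
  the dimension of their span in the quotient.\<close>

lemma HF_minors_vanish_iff:
  assumes phi: "field_hom \<phi>"
  shows "(\<forall>f\<in>minors (k + 1) (first_columns n ts bs (terms_upto n i)). value_at \<phi> \<Gamma> f = 0)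
    \<longleftrightarrow> HF i \<le> k"
proof -
  let ?h = "value_at \<phi> \<Gamma>" and ?us = "terms_upto n i"
  let ?M = "map_mat ?h (first_columns n ts bs ?us)"
  have bp: "border_point n ts bs \<Gamma>" by unfold_locales
  have d: "dim_col ?M = length ?us" by (simp add: first_columns_def)
  have "colf ?M ` {..<dim_col ?M} = (\<lambda>j. v (?us ! j)) ` {..<length ?us}"
    unfolding d using first_columns_at(2)[OF phi bp] by (intro image_cong) auto
  also have "\<dots> = v ` ((!) ?us ` {..<length ?us})" by (simp add: image_image)
  also have "(!) ?us ` {..<length ?us} = set ?us" by (auto simp: set_conv_nth)
  also have "set ?us = terms_le n i"
    by (rule set_sorted_list_of_set[OF finite_terms])
  finally have c: "colf ?M ` {..<dim_col ?M} = v ` terms_le n i" .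
  have "(\<forall>f\<in>minors (k + 1) (first_columns n ts bs ?us). ?h f = 0) \<longleftrightarrow> (\<forall>d\<in>minors (k + 1) ?M. d = 0)"
    unfolding minors_hom[OF h_hom[OF phi]] by simp
  also have "\<dots> \<longleftrightarrow> HF i \<le> k" unfolding minors_vanish_iff c HF_eq ..
  finally show ?thesis .
qed

lemma HF_ideal_vanishes_iff:
  assumes phi: "field_hom \<phi>"
  shows "(\<forall>f\<in>bbs_HF_ideal n ts bs G. value_at \<phi> \<Gamma> f = 0) \<longleftrightarrow>
    (\<forall>i\<in>{1..<(LEAST i. G i = \<mu>)}. HF i \<le> G i)"
proof -
  let ?h = "value_at \<phi> \<Gamma>" and ?K = "{1..<(LEAST i. G i = \<mu>)}"
  have bp: "border_point n ts bs \<Gamma>" by unfold_locales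
  have "(\<forall>f\<in>bbs_HF_ideal n ts bs G. ?h f = 0) \<longleftrightarrow>
     (\<forall>f\<in>bbs_ideal n ts bs. ?h f = 0) \<and>
     (\<forall>f\<in>(\<Union>i\<in>?K. minors (G i + 1) (first_columns n ts bs (terms_upto n i))). ?h f = 0)"
    unfolding bbs_HF_ideal_def Let_def C_ring_eq
      vanish_sum[OF h_hom[OF phi] bbs_ideal_ideal[OF enum] mpoly_Idl_ideal[OF HF_gens_carrier[OF enum]]]
      vanish_Idl[OF h_hom[OF phi] HF_gens_carrier[OF enum]] ..
  also have "\<dots> \<longleftrightarrow> (\<forall>i\<in>?K. \<forall>f\<in>minors (G i + 1) (first_columns n ts bs (terms_upto n i)). ?h f = 0)"
    using bp unfolding bbs_ideal_vanishes_iff[OF phi enum \<Gamma>_carr] by simp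
  also have "\<dots> \<longleftrightarrow> (\<forall>i\<in>?K. HF i \<le> G i)" unfolding HF_minors_vanish_iff[OF phi] ..
  finally show ?thesis .
qed

end

lemma to_ac_field_hom: "field_hom (to_ac :: 'k::field \<Rightarrow> 'k alg_closure)"
  by unfold_locales auto

text \<open>The Hilbert function is bounded by \<open>H\<close> because the minors bounding it lie in the vanishing ideal.  If it
  were strictly smaller, a specialization to the algebraic closure of the ground field, which can
  only decrease it further, would be a point at which the separating polynomial vanishes as well as
  not.\<close>

theorem HF_points:
  fixes \<phi> :: "'k::field \<Rightarrow> 'l::field"
  assumes enum: "order_ideal_enum n ts bs" and phi: "field_hom \<phi>" and G: "\<Gamma> \<in> bbs_HF_points \<phi> n ts bs H"
  shows "border_point n ts bs \<Gamma>" "affine_HF n (point_ideal n ts bs \<Gamma>) = H"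
proof -
  define B where "B = zero_locus (to_ac :: 'k \<Rightarrow> 'k alg_closure) ts bs (bbs_ideal n ts bs)"
  define S where "S = {\<Gamma> \<in> B. dominates H (affine_HF n (point_ideal n ts bs \<Gamma>))}"
  define S' where "S' = {\<Gamma> \<in> B. strictly_dominates H (affine_HF n (point_ideal n ts bs \<Gamma>))}"
  let ?h = "value_at \<phi> \<Gamma>" and ?R = "mpoly_ring (cvars ts bs) :: (nat \<times> nat, 'k) mpoly ring"
  let ?hf = "\<lambda>\<Gamma>. affine_HF n (point_ideal n ts bs \<Gamma>)"
  have "\<Gamma> \<in> zero_locus \<phi> ts bs (vanishing_ideal ts bs S) - zero_locus \<phi> ts bs (vanishing_ideal ts bs S')"
    using G unfolding bbs_HF_points_def Let_def B_def S_def S'_def .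
  then have car: "\<Gamma> \<in> carrier_mat (length ts) (length bs)"
    and van: "\<And>f. f \<in> vanishing_ideal ts bs S \<Longrightarrow> ?h f = 0"
    and nvan: "\<exists>f\<in>vanishing_ideal ts bs S'. ?h f \<noteq> 0" unfolding zero_locus_def by auto
  have bp: "border_point n ts bs \<Delta>" if "\<Delta> \<in> B" for \<Delta>
    using that bbs_ideal_vanishes_iff[OF to_ac_field_hom enum] unfolding B_def zero_locus_def by auto
  have bbs: "bbs_ideal n ts bs \<subseteq> carrier ?R" using mpoly_ideal(1)[OF bbs_ideal_ideal[OF enum]] by blast
  have "bbs_ideal n ts bs \<subseteq> vanishing_ideal ts bs S"
    using bbs unfolding vanishing_ideal_def C_ring_eq S_def B_def zero_locus_def by auto
  then have "\<forall>f\<in>bbs_ideal n ts bs. ?h f = 0" using van by blast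
  then show bpG: "border_point n ts bs \<Gamma>" using bbs_ideal_vanishes_iff[OF phi enum car] by blast
  have mins: "minors k (first_columns n ts bs us) \<subseteq> carrier ?R" for k us
    by (rule minors_carrier[OF first_columns_over[OF enum]])
  have le: "?hf \<Gamma> i \<le> H i" for i
  proof -
    have "minors (H i + 1) (first_columns n ts bs (terms_upto n i)) \<subseteq> vanishing_ideal ts bs S"
    proof
      fix f :: "(nat \<times> nat, 'k) mpoly"
      assume f: "f \<in> minors (H i + 1) (first_columns n ts bs (terms_upto n i))"
      have "mpoly_at to_ac (\<lambda>ij. \<Delta> $$ ij) f = 0" if "\<Delta> \<in> S" for \<Delta>
      proof -
        have D: "\<Delta> \<in> B" "?hf \<Delta> i \<le> H i" using that unfolding S_def dominates_def by auto
        show ?thesis using D(2) f unfolding border_point.HF_minors_vanish_iff[OF bp[OF D(1)] to_ac_field_hom, symmetric] by blast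
      qed
      then show "f \<in> vanishing_ideal ts bs S" unfolding vanishing_ideal_def C_ring_eq using f mins by blast
    qed
    then show ?thesis
      using van border_point.HF_minors_vanish_iff[OF bpG phi, of "H i" i] by blast
  qed
  show "?hf \<Gamma> = H"
  proof (rule ccontr)
    assume ne: "?hf \<Gamma> \<noteq> H"
    then obtain k where k: "?hf \<Gamma> k < H k" using le by (metis ext le_neq_implies_less)
    obtain f where f: "f \<in> vanishing_ideal ts bs S'" "?h f \<noteq> 0" using nvan by blast
    have fc: "f \<in> carrier ?R" using f(1) unfolding vanishing_ideal_def C_ring_eq by blast
    obtain d :: "nat \<times> nat \<Rightarrow> 'k alg_closure" where d: "mpoly_at to_ac d f \<noteq> 0"
      "\<And>g. g \<in> carrier ?R \<Longrightarrow> ?h g = 0 \<Longrightarrow> mpoly_at to_ac d g = 0"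
    proof (rule specialize_point[OF phi to_ac_field_hom _ fc f(2)])
      show "finite (cvars ts bs)" by simp
    qed (rule that)
    define \<Delta> where "\<Delta> = mat (length ts) (length bs) d"
    have at: "mpoly_at to_ac (\<lambda>ij. \<Delta> $$ ij) g = mpoly_at to_ac d g" if "g \<in> carrier ?R" for g
      by (rule mpoly_at_cong[OF that]) (auto simp: \<Delta>_def)
    have sp: "mpoly_at to_ac (\<lambda>ij. \<Delta> $$ ij) g = 0" if "g \<in> carrier ?R" "?h g = 0" for g
      unfolding at[OF that(1)] by (rule d(2)[OF that])
    have "\<Delta> \<in> B" unfolding B_def zero_locus_def
      using sp bbs \<open>\<forall>f\<in>bbs_ideal n ts bs. ?h f = 0\<close> by (auto simp: \<Delta>_def)
    moreover have "?hf \<Delta> i \<le> ?hf \<Gamma> i" for i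
    proof -
      have "\<forall>g\<in>minors (?hf \<Gamma> i + 1) (first_columns n ts bs (terms_upto n i)). ?h g = 0"
        unfolding border_point.HF_minors_vanish_iff[OF bpG phi] by simp
      then have "\<forall>g\<in>minors (?hf \<Gamma> i + 1) (first_columns n ts bs (terms_upto n i)). mpoly_at to_ac (\<lambda>ij. \<Delta> $$ ij) g = 0"
        using sp mins by blast
      then show ?thesis unfolding border_point.HF_minors_vanish_iff[OF bp[OF \<open>\<Delta> \<in> B\<close>] to_ac_field_hom] .
    qed
    then have "?hf \<Delta> i \<le> H i" "?hf \<Delta> k < H k" for i using le[of i] k order_trans le_less_trans by blast+
    then have "strictly_dominates H (?hf \<Delta>)" unfolding strictly_dominates_def dominates_def by auto
    ultimately have "\<Delta> \<in> S'" unfolding S'_def by simp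
    then have "mpoly_at to_ac (\<lambda>ij. \<Delta> $$ ij) f = 0" using f(1) unfolding vanishing_ideal_def by blast
    then show False using d(1) at[OF fc] by simp
  qed
qed

section \<open>The non-Cayley-Bacharach locus at a point with adapted order ideal\<close>

lemma term_at_cong: "(\<And>r. r < n \<Longrightarrow> M r = M' r) \<Longrightarrow> term_at n k M t = term_at n k M' t"
  unfolding term_at_def by (rule foldr_cong) auto

lemma term_at_zero:
  assumes "\<And>r. r < n \<Longrightarrow> M r \<in> carrier_mat k k" shows "term_at n k M 0 = 1\<^sub>m k"
proof -
  have "foldr (\<lambda>r B. M r ^\<^sub>m 0 * B) xs (1\<^sub>m k) = 1\<^sub>m k" if "set xs \<subseteq> {..<n}" for xs
    using that
  proof (induction xs)
    case (Cons x xs)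
    then have "M x \<in> carrier_mat k k" using assms by simp
    then show ?case using Cons by simp
  qed simp
  from this[of "[0..<n]"] show ?thesis unfolding term_at_def by (simp add: atLeast0LessThan)
qed

context border_point begin

interpretation pa: presented_algebra n "point_ideal n ts bs \<Gamma>" ev \<mu> by (rule presented)

lemma v_term:
  assumes "keys t \<subseteq> {..<n}" "i < \<mu>"
  shows "v (t + s) i = (\<Sum>j<\<mu>. term_at n \<mu> Am t $$ (i, j) * v s j)"
  using assms
proof (induction t arbitrary: i rule: pp_induct)
  case zero
  have "(\<Sum>j<\<mu>. (1\<^sub>m \<mu> :: 'l mat) $$ (i, j) * v s j) = (\<Sum>j<\<mu>. if j = i then v s i else 0)"
    using zero by (intro sum.cong) auto
  then show ?case using zero term_at_zero[of n Am \<mu>, OF Am_carr] by simp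
next
  case (step r t)
  have T: "term_at n \<mu> Am t \<in> carrier_mat \<mu> \<mu>" by (rule term_at_carrier[OF Am_carr])
  have e: "term_at n \<mu> Am (single r 1 + t) = Am r * term_at n \<mu> Am t"
    by (rule term_at_add_single[OF Am_carr commute step(1)])
  have "v (single r 1 + t + s) i = op r (v (t + s)) i"
    using v_step[OF step(1), of "t + s"] by (simp add: add.assoc)
  also have "\<dots> = (\<Sum>a<\<mu>. Am r $$ (i, a) * (\<Sum>j<\<mu>. term_at n \<mu> Am t $$ (a, j) * v s j))"
    unfolding op_def using step by (auto intro!: sum.cong)
  also have "\<dots> = (\<Sum>a<\<mu>. \<Sum>j<\<mu>. (Am r $$ (i, a) * term_at n \<mu> Am t $$ (a, j)) * v s j)"
    by (simp add: sum_distrib_left mult.assoc)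
  also have "\<dots> = (\<Sum>j<\<mu>. \<Sum>a<\<mu>. (Am r $$ (i, a) * term_at n \<mu> Am t $$ (a, j)) * v s j)" by (rule sum.swap)
  also have "\<dots> = (\<Sum>j<\<mu>. (Am r * term_at n \<mu> Am t) $$ (i, j) * v s j)"
    using T Am_carr[of r] step(4)
    by (auto simp: scalar_prod_def atLeast0LessThan sum_distrib_right intro!: sum.cong)
  finally show ?case unfolding e .
qed

text \<open>Both factors may be replaced by their normal forms.\<close>

lemma ev_product:
  assumes p: "p \<in> carrier PR" and q: "q \<in> carrier PR"
  shows "ev (p * q) k = (\<Sum>i<\<mu>. \<Sum>a<\<mu>. ev p i * ev q a * v (ts ! i + ts ! a) k)"
proof -
  have z: "ev (a * (b - nf (ev b))) = 0" if "a \<in> carrier PR" "b \<in> carrier PR" for a b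
  proof -
    have "ev (b - nf (ev b)) = 0"
      using kernel(1)[OF carrier_diff[OF that(2) nf_carrier]] kernel(2)[OF that(2)] by blast
    then show ?thesis by (rule ev_mult_zero[OF _ that(1)])
  qed
  have pq: "ev (p * q) = ev (nf (ev p) * nf (ev q))"
  proof -
    have "p * q = q * (p - nf (ev p)) + nf (ev p) * (q - nf (ev q)) + nf (ev p) * nf (ev q)"
      by (simp add: algebra_simps)
    then have "ev (p * q) = ev (q * (p - nf (ev p))) + ev (nf (ev p) * (q - nf (ev q))) + ev (nf (ev p) * nf (ev q))"
      by (simp only: ev_add)
    then show ?thesis unfolding z[OF q p] z[OF nf_carrier q] by (simp only: add_0)
  qed
  have e: "nf (ev p) * nf (ev q) = (\<Sum>i<\<mu>. \<Sum>a<\<mu>. single (ts ! i + ts ! a) (ev p i * ev q a))"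
    unfolding nf_def by (simp add: sum_product mult_single)
  show ?thesis unfolding pq e ev_sum fun_sum_apply ev_single ..
qed

lemma unit_indep: "D \<subseteq> {..<\<mu>} \<Longrightarrow> fam_indep unit D"
  unfolding fam_indep_def
proof (intro allI impI ballI)
  fix c j assume D: "D \<subseteq> {..<\<mu>}" and z: "\<forall>i. (\<Sum>j\<in>D. c j * unit j i) = 0" and j: "j \<in> D"
  have "finite D" using D finite_subset by blast
  have "(\<Sum>j'\<in>D. c j' * unit j' j) = (\<Sum>j'\<in>D. if j' = j then c j else 0)"
    by (intro sum.cong) (auto simp: unit_def)
  also have "\<dots> = c j" using j \<open>finite D\<close> by simp
  finally show "c j = 0" using z by simp
qed

lemma card_inner: "order_ideal_HF (set ts) i = card {\<kappa>. \<kappa> < \<mu> \<and> pp_deg (ts ! \<kappa>) \<le> i}"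
proof -
  have "bij_betw ((!) ts) {\<kappa>. \<kappa> < \<mu> \<and> pp_deg (ts ! \<kappa>) \<le> i} {t \<in> set ts. pp_deg t \<le> i}"
  proof (rule bij_betw_imageI)
    show "inj_on ((!) ts) {\<kappa>. \<kappa> < \<mu> \<and> pp_deg (ts ! \<kappa>) \<le> i}"
      using nth_eq_iff_index_eq[OF oi(3)] by (auto simp: inj_on_def)
    show "(!) ts ` {\<kappa>. \<kappa> < \<mu> \<and> pp_deg (ts ! \<kappa>) \<le> i} = {t \<in> set ts. pp_deg t \<le> i}"
      by (auto simp: in_set_conv_nth)
  qed
  then show ?thesis unfolding order_ideal_HF_def by (rule bij_betw_same_card[symmetric])
qed

end

lemma df_gens_carrier:
  "{indet (k, l) | k l. k < length ts \<and> l < length bs \<and> pp_deg (ts ! k) > pp_deg (bs ! l)} \<subseteq>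
    carrier (mpoly_ring (cvars ts bs) :: (nat \<times> nat, 'k::field) mpoly ring)"
proof
  fix f :: "(nat \<times> nat, 'k) mpoly"
  assume "f \<in> {indet (k, l) | k l. k < length ts \<and> l < length bs \<and> pp_deg (ts ! k) > pp_deg (bs ! l)}"
  then obtain k l where f: "f = indet (k, l)" "k < length ts" "l < length bs" by blast
  show "f \<in> carrier (mpoly_ring (cvars ts bs))" unfolding f(1) by (rule carr_indet) (use f in simp)
qed

lemma df_ideal_ideal:
  assumes "order_ideal_enum n ts bs"
  shows "ideal (df_ideal n ts bs) (mpoly_ring (cvars ts bs) :: (nat \<times> nat, 'k::field) mpoly ring)"
  unfolding df_ideal_def C_ring_eq
  by (rule mpoly_sum_ideal[OF bbs_ideal_ideal[OF assms] mpoly_Idl_ideal[OF df_gens_carrier]])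

text \<open>The order ideal has the Hilbert function of the quotient.  Then its terms of degree at most \<open>i\<close> are
  a basis of the polynomials of degree at most \<open>i\<close>, for every \<open>i\<close>.\<close>

locale adapted_point = border_point +
  assumes adapted: "order_ideal_HF (set ts) = affine_HF n (point_ideal n ts bs \<Gamma>)"
    and symmetric: "symmetric_HF (length ts) (affine_HF n (point_ideal n ts bs \<Gamma>))"
begin

interpretation pa: presented_algebra n "point_ideal n ts bs \<Gamma>" ev \<mu> by (rule presented)

definition D :: "nat \<Rightarrow> nat set" where "D i = {\<kappa>. \<kappa> < \<mu> \<and> pp_deg (ts ! \<kappa>) \<le> i}"

lemma D_finite: "finite (D i)" unfolding D_def by simp

lemma card_D: "card (D i) = HF i" using card_inner[of i] adapted unfolding D_def by simp

lemma V_le_units: "V_le i = funs.span (unit ` D i)"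
proof -
  have sub: "funs.span (unit ` D i) \<subseteq> V_le i"
  proof (rule funs.span_mono, rule subsetI)
    fix x assume "x \<in> unit ` D i"
    then obtain \<kappa> where k: "\<kappa> < \<mu>" "pp_deg (ts ! \<kappa>) \<le> i" "x = unit \<kappa>" unfolding D_def by auto
    have "x = v (ts ! \<kappa>)" using v_ts[OF k(1)] k(3) by simp
    then show "x \<in> v ` terms_le n i"
      using k oi(5)[OF nth_mem[OF k(1)]] by blast
  qed
  have "\<exists>J\<subseteq>D i. card J = HF i \<and> fam_indep unit J"
    using unit_indep[of "D i"] card_D by (intro exI[of _ "D i"]) (auto simp: D_def)
  then have ge: "funs.dim (V_le i) \<le> funs.dim (funs.span (unit ` D i))"
    unfolding HF_eq[symmetric] dim_ge_iff[OF D_finite] .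
  have fin: "finite (v ` terms_le n i)"
    by (rule finite_imageI[OF finite_terms])
  have "funs.dim (funs.span (unit ` D i)) = funs.dim (V_le i)"
    by (rule antisym[OF funs.subspace_dim_mono[OF funs.subspace_span funs.subspace_span sub subset_refl fin] ge])
  then show ?thesis
    using funs.subspace_eq_of_dim[OF funs.subspace_span funs.subspace_span sub subset_refl fin] by simp
qed

lemma V_le_iff: "x \<in> V_le i \<longleftrightarrow> (\<forall>\<kappa>. \<kappa> \<notin> D i \<longrightarrow> x \<kappa> = 0)"
proof
  have "V_le i \<subseteq> {x. \<forall>\<kappa>. \<kappa> \<notin> D i \<longrightarrow> x \<kappa> = 0}"
    unfolding V_le_units
  proof (rule funs.span_minimal)
    show "unit ` D i \<subseteq> {x. \<forall>\<kappa>. \<kappa> \<notin> D i \<longrightarrow> x \<kappa> = 0}" by (auto simp: unit_def)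
    show "funs.subspace {x :: nat \<Rightarrow> 'a. \<forall>\<kappa>. \<kappa> \<notin> D i \<longrightarrow> x \<kappa> = 0}" by (rule funs.subspaceI) auto
  qed
  then show "x \<in> V_le i \<Longrightarrow> \<forall>\<kappa>. \<kappa> \<notin> D i \<longrightarrow> x \<kappa> = 0" by blast
  assume "\<forall>\<kappa>. \<kappa> \<notin> D i \<longrightarrow> x \<kappa> = 0"
  then have "x \<in> funs.span ((\<lambda>j i. if i = j then 1 else 0) ` D i)"
    by (intro funs_finite_support_span[OF D_finite]) auto
  then show "x \<in> V_le i" unfolding V_le_units unit_def .
qed

text \<open>Reducing a border term does not raise the degree, so the point lies on the degree filtered locus.\<close>

lemma \<Gamma>_degree:
  assumes "k < \<mu>" "l < length bs" "pp_deg (ts ! k) > pp_deg (bs ! l)"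
  shows "\<Gamma> $$ (k, l) = 0"
proof -
  have "v (bs ! l) \<in> V_le (pp_deg (bs ! l))" using bs_keys[OF assms(2)] by (intro funs.span_base) auto
  then have "v (bs ! l) k = 0" unfolding V_le_iff using assms by (auto simp: D_def)
  then show ?thesis unfolding v_bs[OF assms(2)] using assms(1) by simp
qed

text \<open>By symmetry there are as many terms in degree \<open>\<rho>\<close> as in degree zero, namely one.  Hence \<open>F\<^bsub>\<rho>-1\<^esub>\<close> is
  the kernel of the last coordinate.\<close>

lemma top_term: "i < \<mu> \<Longrightarrow> pp_deg (ts ! i) = pp_deg (ts ! (\<mu> - 1)) \<longleftrightarrow> i = \<mu> - 1"
  and low_eq: "pa.low = {p \<in> carrier PR. ev p (\<mu> - 1) = 0}"
proof -
  have sym: "\<forall>i<pa.rho. HF i + HF (pa.rho - 1 - i) = \<mu>"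
    using symmetric unfolding pa.symmetric_HF_iff[OF HF_rho] HF_rho .
  have "(\<forall>i<\<mu>. pp_deg (ts ! i) = pp_deg (ts ! (\<mu> - 1)) \<longleftrightarrow> i = \<mu> - 1) \<and>
    pa.low = {p \<in> carrier PR. ev p (\<mu> - 1) = 0}"
  proof (cases "pa.rho = 0")
    case True
    then have m: "\<mu> = 1" using HF_rho pa.affine_HF_zero by simp
    have "p \<in> point_ideal n ts bs \<Gamma> \<longleftrightarrow> p \<in> carrier PR \<and> ev p 0 = 0" for p
    proof -
      have "ev p = 0 \<longleftrightarrow> ev p 0 = 0"
      proof
        assume z: "ev p 0 = 0"
        show "ev p = 0"
        proof
          fix i show "ev p i = 0 i" using z ev_support[of i p] m by (cases "i = 0") auto
        qed
      qed simp
      then show ?thesis using kernel(1)[of p] mpoly_ideal(1)[OF point_ideal, of p] by blast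
    qed
    then have "pa.low = {p \<in> carrier PR. ev p (\<mu> - 1) = 0}" unfolding pa.low_def m using True by auto
    moreover have "\<forall>i<\<mu>. pp_deg (ts ! i) = pp_deg (ts ! (\<mu> - 1)) \<longleftrightarrow> i = \<mu> - 1" unfolding m by auto
    ultimately show ?thesis by blast
  next
    case False
    then have "HF 0 + HF (pa.rho - 1 - 0) = \<mu>" using sym by blast
    then have h: "HF (pa.rho - 1) = \<mu> - 1" using pa.affine_HF_zero by simp
    let ?D = "D (pa.rho - 1)"
    have D: "?D = {..<\<mu> - 1}"
    proof -
      have nin: "\<mu> - 1 \<notin> ?D"
      proof
        assume "\<mu> - 1 \<in> ?D"
        then have d: "pp_deg (ts ! (\<mu> - 1)) \<le> pa.rho - 1" unfolding D_def by simp
        have "i \<in> ?D" if "i < \<mu>" for i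
        proof -
          have "i \<le> \<mu> - 1" "\<mu> - 1 < \<mu>" using that by linarith+
          then have "pp_deg (ts ! i) \<le> pp_deg (ts ! (\<mu> - 1))"
            using sorted_nth_mono[OF oi(4), of i "\<mu> - 1"] that by simp
          then show ?thesis using that d unfolding D_def by simp
        qed
        then have "{..<\<mu>} \<subseteq> ?D" by blast
        then have "\<mu> \<le> card ?D" using card_mono[OF D_finite, of "{..<\<mu>}"] by simp
        then show False using card_D h \<mu>_pos by simp
      qed
      have "i < \<mu> - 1" if "i \<in> ?D" for i using that nin unfolding D_def by (cases "i = \<mu> - 1") auto
      then have "?D \<subseteq> {..<\<mu> - 1}" by blast
      then show ?thesis by (rule card_subset_eq[rotated]) (simp_all add: card_D h)
    qed
    have "pp_deg (ts ! i) \<noteq> pp_deg (ts ! (\<mu> - 1))" if "i < \<mu>" "i \<noteq> \<mu> - 1" for i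
    proof
      assume e: "pp_deg (ts ! i) = pp_deg (ts ! (\<mu> - 1))"
      have "i \<in> ?D" unfolding D using that by simp
      then have "\<mu> - 1 \<in> ?D" using e \<mu>_pos unfolding D_def by simp
      then show False unfolding D by simp
    qed
    moreover have "ev p \<in> V_le (pa.rho - 1) \<longleftrightarrow> ev p (\<mu> - 1) = 0" for p
      unfolding V_le_iff D
    proof
      assume z: "ev p (\<mu> - 1) = 0"
      show "\<forall>\<kappa>. \<kappa> \<notin> {..<\<mu> - 1} \<longrightarrow> ev p \<kappa> = 0"
      proof (intro allI impI)
        fix \<kappa> assume "\<kappa> \<notin> {..<\<mu> - 1}"
        then have "\<kappa> = \<mu> - 1 \<or> \<kappa> \<ge> \<mu>" by auto
        then show "ev p \<kappa> = 0" using z ev_support by blast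
      qed
    qed simp
    then have "pa.low = {p \<in> carrier PR. ev p (\<mu> - 1) = 0}"
      unfolding pa.low_def using False ev_P_le by simp
    ultimately show ?thesis by blast
  qed
  note both = this
  show "pp_deg (ts ! i) = pp_deg (ts ! (\<mu> - 1)) \<longleftrightarrow> i = \<mu> - 1" if "i < \<mu>"
    using spec[OF conjunct1[OF both], of i] that by simp
  show "pa.low = {p \<in> carrier PR. ev p (\<mu> - 1) = 0}" by (rule conjunct2[OF both])
qed

text \<open>The Cayley-Bacharach property says that the Gram matrix of the top coordinate of products has
  trivial kernel.\<close>

lemma pairing_nondegenerate_iff:
  "(\<forall>f\<in>carrier PR. f \<notin> point_ideal n ts bs \<Gamma> \<longrightarrow> (\<exists>g\<in>carrier PR. f * g \<notin> pa.low)) \<longleftrightarrow>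
   (\<forall>c. (\<forall>a<\<mu>. (\<Sum>i<\<mu>. c i * v (ts ! i + ts ! a) (\<mu> - 1)) = 0) \<longrightarrow> (\<forall>i<\<mu>. c i = 0))"
  (is "?L \<longleftrightarrow> ?R")
proof
  assume L: ?L
  show ?R
  proof (rule allI, rule impI)
    fix c assume z: "\<forall>a<\<mu>. (\<Sum>i<\<mu>. c i * v (ts ! i + ts ! a) (\<mu> - 1)) = 0"
    define x where "x = (\<lambda>i. if i < \<mu> then c i else 0)"
    have ex: "ev (nf x) = x" by (rule ev_nf) (simp add: x_def)
    have "nf x * g \<in> pa.low" if g: "g \<in> carrier PR" for g
    proof -
      have "ev (nf x * g) (\<mu> - 1) = (\<Sum>i<\<mu>. \<Sum>a<\<mu>. x i * ev g a * v (ts ! i + ts ! a) (\<mu> - 1))"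
        unfolding ev_product[OF nf_carrier g] ex ..
      also have "\<dots> = (\<Sum>a<\<mu>. \<Sum>i<\<mu>. x i * ev g a * v (ts ! i + ts ! a) (\<mu> - 1))" by (rule sum.swap)
      also have "\<dots> = (\<Sum>a<\<mu>. ev g a * (\<Sum>i<\<mu>. c i * v (ts ! i + ts ! a) (\<mu> - 1)))"
        unfolding sum_distrib_left by (intro sum.cong) (auto simp: x_def)
      also have "\<dots> = 0" using z by simp
      finally show ?thesis unfolding low_eq using mpoly_ring_mult_closed[OF nf_carrier g] by simp
    qed
    then have "nf x \<in> point_ideal n ts bs \<Gamma>" using L nf_carrier[of x] by blast
    then have "x = 0" using kernel(1)[OF nf_carrier, of x] ex by simp
    show "\<forall>i<\<mu>. c i = 0"
    proof (intro allI impI)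
      fix i assume "i < \<mu>"
      then show "c i = 0" using fun_cong[OF \<open>x = 0\<close>, of i] by (simp add: x_def)
    qed
  qed
next
  assume R: ?R
  show ?L
  proof (intro ballI impI)
    fix f assume f: "f \<in> carrier PR" "f \<notin> point_ideal n ts bs \<Gamma>"
    show "\<exists>g\<in>carrier PR. f * g \<notin> pa.low"
    proof (rule ccontr)
      assume "\<not> (\<exists>g\<in>carrier PR. f * g \<notin> pa.low)"
      then have all: "\<And>g. g \<in> carrier PR \<Longrightarrow> ev (f * g) (\<mu> - 1) = 0" unfolding low_eq by blast
      have "(\<Sum>i<\<mu>. ev f i * v (ts ! i + ts ! a) (\<mu> - 1)) = 0" if a: "a < \<mu>" for a
      proof -
        have t: "tm (ts ! a) \<in> carrier PR" by (rule mpoly_ring_single_closed[OF oi(5)[OF nth_mem[OF a]]])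
        have "ev (f * tm (ts ! a)) (\<mu> - 1) =
          (\<Sum>i<\<mu>. \<Sum>b<\<mu>. if b = a then ev f i * v (ts ! i + ts ! a) (\<mu> - 1) else 0)"
          unfolding ev_product[OF f(1) t] ev_tm v_ts[OF a] by (intro sum.cong) (auto simp: unit_def)
        then show ?thesis using all[OF t] a by simp
      qed
      then have x0: "\<forall>i<\<mu>. ev f i = 0" using spec[OF R, of "ev f"] by blast
      have "ev f = 0"
      proof
        fix i show "ev f i = 0 i" using x0 ev_support[of i f] by (cases "i < \<mu>") auto
      qed
      then show False using kernel(1)[OF f(1)] f(2) by simp
    qed
  qed
qed

lemma df_ideal_vanishes:
  assumes phi: "field_hom (\<phi> :: 'k::field \<Rightarrow> 'a)" shows "\<forall>f\<in>df_ideal n ts bs. value_at \<phi> \<Gamma> f = 0"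
proof -
  let ?h = "value_at \<phi> \<Gamma>"
  let ?S = "{indet (k, l) | k l. k < \<mu> \<and> l < length bs \<and> pp_deg (ts ! k) > pp_deg (bs ! l)} :: (nat \<times> nat, 'k) mpoly set"
  note S = df_gens_carrier
  have bp: "border_point n ts bs \<Gamma>" by unfold_locales
  have "\<forall>f\<in>?S. ?h f = 0"
  proof
    fix f :: "(nat \<times> nat, 'k) mpoly" assume "f \<in> ?S"
    then obtain k l where f: "f = indet (k, l)" "k < \<mu>" "l < length bs" "pp_deg (ts ! k) > pp_deg (bs ! l)" by blast
    show "?h f = 0" unfolding f(1) mpoly_at_indet[OF field_hom_comm_ring_hom[OF phi]] by (rule \<Gamma>_degree[OF f(2-4)])
  qed
  with bp show ?thesis
    unfolding df_ideal_def C_ring_eq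
      vanish_sum[OF h_hom[OF phi] bbs_ideal_ideal[OF enum] mpoly_Idl_ideal[OF S]]
      vanish_Idl[OF h_hom[OF phi] S] bbs_ideal_vanishes_iff[OF phi enum \<Gamma>_carr]
    by (rule conjI)
qed

text \<open>With a single term of top degree the block column matrix consists of one square block; its entry
  at \<open>(a, i)\<close> becomes the top coordinate of the product of the terms \<open>ts ! i\<close> and \<open>ts ! a\<close>.\<close>

lemma CBLocus_vanishes_iff:
  assumes phi: "field_hom (\<phi> :: 'k::field \<Rightarrow> 'a)"
  shows "(\<forall>f\<in>CBLocus n ts bs. value_at \<phi> \<Gamma> f = 0) \<longleftrightarrow>
    \<not> strictly_gorenstein n (point_ideal n ts bs \<Gamma>)"
proof -
  let ?h = "value_at \<phi> \<Gamma>"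
  let ?df = "df_matrix ts bs :: nat \<Rightarrow> (nat \<times> nat, 'k) mpoly mat"
  let ?T = "\<lambda>t. term_at n \<mu> ?df t"
  let ?Col = "mat \<mu> \<mu> (\<lambda>(a, i). ?T (ts ! i) $$ (\<mu> - 1, a))"
  note hom = h_hom[OF phi, of \<Gamma>]
  interpret h: comm_ring_hom ?h by (rule hom)
  have z: "?h 0 = 0" by (rule h.hom_zero)
  have dfc: "?df r \<in> carrier_mat \<mu> \<mu>" for r unfolding df_matrix_def by (rule mult_matrix_carrier)
  have dfo: "mat_over (cvars ts bs) (?df r)" if "r < n" for r
    unfolding df_matrix_def by (rule mult_matrix_over[OF enum that]) (auto intro: carr_indet simp: carr_0)
  have Tc: "?T t \<in> carrier_mat \<mu> \<mu>" for t by (rule term_at_carrier[OF dfc])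
  have To: "mat_over (cvars ts bs) (?T t)" for t by (rule term_at_mat_over[OF dfc dfo])
  have dfh: "map_mat ?h (?df r) = Am r" if r: "r < n" for r
  proof (rule eq_matI)
    fix i j assume "i < dim_row (Am r)" "j < dim_col (Am r)"
    then have ij: "i < \<mu>" "j < \<mu>" using carrier_matD[OF Am_carr] by auto
    let ?u = "single r 1 + ts ! j"
    let ?m = "THE m. m < length bs \<and> bs ! m = ?u"
    have "?h (if pp_deg (ts ! i) > pp_deg (bs ! l) then 0 else indet (i, l)) = \<Gamma> $$ (i, l)" if "l < length bs" for l
      using \<Gamma>_degree[OF ij(1) that] z by (simp add: mpoly_at_indet[OF field_hom_comm_ring_hom[OF phi]])
    then have m: "?u \<notin> set ts \<Longrightarrow> ?h (if pp_deg (ts ! i) > pp_deg (bs ! ?m) then 0 else indet (i, ?m)) = \<Gamma> $$ (i, ?m)"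
      using enum_the[OF enum r ij(2)] by blast
    have "map_mat ?h (?df r) $$ (i, j) = mult_matrix ts bs (\<lambda>ij. ?h ((\<lambda>(k, l). if pp_deg (ts ! k) > pp_deg (bs ! l) then 0 else indet (k, l)) ij)) r $$ (i, j)"
      unfolding df_matrix_def mult_matrix_hom[OF hom] ..
    also have "\<dots> = Am r $$ (i, j)"
      using m ij by (simp add: mult_matrix_def Let_def)
    finally show "map_mat ?h (?df r) $$ (i, j) = Am r $$ (i, j)" .
  qed (use carrier_matD[OF Am_carr] carrier_matD[OF dfc] in auto)
  have Th: "map_mat ?h (?T t) = term_at n \<mu> Am t" for t
    unfolding term_at_hom[OF hom dfc] by (rule term_at_cong[OF dfh])
  have Te: "?h (?T (ts ! i) $$ (\<mu> - 1, a)) = v (ts ! i + ts ! a) (\<mu> - 1)" if ia: "i < \<mu>" "a < \<mu>" for i a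
  proof -
    have "?h (?T (ts ! i) $$ (\<mu> - 1, a)) = map_mat ?h (?T (ts ! i)) $$ (\<mu> - 1, a)"
      using ia \<mu>_pos carrier_matD[OF Tc] by simp
    also have "\<dots> = (\<Sum>j<\<mu>. if j = a then term_at n \<mu> Am (ts ! i) $$ (\<mu> - 1, a) else 0)" unfolding Th using ia by simp
    also have "\<dots> = (\<Sum>j<\<mu>. term_at n \<mu> Am (ts ! i) $$ (\<mu> - 1, j) * v (ts ! a) j)"
      unfolding v_ts[OF ia(2)] by (intro sum.cong) (auto simp: unit_def)
    also have "\<dots> = v (ts ! i + ts ! a) (\<mu> - 1)"
      using v_term[OF oi(5)[OF nth_mem[OF ia(1)]], of "\<mu> - 1" "ts ! a"] \<mu>_pos by simp
    finally show ?thesis .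
  qed
  have "{i. i < \<mu> \<and> pp_deg (ts ! i) = pp_deg (ts ! (\<mu> - 1))} = {\<mu> - 1}" using top_term \<mu>_pos by auto
  then have D1: "card {i. i < \<mu> \<and> pp_deg (ts ! i) = pp_deg (ts ! (\<mu> - 1))} = 1" by simp
  have ColE: "mat (1 * \<mu>) \<mu> (\<lambda>(a, i). mat_of_cols \<mu>
               (map (\<lambda>t. col (transpose_mat (?T t)) (\<mu> - 1 + a div \<mu>)) ts) $$ (a mod \<mu>, i)) = ?Col"
    using carrier_matD[OF Tc] \<mu>_pos by (intro eq_matI) (auto simp: mat_of_cols_def)
  have CBE: "CBLocus n ts bs = df_ideal n ts bs <+>\<^bsub>mpoly_ring (cvars ts bs)\<^esub> Idl\<^bsub>mpoly_ring (cvars ts bs)\<^esub> (minors \<mu> ?Col)"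
    unfolding CBLocus_def Let_def D1 ColE C_ring_eq ..
  have Co: "mat_over (cvars ts bs) ?Col"
    using To carrier_matD[OF Tc] \<mu>_pos unfolding mat_over_def by simp
  note dfi = df_ideal_ideal[OF enum]
  have m1: "\<mu> - 1 + 1 = \<mu>" using \<mu>_pos by linarith
  have "(\<forall>f\<in>CBLocus n ts bs. ?h f = 0) \<longleftrightarrow> (\<forall>f\<in>minors \<mu> ?Col. ?h f = 0)"
    unfolding CBE vanish_sum[OF hom dfi mpoly_Idl_ideal[OF minors_carrier[OF Co]]]
      vanish_Idl[OF hom minors_carrier[OF Co]]
    by (rule iffI) (erule conjunct2, rule conjI[OF df_ideal_vanishes[OF phi]])
  also have "\<dots> \<longleftrightarrow> (\<forall>d\<in>minors (\<mu> - 1 + 1) (map_mat ?h ?Col). d = 0)"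
    unfolding minors_hom[OF hom] m1 by simp
  also have "\<dots> \<longleftrightarrow> \<not> \<mu> \<le> funs.dim (funs.span (colf (map_mat ?h ?Col) ` {..<\<mu>}))"
  proof -
    have d: "dim_col (map_mat ?h ?Col) = \<mu>" by simp
    have "x \<le> \<mu> - 1 \<longleftrightarrow> \<not> \<mu> \<le> x" for x using \<mu>_pos by linarith
    then show ?thesis unfolding minors_vanish_iff d .
  qed
  also have "\<dots> \<longleftrightarrow> \<not> fam_indep (colf (map_mat ?h ?Col)) {..<\<mu>}"
  proof -
    have "(\<exists>J\<subseteq>{..<\<mu>}. card J = \<mu> \<and> fam_indep f J) \<longleftrightarrow> fam_indep f {..<\<mu>}" for f :: "nat \<Rightarrow> nat \<Rightarrow> 'a"
      using card_subset_eq[of "{..<\<mu>}"] by auto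
    then show ?thesis unfolding dim_ge_iff[OF finite_lessThan] by simp
  qed
  also have "fam_indep (colf (map_mat ?h ?Col)) {..<\<mu>} \<longleftrightarrow>
    (\<forall>c. (\<forall>a<\<mu>. (\<Sum>i<\<mu>. c i * v (ts ! i + ts ! a) (\<mu> - 1)) = 0) \<longrightarrow> (\<forall>i<\<mu>. c i = 0))"
  proof -
    have "(\<Sum>j<\<mu>. c j * colf (map_mat ?h ?Col) j a) =
      (if a < \<mu> then \<Sum>i<\<mu>. c i * v (ts ! i + ts ! a) (\<mu> - 1) else 0)" for a c
      using Te by (auto simp: colf_def intro!: sum.cong)
    then show ?thesis unfolding fam_indep_def by auto
  qed
  also have "\<dots> \<longleftrightarrow> strictly_gorenstein n (point_ideal n ts bs \<Gamma>)"
    unfolding pairing_nondegenerate_iff[symmetric] pa.strictly_gorenstein_iff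
    using symmetric unfolding pa.symmetric_HF_iff[OF HF_rho] by blast
  finally show ?thesis .
qed

end

section \<open>Changing the order ideal\<close>

lemma monomial_at_single: "monomial_at b (single w e) = b w ^ e"
  by (cases "e = 0") (simp_all add: monomial_at_def)

lemma monomial_at_sum:
  fixes b :: "'v \<Rightarrow> 'b::comm_ring_1"
  shows "monomial_at b (\<Sum>a\<in>A. f a) = (\<Prod>a\<in>A. monomial_at b (f a))"
  by (induction A rule: infinite_finite_induct) (simp_all add: monomial_at_add, simp_all add: monomial_at_def)

lemma mpoly_at_sum:
  assumes "comm_ring_hom \<phi>" shows "mpoly_at \<phi> b (\<Sum>a\<in>A. f a) = (\<Sum>a\<in>A. mpoly_at \<phi> b (f a))"
proof -
  interpret comm_ring_hom "mpoly_at \<phi> b" by (rule mpoly_at_comm_ring_hom[OF assms])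
  show ?thesis by (rule hom_sum)
qed

lemma pp_deg_le_mpoly_deg: "m \<in> keys a \<Longrightarrow> pp_deg m \<le> mpoly_deg a"
  unfolding mpoly_deg_def by (intro Max_ge) auto

text \<open>Substituting \<open>\<delta> c\<close> for the variables and \<open>\<delta>\<close> for the homogenizing one multiplies the value at \<open>c\<close> by a
  power of \<open>\<delta>\<close>.\<close>

lemma homogenization_at:
  assumes phi: "comm_ring_hom \<phi>" and a: "a \<in> carrier (mpoly_ring V)"
    and g: "\<And>x. x \<in> V \<Longrightarrow> g (Some x) = g None * c x"
  shows "mpoly_at \<phi> g (homogenization a) = g None ^ mpoly_deg a * mpoly_at \<phi> c a"
proof -
  let ?d = "g None"
  have m: "monomial_at g ((\<Sum>x\<in>keys m. single (Some x) (lookup m x)) +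
       single None (mpoly_deg a - pp_deg m)) = ?d ^ mpoly_deg a * monomial_at c m"
    if m: "m \<in> keys a" for m
  proof -
    have "(\<Prod>x\<in>keys m. g (Some x) ^ lookup m x) =
      (\<Prod>x\<in>keys m. ?d ^ lookup m x * c x ^ lookup m x)"
    proof (intro prod.cong refl)
      fix x assume "x \<in> keys m"
      then have "x \<in> V" using a m unfolding mpoly_ring_carrier by blast
      show "g (Some x) ^ lookup m x = ?d ^ lookup m x * c x ^ lookup m x"
        unfolding g[OF \<open>x \<in> V\<close>] by (rule power_mult_distrib)
    qed
    also have "\<dots> = ?d ^ pp_deg m * monomial_at c m"
      unfolding prod.distrib pp_deg_def monomial_at_def power_sum ..
    finally have p: "(\<Prod>x\<in>keys m. g (Some x) ^ lookup m x) = ?d ^ pp_deg m * monomial_at c m" .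
    have "?d ^ mpoly_deg a = ?d ^ pp_deg m * ?d ^ (mpoly_deg a - pp_deg m)"
      using pp_deg_le_mpoly_deg[OF m] by (simp add: power_add[symmetric])
    then show ?thesis unfolding monomial_at_add monomial_at_sum monomial_at_single p by (simp add: mult_ac)
  qed
  have "mpoly_at \<phi> g (homogenization a) =
    (\<Sum>m\<in>keys a. \<phi> (lookup a m) * (?d ^ mpoly_deg a * monomial_at c m))"
    unfolding homogenization_def mpoly_at_sum[OF phi] mpoly_at_single[OF phi] using m by (intro sum.cong) auto
  also have "\<dots> = ?d ^ mpoly_deg a * mpoly_at \<phi> c a"
    unfolding mpoly_at_alt sum_distrib_left by (simp add: mult_ac)
  finally show ?thesis .
qed

lemma homogenization_carrier:
  assumes a: "a \<in> carrier (mpoly_ring V)"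
  shows "homogenization a \<in> carrier (mpoly_ring (insert None (Some ` V)))"
  unfolding homogenization_def
proof (intro carr_sum mpoly_ring_single_closed subsetI)
  fix m w assume m: "m \<in> keys a"
    and "w \<in> keys ((\<Sum>x\<in>keys m. single (Some x) (lookup m x)) +
       single None (mpoly_deg a - pp_deg m))"
  then have "w \<in> keys (\<Sum>x\<in>keys m. single (Some x) (lookup m x)) \<or> w = None"
    using keys_add by (fastforce split: if_splits)
  moreover have "keys (\<Sum>x\<in>keys m. single (Some x) (lookup m x)) \<subseteq>
      (\<Union>x\<in>keys m. keys (single (Some x) (lookup m x)))"
    by (rule keys_sum)
  moreover have "(\<Union>x\<in>keys m. keys (single (Some x) (lookup m x))) \<subseteq> Some ` V"
    using a m unfolding mpoly_ring_carrier by (auto split: if_splits)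
  ultimately show "w \<in> insert None (Some ` V)" by blast
qed

lemma mpoly_at_const_closed:
  assumes "q \<in> carrier (mpoly_ring W)" "\<And>w. w \<in> W \<Longrightarrow> g w \<in> carrier (mpoly_ring V)"
  shows "mpoly_at const g q \<in> carrier (mpoly_ring V)"
  unfolding mpoly_at_def
proof (intro carr_sum mpoly_ring_mult_closed mpoly_ring_const_closed carr_prod carr_power)
  fix m w assume "m \<in> keys q" "w \<in> keys m"
  then have "w \<in> W" using assms(1) unfolding mpoly_ring_carrier by blast
  then show "g w \<in> carrier (mpoly_ring V)" by (rule assms(2))
qed

lemma mat_over_adj:
  assumes A: "A \<in> carrier_mat k k" "mat_over V A" shows "mat_over V (adj_mat A)"
proof -
  have "mat_over V (mat_delete A i j)" for i j
    using A unfolding mat_over_def mat_delete_def by auto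
  then have "det (mat_delete A i j) \<in> carrier (mpoly_ring V)" for i j by (rule mat_over_det)
  then have "cofactor A i j \<in> carrier (mpoly_ring V)" for i j
    unfolding cofactor_def by (intro mpoly_ring_mult_closed carr_power carr_uminus carr_1)
  then show ?thesis unfolding mat_over_def adj_mat_def by simp
qed

lemma base_change_closed:
  fixes ts bs ts' bs' :: "nat pp list"
  assumes enum: "order_ideal_enum n ts bs" and len: "length ts' = length ts"
  shows "base_change_det n ts bs ts' \<in> carrier (mpoly_ring (cvars ts bs) :: (nat \<times> nat, 'k::field) mpoly ring)"
    "k < length ts \<Longrightarrow> base_change_coord n ts bs ts' bs' (k, l) \<in> carrier (mpoly_ring (cvars ts bs) :: (nat \<times> nat, 'k::field) mpoly ring)"
proof -
  let ?M = "first_columns n ts bs ts' :: (nat \<times> nat, 'k) mpoly mat" and ?m = "length ts"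
  let ?T = "\<lambda>u. term_at n ?m (generic_matrix ts bs) u :: (nat \<times> nat, 'k) mpoly mat"
  have M: "?M \<in> carrier_mat ?m ?m" using len by (auto simp: first_columns_def)
  have Mo: "mat_over (cvars ts bs) ?M" by (rule first_columns_over[OF enum])
  have To: "mat_over (cvars ts bs) (?T u)" for u
    by (rule term_at_mat_over) (use generic_over[OF enum] mult_matrix_carrier in auto)
  have Tc: "?T u \<in> carrier_mat ?m ?m" for u by (rule term_at_carrier) (rule mult_matrix_carrier)
  have p: "?m > 0" using enum unfolding order_ideal_enum_def order_ideal_def by auto
  show "base_change_det n ts bs ts' \<in> carrier (mpoly_ring (cvars ts bs) :: (nat \<times> nat, 'k) mpoly ring)"
    unfolding base_change_det_def by (rule mat_over_det[OF Mo])
  assume k: "k < ?m"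
  have "base_change_coord n ts bs ts' bs' (k, l) = (\<Sum>j<?m. adj_mat ?M $$ (k, j) * ?T (bs' ! l) $$ (j, 0))"
    using k M carrier_matD[OF Tc] adj_mat(1)[OF M] p
    by (auto simp: base_change_coord_def scalar_prod_def atLeast0LessThan intro!: sum.cong)
  also have "\<dots> \<in> carrier (mpoly_ring (cvars ts bs))"
    using mat_over_adj[OF M Mo] To adj_mat(1)[OF M] carrier_matD[OF Tc] k p
    by (intro carr_sum mpoly_ring_mult_closed) (auto simp: mat_over_def)
  finally show "base_change_coord n ts bs ts' bs' (k, l) \<in> carrier (mpoly_ring (cvars ts bs) :: (nat \<times> nat, 'k) mpoly ring)" .
qed

lemma transported_closed:
  fixes a :: "(nat \<times> nat, 'k::field) mpoly"
  assumes enum: "order_ideal_enum n ts bs" and len: "length ts' = length ts"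
    and a: "a \<in> carrier (mpoly_ring (cvars ts' bs'))"
  shows "transported n ts bs ts' bs' a \<in> carrier (mpoly_ring (cvars ts bs))"
  unfolding transported_def
  by (rule mpoly_at_const_closed[OF homogenization_carrier[OF a]]) (use base_change_closed[OF enum len] len in auto)

context border_point begin

text \<open>The last claim is Cramer's rule: the base change coordinates solve, up to the factor \<open>det T\<close>, the linear system that
  expresses a border term by the new basis.\<close>

lemma base_change_matrix:
  assumes phi: "field_hom (\<phi> :: 'k::field \<Rightarrow> 'l)" and len: "length ts' = \<mu>"
  defines "h \<equiv> value_at \<phi> \<Gamma>"
  defines "T \<equiv> map_mat h (first_columns n ts bs ts')"
  shows "T \<in> carrier_mat \<mu> \<mu>" "\<And>i \<kappa>. i < \<mu> \<Longrightarrow> \<kappa> < \<mu> \<Longrightarrow> T $$ (i, \<kappa>) = v (ts' ! \<kappa>) i"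
    "det T = h (base_change_det n ts bs ts')"
    "\<And>i l. i < \<mu> \<Longrightarrow> (\<Sum>\<kappa><\<mu>. v (ts' ! \<kappa>) i * h (base_change_coord n ts bs ts' bs' (\<kappa>, l))) = det T * v (bs' ! l) i"
proof -
  let ?M = "first_columns n ts bs ts' :: (nat \<times> nat, 'k) mpoly mat"
  note bp = border_point_axioms
  interpret h: comm_ring_hom h unfolding h_def by (rule h_hom[OF phi])
  have M: "?M \<in> carrier_mat \<mu> \<mu>" using len by (auto simp: first_columns_def)
  show T: "T \<in> carrier_mat \<mu> \<mu>" unfolding T_def using M by simp
  show e: "T $$ (i, \<kappa>) = v (ts' ! \<kappa>) i" if "i < \<mu>" "\<kappa> < \<mu>" for i \<kappa>
    unfolding T_def h_def using first_columns_at(1)[OF phi bp that(1)] that len by simp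
  show dT: "det T = h (base_change_det n ts bs ts')"
    unfolding T_def base_change_det_def by simp
  fix i l assume i: "i < \<mu>"
  define w :: "(nat \<times> nat, 'k) mpoly vec" where "w = col (term_at n \<mu> (generic_matrix ts bs) (bs' ! l)) 0"
  have Tc: "term_at n \<mu> (generic_matrix ts bs :: nat \<Rightarrow> (nat \<times> nat, 'k) mpoly mat) u \<in> carrier_mat \<mu> \<mu>" for u
    by (rule term_at_carrier) (rule mult_matrix_carrier)
  have w: "w \<in> carrier_vec \<mu>" unfolding w_def using carrier_matD[OF Tc] by (auto intro!: carrier_vecI)
  have hw: "h (w $ i) = v (bs' ! l) i"
  proof -
    have "w $ i = first_columns n ts bs [bs' ! l] $$ (i, 0)"
      using i by (simp add: first_columns_def mat_of_cols_def w_def)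
    then have "h (w $ i) = map_mat h (first_columns n ts bs [bs' ! l]) $$ (i, 0)"
      using i by (simp add: first_columns_def)
    then show ?thesis unfolding h_def using first_columns_at(1)[OF phi bp i, of 0 "[bs' ! l]"] by simp
  qed
  have A: "adj_mat ?M \<in> carrier_mat \<mu> \<mu>" by (rule adj_mat(1)[OF M])
  have "?M *\<^sub>v (adj_mat ?M *\<^sub>v w) = (?M * adj_mat ?M) *\<^sub>v w" using assoc_mult_mat_vec[OF M A w] by simp
  also have "\<dots> = (det ?M \<cdot>\<^sub>m 1\<^sub>m \<mu>) *\<^sub>v w" unfolding adj_mat(2)[OF M] ..
  finally have "(?M *\<^sub>v (adj_mat ?M *\<^sub>v w)) $ i = ((det ?M \<cdot>\<^sub>m 1\<^sub>m \<mu>) *\<^sub>v w) $ i" by simp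
  moreover have "(?M *\<^sub>v (adj_mat ?M *\<^sub>v w)) $ i = (\<Sum>\<kappa><\<mu>. ?M $$ (i, \<kappa>) * base_change_coord n ts bs ts' bs' (\<kappa>, l))"
  proof -
    have "base_change_coord n ts bs ts' bs' (\<kappa>, l) = (adj_mat ?M *\<^sub>v w) $ \<kappa>" for \<kappa>
      by (simp add: base_change_coord_def w_def)
    then show ?thesis using M A w i by (auto simp: scalar_prod_def atLeast0LessThan intro!: sum.cong)
  qed
  moreover have "((det ?M \<cdot>\<^sub>m 1\<^sub>m \<mu>) *\<^sub>v w) $ i = det ?M * w $ i"
  proof -
    have "((det ?M \<cdot>\<^sub>m 1\<^sub>m \<mu>) *\<^sub>v w) $ i = (\<Sum>j<\<mu>. (det ?M * (if j = i then 1 else 0)) * w $ j)"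
      using w i by (simp add: scalar_prod_def atLeast0LessThan)
    also have "\<dots> = (\<Sum>j<\<mu>. if j = i then det ?M * w $ i else 0)" by (intro sum.cong) auto
    finally show ?thesis using i by simp
  qed
  ultimately have "h (\<Sum>\<kappa><\<mu>. ?M $$ (i, \<kappa>) * base_change_coord n ts bs ts' bs' (\<kappa>, l)) = h (det ?M * w $ i)" by simp
  moreover have "h (?M $$ (i, \<kappa>)) = v (ts' ! \<kappa>) i" if "\<kappa> < \<mu>" for \<kappa>
    using e[OF i that] M i that unfolding T_def by simp
  ultimately show "(\<Sum>\<kappa><\<mu>. v (ts' ! \<kappa>) i * h (base_change_coord n ts bs ts' bs' (\<kappa>, l))) = det T * v (bs' ! l) i"
    unfolding dT base_change_det_def by (simp add: h.hom_sum h.hom_mult hw)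
qed

text \<open>The coordinates of the same ideal in the border basis scheme of the new order ideal.\<close>

definition moved_point :: "('k::field \<Rightarrow> 'l) \<Rightarrow> nat pp list \<Rightarrow> nat pp list \<Rightarrow> 'l mat" where
  "moved_point \<phi> ts' bs' = mat (length ts') (length bs') (\<lambda>kl.
     value_at \<phi> \<Gamma> (base_change_coord n ts bs ts' bs' kl) /
     value_at \<phi> \<Gamma> (base_change_det n ts bs ts'))"

text \<open>The base change matrix intertwines the old and the new multiplication matrices, hence the latter commute.
  It also transforms new coordinate vectors of polynomials to old ones, hence both ideals are the
  kernel of the same map up to an isomorphism.\<close>

theorem moved_point:
  assumes phi: "field_hom (\<phi> :: 'k::field \<Rightarrow> 'l)" and len: "length ts' = \<mu>"
    and enum': "order_ideal_enum n ts' bs'"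
    and nz: "value_at \<phi> \<Gamma> (base_change_det n ts bs ts') \<noteq> 0"
  shows "border_point n ts' bs' (moved_point \<phi> ts' bs')"
    "point_ideal n ts' bs' (moved_point \<phi> ts' bs') = point_ideal n ts bs \<Gamma>"
proof -
  let ?h = "value_at \<phi> \<Gamma>"
  define T where "T = map_mat ?h (first_columns n ts bs ts')"
  define G where "G = moved_point \<phi> ts' bs'"
  let ?A = "mult_matrix ts' bs' (\<lambda>ij. G $$ ij)"
  note bc = base_change_matrix[OF phi len, folded T_def]
  have dT: "det T \<noteq> 0" using nz bc(3) by simp
  have T: "T \<in> carrier_mat \<mu> \<mu>" by (rule bc(1))
  have A: "?A r \<in> carrier_mat \<mu> \<mu>" for r using mult_matrix_carrier[of ts' bs'] len by simp
  have border: "(\<Sum>\<kappa><\<mu>. v (ts' ! \<kappa>) i * G $$ (\<kappa>, l)) = v (bs' ! l) i" if "i < \<mu>" "l < length bs'" for i l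
  proof -
    have "(\<Sum>\<kappa><\<mu>. v (ts' ! \<kappa>) i * G $$ (\<kappa>, l)) =
       (\<Sum>\<kappa><\<mu>. v (ts' ! \<kappa>) i * ?h (base_change_coord n ts bs ts' bs' (\<kappa>, l))) / det T"
      unfolding sum_divide_distrib bc(3) G_def moved_point_def using that len by (intro sum.cong) auto
    then show ?thesis unfolding bc(4)[OF that(1)] using dT by simp
  qed
  have d': "distinct ts'" "distinct bs'" and b': "set bs' = border n (set ts')"
    using enum' unfolding order_ideal_enum_def by auto
  have column: "(\<Sum>\<kappa><\<mu>. v (ts' ! \<kappa>) i * ?A r $$ (\<kappa>, j)) = v (single r 1 + ts' ! j) i"
    if "i < \<mu>" "j < \<mu>" "r < n" for i j r
  proof (cases "single r 1 + ts' ! j \<in> set ts'")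
    case True
    then obtain k where k: "k < \<mu>" "ts' ! k = single r 1 + ts' ! j" using len by (auto simp: in_set_conv_nth)
    have "(\<Sum>\<kappa><\<mu>. v (ts' ! \<kappa>) i * ?A r $$ (\<kappa>, j)) = (\<Sum>\<kappa><\<mu>. if \<kappa> = k then v (ts' ! k) i else 0)"
    proof (intro sum.cong refl)
      fix \<kappa> assume "\<kappa> \<in> {..<\<mu>}"
      then have "?A r $$ (\<kappa>, j) = (if \<kappa> = k then 1 else 0)"
        using True that k len nth_eq_iff_index_eq[OF d'(1), of \<kappa> k] by (simp add: mult_matrix_def Let_def)
      then show "v (ts' ! \<kappa>) i * ?A r $$ (\<kappa>, j) = (if \<kappa> = k then v (ts' ! k) i else 0)" by simp
    qed
    then show ?thesis using k by simp
  next
    case False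
    let ?m = "THE m. m < length bs' \<and> bs' ! m = single r 1 + ts' ! j"
    have "ts' ! j \<in> set ts'" using that len by simp
    then have "single r 1 + ts' ! j \<in> set bs'"
      using False that(3) unfolding b' border_def by blast
    then obtain k where k: "k < length bs'" "bs' ! k = single r 1 + ts' ! j"
      by (auto simp: in_set_conv_nth)
    have m: "?m = k"
    proof (rule the_equality)
      show "k < length bs' \<and> bs' ! k = single r 1 + ts' ! j" using k by blast
      fix m assume m: "m < length bs' \<and> bs' ! m = single r 1 + ts' ! j"
      then have "bs' ! m = bs' ! k" using k(2) by simp
      then show "m = k" using nth_eq_iff_index_eq[OF d'(2) _ k(1)] m by blast
    qed
    have "(\<Sum>\<kappa><\<mu>. v (ts' ! \<kappa>) i * ?A r $$ (\<kappa>, j)) = (\<Sum>\<kappa><\<mu>. v (ts' ! \<kappa>) i * G $$ (\<kappa>, k))"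
      using False that len m by (intro sum.cong) (auto simp: mult_matrix_def Let_def)
    then show ?thesis unfolding border[OF that(1) k(1)] k(2) .
  qed
  have inter: "T * ?A r = Am r * T" if r: "r < n" for r
  proof (rule eq_matI)
    fix i j assume "i < dim_row (Am r * T)" "j < dim_col (Am r * T)"
    then have ij: "i < \<mu>" "j < \<mu>" using T Am_carr[of r] by auto
    have "(T * ?A r) $$ (i, j) = (\<Sum>\<kappa><\<mu>. v (ts' ! \<kappa>) i * ?A r $$ (\<kappa>, j))"
      using T A[of r] ij bc(2) by (auto simp: scalar_prod_def atLeast0LessThan intro!: sum.cong)
    also have "\<dots> = op r (v (ts' ! j)) i" unfolding column[OF ij r] using v_step[OF r] by simp
    also have "\<dots> = (Am r * T) $$ (i, j)"
      using T Am_carr[of r] ij bc(2) by (auto simp: op_def scalar_prod_def atLeast0LessThan intro!: sum.cong)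
    finally show "(T * ?A r) $$ (i, j) = (Am r * T) $$ (i, j)" .
  qed (use carrier_matD[OF T] carrier_matD[OF A] carrier_matD[OF Am_carr] in auto)
  have TAA: "T * (?A r * ?A s) = (Am r * Am s) * T" if "r < n" "s < n" for r s
  proof -
    have "T * (?A r * ?A s) = (T * ?A r) * ?A s" using assoc_mult_mat[OF T A A] by simp
    also have "\<dots> = Am r * (T * ?A s)" unfolding inter[OF that(1)] using assoc_mult_mat[OF Am_carr T A] by simp
    also have "\<dots> = (Am r * Am s) * T" unfolding inter[OF that(2)] using assoc_mult_mat[OF Am_carr Am_carr T] by simp
    finally show ?thesis .
  qed
  have cancel: "U = W" if "U \<in> carrier_mat \<mu> \<mu>" "W \<in> carrier_mat \<mu> \<mu>" "T * U = T * W" for U W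
  proof -
    have B: "adj_mat T \<in> carrier_mat \<mu> \<mu>" by (rule adj_mat(1)[OF T])
    have "det T \<cdot>\<^sub>m S = adj_mat T * (T * S)" if S: "S \<in> carrier_mat \<mu> \<mu>" for S
    proof -
      have "adj_mat T * (T * S) = (det T \<cdot>\<^sub>m 1\<^sub>m \<mu>) * S"
        using assoc_mult_mat[OF B T S] adj_mat(3)[OF T] by simp
      also have "\<dots> = det T \<cdot>\<^sub>m S" using mult_smult_assoc_mat[OF one_carrier_mat S] S by simp
      finally show ?thesis by simp
    qed
    then have e: "det T \<cdot>\<^sub>m U = det T \<cdot>\<^sub>m W" using that by simp
    show ?thesis
    proof (rule eq_matI)
      fix i j assume "i < dim_row W" "j < dim_col W"
      then show "U $$ (i, j) = W $$ (i, j)" using arg_cong[OF e, of "\<lambda>M. M $$ (i, j)"] that dT by simp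
    qed (use that in auto)
  qed
  show bp': "border_point n ts' bs' (moved_point \<phi> ts' bs')"
    unfolding G_def[symmetric]
  proof (rule border_point.intro[OF enum'])
    show "G \<in> carrier_mat (length ts') (length bs')" unfolding G_def moved_point_def by simp
    fix r s assume rs: "r < n" "s < n"
    show "?A r * ?A s = ?A s * ?A r"
      by (rule cancel) (use TAA rs commute A mult_carrier_mat[OF A A] in auto)
  qed
  interpret B: border_point n ts' bs' G using bp' unfolding G_def .
  have vv: "v t i = (\<Sum>\<kappa><\<mu>. B.v t \<kappa> * v (ts' ! \<kappa>) i)" if "keys t \<subseteq> {..<n}" for t i
    using that
  proof (induction t arbitrary: i rule: pp_induct)
    case zero
    have "(\<Sum>\<kappa><\<mu>. B.v 0 \<kappa> * v (ts' ! \<kappa>) i) = (\<Sum>\<kappa><\<mu>. if \<kappa> = 0 then v 0 i else 0)"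
      unfolding B.v_zero by (intro sum.cong) (auto simp: B.unit_def B.first_term)
    then show ?case using \<mu>_pos by simp
  next
    case (step r t)
    show ?case
    proof (cases "i < \<mu>")
      case True
      have "v (single r 1 + t) i = (\<Sum>j<\<mu>. Am r $$ (i, j) * (\<Sum>\<kappa><\<mu>. B.v t \<kappa> * v (ts' ! \<kappa>) j))"
        unfolding v_step[OF step(1)] op_def using True step(3) by simp
      also have "\<dots> = (\<Sum>j<\<mu>. \<Sum>\<kappa><\<mu>. B.v t \<kappa> * (Am r $$ (i, j) * v (ts' ! \<kappa>) j))"
        unfolding sum_distrib_left by (intro sum.cong) auto
      also have "\<dots> = (\<Sum>\<kappa><\<mu>. \<Sum>j<\<mu>. B.v t \<kappa> * (Am r $$ (i, j) * v (ts' ! \<kappa>) j))" by (rule sum.swap)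
      also have "\<dots> = (\<Sum>\<kappa><\<mu>. B.v t \<kappa> * v (single r 1 + ts' ! \<kappa>) i)"
        unfolding v_step[OF step(1)] op_def using True by (simp add: sum_distrib_left)
      also have "\<dots> = (\<Sum>\<kappa><\<mu>. \<Sum>\<tau><\<mu>. B.v t \<kappa> * (v (ts' ! \<tau>) i * ?A r $$ (\<tau>, \<kappa>)))"
        using column[OF True _ step(1)] by (auto simp: sum_distrib_left[symmetric] intro!: sum.cong)
      also have "\<dots> = (\<Sum>\<tau><\<mu>. \<Sum>\<kappa><\<mu>. B.v t \<kappa> * (v (ts' ! \<tau>) i * ?A r $$ (\<tau>, \<kappa>)))" by (rule sum.swap)
      also have "\<dots> = (\<Sum>\<tau><\<mu>. B.v (single r 1 + t) \<tau> * v (ts' ! \<tau>) i)"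
        unfolding B.v_step[OF step(1)] B.op_def using len by (auto simp: sum_distrib_left sum_distrib_right mult_ac intro!: sum.cong)
      finally show ?thesis .
    qed (simp add: v_support)
  qed
  have ee: "ev p i = (\<Sum>\<kappa><\<mu>. B.ev p \<kappa> * v (ts' ! \<kappa>) i)" if p: "p \<in> carrier PR" for p i
  proof -
    have "ev p i = (\<Sum>m\<in>keys p. \<Sum>\<kappa><\<mu>. lookup p m * B.v m \<kappa> * v (ts' ! \<kappa>) i)"
      unfolding ev_def fun_sum_apply
    proof (intro sum.cong refl)
      fix m assume "m \<in> keys p"
      then have "keys m \<subseteq> {..<n}" using p unfolding mpoly_ring_carrier by blast
      then show "lookup p m * v m i = (\<Sum>\<kappa><\<mu>. lookup p m * B.v m \<kappa> * v (ts' ! \<kappa>) i)"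
        using vv[of m i] by (simp add: sum_distrib_left mult.assoc)
    qed
    also have "\<dots> = (\<Sum>\<kappa><\<mu>. \<Sum>m\<in>keys p. lookup p m * B.v m \<kappa> * v (ts' ! \<kappa>) i)"
      by (rule sum.swap)
    also have "\<dots> = (\<Sum>\<kappa><\<mu>. B.ev p \<kappa> * v (ts' ! \<kappa>) i)"
      unfolding B.ev_def fun_sum_apply by (simp add: sum_distrib_right)
    finally show ?thesis .
  qed
  have "ev p = 0 \<longleftrightarrow> B.ev p = 0" if p: "p \<in> carrier PR" for p
  proof
    assume z: "B.ev p = 0"
    show "ev p = 0"
    proof
      fix i show "ev p i = 0 i" unfolding ee[OF p] z by simp
    qed
  next
    assume z: "ev p = 0"
    have "(\<Sum>j<\<mu>. T $$ (i, j) * B.ev p j) = 0" if i: "i < \<mu>" for i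
    proof -
      have "(\<Sum>j<\<mu>. T $$ (i, j) * B.ev p j) = ev p i"
        unfolding ee[OF p] using bc(2)[OF i] by (intro sum.cong) (auto simp: mult.commute)
      then show ?thesis using z by simp
    qed
    then have "\<forall>j<\<mu>. B.ev p j = 0" using iffD1[OF det_nonzero_iff[OF T] dT, THEN spec, of "B.ev p"] by blast
    then show "B.ev p = 0" using B.ev_support[of _ p] len
    proof -
      assume z: "\<forall>j<\<mu>. B.ev p j = 0"
      show ?thesis
      proof
        fix j show "B.ev p j = 0 j" using z B.ev_support[of j p] len by (cases "j < \<mu>") auto
      qed
    qed
  qed
  then have "p \<in> point_ideal n ts' bs' G \<longleftrightarrow> p \<in> point_ideal n ts bs \<Gamma>" if "p \<in> carrier PR" for p
    using that kernel(1)[OF that] B.kernel(1)[OF that] by simp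
  then show "point_ideal n ts' bs' (moved_point \<phi> ts' bs') = point_ideal n ts bs \<Gamma>"
    unfolding G_def[symmetric] using mpoly_ideal(1)[OF point_ideal] mpoly_ideal(1)[OF B.point_ideal] by blast
qed

theorem transported_at:
  assumes phi: "field_hom (\<phi> :: 'k::field \<Rightarrow> 'l)" 
    and nz: "value_at \<phi> \<Gamma> (base_change_det n ts bs ts') \<noteq> 0"
    and a: "a \<in> carrier (mpoly_ring (cvars ts' bs'))"
  shows "value_at \<phi> \<Gamma> (transported n ts bs ts' bs' a) = 0 \<longleftrightarrow>
    mpoly_at \<phi> (\<lambda>kl. moved_point \<phi> ts' bs' $$ kl) a = 0"
proof -
  define h where "h = value_at \<phi> \<Gamma>"
  note cr = field_hom_comm_ring_hom[OF phi]
  interpret h: comm_ring_hom h unfolding h_def by (rule h_hom[OF phi])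
  let ?g = "\<lambda>x. case x of None \<Rightarrow> base_change_det n ts bs ts' | Some kl \<Rightarrow> base_change_coord n ts bs ts' bs' kl"
  have hc: "h (const c) = \<phi> c" for c
    unfolding h_def const_def mpoly_at_single[OF cr] by (simp add: monomial_at_def)
  have "h (mpoly_at const ?g q) = mpoly_at \<phi> (\<lambda>x. h (?g x)) q" for q
    unfolding mpoly_at_def by (simp add: h.hom_sum h.hom_mult h.hom_prod h.hom_power hc)
  then have "h (transported n ts bs ts' bs' a) = mpoly_at \<phi> (\<lambda>x. h (?g x)) (homogenization a)"
    unfolding transported_def by simp
  also have "\<dots> = h (?g None) ^ mpoly_deg a * mpoly_at \<phi> (\<lambda>kl. moved_point \<phi> ts' bs' $$ kl) a"
  proof (rule homogenization_at[OF cr a])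
    fix x assume "x \<in> cvars ts' bs'"
    then show "h (?g (Some x)) = h (?g None) * moved_point \<phi> ts' bs' $$ x"
      using nz unfolding moved_point_def h_def by auto
  qed
  finally show ?thesis using nz unfolding h_def by simp
qed

end

section \<open>An order ideal adapted to the degree filtration\<close>

lemma dim_span_indep:
  assumes "finite A" "fam_indep f A" shows "funs.dim (funs.span (f ` A)) = card A"
proof (rule antisym)
  show "card A \<le> funs.dim (funs.span (f ` A))" unfolding dim_ge_iff[OF assms(1)] using assms(2) by blast
  obtain J where J: "J \<subseteq> A" "card J = funs.dim (funs.span (f ` A))"
    using iffD1[OF dim_ge_iff[OF assms(1)] order_refl] by blast
  show "funs.dim (funs.span (f ` A)) \<le> card A" unfolding J(2)[symmetric] by (rule card_mono[OF assms(1) J(1)])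
qed

context border_point begin

interpretation pa: presented_algebra n "point_ideal n ts bs \<Gamma>" ev \<mu> by (rule presented)

text \<open>The terms smaller than \<open>t\<close> in a term ordering that compares degrees first.\<close>

definition below :: "nat pp \<Rightarrow> nat pp set" where
  "below t = {s. keys s \<subseteq> {..<n} \<and> (pp_deg s < pp_deg t \<or> pp_deg s = pp_deg t \<and> s < t)}"

text \<open>The complement of the leading terms of the ideal for this term ordering.\<close>

definition lead :: "nat pp set" where
  "lead = {t. keys t \<subseteq> {..<n} \<and> v t \<notin> funs.span (v ` below t)}"

lemma below_finite: "finite (below t)"
  by (rule finite_subset[OF _ finite_terms[of n "pp_deg t"]]) (auto simp: below_def)

lemma below_trans: "s \<in> below t \<Longrightarrow> below s \<subseteq> below t" unfolding below_def by auto

lemma below_card: "s \<in> below t \<Longrightarrow> card (below s) < card (below t)"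
proof (rule psubset_card_mono[OF below_finite])
  assume "s \<in> below t"
  moreover have "s \<notin> below s" unfolding below_def by simp
  ultimately show "below s \<subset> below t" using below_trans by blast
qed

lemma below_total:
  "keys s \<subseteq> {..<n} \<Longrightarrow> keys t \<subseteq> {..<n} \<Longrightarrow> s \<noteq> t \<Longrightarrow> s \<in> below t \<or> t \<in> below s"
  unfolding below_def by auto

lemma keys_step: "r < n \<Longrightarrow> keys (t :: nat pp) \<subseteq> {..<n} \<Longrightarrow> keys (single r 1 + t) \<subseteq> {..<n}"
  using keys_add[of "single r (1::nat)" t] by (auto split: if_splits)

lemma below_step: assumes "r < n" "s \<in> below t" shows "single r 1 + s \<in> below (single r 1 + t)"
proof -
  have "single r 1 + s < single r 1 + t" if "s < t"
  proof -
    have "single r 1 + s \<le> single r 1 + t" using that by (intro add_left_mono) simp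
    moreover have "single r 1 + s \<noteq> single r 1 + t" using that by simp
    ultimately show ?thesis by simp
  qed
  then show ?thesis using assms keys_step unfolding below_def by (auto simp: pp_deg_add)
qed

lemma op_span: "x \<in> funs.span A \<Longrightarrow> op r x \<in> funs.span (op r ` A)"
proof (induction x rule: funs.span_induct_alt)
  case base
  show ?case unfolding op_zero by (rule funs.span_zero)
next
  case (step c x y)
  have "op r ((\<lambda>i. c * x i) + y) = (\<lambda>i. c * op r x i) + op r y" unfolding op_add op_scale ..
  then show ?case using step by (simp only:) (rule funs.span_add[OF funs.span_scale[OF funs.span_base[OF imageI]]])
qed

lemma not_lead_step:
  assumes "r < n" "v s \<in> funs.span (v ` below s)"
  shows "v (single r 1 + s) \<in> funs.span (v ` below (single r 1 + s))"
proof -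
  have "op r (v s) \<in> funs.span (op r ` v ` below s)" by (rule op_span[OF assms(2)])
  moreover have "op r ` v ` below s \<subseteq> v ` below (single r 1 + s)"
  proof
    fix x assume "x \<in> op r ` v ` below s"
    then obtain u where u: "u \<in> below s" "x = op r (v u)" by blast
    have "x = v (single r 1 + u)" unfolding u(2) v_step[OF assms(1)] ..
    then show "x \<in> v ` below (single r 1 + s)" by (rule image_eqI) (rule below_step[OF assms(1) u(1)])
  qed
  ultimately show ?thesis unfolding v_step[OF assms(1)] using funs.span_mono by blast
qed

text \<open>If a term reduces to smaller ones, so does each of its multiples, since the ordering is compatible with
  multiplication.\<close>

lemma lead_divisor: assumes "s + s' \<in> lead" shows "s \<in> lead"
proof -
  have k: "keys (s + s') \<subseteq> {..<n}" "v (s + s') \<notin> funs.span (v ` below (s + s'))"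
    using assms unfolding lead_def by auto
  have ks: "keys s \<subseteq> {..<n}" "keys s' \<subseteq> {..<n}"
    using k(1) by (auto simp: in_keys_iff lookup_add subset_iff)
  have "v (s' + s) \<in> funs.span (v ` below (s' + s))" if s: "v s \<in> funs.span (v ` below s)"
    using ks(2)
  proof (induction s' rule: pp_induct)
    case zero then show ?case using s by simp
  next
    case (step r t)
    then show ?case using not_lead_step[OF step(1), of "t + s"] by (simp add: add.assoc)
  qed
  then have "v s \<notin> funs.span (v ` below s)" using k(2) by (auto simp: add.commute)
  then show ?thesis unfolding lead_def using ks by simp
qed

lemma lead_spans: "keys t \<subseteq> {..<n} \<Longrightarrow> v t \<in> funs.span (v ` (lead \<inter> insert t (below t)))"
proof (induction "card (below t)" arbitrary: t rule: less_induct)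
  case less
  show ?case
  proof (cases "t \<in> lead")
    case True
    then show ?thesis by (intro funs.span_base) auto
  next
    case False
    then have "v t \<in> funs.span (v ` below t)" using less.prems unfolding lead_def by simp
    moreover have "funs.span (v ` below t) \<subseteq> funs.span (v ` (lead \<inter> insert t (below t)))"
    proof (rule funs.span_minimal[OF _ funs.subspace_span], rule subsetI)
      fix x assume "x \<in> v ` below t"
      then obtain s where s: "s \<in> below t" "x = v s" by blast
      have "keys s \<subseteq> {..<n}" using s(1) unfolding below_def by simp
      then have "v s \<in> funs.span (v ` (lead \<inter> insert s (below s)))" by (rule less.hyps[OF below_card[OF s(1)]])
      moreover have "lead \<inter> insert s (below s) \<subseteq> lead \<inter> insert t (below t)" using below_trans[OF s(1)] s(1) by blast
      ultimately show "x \<in> funs.span (v ` (lead \<inter> insert t (below t)))"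
        unfolding s(2) using funs.span_mono[OF image_mono] by blast
    qed
    ultimately show ?thesis by blast
  qed
qed

text \<open>In a linear relation the largest term would reduce to smaller ones.\<close>

lemma lead_indep: assumes A: "finite A" "A \<subseteq> lead" shows "fam_indep v A"
  unfolding fam_indep_def
proof (rule allI, rule impI)
  fix c assume z: "\<forall>i. (\<Sum>t\<in>A. c t * v t i) = 0"
  show "\<forall>t\<in>A. c t = 0"
  proof (rule ccontr)
    assume "\<not> (\<forall>t\<in>A. c t = 0)"
    define S where "S = {t \<in> A. c t \<noteq> 0}"
    have S: "finite S" "S \<noteq> {}" unfolding S_def using A(1) \<open>\<not> _\<close> by auto
    have "Max ((\<lambda>t. card (below t)) ` S) \<in> (\<lambda>t. card (below t)) ` S" using S by (intro Max_in) auto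
    then obtain t where t: "t \<in> S" "card (below t) = Max ((\<lambda>t. card (below t)) ` S)" by auto
    have tmax: "card (below s) \<le> card (below t)" if "s \<in> S" for s
      unfolding t(2) using that S(1) by (intro Max_ge) auto
    have tA: "t \<in> A" "c t \<noteq> 0" using t(1) unfolding S_def by auto
    have bel: "s \<in> below t" if s: "s \<in> S - {t}" for s
    proof -
      have "s \<in> lead" "t \<in> lead" using s t(1) A(2) unfolding S_def by auto
      then have "s \<in> below t \<or> t \<in> below s" using below_total[of s t] s unfolding lead_def by auto
      then show ?thesis using below_card[of t s] tmax[of s] s by fastforce
    qed
    have "v t = (\<Sum>s\<in>S - {t}. (\<lambda>i. (- c s / c t) * v s i))"
    proof
      fix i
      have "(\<Sum>s\<in>A. c s * v s i) = (\<Sum>s\<in>S. c s * v s i)"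
        using A(1) by (intro sum.mono_neutral_right) (auto simp: S_def)
      also have "\<dots> = c t * v t i + (\<Sum>s\<in>S - {t}. c s * v s i)" using S(1) t(1) by (rule sum.remove)
      finally have "c t * v t i = - (\<Sum>s\<in>S - {t}. c s * v s i)" using z by (simp add: eq_neg_iff_add_eq_0)
      then have "v t i = - (\<Sum>s\<in>S - {t}. c s * v s i) / c t" using tA(2) by (simp add: field_simps)
      also have "\<dots> = (\<Sum>s\<in>S - {t}. (- c s / c t) * v s i)"
        by (simp add: sum_negf[symmetric] sum_divide_distrib)
      finally show "v t i = (\<Sum>s\<in>S - {t}. (\<lambda>i. (- c s / c t) * v s i)) i" unfolding fun_sum_apply .
    qed
    also have "\<dots> \<in> funs.span (v ` below t)"
      by (intro funs.span_sum funs.span_scale funs.span_base imageI bel)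
    finally have "v t \<in> funs.span (v ` below t)" .
    moreover have "t \<in> lead" using tA(1) A(2) by blast
    ultimately show False unfolding lead_def by blast
  qed
qed

lemma lead_keys: "t \<in> lead \<Longrightarrow> keys t \<subseteq> {..<n}" unfolding lead_def by simp

lemma lead_finite: "finite {t \<in> lead. pp_deg t \<le> i}"
  by (rule finite_subset[OF _ finite_terms[of n i]]) (use lead_keys in auto)

text \<open>Because smaller terms have at most the same degree, the terms of degree at most \<open>i\<close> reduce to terms of
  \<open>lead\<close> of degree at most \<open>i\<close>.\<close>

lemma lead_HF: "order_ideal_HF lead i = HF i"
proof -
  have "V_le i = funs.span (v ` {t \<in> lead. pp_deg t \<le> i})"
  proof
    show "funs.span (v ` {t \<in> lead. pp_deg t \<le> i}) \<subseteq> V_le i"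
      by (intro funs.span_mono image_mono) (use lead_keys in auto)
    show "V_le i \<subseteq> funs.span (v ` {t \<in> lead. pp_deg t \<le> i})"
    proof (rule funs.span_minimal[OF _ funs.subspace_span], rule subsetI)
      fix x assume "x \<in> v ` terms_le n i"
      then obtain u where u: "keys u \<subseteq> {..<n}" "pp_deg u \<le> i" "x = v u" by blast
      have "lead \<inter> insert u (below u) \<subseteq> {t \<in> lead. pp_deg t \<le> i}" using u(2) unfolding below_def by auto
      then show "x \<in> funs.span (v ` {t \<in> lead. pp_deg t \<le> i})"
        unfolding u(3) using lead_spans[OF u(1)] funs.span_mono[OF image_mono] by blast
    qed
  qed
  then show ?thesis unfolding HF_eq order_ideal_HF_def
    using dim_span_indep[OF lead_finite lead_indep[OF lead_finite], of i] by simp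
qed

lemma lead_deg: assumes "t \<in> lead" shows "pp_deg t \<le> pa.rho"
proof (rule ccontr)
  assume d: "\<not> pp_deg t \<le> pa.rho"
  have "{s \<in> lead. pp_deg s \<le> pa.rho} \<subset> {s \<in> lead. pp_deg s \<le> pp_deg t}" using assms d by auto
  then have "order_ideal_HF lead pa.rho < order_ideal_HF lead (pp_deg t)"
    unfolding order_ideal_HF_def by (rule psubset_card_mono[OF lead_finite])
  moreover have "HF (pp_deg t) = \<mu>" unfolding HF_eq_top_iff using d by simp
  ultimately show False unfolding lead_HF HF_rho by simp
qed

lemma lead_order_ideal: "order_ideal n lead"
  unfolding order_ideal_def
proof (intro conjI ballI allI impI)
  have e: "{t \<in> lead. pp_deg t \<le> pa.rho} = lead" using lead_deg by auto
  show f: "finite lead" using lead_finite[of pa.rho] unfolding e .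
  have "card lead = \<mu>" using lead_HF[of pa.rho] unfolding order_ideal_HF_def e HF_rho .
  then show "lead \<noteq> {}" using \<mu>_pos by auto
qed (use lead_keys lead_divisor in auto)

lemma adapted_card:
  assumes "finite T" "order_ideal_HF T = HF" shows "card T = \<mu>"
proof -
  define k where "k = Max (insert pa.rho (pp_deg ` T))"
  have "{t \<in> T. pp_deg t \<le> k} = T" unfolding k_def using assms(1) by auto
  moreover have "HF k = \<mu>" unfolding HF_eq_top_iff k_def using assms(1) by simp
  ultimately show ?thesis using fun_cong[OF assms(2), of k] unfolding order_ideal_HF_def by simp
qed

lemma base_change_det_nonzero:
  assumes phi: "field_hom (\<phi> :: 'k::field \<Rightarrow> 'l)" and len: "length ts' = \<mu>" and dist: "distinct ts'"
    and ind: "fam_indep v (set ts')"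
  shows "value_at \<phi> \<Gamma> (base_change_det n ts bs ts') \<noteq> 0"
  unfolding base_change_matrix(3)[OF phi len, symmetric] det_nonzero_iff[OF base_change_matrix(1)[OF phi len]]
proof (rule allI, rule impI)
  let ?T = "map_mat (value_at \<phi> \<Gamma>) (first_columns n ts bs ts')"
  fix c assume z: "\<forall>i<\<mu>. (\<Sum>j<\<mu>. ?T $$ (i, j) * c j) = 0"
  define g where "g = (\<lambda>t. c (THE j. j < \<mu> \<and> ts' ! j = t))"
  have g: "g (ts' ! j) = c j" if "j < \<mu>" for j
  proof -
    have "(THE j'. j' < \<mu> \<and> ts' ! j' = ts' ! j) = j"
      using that len nth_eq_iff_index_eq[OF dist] by (intro the_equality) auto
    then show ?thesis unfolding g_def by simp
  qed
  have bij: "bij_betw ((!) ts') {..<\<mu>} (set ts')" using bij_betw_nth[OF dist] len by simp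
  have "(\<Sum>t\<in>set ts'. g t * v t i) = 0" for i
  proof -
    have "(\<Sum>t\<in>set ts'. g t * v t i) = (\<Sum>j<\<mu>. g (ts' ! j) * v (ts' ! j) i)"
      by (rule sum.reindex_bij_betw[OF bij, symmetric])
    also have "\<dots> = 0"
    proof (cases "i < \<mu>")
      case True
      then show ?thesis using spec[OF z, of i] base_change_matrix(2)[OF phi len True] g
        by (simp add: mult.commute)
    qed (simp add: v_support)
    finally show ?thesis .
  qed
  then have "g t = 0" if "t \<in> set ts'" for t using fam_indepD[OF ind] that by blast
  then show "\<forall>j<\<mu>. c j = 0" using g len by (metis nth_mem)
qed

lemma HF_le: "HF i \<le> \<mu>"
proof -
  let ?U = "{x :: nat \<Rightarrow> 'l. \<forall>j\<ge>\<mu>. x j = 0}"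
  have U: "funs.subspace ?U" by (rule funs.subspaceI) auto
  have "V_le i \<subseteq> ?U" by (rule funs.span_minimal[OF _ U]) (use v_support in auto)
  then have "HF i \<le> funs.dim ?U"
    unfolding HF_eq by (rule funs.subspace_dim_mono[OF funs.subspace_span U _ coordinate_space(1)]) simp
  then show ?thesis unfolding coordinate_space(2) .
qed

section \<open>The locus where the Hilbert function is strictly smaller\<close>

text \<open>Otherwise one of the intersected ideals would vanish and give the bound \<open>HF i - 1\<close> for \<open>HF i\<close> itself.  Lowering
  the value at \<open>i\<close> moves the place where \<open>\<mu>\<close> is first attained beyond \<open>i\<close>, so the minors for this \<open>i\<close> are among the
  generators.\<close>

lemma bbs_Z_ideal_at:
  assumes phi: "field_hom (\<phi> :: 'k::field \<Rightarrow> 'l)"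
  shows "ideal (bbs_Z_ideal n ts bs HF) (mpoly_ring (cvars ts bs) :: (nat \<times> nat, 'k) mpoly ring)"
    "\<exists>f\<in>bbs_Z_ideal n ts bs HF. value_at \<phi> \<Gamma> f \<noteq> 0"
proof -
  let ?h = "value_at \<phi> \<Gamma>"
  define K where "K = {i \<in> {1..pa.rho}. int (HF i) - 1 \<ge> int (order_ideal_HF (set ts) i)}"
  define J where "J = (\<lambda>i. bbs_HF_ideal n ts bs (HF(i := HF i - 1)) :: (nat \<times> nat, 'k) mpoly set)"
  have Z: "bbs_Z_ideal n ts bs HF = carrier (mpoly_ring (cvars ts bs)) \<inter> (\<Inter>i\<in>K. J i)"
    unfolding bbs_Z_ideal_def Let_def Least_HF K_def J_def C_ring_eq ..
  have K: "finite K" unfolding K_def by simp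
  have J: "ideal (J i) (mpoly_ring (cvars ts bs))" for i unfolding J_def by (rule bbs_HF_ideal_ideal[OF enum])
  note V = vanish_Inter[OF h_hom[OF phi] K J]
  show "ideal (bbs_Z_ideal n ts bs HF) (mpoly_ring (cvars ts bs) :: (nat \<times> nat, 'k) mpoly ring)"
    unfolding Z by (rule conjunct1[OF V])
  show "\<exists>f\<in>bbs_Z_ideal n ts bs HF. ?h f \<noteq> 0"
  proof (rule ccontr)
    assume "\<not> (\<exists>f\<in>bbs_Z_ideal n ts bs HF. ?h f \<noteq> 0)"
    then have "\<forall>f\<in>carrier (mpoly_ring (cvars ts bs)) \<inter> (\<Inter>i\<in>K. J i). ?h f = 0" unfolding Z by simp
    then obtain i where i: "i \<in> K" "\<forall>f\<in>J i. ?h f = 0" using conjunct2[OF V] by auto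
    let ?G = "HF(i := HF i - 1)"
    have i1: "1 \<le> i" "i \<le> pa.rho" "HF i \<ge> 1" using i(1) unfolding K_def by auto
    \<comment> \<open>Only the value at \<open>i \<le> \<rho>\<close> was changed, so \<open>\<mu>\<close> is still attained at \<open>\<rho> + 1\<close>.\<close>
    have ex: "?G (pa.rho + 1) = \<mu>" using i1 HF_eq_top_iff[of "pa.rho + 1"] by simp
    define \<sigma> where "\<sigma> = (LEAST j. ?G j = \<mu>)"
    have s: "?G \<sigma> = \<mu>" unfolding \<sigma>_def by (rule LeastI[where P = "\<lambda>j. ?G j = \<mu>", OF ex])
    have "i < \<sigma>"
    proof (rule ccontr)
      assume "\<not> i < \<sigma>"
      then consider "\<sigma> = i" | "\<sigma> < i" by linarith
      then show False
      proof cases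
        case 1
        then show False using s HF_le[of i] \<mu>_pos i1(3) by simp
      next
        case 2
        then show False using s HF_eq_top_iff[of \<sigma>] i1(2) by simp
      qed
    qed
    moreover have le: "\<forall>j\<in>{1..<\<sigma>}. HF j \<le> ?G j"
      using i(2) unfolding J_def HF_ideal_vanishes_iff[OF phi] \<sigma>_def .
    ultimately have "HF i \<le> ?G i" using i1(1) by (intro bspec[OF le]) simp
    then show False using i1(3) by simp
  qed
qed

end

section \<open>The strictly Gorenstein locus\<close>

text \<open>After moving the point to the new order ideal, the criterion for adapted points applies.\<close>

lemma (in border_point) not_vanishing_iff_strictly_gorenstein:
  fixes \<phi> :: "'k::field \<Rightarrow> 'l" and as :: "(nat \<times> nat, 'k) mpoly list"
  assumes phi: "field_hom \<phi>" and enum': "order_ideal_enum n ts' bs'"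
    and adapted: "order_ideal_HF (set ts') = HF" and sym: "symmetric_HF \<mu> HF"
    and as: "set as \<subseteq> carrier (C_ring ts' bs')" "Idl\<^bsub>C_ring ts' bs'\<^esub> (set as) = CBLocus n ts' bs'"
    and nz: "value_at \<phi> \<Gamma> (base_change_det n ts bs ts') \<noteq> 0"
  shows "(\<forall>a\<in>set as. value_at \<phi> \<Gamma> (transported n ts bs ts' bs' a) = 0) \<longleftrightarrow>
    \<not> strictly_gorenstein n (point_ideal n ts bs \<Gamma>)"
proof -
  let ?G = "moved_point \<phi> ts' bs'"
  have len: "length ts' = \<mu>"
    using adapted_card[OF _ adapted] enum' distinct_card[of ts'] unfolding order_ideal_enum_def by simp
  note mp = moved_point[OF phi len enum' nz]
  interpret B: border_point n ts' bs' ?G by (rule mp(1))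
  interpret B: adapted_point n ts' bs' ?G
    by unfold_locales (simp_all only: mp(2) adapted len sym)
  have car: "a \<in> carrier (mpoly_ring (cvars ts' bs'))" if "a \<in> set as" for a
    using that as(1) unfolding C_ring_eq by blast
  have "(\<forall>a\<in>set as. value_at \<phi> \<Gamma> (transported n ts bs ts' bs' a) = 0) \<longleftrightarrow>
    (\<forall>a\<in>set as. mpoly_at \<phi> (\<lambda>kl. ?G $$ kl) a = 0)"
    using transported_at[OF phi nz car] by simp
  also have "\<dots> \<longleftrightarrow> (\<forall>a\<in>CBLocus n ts' bs'. mpoly_at \<phi> (\<lambda>kl. ?G $$ kl) a = 0)"
    unfolding as(2)[symmetric] C_ring_eq
    by (rule vanish_Idl[OF h_hom[OF phi], symmetric]) (use as(1) in \<open>simp add: C_ring_eq\<close>)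
  also have "\<dots> \<longleftrightarrow> \<not> strictly_gorenstein n (point_ideal n ts' bs' ?G)" by (rule B.CBLocus_vanishes_iff[OF phi])
  finally show ?thesis unfolding mp(2) .
qed

theorem corollary11p4:
  fixes n :: nat and ts bs :: "nat pp list" and H :: "nat \<Rightarrow> nat"
    and l :: nat and ts' bs' :: "nat \<Rightarrow> nat pp list"
    and as :: "nat \<Rightarrow> (nat \<times> nat, 'k::field) mpoly list"
    and \<phi> :: "'k \<Rightarrow> 'l::field"
  assumes "order_ideal_enum n ts bs"
    and "admissible TYPE('k) n (length ts) H"
    and "dominates H (order_ideal_HF (set ts))"
    and "\<And>i. i < l \<Longrightarrow> order_ideal_enum n (ts' i) (bs' i)"
    and "bij_betw (\<lambda>i. set (ts' i)) {..<l} {T. order_ideal n T \<and> order_ideal_HF T = H}"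
    and "\<And>i. i < l \<Longrightarrow> set (as i) \<subseteq> carrier (C_ring (ts' i) (bs' i))"
    and "\<And>i. i < l \<Longrightarrow> Idl\<^bsub>C_ring (ts' i) (bs' i)\<^esub> (set (as i)) = CBLocus n (ts' i) (bs' i)"
    and "field_hom \<phi>"
  shows "bbs_HF_points \<phi> n ts bs H - zero_locus \<phi> ts bs (SG_ideal n ts bs H l ts' bs' as) =
         {\<Gamma> \<in> bbs_HF_points \<phi> n ts bs H. strictly_gorenstein n (point_ideal n ts bs \<Gamma>)}"
proof -
  note enum = assms(1) and phi = assms(8)
  have "\<Gamma> \<notin> zero_locus \<phi> ts bs (SG_ideal n ts bs H l ts' bs' as) \<longleftrightarrow>
    strictly_gorenstein n (point_ideal n ts bs \<Gamma>)" if pt: "\<Gamma> \<in> bbs_HF_points \<phi> n ts bs H" for \<Gamma>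
  proof -
    have HFH: "affine_HF n (point_ideal n ts bs \<Gamma>) = H" by (rule HF_points(2)[OF enum phi pt])
    interpret border_point n ts bs \<Gamma> by (rule HF_points(1)[OF enum phi pt])
    interpret pa: presented_algebra n "point_ideal n ts bs \<Gamma>" ev \<mu> by (rule presented)
    define h where "h = value_at \<phi> \<Gamma>"
    have hom: "comm_ring_hom h" unfolding h_def by (rule h_hom[OF phi])
    interpret h: comm_ring_hom h by (rule hom)
    let ?R = "mpoly_ring (cvars ts bs) :: (nat \<times> nat, 'k) mpoly ring"
    have zl: "\<Gamma> \<in> zero_locus \<phi> ts bs I \<longleftrightarrow> (\<forall>f\<in>I. h f = 0)" for I
      unfolding zero_locus_def h_def using \<Gamma>_carr by simp
    show ?thesis
    proof (cases "symmetric_HF \<mu> H")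
      case False
      have "{0} \<subseteq> carrier ?R" by (simp add: carr_0)
      then have "\<forall>f\<in>SG_ideal n ts bs H l ts' bs' as. h f = 0"
        unfolding SG_ideal_def C_ring_eq using False vanish_Idl[OF hom, of "{0}"] by simp
      moreover have "\<not> strictly_gorenstein n (point_ideal n ts bs \<Gamma>)"
        using False pa.symmetric_HF_iff[OF HF_rho] unfolding pa.strictly_gorenstein_iff HFH by blast
      ultimately show ?thesis unfolding zl by blast
    next
      case True
      let ?F = "bbs_HF_ideal n ts bs H :: (nat \<times> nat, 'k) mpoly set"
      let ?Z = "bbs_Z_ideal n ts bs H :: (nat \<times> nat, 'k) mpoly set"
      define \<delta> :: "nat \<Rightarrow> (nat \<times> nat, 'k) mpoly" where "\<delta> = (\<lambda>i. base_change_det n ts bs (ts' i))"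
      define tr where "tr = (\<lambda>i. transported n ts bs (ts' i) (bs' i) ` set (as i))"
      define D where "D = (\<lambda>i. dfb_ideal n ts bs H (ts' i) <+>\<^bsub>?R\<^esub> ?F)"
      define J where "J = (\<lambda>i. J_ideal n ts bs (ts' i) (bs' i) (as i) <+>\<^bsub>?R\<^esub> ?F)"
      have F: "ideal ?F ?R" by (rule bbs_HF_ideal_ideal[OF enum])
      have Fv: "\<forall>f\<in>?F. h f = 0" unfolding h_def HF_ideal_vanishes_iff[OF phi] HFH by simp
      have Z: "ideal ?Z ?R" "\<not> (\<forall>f\<in>?Z. h f = 0)"
        using bbs_Z_ideal_at[OF phi] unfolding HFH h_def by auto
      have ad: "order_ideal_HF (set (ts' i)) = H" if "i < l" for i
        using bij_betwE[OF assms(5)] that by blast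
      have len: "length (ts' i) = \<mu>" if i: "i < l" for i
        using adapted_card[of "set (ts' i)"] ad[OF i] assms(4)[OF i] distinct_card[of "ts' i"]
        unfolding order_ideal_enum_def HFH by simp
      have dc: "{\<delta> i} \<subseteq> carrier ?R" if "i < l" for i
        unfolding \<delta>_def using base_change_closed(1)[OF enum len[OF that]] by simp
      have trc: "tr i \<subseteq> carrier ?R" if i: "i < l" for i
        unfolding tr_def using transported_closed[OF enum len[OF i]] assms(6)[OF i] unfolding C_ring_eq by blast
      have Did: "ideal (dfb_ideal n ts bs H (ts' i)) ?R" if i: "i < l" for i
      proof -
        interpret R: cring ?R by (rule mpoly_ring_cring)
        show ?thesis unfolding dfb_ideal_def C_ring_eq
          by (rule R.i_intersect[OF Z(1) mpoly_Idl_ideal[OF dc[OF i, unfolded \<delta>_def]]])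
      qed
      have Jid: "ideal (J_ideal n ts bs (ts' i) (bs' i) (as i)) ?R" if i: "i < l" for i
        unfolding J_ideal_def C_ring_eq by (rule mpoly_Idl_ideal[OF trc[OF i, unfolded tr_def]])
      have Dv: "(\<forall>f\<in>D i. h f = 0) \<longleftrightarrow> h (\<delta> i) = 0" if i: "i < l" for i
      proof -
        have "(\<forall>f\<in>D i. h f = 0) \<longleftrightarrow> (\<forall>f\<in>dfb_ideal n ts bs H (ts' i). h f = 0)"
          unfolding D_def vanish_sum[OF hom Did[OF i] F] using Fv by simp
        also have "\<dots> \<longleftrightarrow> (\<forall>f\<in>Idl\<^bsub>?R\<^esub> {\<delta> i}. h f = 0)"
          unfolding dfb_ideal_def C_ring_eq \<delta>_def
            vanish_inter[OF hom Z(1) mpoly_Idl_ideal[OF dc[OF i, unfolded \<delta>_def]]]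
          by (simp only: Z(2) simp_thms)
        also have "\<dots> \<longleftrightarrow> h (\<delta> i) = 0" unfolding vanish_Idl[OF hom dc[OF i]] by simp
        finally show ?thesis .
      qed
      have Jv: "(\<forall>f\<in>J i. h f = 0) \<longleftrightarrow> (\<forall>f\<in>tr i. h f = 0)" if i: "i < l" for i
        unfolding J_def vanish_sum[OF hom Jid[OF i] F]
        unfolding J_ideal_def C_ring_eq tr_def[symmetric]
        using vanish_Idl[OF hom trc[OF i]] Fv unfolding tr_def by simp
      have Jsg: "(\<forall>f\<in>J i. h f = 0) \<longleftrightarrow> \<not> strictly_gorenstein n (point_ideal n ts bs \<Gamma>)"
        if i: "i < l" "h (\<delta> i) \<noteq> 0" for i
      proof -
        have "order_ideal_HF (set (ts' i)) = HF" "symmetric_HF \<mu> HF" unfolding HFH by (rule ad[OF i(1)], rule True)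
        note iff = not_vanishing_iff_strictly_gorenstein[OF phi assms(4)[OF i(1)] this assms(6,7)[OF i(1)]
          i(2)[unfolded h_def \<delta>_def]]
        show ?thesis unfolding Jv[OF i(1)] iff[symmetric] unfolding tr_def h_def by simp
      qed
      have Dideal: "ideal (D i) ?R" and Jideal: "ideal (J i) ?R" if "i < l" for i
        unfolding D_def J_def by (rule mpoly_sum_ideal[OF Did[OF that] F], rule mpoly_sum_ideal[OF Jid[OF that] F])
      have gens: "(\<Union>i<l. D i \<inter> J i) \<subseteq> carrier ?R" using mpoly_ideal(1)[OF Dideal] by blast
      have "SG_ideal n ts bs H l ts' bs' as = Idl\<^bsub>?R\<^esub> (\<Union>i<l. D i \<inter> J i)"
        unfolding SG_ideal_def NCB_ideal_def D_def J_def C_ring_eq using True by simp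
      then have "(\<forall>f\<in>SG_ideal n ts bs H l ts' bs' as. h f = 0) \<longleftrightarrow> (\<forall>i<l. \<forall>f\<in>D i \<inter> J i. h f = 0)"
        using vanish_Idl[OF hom gens] by auto
      also have "\<dots> \<longleftrightarrow> (\<forall>i<l. h (\<delta> i) = 0 \<or> (\<forall>f\<in>J i. h f = 0))"
        using vanish_inter[OF hom Dideal Jideal] Dv by simp
      also have "\<dots> \<longleftrightarrow> (\<forall>i<l. h (\<delta> i) = 0 \<or> \<not> strictly_gorenstein n (point_ideal n ts bs \<Gamma>))"
        using Jsg by auto
      also have "\<dots> \<longleftrightarrow> \<not> strictly_gorenstein n (point_ideal n ts bs \<Gamma>)"
      proof -
        have "lead \<in> {T. order_ideal n T \<and> order_ideal_HF T = H}"
          using lead_order_ideal lead_HF unfolding HFH by auto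
        then obtain i where i: "i < l" "set (ts' i) = lead"
          using bij_betw_imp_surj_on[OF assms(5)] by (metis (mono_tags, lifting) imageE lessThan_iff)
        have "h (\<delta> i) \<noteq> 0" unfolding h_def \<delta>_def
        proof (rule base_change_det_nonzero[OF phi len[OF i(1)]])
          show "distinct (ts' i)" using assms(4)[OF i(1)] unfolding order_ideal_enum_def by simp
          show "fam_indep v (set (ts' i))" by (rule lead_indep) (simp_all add: i(2)[symmetric])
        qed
        then show ?thesis using i(1) by auto
      qed
      finally show ?thesis unfolding zl by simp
    qed
  qed
  then show ?thesis by blast
qed

end
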